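(* Let $w\in S_n$ be a permutation, and let $S$ be a subset of $[n]^2$ of size $\ell(w)$. Then $$\llbracket z^S\rrbracket\,\mathfrak{F}_w(z)\ \le\ \Big\llbracket \prod_{(i,j)\in S}x_i\Big\rrbracket\,\mathfrak{S}_w(x),$$ where $\mathfrak{F}_w(z)$ is the fine Schubert polynomial of $w$ and $\mathfrak{S}_w(x)$ is the Schubert polynomial of $w$.
   Context: $[n]=\{1,\dots,n\}$, $\ell(w)$ is the Coxeter length, and $\llbracket m\rrbracket f$ denotes the coefficient of the monomial $m$ in $f$. For $S\subset[n]^2$, $z^S=\prod_{(i,j)\in S}z_{i,j}$. Matrix Schubert variety: $r_{p\times q}(w)=\#\{(i,j): i\le p,\ j\le q,\ w(i)=j\}$, and $X_w\subset\mathbb{A}^{n^2}$ is the variety of $n\times n$ complex matrices whose northwest $p\times q$ submatrix (rows $1,\dots,p$, columns $1,\dots,q$) has rank at most $r_{p\times q}(w)$ for all $p,q$; its ideal $I_w\subset\mathbb{C}[a_{i,j}]$ is generated by the minors of size $1+r_{p\times q}(w)$ of the northwest $p\times q$ submatrices of the generic matrix $(a_{i,j})$. It is irreducible of codimension $\ell(w)$. Fine Schubert polynomial: let $\overline{X}_w$ be the closure of $X_w$ in $(\mathbb{P}^1)^{n^2}\supset\mathbb{A}^{n^2}$ and $[H_{i,j}]\in H^2((\mathbb{P}^1)^{n^2})$ the class of the closure of $\{a_{i,j}=0\}$. $\mathfrak{F}_w(z)\in\mathbb{Z}[z_{i,j}:(i,j)\in[n]^2]$ is the unique polynomial, all of whose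 monomials are products of distinct variables, with $[\overline{X}_w]=\mathfrak{F}_w([H_{1,1}],\dots,[H_{n,n}])\cap[(\mathbb{P}^1)^{n^2}]$ (cap product). Equivalently it is homogeneous of degree $\ell(w)$, and for $|S|=\ell(w)$ the coefficient of $z^S$ is the degree of the coordinate projection $X_w\to\mathbb{A}^{[n]^2\setminus S}$ (zero if not dominant). Schubert polynomials: $\mathfrak{S}_{w_0}=x_1^{n-1}x_2^{n-2}\cdots x_{n-1}$ for $w_0=(n,n-1,\dots,1)$, and $\mathfrak{S}_{ws_i}=\dfrac{\mathfrak{S}_w-s_i\mathfrak{S}_w}{x_i-x_{i+1}}$ whenever $w(i)>w(i+1)$, where $s_i=(i\ i+1)$ acts on polynomials by exchanging $x_i$ and $x_{i+1}$. *)

theory Defs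
  imports
    "HOL-Combinatorics.Permutations"
    "HOL-Library.Poly_Mapping"
    "HOL-Library.FuncSet"
    "HOL-Algebra.QuotRing"
    "HOL-Algebra.Embedded_Algebras"
    "Jordan_Normal_Form.DL_Rank"
begin

section \<open>Multivariate polynomials\<close>

text \<open>
  The coefficient of the monomial with exponent vector \<open>m\<close> in \<open>f\<close> is \<open>Poly_Mapping.lookup f m\<close>.
\<close>

type_synonym ('v, 'a) mpoly = "('v \<Rightarrow>\<^sub>0 nat) \<Rightarrow>\<^sub>0 'a"

definition mvar :: "'v \<Rightarrow> ('v, 'a::comm_ring_1) mpoly" where
  "mvar v = Poly_Mapping.single (Poly_Mapping.single v 1) 1"

definition poly_eval :: "('v \<Rightarrow> 'a) \<Rightarrow> ('v, 'a::comm_ring_1) mpoly \<Rightarrow> 'a" where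
  "poly_eval a f = (\<Sum>m\<in>Poly_Mapping.keys f. Poly_Mapping.lookup f m *
     (\<Prod>v\<in>Poly_Mapping.keys m. a v ^ Poly_Mapping.lookup m v))"

text \<open>Exchanging the variables \<open>u\<close> and \<open>v\<close>: the coefficient of the new polynomial at an exponent
  vector \<open>m\<close> is the coefficient of \<open>f\<close> at \<open>m \<circ> (u v)\<close>.\<close>

definition swap_vars :: "'v \<Rightarrow> 'v \<Rightarrow> ('v, 'a::comm_ring_1) mpoly \<Rightarrow> ('v, 'a) mpoly" where
  "swap_vars u v f =
     Poly_Mapping.map_key (Poly_Mapping.map_key (Transposition.transpose u v)) f"


section \<open>Permutations and Schubert polynomials\<close>

text \<open>Elements of the symmetric group are functions \<open>w\<close> with \<open>w permutes {1..n}\<close>; the product is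
  composition of functions, so that \<open>w s\<^sub>i = w \<circ> s\<^sub>i\<close>.\<close>

definition simple_refl :: "nat \<Rightarrow> nat \<Rightarrow> nat" where
  "simple_refl i = Transposition.transpose i (Suc i)"

definition coxeter_length :: "nat \<Rightarrow> (nat \<Rightarrow> nat) \<Rightarrow> nat" where
  "coxeter_length n w = (LEAST k. \<exists>is. length is = k \<and> set is \<subseteq> {1..<n} \<and>
     w = foldr (\<lambda>i u. simple_refl i \<circ> u) is id)"

definition longest_perm :: "nat \<Rightarrow> nat \<Rightarrow> nat" where
  "longest_perm n = (\<lambda>i. if i \<in> {1..n} then n + 1 - i else i)"

text \<open>In rule \<open>step\<close>, the equation says that \<open>g\<close> is the divided difference
  \<open>(f - s\<^sub>i f) / (x\<^sub>i - x\<^sub>i\<^sub>+\<^sub>1)\<close>. Every permutation is reached from the longest one, and the resulting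
  polynomial does not depend on the path taken.\<close>

inductive is_schubert :: "nat \<Rightarrow> (nat \<Rightarrow> nat) \<Rightarrow> (nat, int) mpoly \<Rightarrow> bool" for n where
  longest: "is_schubert n (longest_perm n) (\<Prod>i\<in>{1..n}. mvar i ^ (n - i))"
| step: "is_schubert n w f \<Longrightarrow> i \<in> {1..<n} \<Longrightarrow> w i > w (Suc i) \<Longrightarrow>
    g * (mvar i - mvar (Suc i)) = f - swap_vars i (Suc i) f \<Longrightarrow>
    is_schubert n (w \<circ> simple_refl i) g"

definition schubert_poly :: "nat \<Rightarrow> (nat \<Rightarrow> nat) \<Rightarrow> (nat, int) mpoly" where
  "schubert_poly n w = (THE f. is_schubert n w f)"


section \<open>Fields of fractions\<close>

definition fraction :: "('a, 'b) ring_scheme \<Rightarrow> 'a \<Rightarrow> 'a \<Rightarrow> ('a \<times> 'a) set" where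
  "fraction R a b = {(c, d). c \<in> carrier R \<and> d \<in> carrier R - {\<zero>\<^bsub>R\<^esub>} \<and> a \<otimes>\<^bsub>R\<^esub> d = c \<otimes>\<^bsub>R\<^esub> b}"

text \<open>The field of fractions of an integral domain \<open>R\<close>, with \<open>fraction R a b\<close> the fraction \<open>a / b\<close>. The
  unions below are taken over a single class, by independence of representatives.\<close>

definition frac_field :: "('a, 'b) ring_scheme \<Rightarrow> ('a \<times> 'a) set ring" where
  "frac_field R =
    \<lparr> carrier = {fraction R a b | a b. a \<in> carrier R \<and> b \<in> carrier R - {\<zero>\<^bsub>R\<^esub>}},
      monoid.mult = (\<lambda>A B. \<Union>(a, b)\<in>A. \<Union>(c, d)\<in>B. fraction R (a \<otimes>\<^bsub>R\<^esub> c) (b \<otimes>\<^bsub>R\<^esub> d)),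
      one = fraction R \<one>\<^bsub>R\<^esub> \<one>\<^bsub>R\<^esub>,
      zero = fraction R \<zero>\<^bsub>R\<^esub> \<one>\<^bsub>R\<^esub>,
      add = (\<lambda>A B. \<Union>(a, b)\<in>A. \<Union>(c, d)\<in>B.
               fraction R (a \<otimes>\<^bsub>R\<^esub> d \<oplus>\<^bsub>R\<^esub> c \<otimes>\<^bsub>R\<^esub> b) (b \<otimes>\<^bsub>R\<^esub> d)) \<rparr>"


section \<open>Affine varieties and degrees of coordinate projections\<close>

text \<open>The affine space with coordinates indexed by \<open>I\<close> consists of extensional functions on \<open>I\<close>, and
  its coordinate ring of the polynomials all of whose variables lie in \<open>I\<close>.\<close>

definition affine_space :: "'v set \<Rightarrow> ('v \<Rightarrow> complex) set" where
  "affine_space I = I \<rightarrow>\<^sub>E UNIV"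

definition polys_on :: "'v set \<Rightarrow> ('v, complex) mpoly set" where
  "polys_on I = {f. \<forall>m\<in>Poly_Mapping.keys f. Poly_Mapping.keys m \<subseteq> I}"

definition poly_ring :: "'v set \<Rightarrow> ('v, complex) mpoly ring" where
  "poly_ring I =
    \<lparr> carrier = polys_on I, monoid.mult = (*), one = 1, zero = 0, add = (+) \<rparr>"

definition vanishing_ideal :: "'v set \<Rightarrow> ('v \<Rightarrow> complex) set \<Rightarrow> ('v, complex) mpoly set" where
  "vanishing_ideal I X = {f \<in> polys_on I. \<forall>a\<in>X. poly_eval a f = 0}"

definition zariski_closure :: "'v set \<Rightarrow> ('v \<Rightarrow> complex) set \<Rightarrow> ('v \<Rightarrow> complex) set" where
  "zariski_closure I X =
     {a \<in> affine_space I. \<forall>f\<in>vanishing_ideal I X. poly_eval a f = 0}"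

definition coord_ring :: "'v set \<Rightarrow> ('v \<Rightarrow> complex) set \<Rightarrow> ('v, complex) mpoly set ring" where
  "coord_ring I X = poly_ring I Quot vanishing_ideal I X"

definition coord_fun ::
  "'v set \<Rightarrow> ('v \<Rightarrow> complex) set \<Rightarrow> ('v, complex) mpoly \<Rightarrow> ('v, complex) mpoly set" where
  "coord_fun I X f = vanishing_ideal I X +>\<^bsub>poly_ring I\<^esub> f"

definition function_field where
  "function_field I X = frac_field (coord_ring I X)"

text \<open>For \<open>T \<subseteq> I\<close>, the coordinate projection of an irreducible closed subset \<open>X\<close> of the affine space
  on \<open>I\<close> to the affine space on \<open>T\<close> is \<open>a \<mapsto> restrict a T\<close>. Pulling back along it sends a polynomial in
  the variables \<open>T\<close> to its restriction to \<open>X\<close>. If the projection is dominant, this extends to function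
  fields, with the following image.\<close>

definition pullback_field where
  "pullback_field I X T =
     {fraction (coord_ring I X) (coord_fun I X f) (coord_fun I X g) | f g.
        f \<in> polys_on T \<and> g \<in> polys_on T - {0}}"

definition dominant_projection :: "('v \<Rightarrow> complex) set \<Rightarrow> 'v set \<Rightarrow> bool" where
  "dominant_projection X T \<longleftrightarrow> zariski_closure T ((\<lambda>a. restrict a T) ` X) = affine_space T"

text \<open>The degree of the function field extension; it is finite if \<open>X\<close> has dimension \<open>card T\<close>.\<close>

definition projection_degree :: "'v set \<Rightarrow> ('v \<Rightarrow> complex) set \<Rightarrow> 'v set \<Rightarrow> nat" where
  "projection_degree I X T =
     (if dominant_projection X T
      then ring.dim (function_field I X) (pullback_field I X T) (carrier (function_field I X))
      else 0)"


section \<open>Matrix Schubert varieties and fine Schubert polynomials\<close>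

abbreviation grid :: "nat \<Rightarrow> (nat \<times> nat) set" where
  "grid n \<equiv> {1..n} \<times> {1..n}"

definition nw_rank :: "(nat \<Rightarrow> nat) \<Rightarrow> nat \<Rightarrow> nat \<Rightarrow> nat" where
  "nw_rank w p q = card {(i, j). i \<in> {1..p} \<and> j \<in> {1..q} \<and> w i = j}"

text \<open>Points have coordinates indexed from 1, whereas the entries of \<open>mat\<close> are indexed from 0.\<close>

definition nw_submatrix :: "(nat \<times> nat \<Rightarrow> complex) \<Rightarrow> nat \<Rightarrow> nat \<Rightarrow> complex mat" where
  "nw_submatrix a p q = mat p q (\<lambda>(i, j). a (Suc i, Suc j))"

definition matrix_schubert :: "nat \<Rightarrow> (nat \<Rightarrow> nat) \<Rightarrow> (nat \<times> nat \<Rightarrow> complex) set" where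
  "matrix_schubert n w = {a \<in> affine_space (grid n).
     \<forall>p\<in>{1..n}. \<forall>q\<in>{1..n}. vec_space.rank p (nw_submatrix a p q) \<le> nw_rank w p q}"

text \<open>The coefficient of a squarefree monomial supported on \<open>S\<close> in the class of the closure of the
  matrix Schubert variety in a product of projective lines is the degree of the projection that
  forgets the coordinates in \<open>S\<close>.\<close>

definition fine_schubert :: "nat \<Rightarrow> (nat \<Rightarrow> nat) \<Rightarrow> (nat \<times> nat, int) mpoly" where
  "fine_schubert n w = (\<Sum>S\<in>{S. S \<subseteq> grid n \<and> card S = coxeter_length n w}.
     of_nat (projection_degree (grid n) (matrix_schubert n w) (grid n - S)) * (\<Prod>v\<in>S. mvar v))"

end

theory Submission
  imports
    Defs
    "HOL-Library.Product_Lexorder"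
    "HOL-Computational_Algebra.Polynomial"
    "Jordan_Normal_Form.DL_Rank_Submatrix"
begin

text \<open>
  Let \<open>T\<close> be the complement of \<open>S\<close>. The degree and the coefficient are compared through facets of a complex: its faces are the
  subsets of the grid whose antidiagonal chains inside each northwest block are no longer than its
  prescribed rank, and we count the facets having in every row as many elements as \<open>T\<close>.
  By the co-transition formula, deleting the cone point \<open>(i, w i)\<close> of this complex splits the facets
  among the covers of \<open>w\<close>, so their number is at most the coefficient of the Schubert polynomial.
  On the other hand, antidiagonal terms of minors and a degeneration of the coordinates in \<open>T\<close> to
  row-wise Vandermonde forms span all monomials of high degree modulo the facet monomials. Hence, up to
  specialisation of parameters, any larger number of functions on the matrix Schubert variety satisfies
  a linear relation over the polynomials in the coordinates \<open>T\<close>, and this bounds the degree of the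
  projection. Irreducibility of the variety comes from its being swept out by row operations.
\<close>

text \<open>The limit of the minors alone does not control the degree of a projection: on the
  limiting union of coordinate subspaces only the facet equal to \<open>T\<close> dominates the
  coordinates in \<open>T\<close>, while other sheets may escape to infinity. Hence these
  coordinates are deformed together with the variety, row by row, to linear forms in general
  position, for which every facet with the right number of cells in each row contributes. Each row
  is treated as a projective space: the \<open>t\<close> coordinates of \<open>T\<close> in a row
  enter through the \<open>t - 1\<close> relations that fix their ratios to one of them. All
  relations are then homogeneous in every row, and the monomials of given row degrees are finite in
  number. Spanning is an open condition on parameters, so it spreads from the special values to
  generic ones at the cost of a denominator. A linear relation is a closed condition, so it survives
  in the limit of undeformed coordinates once a common factor is removed.\<close>

text \<open>Exponent vectors over linearly ordered variables are linearly ordered, so polynomials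
  over a domain form a domain; for the matrix variables the order on pairs is lexicographic.\<close>

instance poly_mapping :: ("{ordered_cancel_comm_monoid_add, linorder}", idom) idom ..

section \<open>Coxeter length as number of inversions\<close>

definition inv_set :: "nat \<Rightarrow> (nat \<Rightarrow> nat) \<Rightarrow> (nat \<times> nat) set" where
  "inv_set n w = {(a, b). 1 \<le> a \<and> a < b \<and> b \<le> n \<and> w b < w a}"

definition ninv :: "nat \<Rightarrow> (nat \<Rightarrow> nat) \<Rightarrow> nat" where
  "ninv n w = card (inv_set n w)"

lemma finite_inv_set: "finite (inv_set n w)"
  by (rule finite_subset[of _ "{1..n} \<times> {1..n}"]) (auto simp: inv_set_def)

lemma simple_refl_permutes: "i \<in> {1..<n} \<Longrightarrow> simple_refl i permutes {1..n}"
  unfolding simple_refl_def by (rule permutes_swap_id) auto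

lemma simple_refl_invol [simp]: "simple_refl i (simple_refl i a) = a" "simple_refl i \<circ> simple_refl i = id"
  by (auto simp: simple_refl_def)

lemma simple_refl_apply: "simple_refl i a = (if a = i then Suc i else if a = Suc i then i else a)"
  by (simp add: simple_refl_def Transposition.transpose_def)

lemma permutes_simple: "w permutes {1..n} \<Longrightarrow> i \<in> {1..<n} \<Longrightarrow> w \<circ> simple_refl i permutes {1..n}"
  by (rule permutes_compose[OF simple_refl_permutes])

text \<open>The involution \<open>f\<close> on pairs of positions carries the inversions of
  \<open>w\<close> to those of \<open>w s_i\<close> other than \<open>(i, i + 1)\<close>, the only
  pair of positions whose order \<open>s_i\<close> reverses.\<close>

lemma ninv_simple_ascent:
  assumes "w permutes {1..n}" "i \<in> {1..<n}" "w i < w (Suc i)"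
  shows "ninv n (w \<circ> simple_refl i) = Suc (ninv n w)"
proof -
  let ?s = "simple_refl i"
  define f where "f = map_prod ?s ?s"
  have invol: "f (f x) = x" for x by (cases x) (simp add: f_def)
  have eq: "inv_set n (w \<circ> ?s) = insert (i, Suc i) (f ` inv_set n w)" (is "?L = ?R")
  proof (rule Set.set_eqI)
    fix x :: "nat \<times> nat" obtain a b where x: "x = (a, b)" by (cases x)
    have "x \<in> f ` inv_set n w \<longleftrightarrow> f x \<in> inv_set n w"
    proof
      assume "x \<in> f ` inv_set n w"
      then obtain y where "y \<in> inv_set n w" "x = f y" by blast
      then show "f x \<in> inv_set n w" by (simp add: invol)
    next
      assume "f x \<in> inv_set n w"
      then have "f (f x) \<in> f ` inv_set n w" by (rule imageI)
      then show "x \<in> f ` inv_set n w" by (simp add: invol)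
    qed
    then have "x \<in> f ` inv_set n w \<longleftrightarrow> (?s a, ?s b) \<in> inv_set n w" by (simp add: f_def x)
    moreover have "(a, b) \<in> inv_set n (w \<circ> ?s) \<longleftrightarrow> (a, b) = (i, Suc i) \<or> (?s a, ?s b) \<in> inv_set n w"
    proof (cases "a = i \<or> a = Suc i \<or> b = i \<or> b = Suc i")
      case True
      have d: "\<not> w (Suc i) < w i" using assms(3) by simp
      from True show ?thesis
        using assms(2,3) d unfolding inv_set_def simple_refl_apply mem_Collect_eq prod.case comp_apply prod.inject
        by (elim disjE) (simp_all, (auto simp: not_less)[4])
    next
      case False
      then show ?thesis by (simp add: inv_set_def simple_refl_apply)
    qed
    ultimately show "x \<in> ?L \<longleftrightarrow> x \<in> ?R" using x by simp
  qed
  have "(i, Suc i) \<notin> f ` inv_set n w"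
  proof
    assume "(i, Suc i) \<in> f ` inv_set n w"
    then obtain x where x: "x \<in> inv_set n w" "(i, Suc i) = f x" by blast
    then have "f (i, Suc i) = x" by (simp add: invol)
    with x(1) show False by (auto simp: inv_set_def simple_refl_apply f_def)
  qed
  moreover have "inj (f)"
    by (rule inj_on_inverseI[where g = "f"]) (rule invol)
  ultimately show ?thesis unfolding ninv_def eq
    using finite_inv_set[of n w] by (simp add: card_image inj_on_subset[of _ UNIV])
qed

lemma ninv_simple_descent:
  assumes "w permutes {1..n}" "i \<in> {1..<n}" "w (Suc i) < w i"
  shows "ninv n w = Suc (ninv n (w \<circ> simple_refl i))"
proof -
  have "(w \<circ> simple_refl i) i < (w \<circ> simple_refl i) (Suc i)" using assms(3) by (simp add: simple_refl_apply)
  from ninv_simple_ascent[OF permutes_simple[OF assms(1,2)] assms(2) this]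
  have "ninv n ((w \<circ> simple_refl i) \<circ> simple_refl i) = Suc (ninv n (w \<circ> simple_refl i))" .
  then show ?thesis by (simp add: comp_assoc)
qed

lemma permutes_neq: "w permutes {1..n} \<Longrightarrow> a \<noteq> b \<Longrightarrow> w a \<noteq> w b"
  by (metis permutes_inj injD)

lemma ninv_simple_le:
  assumes "w permutes {1..n}" "i \<in> {1..<n}"
  shows "ninv n (w \<circ> simple_refl i) \<le> Suc (ninv n w)"
  using ninv_simple_ascent[OF assms] ninv_simple_descent[OF assms] permutes_neq[OF assms(1), of i "Suc i"]
  by (cases "w i < w (Suc i)") auto

lemma foldr_simple_snoc:
  "foldr (\<lambda>i u. simple_refl i \<circ> u) (is @ [j]) id = foldr (\<lambda>i u. simple_refl i \<circ> u) is id \<circ> simple_refl j"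
proof -
  have "foldr (\<lambda>i u. simple_refl i \<circ> u) is (v \<circ> x) = foldr (\<lambda>i u. simple_refl i \<circ> u) is v \<circ> x" for v x :: "nat \<Rightarrow> nat"
    by (induction "is") (auto simp: comp_assoc)
  from this[of id "simple_refl j"] show ?thesis by simp
qed

lemma ninv_id: "ninv n id = 0"
proof -
  have "inv_set n id = {}" by (auto simp: inv_set_def)
  then show ?thesis by (simp add: ninv_def)
qed

lemma ninv_word_le:
  "set is \<subseteq> {1..<n} \<Longrightarrow> foldr (\<lambda>i u. simple_refl i \<circ> u) is id permutes {1..n} \<and>
     ninv n (foldr (\<lambda>i u. simple_refl i \<circ> u) is id) \<le> length is"
proof (induction "is" rule: rev_induct)
  case Nil
  then show ?case using ninv_id[of n] permutes_id[of "{1..n}"] by (simp add: id_def)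
next
  case (snoc j "is")
  let ?w = "foldr (\<lambda>i u. simple_refl i \<circ> u) is id"
  have "set is \<subseteq> {1..<n}" and j: "j \<in> {1..<n}" using snoc.prems by simp_all
  from snoc.IH[OF this(1)] have w: "?w permutes {1..n}" "ninv n ?w \<le> length is" by blast+
  have "ninv n (?w \<circ> simple_refl j) \<le> length (is @ [j])"
    using ninv_simple_le[OF w(1) j] w(2) by simp
  then show ?case unfolding foldr_simple_snoc using permutes_simple[OF w(1) j] by blast
qed

text \<open>Increase at every step gives \<open>w b - w a \<ge> b - a\<close>; applied from position
  \<open>1\<close> and up to position \<open>n\<close>, this squeezes each value from both
  sides.\<close>

lemma no_descent_id:
  assumes "w permutes {1..n}" "\<And>i. i \<in> {1..<n} \<Longrightarrow> w i < w (Suc i)"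
  shows "w = id"
proof -
  have mono: "1 \<le> a \<Longrightarrow> a \<le> b \<Longrightarrow> b \<le> n \<Longrightarrow> w a + (b - a) \<le> w b" for a b
  proof (induction "b - a" arbitrary: b)
    case (Suc d)
    then obtain b' where b: "b = Suc b'" "a \<le> b'" by (cases b) auto
    have "w a + (b' - a) \<le> w b'" using Suc.hyps(1)[of b'] Suc.hyps(2) Suc.prems b by simp
    moreover have "w b' < w b" using assms(2)[of b'] Suc.prems b by simp
    ultimately show ?case using b by simp
  qed auto
  have "w i = i" if "i \<in> {1..n}" for i
  proof -
    have "w 1 \<in> {1..n}" "w n \<in> {1..n}" using assms(1) that permutes_in_image[of w "{1..n}"] by auto
    then show ?thesis using mono[of 1 i] mono[of i n] that by auto
  qed
  then show ?thesis using assms(1) by (auto simp: fun_eq_iff permutes_def)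
qed

text \<open>Sorting at descents removes one inversion per simple reflection, so the word obtained
  has as many letters as \<open>w\<close> has inversions.\<close>

lemma ex_word: "w permutes {1..n} \<Longrightarrow> \<exists>is. length is = ninv n w \<and> set is \<subseteq> {1..<n} \<and>
     w = foldr (\<lambda>i u. simple_refl i \<circ> u) is id"
proof (induction "ninv n w" arbitrary: w)
  case 0
  have "w i < w (Suc i)" if "i \<in> {1..<n}" for i
    using 0(1) ninv_simple_descent[OF 0(2) that] permutes_neq[OF 0(2), of i "Suc i"] by (cases "w (Suc i) < w i") auto
  then have "w = id" using no_descent_id[OF 0(2)] by blast
  then show ?case using 0(1) by (intro exI[of _ "[]"]) simp
next
  case (Suc k)
  have "w \<noteq> id" using ninv_id[of n] Suc(2) by auto
  then have "\<exists>i\<in>{1..<n}. \<not> w i < w (Suc i)" using no_descent_id[OF Suc(3)] by blast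
  then obtain i where i: "i \<in> {1..<n}" "\<not> w i < w (Suc i)" by blast
  then have d: "w (Suc i) < w i" using permutes_neq[OF Suc(3), of i "Suc i"] by auto
  have k: "k = ninv n (w \<circ> simple_refl i)" using ninv_simple_descent[OF Suc(3) i(1) d] Suc(2) by simp
  obtain "is" where "is": "length is = k" "set is \<subseteq> {1..<n}"
     "w \<circ> simple_refl i = foldr (\<lambda>i u. simple_refl i \<circ> u) is id"
    using Suc(1)[OF k permutes_simple[OF Suc(3) i(1)]] k by auto
  have "foldr (\<lambda>i u. simple_refl i \<circ> u) (is @ [i]) id = w"
    unfolding foldr_simple_snoc "is"(3)[symmetric] by (simp add: comp_assoc)
  moreover have "length (is @ [i]) = ninv n w" "set (is @ [i]) \<subseteq> {1..<n}" using "is"(1,2) i Suc(2) by auto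
  ultimately show ?case by metis
qed

lemma coxeter_length_eq_ninv:
  assumes "w permutes {1..n}" shows "coxeter_length n w = ninv n w"
  unfolding coxeter_length_def
proof (rule Least_equality)
  show "\<exists>is. length is = ninv n w \<and> set is \<subseteq> {1..<n} \<and> w = foldr (\<lambda>i u. simple_refl i \<circ> u) is id"
    by (rule ex_word[OF assms])
next
  fix k assume "\<exists>is. length is = k \<and> set is \<subseteq> {1..<n} \<and> w = foldr (\<lambda>i u. simple_refl i \<circ> u) is id"
  then obtain "is" where "is": "length is = k" "set is \<subseteq> {1..<n}" "w = foldr (\<lambda>i u. simple_refl i \<circ> u) is id"
    by blast
  show "ninv n w \<le> k" using ninv_word_le[OF "is"(2)] unfolding "is"(1) "is"(3)[symmetric] by (rule conjunct2)
qed

lemma longest_perm_permutes: "longest_perm n permutes {1..n}"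
proof -
  have "bij_betw (longest_perm n) {1..n} {1..n}"
    by (rule bij_betw_byWitness[where f' = "longest_perm n"]) (auto simp: longest_perm_def)
  then show ?thesis by (rule bij_imp_permutes) (auto simp: longest_perm_def)
qed

lemma no_ascent_longest:
  assumes "w permutes {1..n}" "\<And>i. i \<in> {1..<n} \<Longrightarrow> w (Suc i) < w i"
  shows "w = longest_perm n"
proof -
  have "longest_perm n \<circ> w = id"
  proof (rule no_descent_id)
    show "longest_perm n \<circ> w permutes {1..n}" using assms(1) longest_perm_permutes permutes_compose by blast
    fix i assume i: "i \<in> {1..<n}"
    have "w i \<in> {1..n}" "w (Suc i) \<in> {1..n}" using permutes_in_image[OF assms(1)] i by auto
    then show "(longest_perm n \<circ> w) i < (longest_perm n \<circ> w) (Suc i)"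
      using assms(2)[OF i] by (auto simp: longest_perm_def)
  qed
  then have "longest_perm n \<circ> (longest_perm n \<circ> w) = longest_perm n" by simp
  moreover have "longest_perm n (longest_perm n x) = x" for x by (auto simp: longest_perm_def)
  ultimately show ?thesis by (simp add: fun_eq_iff)
qed

lemma ninv_le: "ninv n w \<le> n * n"
proof -
  have "card (inv_set n w) \<le> card ({1..n} \<times> {1..n})"
    by (rule card_mono) (auto simp: inv_set_def)
  then show ?thesis by (simp add: ninv_def)
qed

text \<open>The hypothesis is available for all permutations with more inversions, not just for
  those one step above: the braid relation looks three steps up.\<close>

lemma perm_downward_induct [consumes 1, case_names longest step]:
  assumes "w permutes {1..n}" "P (longest_perm n)"
    and step: "\<And>w i. w permutes {1..n} \<Longrightarrow> i \<in> {1..<n} \<Longrightarrow> w i < w (Suc i) \<Longrightarrow>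
      (\<And>v. v permutes {1..n} \<Longrightarrow> ninv n v > ninv n w \<Longrightarrow> P v) \<Longrightarrow> P w"
  shows "P w"
  using assms(1)
proof (induction "n * n - ninv n w" arbitrary: w rule: less_induct)
  case less
  show ?case
  proof (cases "w = longest_perm n")
    case False
    have "\<exists>i\<in>{1..<n}. \<not> w (Suc i) < w i"
      using False no_ascent_longest[OF less(2)] by blast
    then obtain i where i: "i \<in> {1..<n}" "\<not> w (Suc i) < w i" by blast
    then have i: "i \<in> {1..<n}" "w i < w (Suc i)"
      using permutes_neq[OF less(2), of i "Suc i"] by auto
    have above: "P v" if v: "v permutes {1..n}" "ninv n v > ninv n w" for v
    proof -
      have "ninv n w < n * n" using v(2) ninv_le[of n v] by (rule less_le_trans)
      then have "n * n - ninv n v < n * n - ninv n w" using v(2) by (rule diff_less_mono2[rotated])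
      then show "P v" using v(1) by (rule less(1))
    qed
    have st: "(\<And>v. v permutes {1..n} \<Longrightarrow> ninv n v > ninv n w \<Longrightarrow> P v) \<Longrightarrow> P w"
      by (rule step[OF less(2) i(1) i(2)])
    show "P w" by (rule st) (rule above)
  qed (simp add: assms(2))
qed

section \<open>Polynomial induction and monomials\<close>

lemma poly_mapping_add_induct [case_names zero single add]:
  fixes f :: "'b \<Rightarrow>\<^sub>0 'c::comm_monoid_add"
  assumes "P 0" "\<And>m c. P (Poly_Mapping.single m c)" "\<And>f g. P f \<Longrightarrow> P g \<Longrightarrow> P (f + g)"
  shows "P f"
proof -
  have "P (\<Sum>m\<in>A. Poly_Mapping.single m (Poly_Mapping.lookup f m))" if "finite A" for A
    using that by (induction A rule: finite_induct) (auto intro: assms)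
  moreover have "f = (\<Sum>m\<in>Poly_Mapping.keys f. Poly_Mapping.single m (Poly_Mapping.lookup f m))"
    by (rule poly_mapping_eqI) (auto simp: lookup_sum lookup_single when_def in_keys_iff sum.delta)
  ultimately show ?thesis by (metis finite_keys)
qed

lemma mvar_power: "mvar v ^ k = Poly_Mapping.single (Poly_Mapping.single v k) (1::'a::comm_ring_1)"
  by (induction k) (simp_all add: mvar_def mult_single flip: single_add)

lemma single_power_sum: "finite A \<Longrightarrow> (\<Prod>v\<in>A. mvar v ^ e v) =
    Poly_Mapping.single (\<Sum>v\<in>A. Poly_Mapping.single v (e v)) (1::'a::comm_ring_1)"
  by (induction A rule: finite_induct) (simp_all add: mvar_power mult_single)

lemma exponent_sum: "(\<Sum>v\<in>Poly_Mapping.keys m. Poly_Mapping.single v (Poly_Mapping.lookup m v)) = m"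
  by (rule poly_mapping_eqI) (auto simp: lookup_sum lookup_single when_def in_keys_iff sum.delta)

lemma single_eq_prod: "Poly_Mapping.single m c =
    Poly_Mapping.single 0 c * (\<Prod>v\<in>Poly_Mapping.keys m. mvar v ^ Poly_Mapping.lookup m v)"
  for c :: "'a::comm_ring_1"
  by (simp add: single_power_sum exponent_sum mult_single)

text \<open>Constants and variables generate the ring, so identities between ring homomorphisms need
  to be checked only on them.\<close>

lemma mpoly_induct [case_names const var add mult]:
  fixes f :: "('v, 'a::comm_ring_1) mpoly"
  assumes c: "\<And>c. P (Poly_Mapping.single 0 c)" and v: "\<And>v. P (mvar v)"
    and a: "\<And>f g. P f \<Longrightarrow> P g \<Longrightarrow> P (f + g)" and m: "\<And>f g. P f \<Longrightarrow> P g \<Longrightarrow> P (f * g)"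
  shows "P f"
proof (induction f rule: poly_mapping_add_induct)
  case zero
  show ?case using c[of 0] by simp
next
  case (single e b)
  have one: "P 1" using c[of 1] by simp
  have pw: "P (mvar x ^ k)" for x k by (induction k) (auto intro: one v m)
  have "P (\<Prod>v\<in>A. mvar v ^ Poly_Mapping.lookup e v)" if "finite A" for A
    using that by (induction A rule: finite_induct) (auto intro: one pw m)
  then show ?case unfolding single_eq_prod[of e b] by (intro m c) simp
qed (rule a)

subsection \<open>Evaluation\<close>

definition mon :: "('v \<Rightarrow> 'a::comm_ring_1) \<Rightarrow> ('v \<Rightarrow>\<^sub>0 nat) \<Rightarrow> 'a" where
  "mon x m = (\<Prod>v\<in>Poly_Mapping.keys m. x v ^ Poly_Mapping.lookup m v)"

lemma mon_superset: "finite A \<Longrightarrow> Poly_Mapping.keys m \<subseteq> A \<Longrightarrow> mon x m = (\<Prod>v\<in>A. x v ^ Poly_Mapping.lookup m v)"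
  unfolding mon_def by (rule prod.mono_neutral_left) (auto simp: in_keys_iff)

lemma mon_0 [simp]: "mon x 0 = 1"
  by (simp add: mon_def)

lemma mon_single [simp]: "mon x (Poly_Mapping.single v k) = x v ^ k"
  by (simp add: mon_def)

lemma mon_add: "mon x (m + m') = mon x m * mon x m'"
proof -
  let ?A = "Poly_Mapping.keys m \<union> Poly_Mapping.keys m'"
  have "mon x (m + m') = (\<Prod>v\<in>?A. x v ^ Poly_Mapping.lookup (m + m') v)"
    by (rule mon_superset) (auto simp: keys_add)
  also have "\<dots> = (\<Prod>v\<in>?A. x v ^ Poly_Mapping.lookup m v) * (\<Prod>v\<in>?A. x v ^ Poly_Mapping.lookup m' v)"
    by (simp add: lookup_add power_add prod.distrib)
  also have "\<dots> = mon x m * mon x m'" by (simp add: mon_superset[of ?A])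
  finally show ?thesis .
qed

lemma mon_sum: "mon x (\<Sum>a\<in>A. f a) = (\<Prod>a\<in>A. mon x (f a))"
  by (induction A rule: infinite_finite_induct) (auto simp: mon_add)

text \<open>The coefficient map \<open>\<phi>\<close> lets one construction serve for evaluation at
  points, substitution of polynomials, restriction to a curve, and evaluation with specialised
  parameters.\<close>

definition hom_eval :: "('a \<Rightarrow> 'b) \<Rightarrow> ('v \<Rightarrow> 'b) \<Rightarrow> ('v, 'a::comm_ring_1) mpoly \<Rightarrow> 'b::comm_ring_1" where
  "hom_eval \<phi> x f = (\<Sum>m\<in>Poly_Mapping.keys f. \<phi> (Poly_Mapping.lookup f m) * mon x m)"

lemma poly_eval_eq_hom_eval: "poly_eval a f = hom_eval (\<lambda>c. c) a f"
  by (simp add: poly_eval_def hom_eval_def mon_def)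

context
  fixes \<phi> :: "'a::comm_ring_1 \<Rightarrow> 'b::comm_ring_1"
  assumes hom: "comm_ring_hom \<phi>"
begin

interpretation comm_ring_hom \<phi> by (rule hom)

lemma hom_eval_superset: "finite A \<Longrightarrow> Poly_Mapping.keys f \<subseteq> A \<Longrightarrow>
    hom_eval \<phi> x f = (\<Sum>m\<in>A. \<phi> (Poly_Mapping.lookup f m) * mon x m)"
  unfolding hom_eval_def by (rule sum.mono_neutral_left) (auto simp: in_keys_iff)

lemma hom_eval_0: "hom_eval \<phi> x 0 = 0"
  by (simp add: hom_eval_def)

lemma hom_eval_single: "hom_eval \<phi> x (Poly_Mapping.single m c) = \<phi> c * mon x m"
  by (simp add: hom_eval_def)

lemma hom_eval_add: "hom_eval \<phi> x (f + g) = hom_eval \<phi> x f + hom_eval \<phi> x g"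
proof -
  let ?A = "Poly_Mapping.keys f \<union> Poly_Mapping.keys g"
  have "hom_eval \<phi> x (f + g) = (\<Sum>m\<in>?A. \<phi> (Poly_Mapping.lookup (f + g) m) * mon x m)"
    by (rule hom_eval_superset) (auto simp: keys_add)
  also have "\<dots> = hom_eval \<phi> x f + hom_eval \<phi> x g"
    by (simp add: hom_eval_superset[of ?A] lookup_add hom_add ring_distribs sum.distrib)
  finally show ?thesis .
qed

lemma hom_eval_sum: "hom_eval \<phi> x (\<Sum>a\<in>A. f a) = (\<Sum>a\<in>A. hom_eval \<phi> x (f a))"
  by (induction A rule: infinite_finite_induct) (auto simp: hom_eval_add hom_eval_0)

lemma hom_eval_mult: "hom_eval \<phi> x (f * g) = hom_eval \<phi> x f * hom_eval \<phi> x g"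
proof (induction f rule: poly_mapping_add_induct)
  case (single m c)
  show ?case
  proof (induction g rule: poly_mapping_add_induct)
    case (single m' c')
    show ?case by (simp add: mult_single hom_eval_single hom_mult mon_add ac_simps)
  qed (auto simp: hom_eval_0 hom_eval_add ring_distribs)
qed (auto simp: hom_eval_0 hom_eval_add ring_distribs)

lemma hom_eval_hom: "comm_ring_hom (hom_eval \<phi> x)"
proof
  show "hom_eval \<phi> x 1 = 1" using hom_eval_single[of x 0 1] by simp
qed (auto simp: hom_eval_0 hom_eval_add hom_eval_mult)

lemma hom_eval_mvar: "hom_eval \<phi> x (mvar v) = x v"
  by (simp add: mvar_def hom_eval_single)

lemma hom_eval_const: "hom_eval \<phi> x (Poly_Mapping.single 0 c) = \<phi> c"
  by (simp add: hom_eval_single)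

end

lemma comm_ring_hom_ident: "comm_ring_hom (\<lambda>c::'a::comm_ring_1. c)"
  by unfold_locales auto

lemma comm_ring_hom_const: "comm_ring_hom (Poly_Mapping.single (0::'v \<Rightarrow>\<^sub>0 nat) :: 'a::comm_ring_1 \<Rightarrow> _)"
  by unfold_locales (auto simp: single_add mult_single)

lemma poly_eval_hom: "comm_ring_hom (poly_eval a)"
  unfolding poly_eval_eq_hom_eval[abs_def] by (rule hom_eval_hom[OF comm_ring_hom_ident])

interpretation poly_eval: comm_ring_hom "poly_eval a" for a :: "'v \<Rightarrow> 'a::comm_ring_1"
  by (rule poly_eval_hom)

lemma poly_eval_mvar [simp]: "poly_eval a (mvar v) = a v"
  unfolding poly_eval_eq_hom_eval by (rule hom_eval_mvar[OF comm_ring_hom_ident])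

lemma poly_eval_single [simp]: "poly_eval a (Poly_Mapping.single m c) = c * mon a m"
  unfolding poly_eval_eq_hom_eval by (rule hom_eval_single[OF comm_ring_hom_ident])

subsection \<open>Divided differences\<close>

lemma map_key_transpose_single:
  "Poly_Mapping.map_key (Transposition.transpose u v) (Poly_Mapping.single x k) =
    Poly_Mapping.single (Transposition.transpose u v x) k"
  by (metis inj_transpose map_key_single transpose_involutory)

lemma map_key_transpose_invol:
  "Poly_Mapping.map_key (Transposition.transpose u v) (Poly_Mapping.map_key (Transposition.transpose u v) m) = m"
  by (rule poly_mapping_eqI) (simp add: map_key.rep_eq)

lemma inj_map_key_transpose: "inj (Poly_Mapping.map_key (Transposition.transpose u v) :: ('v \<Rightarrow>\<^sub>0 nat) \<Rightarrow> _)"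
  by (rule inj_on_inverseI) (rule map_key_transpose_invol)

lemma swap_vars_single:
  fixes u v :: 'v
  shows "swap_vars u v (Poly_Mapping.single m c) =
    Poly_Mapping.single (Poly_Mapping.map_key (Transposition.transpose u v) m) c"
proof -
  let ?F = "Poly_Mapping.map_key (Transposition.transpose u v) :: ('v \<Rightarrow>\<^sub>0 nat) \<Rightarrow> _"
  have "swap_vars u v (Poly_Mapping.single (?F (?F m)) c) = Poly_Mapping.single (?F m) c"
    unfolding swap_vars_def by (rule map_key_single[OF inj_map_key_transpose])
  then show ?thesis by (simp add: map_key_transpose_invol)
qed

lemma swap_vars_add: "swap_vars u v (f + g) = swap_vars u v f + swap_vars u v g"
  unfolding swap_vars_def by (rule map_key_plus[OF inj_map_key_transpose])

lemma swap_vars_zero: "swap_vars u v 0 = 0"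
  unfolding swap_vars_def by (rule map_key_zero[OF inj_map_key_transpose])

lemma swap_vars_mult: "swap_vars u v (f * g) = swap_vars u v f * swap_vars u v g"
proof (induction f rule: poly_mapping_add_induct)
  case (single m c)
  show ?case
  proof (induction g rule: poly_mapping_add_induct)
    case (single m' c')
    show ?case by (simp add: mult_single swap_vars_single map_key_plus)
  qed (auto simp: swap_vars_zero swap_vars_add ring_distribs)
qed (auto simp: swap_vars_zero swap_vars_add ring_distribs)

lemma swap_vars_hom: "comm_ring_hom (swap_vars u v :: ('v, 'a::comm_ring_1) mpoly \<Rightarrow> _)"
proof
  have "swap_vars u v (Poly_Mapping.single 0 1 :: ('v, 'a) mpoly) = Poly_Mapping.single 0 1"
    unfolding swap_vars_single by (subst map_key_zero) auto
  then show "swap_vars u v (1 :: ('v, 'a) mpoly) = 1" by simp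
qed (auto simp: swap_vars_zero swap_vars_add swap_vars_mult)

interpretation swap_vars: comm_ring_hom "swap_vars u v :: ('v, 'a::comm_ring_1) mpoly \<Rightarrow> _" for u v :: 'v
  by (rule swap_vars_hom)

lemma swap_vars_mvar: "swap_vars u v (mvar x) = mvar (Transposition.transpose u v x)"
  by (simp add: mvar_def swap_vars_single map_key_transpose_single)

lemma swap_vars_const: "swap_vars u v (Poly_Mapping.single 0 c) = Poly_Mapping.single 0 c"
  unfolding swap_vars_single by (subst map_key_zero) auto

lemma swap_vars_invol: "swap_vars u v (swap_vars u v f) = f"
  by (induction f rule: mpoly_induct) (auto simp: swap_vars_const swap_vars_mvar swap_vars_add swap_vars_mult)

lemma swap_vars_braid:
  assumes "a \<noteq> b" "b \<noteq> c" "a \<noteq> c"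
  shows "swap_vars a b (swap_vars b c (swap_vars a b f)) = swap_vars b c (swap_vars a b (swap_vars b c f))"
proof (induction f rule: mpoly_induct)
  case (var v)
  show ?case using assms by (auto simp: swap_vars_mvar Transposition.transpose_def)
qed (auto simp: swap_vars_const swap_vars_add swap_vars_mult)

lemma swap_vars_commute:
  assumes "{a, b} \<inter> {c, d} = {}"
  shows "swap_vars a b (swap_vars c d f) = swap_vars c d (swap_vars a b f)"
proof (induction f rule: mpoly_induct)
  case (var v)
  show ?case using assms by (auto simp: swap_vars_mvar Transposition.transpose_def)
qed (auto simp: swap_vars_const swap_vars_add swap_vars_mult)

text \<open>The twisted product rule \<open>f g - s(f g) = (f - s f) g + s f (g - s g)\<close>
  reduces divisibility to the variables.\<close>

lemma diff_swap_vars_dvd: "(mvar u - mvar v) dvd (f - swap_vars u v f)"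
proof (induction f rule: mpoly_induct)
  case (var x)
  show ?case
  proof (cases "x = v")
    case True
    show ?thesis using True unfolding swap_vars_mvar by (intro dvdI[of _ _ "-1"]) simp
  qed (auto simp: swap_vars_mvar Transposition.transpose_def)
next
  case (add f g)
  have "f + g - swap_vars u v (f + g) = (f - swap_vars u v f) + (g - swap_vars u v g)"
    by (simp add: swap_vars_add)
  then show ?case using add by (metis dvd_add)
next
  case (mult f g)
  have "f * g - swap_vars u v (f * g) = (f - swap_vars u v f) * g + swap_vars u v f * (g - swap_vars u v g)"
    by (simp add: swap_vars_mult algebra_simps)
  then show ?case using mult by (metis dvd_add dvd_mult dvd_mult2)
qed (simp add: swap_vars_const)

text \<open>Divisibility makes the choice possible and cancellation makes it unique. Identities for
  \<open>ddiff\<close> are therefore proved by multiplying with the difference of the two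
  variables.\<close>

definition ddiff :: "nat \<Rightarrow> (nat, int) mpoly \<Rightarrow> (nat, int) mpoly" where
  "ddiff i f = (SOME g. g * (mvar i - mvar (Suc i)) = f - swap_vars i (Suc i) f)"

lemma ddiff: "ddiff i f * (mvar i - mvar (Suc i)) = f - swap_vars i (Suc i) f"
proof -
  have "\<exists>g. g * (mvar i - mvar (Suc i)) = f - swap_vars i (Suc i) f"
    using diff_swap_vars_dvd[of i "Suc i" f] by (auto simp: dvd_def mult.commute)
  then show ?thesis unfolding ddiff_def by (rule someI_ex)
qed

lemma mvar_diff_neq_0: "u \<noteq> v \<Longrightarrow> mvar u - mvar v \<noteq> (0 :: ('v, 'a::comm_ring_1) mpoly)"
proof
  assume "u \<noteq> v" "mvar u - mvar v = (0 :: ('v, 'a::comm_ring_1) mpoly)"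
  then have "poly_eval (\<lambda>x. if x = u then 1 else 0) (mvar u - mvar v :: ('v, 'a) mpoly) = 0" by simp
  then show False using \<open>u \<noteq> v\<close> by (simp add: poly_eval.hom_minus)
qed

lemma ddiff_unique: "g * (mvar i - mvar (Suc i)) = f - swap_vars i (Suc i) f \<Longrightarrow> g = ddiff i f"
  using ddiff[of i f] mvar_diff_neq_0[of i "Suc i", where 'a = int] by (metis mult_right_cancel n_not_Suc_n)

lemma ddiff_add: "ddiff i (f + g) = ddiff i f + ddiff i g"
  by (rule ddiff_unique[symmetric]) (simp add: ring_distribs(2) ddiff swap_vars_add)

lemma ddiff_zero: "ddiff i 0 = 0"
  by (rule ddiff_unique[symmetric]) simp

lemma ddiff_sum: "ddiff i (\<Sum>a\<in>A. f a) = (\<Sum>a\<in>A. ddiff i (f a))"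
  by (induction A rule: infinite_finite_induct) (auto simp: ddiff_add ddiff_zero)

lemma ddiff_symmetric: "swap_vars i (Suc i) f = f \<Longrightarrow> ddiff i f = 0"
  by (rule ddiff_unique[symmetric]) simp

lemma ddiff_mult_symmetric: "swap_vars i (Suc i) f = f \<Longrightarrow> ddiff i (f * g) = f * ddiff i g"
  by (rule ddiff_unique[symmetric]) (simp only: mult.assoc ddiff swap_vars_mult right_diff_distrib[of f])

text \<open>Leibniz rule for a factor that is not symmetric. Its correction term \<open>- f\<close>
  is the source of an additional cover in the co-transition formula.\<close>

lemma ddiff_mvar_Suc: "ddiff i (mvar (Suc i) * f) = mvar i * ddiff i f - f"
proof (rule ddiff_unique[symmetric])
  let ?d = "mvar i - mvar (Suc i) :: (nat, int) mpoly"
  have "(mvar i * ddiff i f - f) * ?d = mvar i * (ddiff i f * ?d) - f * ?d" by (simp add: algebra_simps)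
  also have "\<dots> = mvar (Suc i) * f - swap_vars i (Suc i) (mvar (Suc i) * f)"
    unfolding ddiff swap_vars_mult swap_vars_mvar by (simp add: algebra_simps)
  finally show "(mvar i * ddiff i f - f) * ?d = \<dots>" .
qed

lemma swap_vars_ddiff: "swap_vars i (Suc i) (ddiff i f) = ddiff i f"
proof (rule ddiff_unique)
  have "swap_vars i (Suc i) (ddiff i f * (mvar i - mvar (Suc i))) = swap_vars i (Suc i) f - f"
    unfolding ddiff by (simp add: swap_vars.hom_minus swap_vars_invol)
  then have "swap_vars i (Suc i) (ddiff i f) * (mvar (Suc i) - mvar i) = swap_vars i (Suc i) f - f"
    by (simp add: swap_vars_mult swap_vars.hom_minus swap_vars_mvar)
  then show "swap_vars i (Suc i) (ddiff i f) * (mvar i - mvar (Suc i)) = f - swap_vars i (Suc i) f"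
    by (simp add: algebra_simps)
qed

lemma ddiff_commute:
  assumes "{i, Suc i} \<inter> {j, Suc j} = {}"
  shows "ddiff i (ddiff j f) = ddiff j (ddiff i f)"
proof -
  let ?d = "\<lambda>i. mvar i - mvar (Suc i) :: (nat, int) mpoly" and ?s = "\<lambda>i. swap_vars i (Suc i)"
  have fix1: "?s i (?d j) = ?d j" and fix2: "?s j (?d i) = ?d i"
    using assms by (auto simp: swap_vars.hom_minus swap_vars_mvar Transposition.transpose_def)
  have aux: "ddiff i (ddiff j f) * ?d i * ?d j = f - ?s j f - ?s i f + ?s i (?s j f)"
    if "?s i (?d j) = ?d j" for i j
  proof -
    have "ddiff i (ddiff j f) * ?d i * ?d j = ddiff j f * ?d j - ?s i (ddiff j f) * ?s i (?d j)"
      by (simp only: ddiff that left_diff_distrib)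
    also have "?s i (ddiff j f) * ?s i (?d j) = ?s i (f - ?s j f)"
      unfolding swap_vars_mult[symmetric] ddiff ..
    finally show ?thesis unfolding ddiff by (simp add: swap_vars.hom_minus)
  qed
  have "ddiff i (ddiff j f) * (?d i * ?d j) = ddiff j (ddiff i f) * (?d i * ?d j)"
    using aux[OF fix1] aux[OF fix2] swap_vars_commute[OF assms, of f] by (simp add: ac_simps)
  moreover have "?d i * ?d j \<noteq> 0" using mvar_diff_neq_0 by (metis mult_eq_0_iff n_not_Suc_n)
  ultimately show ?thesis by simp
qed

text \<open>A triple divided difference has the common denominator \<open>A * B * (A + B)\<close>,
  the product of the differences of three variables, and its numerator is the alternating sum over
  the group generated by \<open>s\<close> and \<open>t\<close>. Abstract \<open>s\<close>,
  \<open>t\<close>, \<open>A\<close>, \<open>B\<close> cover both sides of the braid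
  relation.\<close>

lemma ddiff_triple:
  fixes s t :: "(nat, int) mpoly \<Rightarrow> (nat, int) mpoly" and A B :: "(nat, int) mpoly"
  assumes s: "comm_ring_hom s" and t: "comm_ring_hom t"
    and f1: "f1 * A = f - s f" and f2: "f2 * B = f1 - t f1" and f3: "f3 * A = f2 - s f2" and sf1: "s f1 = f1"
    and sA: "s A = - A" and sB: "s B = A + B" and tA: "t A = A + B" and tB: "t B = - B"
    and ss: "\<And>x. s (s x) = x"
  shows "f3 * (A * B * (A + B)) = f - s f - t f + t (s f) + s (t f) - s (t (s f))"
proof -
  interpret s: comm_ring_hom s by (rule s)
  interpret t: comm_ring_hom t by (rule t)
  have e1: "t f1 * (A + B) = t f - t (s f)"
    using arg_cong[OF f1, of t] by (simp add: t.hom_mult t.hom_minus tA)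
  have e2: "s (t f1) * B = s (t f) - s (t (s f))"
    using arg_cong[OF e1, of s] by (simp add: s.hom_mult s.hom_minus s.hom_add sA sB)
  have e3: "s f2 * (A + B) = f1 - s (t f1)"
    using arg_cong[OF f2, of s] by (simp add: s.hom_mult s.hom_minus sB sf1)
  have "f3 * (A * B * (A + B)) = (f3 * A) * B * (A + B)" by (simp add: algebra_simps)
  also have "\<dots> = (f2 * B) * (A + B) - (s f2 * (A + B)) * B" unfolding f3 by (simp add: algebra_simps)
  also have "\<dots> = f1 * A - t f1 * (A + B) + s (t f1) * B" unfolding f2 e3 by (simp add: algebra_simps)
  finally show ?thesis unfolding f1 e1 e2 by simp
qed

lemma ddiff_braid: "ddiff i (ddiff (Suc i) (ddiff i f)) = ddiff (Suc i) (ddiff i (ddiff (Suc i) f))"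
proof -
  let ?s = "swap_vars i (Suc i) :: (nat, int) mpoly \<Rightarrow> _" and ?t = "swap_vars (Suc i) (Suc (Suc i)) :: (nat, int) mpoly \<Rightarrow> _"
  let ?A = "mvar i - mvar (Suc i) :: (nat, int) mpoly" and ?B = "mvar (Suc i) - mvar (Suc (Suc i)) :: (nat, int) mpoly"
  have acts: "?s ?A = - ?A" "?s ?B = ?A + ?B" "?t ?A = ?A + ?B" "?t ?B = - ?B" "?s ?B = ?B + ?A" "?t ?A = ?B + ?A"
    by (simp_all add: swap_vars.hom_minus swap_vars_mvar Transposition.transpose_def)
  have "ddiff i (ddiff (Suc i) (ddiff i f)) * (?A * ?B * (?A + ?B)) =
      f - ?s f - ?t f + ?t (?s f) + ?s (?t f) - ?s (?t (?s f))"
    by (rule ddiff_triple[OF swap_vars_hom swap_vars_hom ddiff ddiff ddiff swap_vars_ddiff])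
      (simp_all add: acts swap_vars_invol)
  \<comment> \<open>Both words have the same alternating sum over six permutations as numerator;
    only the term of the longest permutation is written differently, and there the braid relation
    applies.\<close>
  also have "\<dots> = f - ?t f - ?s f + ?s (?t f) + ?t (?s f) - ?t (?s (?t f))"
    by (subst swap_vars_braid) (auto simp: algebra_simps)
  also have "\<dots> = ddiff (Suc i) (ddiff i (ddiff (Suc i) f)) * (?B * ?A * (?B + ?A))"
    by (rule ddiff_triple[symmetric, OF swap_vars_hom swap_vars_hom ddiff ddiff ddiff swap_vars_ddiff])
      (rule acts(4) acts(6) acts(5) acts(1) swap_vars_invol)+
  finally have "ddiff i (ddiff (Suc i) (ddiff i f)) * (?A * ?B * (?A + ?B)) =
      ddiff (Suc i) (ddiff i (ddiff (Suc i) f)) * (?A * ?B * (?A + ?B))"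
    by (simp only: mult.commute[of ?B ?A] add.commute[of ?B ?A])
  moreover have "?A + ?B = mvar i - mvar (Suc (Suc i))" by simp
  then have "?A * ?B * (?A + ?B) \<noteq> 0" by (simp only: mult_eq_0_iff mvar_diff_neq_0) simp
  ultimately show ?thesis by (metis mult_right_cancel)
qed

section \<open>Existence and uniqueness of Schubert polynomials\<close>

lemma is_schubert_permutes: "is_schubert n w f \<Longrightarrow> w permutes {1..n}"
proof (induction rule: is_schubert.induct)
  case (step w f i g)
  then show ?case by (intro permutes_simple)
qed (rule longest_perm_permutes)

lemma is_schubert_ddiff:
  assumes "is_schubert n w f" "i \<in> {1..<n}" "w (Suc i) < w i"
  shows "is_schubert n (w \<circ> simple_refl i) (ddiff i f)"
  using assms ddiff by (auto intro: is_schubert.step)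

text \<open>The inductive rule descends from a longer permutation; here it is read from below, in
  terms of an ascent of \<open>w\<close>.\<close>

lemma is_schubert_cases:
  assumes "is_schubert n w f"
  obtains "w = longest_perm n" "f = (\<Prod>i\<in>{1..n}. mvar i ^ (n - i))"
  | i u g where "i \<in> {1..<n}" "w i < w (Suc i)" "u = w \<circ> simple_refl i" "is_schubert n u g" "f = ddiff i g"
  using assms
proof (cases rule: is_schubert.cases)
  case (step u g i)
  have "w i < w (Suc i)" using step(4) unfolding step(1) by (simp add: simple_refl_apply)
  moreover have "u = w \<circ> simple_refl i" unfolding step(1) by (simp add: comp_assoc)
  ultimately show ?thesis using that(2) step(2,3) ddiff_unique[OF step(5)] by blast
qed (use that(1) in blast)

lemma longest_perm_desc: "i \<in> {1..<n} \<Longrightarrow> longest_perm n (Suc i) < longest_perm n i"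
  by (auto simp: longest_perm_def)

lemma simple_refl_commute: "Suc j < k \<Longrightarrow> simple_refl j \<circ> simple_refl k = simple_refl k \<circ> simple_refl j"
  by (auto simp: fun_eq_iff simple_refl_apply)

lemma simple_refl_braid:
  "simple_refl j \<circ> simple_refl (Suc j) \<circ> simple_refl j = simple_refl (Suc j) \<circ> simple_refl j \<circ> simple_refl (Suc j)"
  by (auto simp: fun_eq_iff simple_refl_apply)

text \<open>Uniqueness is a local confluence argument: two ascents of \<open>w\<close> are completed to a common permutation
  above, and the two paths agree by the commutation or the braid relation for divided differences.\<close>

lemma ex1_is_schubert:
  assumes "w permutes {1..n}" shows "\<exists>!f. is_schubert n w f"
  using assms
proof (induction rule: perm_downward_induct)
  case longest
  show ?case
  proof (rule ex1I)
    fix f assume "is_schubert n (longest_perm n) f"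
    then show "f = (\<Prod>i\<in>{1..n}. mvar i ^ (n - i))"
    proof (cases rule: is_schubert_cases)
      case (2 i u g)
      then show ?thesis using longest_perm_desc[of i n] by simp
    qed
  qed (rule is_schubert.longest)
next
  case (step w i)
  note w = step(1)
  have up: "w \<circ> simple_refl j permutes {1..n}" "ninv n (w \<circ> simple_refl j) = Suc (ninv n w)"
    if "j \<in> {1..<n}" "w j < w (Suc j)" for j
    using that permutes_simple[OF w] ninv_simple_ascent[OF w] by blast+
  have IH: "v permutes {1..n} \<Longrightarrow> ninv n w < ninv n v \<Longrightarrow> \<exists>!f. is_schubert n v f" for v
    by (rule step(4))
  \<comment> \<open>The permutation \<open>z\<close> above both has two more inversions than
    \<open>w\<close> if the ascents are apart and three more if they are adjacent.\<close>
  have conf: "ddiff j f = ddiff k g"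
    if j: "j \<in> {1..<n}" "w j < w (Suc j)" and k: "k \<in> {1..<n}" "w k < w (Suc k)" and jk: "j < k"
      and f: "is_schubert n (w \<circ> simple_refl j) f" and g: "is_schubert n (w \<circ> simple_refl k) g" for j k f g
  proof (cases "k = Suc j")
    case False
    then have less: "Suc j < k" using jk by simp
    define z where "z = w \<circ> simple_refl j \<circ> simple_refl k"
    have z': "z = w \<circ> simple_refl k \<circ> simple_refl j"
      unfolding z_def comp_assoc simple_refl_commute[OF less] ..
    have "(w \<circ> simple_refl j) k < (w \<circ> simple_refl j) (Suc k)" using k less by (simp add: simple_refl_apply)
    then have "ninv n z = Suc (Suc (ninv n w))"
      unfolding z_def up(2)[OF j, symmetric] by (rule ninv_simple_ascent[OF up(1)[OF j] k(1)])
    moreover have "z permutes {1..n}" unfolding z_def by (rule permutes_simple[OF up(1)[OF j] k(1)])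
    ultimately have z: "z permutes {1..n}" "ninv n w < ninv n z" by simp_all
    obtain h where h: "is_schubert n z h" using IH[OF z] by blast
    have "is_schubert n (z \<circ> simple_refl k) (ddiff k h)"
      by (rule is_schubert_ddiff[OF h k(1)]) (use k less in \<open>simp add: z_def simple_refl_apply\<close>)
    then have f': "is_schubert n (w \<circ> simple_refl j) (ddiff k h)" by (simp add: z_def comp_assoc)
    have "is_schubert n (z \<circ> simple_refl j) (ddiff j h)"
      by (rule is_schubert_ddiff[OF h j(1)]) (use j less in \<open>simp add: z_def simple_refl_apply\<close>)
    then have g': "is_schubert n (w \<circ> simple_refl k) (ddiff j h)" by (simp add: z' comp_assoc)
    have "f = ddiff k h" using IH[OF up(1)[OF j]] up(2)[OF j] f f' by auto
    moreover have "g = ddiff j h" using IH[OF up(1)[OF k]] up(2)[OF k] g g' by auto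
    ultimately show ?thesis using ddiff_commute[of j k h] less by auto
  next
    case k': True
    define z where "z = w \<circ> simple_refl j \<circ> simple_refl k \<circ> simple_refl j"
    have z': "z = w \<circ> simple_refl k \<circ> simple_refl j \<circ> simple_refl k"
      unfolding z_def k' comp_assoc simple_refl_braid[unfolded comp_assoc] ..
    have a1: "(w \<circ> simple_refl j) k < (w \<circ> simple_refl j) (Suc k)" using j k k' by (simp add: simple_refl_apply)
    have p1: "w \<circ> simple_refl j \<circ> simple_refl k permutes {1..n}" using permutes_simple[OF up(1)[OF j] k(1)] .
    have n1: "ninv n (w \<circ> simple_refl j \<circ> simple_refl k) = Suc (Suc (ninv n w))"
      unfolding up(2)[OF j, symmetric] by (rule ninv_simple_ascent[OF up(1)[OF j] k(1) a1])
    have a2: "(w \<circ> simple_refl j \<circ> simple_refl k) j < (w \<circ> simple_refl j \<circ> simple_refl k) (Suc j)"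
      using j k k' by (simp add: simple_refl_apply)
    have "ninv n z = Suc (Suc (Suc (ninv n w)))"
      unfolding z_def n1[symmetric] by (rule ninv_simple_ascent[OF p1 j(1) a2])
    moreover have "z permutes {1..n}" unfolding z_def by (rule permutes_simple[OF p1 j(1)])
    ultimately have z: "z permutes {1..n}" "ninv n w < ninv n z" by simp_all
    obtain h where h: "is_schubert n z h" using IH[OF z] by blast
    have "is_schubert n (z \<circ> simple_refl j) (ddiff j h)"
      by (rule is_schubert_ddiff[OF h j(1)]) (use j k k' in \<open>simp add: z_def simple_refl_apply\<close>)
    then have "is_schubert n (w \<circ> simple_refl j \<circ> simple_refl k) (ddiff j h)" by (simp add: z_def comp_assoc)
    then have "is_schubert n (w \<circ> simple_refl j \<circ> simple_refl k \<circ> simple_refl k) (ddiff k (ddiff j h))"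
      by (rule is_schubert_ddiff[OF _ k(1)]) (use j k k' in \<open>simp add: z_def simple_refl_apply\<close>)
    then have f': "is_schubert n (w \<circ> simple_refl j) (ddiff k (ddiff j h))" by (simp add: comp_assoc)
    have "is_schubert n (z \<circ> simple_refl k) (ddiff k h)"
      by (rule is_schubert_ddiff[OF h k(1)]) (use j k k' in \<open>simp add: z' simple_refl_apply\<close>)
    then have "is_schubert n (w \<circ> simple_refl k \<circ> simple_refl j) (ddiff k h)" by (simp add: z' comp_assoc)
    then have "is_schubert n (w \<circ> simple_refl k \<circ> simple_refl j \<circ> simple_refl j) (ddiff j (ddiff k h))"
      by (rule is_schubert_ddiff[OF _ j(1)]) (use j k k' in \<open>simp add: z_def simple_refl_apply\<close>)
    then have g': "is_schubert n (w \<circ> simple_refl k) (ddiff j (ddiff k h))" by (simp add: comp_assoc)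
    have "f = ddiff k (ddiff j h)" using IH[OF up(1)[OF j]] up(2)[OF j] f f' by auto
    moreover have "g = ddiff j (ddiff k h)" using IH[OF up(1)[OF k]] up(2)[OF k] g g' by auto
    ultimately show ?thesis using ddiff_braid[of j h] k' by simp
  qed
  have not_longest: "w \<noteq> longest_perm n" using longest_perm_desc[of i n] step(2,3) by auto
  obtain f where f: "is_schubert n (w \<circ> simple_refl i) f"
    using IH[OF up(1)[OF step(2,3)]] up(2)[OF step(2,3)] by auto
  have "is_schubert n (w \<circ> simple_refl i \<circ> simple_refl i) (ddiff i f)"
    by (rule is_schubert_ddiff[OF f step(2)]) (use step(3) in \<open>simp add: simple_refl_apply\<close>)
  then have ex: "is_schubert n w (ddiff i f)" by (simp add: comp_assoc)
  show ?case
  proof (rule ex1I)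
    show "is_schubert n w (ddiff i f)" by (rule ex)
    fix g assume "is_schubert n w g"
    then show "g = ddiff i f"
    proof (cases rule: is_schubert_cases)
      case (2 k u h)
      show ?thesis
      proof (cases i k rule: linorder_cases)
        case less
        then show ?thesis using conf[OF step(2,3) 2(1,2) less f] 2 by simp
      next
        case greater
        then show ?thesis using conf[OF 2(1,2) step(2,3) greater _ f] 2 by simp
      next
        case equal
        then show ?thesis using IH[OF up(1)[OF step(2,3)]] up(2)[OF step(2,3)] f 2 by auto
      qed
    qed (use not_longest in simp)
  qed
qed

lemma schubert_poly_is_schubert: "w permutes {1..n} \<Longrightarrow> is_schubert n w (schubert_poly n w)"
  unfolding schubert_poly_def by (rule theI') (rule ex1_is_schubert)

lemma schubert_poly_eqI: "is_schubert n w f \<Longrightarrow> schubert_poly n w = f"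
  using ex1_is_schubert[OF is_schubert_permutes] schubert_poly_is_schubert[OF is_schubert_permutes] by blast

lemma schubert_poly_longest: "schubert_poly n (longest_perm n) = (\<Prod>i\<in>{1..n}. mvar i ^ (n - i))"
  by (rule schubert_poly_eqI) (rule is_schubert.longest)

lemma schubert_poly_descent:
  assumes "w permutes {1..n}" "i \<in> {1..<n}" "w (Suc i) < w i"
  shows "ddiff i (schubert_poly n w) = schubert_poly n (w \<circ> simple_refl i)"
  using schubert_poly_eqI[OF is_schubert_ddiff[OF schubert_poly_is_schubert[OF assms(1)] assms(2,3)]] by simp

lemma schubert_poly_ascent:
  assumes "w permutes {1..n}" "i \<in> {1..<n}" "w i < w (Suc i)"
  shows "schubert_poly n w = ddiff i (schubert_poly n (w \<circ> simple_refl i))"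
proof -
  have "ddiff i (schubert_poly n (w \<circ> simple_refl i)) = schubert_poly n (w \<circ> simple_refl i \<circ> simple_refl i)"
    by (rule schubert_poly_descent[OF permutes_simple[OF assms(1,2)] assms(2)])
      (use assms(3) in \<open>simp add: simple_refl_apply\<close>)
  then show ?thesis by (simp add: comp_assoc)
qed

text \<open>At an ascent the polynomial is itself a divided difference in the same two variables,
  hence symmetric in them.\<close>

lemma ddiff_schubert_poly_ascent:
  assumes "w permutes {1..n}" "i \<in> {1..<n}" "w i < w (Suc i)"
  shows "ddiff i (schubert_poly n w) = 0"
  by (rule ddiff_symmetric) (simp add: schubert_poly_ascent[OF assms] swap_vars_ddiff)

subsection \<open>The co-transition formula\<close>

text \<open>These \<open>l\<close> index the covers of \<open>w\<close> in Bruhat order that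
  exchange position \<open>i\<close> with a later one.\<close>

definition cov :: "nat \<Rightarrow> (nat \<Rightarrow> nat) \<Rightarrow> nat \<Rightarrow> nat set" where
  "cov n w i = {l. i < l \<and> l \<le> n \<and> w i < w l \<and> (\<forall>k. i < k \<and> k < l \<longrightarrow> \<not> (w i < w k \<and> w k < w l))}"

text \<open>The earliest position where \<open>w\<close> differs from the longest permutation. The
  values above \<open>n + 1 - i\<close> are used up before, so the deviation is to a smaller
  value.\<close>

definition first_deviation :: "nat \<Rightarrow> (nat \<Rightarrow> nat) \<Rightarrow> nat \<Rightarrow> bool" where
  "first_deviation n w i \<longleftrightarrow> 1 \<le> i \<and> (\<forall>k. 1 \<le> k \<and> k < i \<longrightarrow> w k = n + 1 - k) \<and> w i < n + 1 - i"

lemma finite_cov: "finite (cov n w i)"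
  by (rule finite_subset[of _ "{..n}"]) (auto simp: cov_def)

lemma transpose_permutes: "1 \<le> (i::nat) \<Longrightarrow> i < l \<Longrightarrow> l \<le> n \<Longrightarrow> Transposition.transpose i l permutes {1..n}"
  by (rule permutes_swap_id) auto

lemma cov_permutes: "w permutes {1..n} \<Longrightarrow> 1 \<le> i \<Longrightarrow> l \<in> cov n w i \<Longrightarrow> w \<circ> Transposition.transpose i l permutes {1..n}"
  by (rule permutes_compose[OF transpose_permutes]) (auto simp: cov_def)

text \<open>The staircase monomial has exponents \<open>n - i\<close> and \<open>n - i - 1\<close>
  at the two variables; one more factor \<open>x_{i+1}\<close> makes them equal.\<close>

lemma prod_mvar_swap:
  assumes "i \<in> {1..<n}"
  shows "swap_vars i (Suc i) (mvar (Suc i) * (\<Prod>k\<in>{1..n}. mvar k ^ (n - k))) =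
    (mvar (Suc i) * (\<Prod>k\<in>{1..n}. mvar k ^ (n - k)) :: (nat, int) mpoly)"
proof -
  have split: "{1..n} = insert i (insert (Suc i) ({1..n} - {i, Suc i}))" using assms by auto
  define R where "R = (\<Prod>k\<in>{1..n} - {i, Suc i}. mvar k ^ (n - k) :: (nat, int) mpoly)"
  have prod: "(\<Prod>k\<in>{1..n}. mvar k ^ (n - k)) = mvar i ^ (n - i) * (mvar (Suc i) ^ (n - Suc i) * R)"
    by (subst split) (simp add: R_def)
  have R: "swap_vars i (Suc i) R = R"
    unfolding R_def swap_vars.hom_prod swap_vars.hom_power swap_vars_mvar
    by (rule prod.cong) (auto simp: Transposition.transpose_def)
  have e: "n - i = Suc (n - Suc i)" using assms by auto
  show ?thesis unfolding prod
    by (simp add: swap_vars_mult swap_vars.hom_power swap_vars_mvar R e)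
qed

text \<open>An ascent \<open>j > i\<close> is used by applying the \<open>j\<close>-th divided
  difference to the formula for \<open>w s_j\<close>: it commutes with \<open>x_i\<close> and
  annihilates the summands having an ascent at \<open>j\<close>. Without such an ascent,
  \<open>w\<close> decreases after \<open>i\<close> and has an ascent at \<open>i\<close> itself;
  the divided difference at \<open>i\<close> then turns \<open>x_{i+1}\<close> into
  \<open>x_i\<close> and leaves one more summand, the cover at \<open>i + 1\<close>. The lengths of
  the covers follow the same induction.\<close>

lemma cotransition:
  assumes "w permutes {1..n}" "first_deviation n w i"
  shows "mvar i * schubert_poly n w = (\<Sum>l\<in>cov n w i. schubert_poly n (w \<circ> Transposition.transpose i l)) \<and>
    (\<forall>l\<in>cov n w i. ninv n (w \<circ> Transposition.transpose i l) = Suc (ninv n w))"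
  using assms
proof (induction arbitrary: i rule: perm_downward_induct)
  case longest
  then show ?case by (auto simp: first_deviation_def longest_perm_def split: if_splits)
next
  case (step w j0)
  note w = step(1) and dev = step(5)
  have i1: "1 \<le> i" and pre: "\<And>k. 1 \<le> k \<Longrightarrow> k < i \<Longrightarrow> w k = n + 1 - k" and wi: "w i < n + 1 - i"
    using dev by (auto simp: first_deviation_def)
  have w_ge: "1 \<le> w k" "w k \<le> n" if "1 \<le> k" "k \<le> n" for k
    using permutes_in_image[OF w, of k] that by auto
  have w_le: "w k \<le> n + 1 - i" if "i \<le> k" "k \<le> n" for k
  proof (rule ccontr)
    assume "\<not> w k \<le> n + 1 - i"
    then have "1 \<le> n + 1 - w k" "n + 1 - w k < i" "w (n + 1 - w k) = w k"
      using pre[of "n + 1 - w k"] w_ge[of k] that i1 by auto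
    then show False using permutes_neq[OF w, of "n + 1 - w k" k] that by auto
  qed
  show ?case
  proof (cases "\<exists>j. i < j \<and> j < n \<and> w j < w (Suc j)")
    case True
    then obtain j where j: "i < j" "j < n" "w j < w (Suc j)" by blast
    then have jn: "j \<in> {1..<n}" by simp
    define u where "u = w \<circ> simple_refl j"
    have u: "u permutes {1..n}" "ninv n u = Suc (ninv n w)"
      using permutes_simple[OF w jn] ninv_simple_ascent[OF w jn j(3)] unfolding u_def by auto
    have "first_deviation n u i" using dev j(1) by (auto simp: first_deviation_def u_def simple_refl_apply)
    note IH = step(4)[OF u(1) _ this]
    have less: "ninv n w < ninv n u" using u(2) by simp
    have ct: "mvar i * schubert_poly n u = (\<Sum>l\<in>cov n u i. schubert_poly n (u \<circ> Transposition.transpose i l))"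
      by (rule IH[OF less, THEN conjunct1])
    have inv: "ninv n (u \<circ> Transposition.transpose i l) = Suc (ninv n u)" if "l \<in> cov n u i" for l
      by (rule IH[OF less, THEN conjunct2, rule_format, OF that])
    let ?s = "simple_refl j"
    define desc where "desc l \<longleftrightarrow> (u \<circ> Transposition.transpose i l) (Suc j) < (u \<circ> Transposition.transpose i l) j" for l
    have ts: "u \<circ> Transposition.transpose i l \<circ> ?s = w \<circ> Transposition.transpose i (?s l)" if "l \<noteq> i" for l
      using j(1) that by (auto simp: fun_eq_iff u_def simple_refl_def Transposition.transpose_def)
    have neqs: "w j \<noteq> w i" "w (Suc j) \<noteq> w i"
      using permutes_neq[OF w, of j i] permutes_neq[OF w, of "Suc j" i] j(1) by auto
    \<comment> \<open>Covers of \<open>w\<close> at \<open>i\<close> correspond under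
      \<open>s_j\<close> to those covers of \<open>u\<close> that keep a descent at
      \<open>j\<close>. For \<open>l\<close> equal to \<open>j\<close> or \<open>j + 1\<close> this
      hinges on how \<open>w i\<close> compares with the two exchanged values.\<close>
    have covl: "l \<in> cov n w i \<longleftrightarrow> ?s l \<in> cov n u i \<and> desc (?s l)" for l
    proof -
      consider "l \<le> i" | "i < l" "l < j" | "l = j" | "l = Suc j" | "Suc j < l" by linarith
      then show ?thesis
      proof cases
        case 1
        then show ?thesis using j by (auto simp: cov_def simple_refl_apply)
      next
        case 2
        then have "desc l" using j by (auto simp: desc_def u_def simple_refl_def Transposition.transpose_def)
        moreover have "l \<in> cov n w i \<longleftrightarrow> l \<in> cov n u i" using 2 j by (auto simp: cov_def u_def simple_refl_apply)
        ultimately show ?thesis using 2 by (simp add: simple_refl_apply)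
      next
        case 3
        have "desc (Suc j) \<longleftrightarrow> w i < w (Suc j)" using j by (simp add: desc_def u_def simple_refl_def Transposition.transpose_def)
        moreover have "Suc j \<in> cov n u i \<longleftrightarrow> w i < w j \<and> (\<forall>k. i < k \<and> k < Suc j \<longrightarrow> \<not> (w i < u k \<and> u k < w j))"
          using j by (auto simp: cov_def u_def simple_refl_apply)
        moreover have "(\<forall>k. i < k \<and> k < Suc j \<longrightarrow> \<not> (w i < u k \<and> u k < w j)) \<longleftrightarrow>
            (\<forall>k. i < k \<and> k < j \<longrightarrow> \<not> (w i < w k \<and> w k < w j))"
          using j by (auto simp: u_def simple_refl_apply less_Suc_eq)
        moreover have "j \<in> cov n w i \<longleftrightarrow> w i < w j \<and> (\<forall>k. i < k \<and> k < j \<longrightarrow> \<not> (w i < w k \<and> w k < w j))"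
          using j by (auto simp: cov_def)
        ultimately show ?thesis using 3 j by (auto simp: simple_refl_apply)
      next
        case 4
        have "desc j \<longleftrightarrow> w j < w i" using j by (simp add: desc_def u_def simple_refl_def Transposition.transpose_def)
        moreover have "j \<in> cov n u i \<longleftrightarrow> w i < w (Suc j) \<and> (\<forall>k. i < k \<and> k < j \<longrightarrow> \<not> (w i < w k \<and> w k < w (Suc j)))"
          using j by (auto simp: cov_def u_def simple_refl_apply)
        moreover have "Suc j \<in> cov n w i \<longleftrightarrow> w i < w (Suc j) \<and> (\<forall>k. i < k \<and> k < j \<longrightarrow> \<not> (w i < w k \<and> w k < w (Suc j))) \<and> \<not> w i < w j"
          using j by (auto simp: cov_def less_Suc_eq)
        ultimately show ?thesis using 4 neqs by (auto simp: simple_refl_apply)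
      next
        case 5
        then have "desc l" using j by (auto simp: desc_def u_def simple_refl_def Transposition.transpose_def)
        moreover have "(\<forall>k. i < k \<and> k < l \<longrightarrow> \<not> (w i < w k \<and> w k < w l)) \<longleftrightarrow>
            (\<forall>k. i < k \<and> k < l \<longrightarrow> \<not> (w i < u k \<and> u k < w l))" (is "?L = ?R")
        proof
          assume L: ?L
          show ?R
          proof (intro allI impI)
            fix k assume "i < k \<and> k < l"
            then have "i < ?s k \<and> ?s k < l" using 5 j by (auto simp: simple_refl_apply)
            then show "\<not> (w i < u k \<and> u k < w l)" using L by (auto simp: u_def)
          qed
        next
          assume R: ?R
          show ?L
          proof (intro allI impI)
            fix k assume "i < k \<and> k < l"
            then have "i < ?s k \<and> ?s k < l" using 5 j by (auto simp: simple_refl_apply)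
            then have "\<not> (w i < u (?s k) \<and> u (?s k) < w l)" using R by blast
            then show "\<not> (w i < w k \<and> w k < w l)" by (simp add: u_def)
          qed
        qed
        then have "l \<in> cov n w i \<longleftrightarrow> l \<in> cov n u i" using 5 j by (simp add: cov_def u_def simple_refl_apply)
        ultimately show ?thesis using 5 by (simp add: simple_refl_apply)
      qed
    qed
    have perm: "u \<circ> Transposition.transpose i l permutes {1..n}" if "l \<in> cov n u i" for l
      by (rule cov_permutes[OF u(1) i1 that])
    have dd: "ddiff j (schubert_poly n (u \<circ> Transposition.transpose i l)) =
        (if desc l then schubert_poly n (w \<circ> Transposition.transpose i (?s l)) else 0)" if "l \<in> cov n u i" for l
    proof (cases "desc l")
      case True
      have "l \<noteq> i" using that by (auto simp: cov_def)
      then show ?thesis using True schubert_poly_descent[OF perm[OF that] jn] ts[of l] by (simp add: desc_def)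
    next
      case False
      have "(u \<circ> Transposition.transpose i l) j \<noteq> (u \<circ> Transposition.transpose i l) (Suc j)"
        by (rule permutes_neq[OF perm[OF that]]) simp
      then have "(u \<circ> Transposition.transpose i l) j < (u \<circ> Transposition.transpose i l) (Suc j)"
        using False unfolding desc_def by linarith
      then show ?thesis using False ddiff_schubert_poly_ascent[OF perm[OF that] jn] by simp
    qed
    have "mvar i * schubert_poly n w = ddiff j (mvar i * schubert_poly n u)"
      using j(1) schubert_poly_ascent[OF w jn j(3)]
      by (subst ddiff_mult_symmetric) (auto simp: swap_vars_mvar Transposition.transpose_def u_def)
    also have "\<dots> = (\<Sum>l\<in>cov n u i. if desc l then schubert_poly n (w \<circ> Transposition.transpose i (?s l)) else 0)"
      unfolding ct ddiff_sum by (rule sum.cong) (auto simp: dd)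
    also have "\<dots> = (\<Sum>l\<in>{l \<in> cov n u i. desc l}. schubert_poly n (w \<circ> Transposition.transpose i (?s l)))"
      by (simp add: sum.inter_filter finite_cov)
    also have "\<dots> = (\<Sum>l\<in>cov n w i. schubert_poly n (w \<circ> Transposition.transpose i l))"
      by (rule sum.reindex_bij_witness[of _ ?s ?s]) (auto simp: covl)
    finally have A: "mvar i * schubert_poly n w = \<dots>" .
    have "ninv n (w \<circ> Transposition.transpose i l) = Suc (ninv n w)" if l: "l \<in> cov n w i" for l
    proof -
      let ?l = "?s l"
      have l': "?l \<in> cov n u i" "desc ?l" using l covl by auto
      have "?l \<noteq> i" using l' by (auto simp: cov_def)
      have "ninv n (u \<circ> Transposition.transpose i ?l) = Suc (ninv n (u \<circ> Transposition.transpose i ?l \<circ> ?s))"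
        by (rule ninv_simple_descent[OF perm[OF l'(1)] jn]) (use l'(2) in \<open>simp add: desc_def\<close>)
      then show ?thesis using ts[OF \<open>?l \<noteq> i\<close>] inv[OF l'(1)] u(2) by simp
    qed
    with A show ?thesis by blast
  next
    case False
    have wi1: "1 \<le> n" "i < n" using wi i1 w_ge[of i] permutes_not_in[OF w, of i]
      by (auto, metis Suc_eq_plus1 add_diff_cancel_left' atLeastAtMost_iff diff_is_0_eq' not_less less_antisym nat_less_le not_less_zero plus_1_eq_Suc w wi)
    have dec: "w k \<le> w (Suc i) - (k - Suc i)" if "Suc i \<le> k" "k \<le> n" for k
      using that
    proof (induction "k - Suc i" arbitrary: k)
      case (Suc d)
      then obtain k' where k': "k = Suc k'" "Suc i \<le> k'" by (cases k) auto
      then have "w k' \<le> w (Suc i) - (k' - Suc i)" using Suc by auto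
      moreover have "w k < w k'" using False k' Suc(4) permutes_neq[OF w, of k' "Suc k'"]
        by (metis Suc_le_lessD less_le_trans linorder_neqE_nat n_not_Suc_n not_less_eq_eq)
      ultimately show ?case using k' by simp
    qed auto
    \<comment> \<open>\<open>n + 1 - i\<close> is the largest value left over by the first
      \<open>i - 1\<close> positions and differs from \<open>w i\<close>. As \<open>w\<close>
      decreases after \<open>i\<close>, this value stands at \<open>i + 1\<close>.\<close>
    have wSi: "w (Suc i) = n + 1 - i"
    proof -
      have "n + 1 - i \<in> {1..n}" using wi1 i1 by auto
      then obtain k where k: "w k = n + 1 - i" "k \<in> {1..n}"
        using permutes_image[OF w] by (metis imageE)
      have "\<not> k < i" using pre[of k] k wi1 i1 by auto
      moreover have "k \<noteq> i" using k wi by auto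
      ultimately have "w k \<le> w (Suc i)" using dec[of k] k by auto
      then show ?thesis using w_le[of "Suc i"] k wi1 by auto
    qed
    have jn: "i \<in> {1..<n}" and asc: "w i < w (Suc i)" using wi1 i1 wi wSi by auto
    define u where "u = w \<circ> simple_refl i"
    have u: "u permutes {1..n}" "ninv n u = Suc (ninv n w)"
      using permutes_simple[OF w jn] ninv_simple_ascent[OF w jn asc] unfolding u_def by auto
    have sw: "schubert_poly n w = ddiff i (schubert_poly n u)"
      using schubert_poly_ascent[OF w jn asc] unfolding u_def .
    have w_lt: "w k < n + 1 - i" if "Suc i < k" "k \<le> n" for k
      using w_le[of k] permutes_neq[OF w, of k "Suc i"] that wSi by fastforce
    \<comment> \<open>The extra summand belongs to the cover \<open>l = i + 1\<close>, because
      \<open>u = w s_i\<close>.\<close>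
    have mult: "mvar i * schubert_poly n w = ddiff i (mvar (Suc i) * schubert_poly n u) + schubert_poly n u"
      unfolding ddiff_mvar_Suc sw by simp
    have ut: "w \<circ> Transposition.transpose i (Suc i) = u" by (simp add: u_def simple_refl_def)
    show ?thesis
    proof (cases "w i = n - i")
      case True
      \<comment> \<open>This case ends the recursion: the remaining divided difference is taken of
        \<open>x_{i+1}\<close> times the staircase monomial, which is symmetric, so only the extra
        summand is left.\<close>
      have "u = longest_perm n"
      proof (rule no_ascent_longest[OF u(1)])
        fix k assume k: "k \<in> {1..<n}"
        consider "Suc k < i" | "Suc k = i" | "k = i" | "k = Suc i" | "Suc i < k" by linarith
        then show "u (Suc k) < u k"
        proof cases
          case 1
          then show ?thesis using pre[of k] pre[of "Suc k"] k by (auto simp: u_def simple_refl_apply)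
        next
          case 2
          then show ?thesis using pre[of k] wSi k by (auto simp: u_def simple_refl_apply)
        next
          case 3
          then show ?thesis using asc by (auto simp: u_def simple_refl_apply)
        next
          case 4
          then show ?thesis using w_lt[of "Suc k"] k True permutes_neq[OF w, of "Suc k" i]
            by (auto simp: u_def simple_refl_apply)
        next
          case 5
          then show ?thesis using False k permutes_neq[OF w, of "Suc k" k]
            by (auto simp: u_def simple_refl_apply)
        qed
      qed
      then have "ddiff i (mvar (Suc i) * schubert_poly n u) = 0"
        using prod_mvar_swap[OF jn] ddiff_symmetric by (simp add: schubert_poly_longest)
      moreover have "cov n w i = {Suc i}"
      proof -
        have "l = Suc i" if "l \<in> cov n w i" for l
          using that w_lt[of l] True by (force simp: cov_def)
        moreover have "Suc i \<in> cov n w i" using jn asc by (auto simp: cov_def)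
        ultimately show ?thesis by blast
      qed
      ultimately show ?thesis using mult u(2) ut by simp
    next
      case neq: False
      \<comment> \<open>The exchange has moved \<open>n + 1 - i\<close> to position
        \<open>i\<close>, so \<open>u\<close> follows the longest permutation one step further and
        the induction hypothesis applies at \<open>i + 1\<close>.\<close>
      have "first_deviation n u (Suc i)"
        using pre wSi wi neq by (auto simp: first_deviation_def u_def simple_refl_apply less_Suc_eq)
      note IH = step(4)[OF u(1) _ this]
      have less: "ninv n w < ninv n u" using u(2) by simp
      have ct: "mvar (Suc i) * schubert_poly n u = (\<Sum>l\<in>cov n u (Suc i). schubert_poly n (u \<circ> Transposition.transpose (Suc i) l))"
        by (rule IH[OF less, THEN conjunct1])
      have inv: "ninv n (u \<circ> Transposition.transpose (Suc i) l) = Suc (ninv n u)" if "l \<in> cov n u (Suc i)" for l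
        by (rule IH[OF less, THEN conjunct2, rule_format, OF that])
      have cv: "cov n w i = insert (Suc i) (cov n u (Suc i))"
      proof (rule Set.set_eqI)
        fix l
        consider "l \<le> i" | "l = Suc i" | "Suc i < l" by linarith
        then show "l \<in> cov n w i \<longleftrightarrow> l \<in> insert (Suc i) (cov n u (Suc i))"
        proof cases
          case 2
          then show ?thesis using jn asc by (auto simp: cov_def)
        next
          case 3
          have "(\<forall>k. i < k \<and> k < l \<longrightarrow> \<not> (w i < w k \<and> w k < w l)) \<longleftrightarrow>
             (\<forall>k. Suc i < k \<and> k < l \<longrightarrow> \<not> (w i < w k \<and> w k < w l))" if "l \<le> n"
            using w_lt[of l] 3 that wSi by (metis Suc_lessI not_less_iff_gr_or_eq Suc_lessD)
          then show ?thesis using 3 by (auto simp: cov_def u_def simple_refl_apply)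
        qed (auto simp: cov_def)
      qed
      have ts: "u \<circ> Transposition.transpose (Suc i) l \<circ> simple_refl i = w \<circ> Transposition.transpose i l"
        if "l \<in> cov n u (Suc i)" for l
      proof -
        have "Suc i < l" using that by (auto simp: cov_def)
        then show ?thesis by (auto simp: fun_eq_iff u_def simple_refl_def Transposition.transpose_def)
      qed
      have perm: "u \<circ> Transposition.transpose (Suc i) l permutes {1..n}" if "l \<in> cov n u (Suc i)" for l
        by (rule cov_permutes[OF u(1) _ that]) simp
      have desc: "(u \<circ> Transposition.transpose (Suc i) l) (Suc i) < (u \<circ> Transposition.transpose (Suc i) l) i"
        if "l \<in> cov n u (Suc i)" for l
      proof -
        have "Suc i < l" "l \<le> n" using that by (auto simp: cov_def)
        then show ?thesis using w_lt[of l] wSi by (simp add: u_def simple_refl_def Transposition.transpose_def)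
      qed
      have "mvar i * schubert_poly n w = (\<Sum>l\<in>cov n u (Suc i). schubert_poly n (w \<circ> Transposition.transpose i l)) + schubert_poly n u"
      proof -
        have "ddiff i (schubert_poly n (u \<circ> Transposition.transpose (Suc i) l)) = schubert_poly n (w \<circ> Transposition.transpose i l)"
          if l: "l \<in> cov n u (Suc i)" for l
          unfolding ts[OF l, symmetric] by (rule schubert_poly_descent[OF perm[OF l] jn desc[OF l]])
        then show ?thesis unfolding mult ct ddiff_sum by simp
      qed
      also have "\<dots> = (\<Sum>l\<in>cov n w i. schubert_poly n (w \<circ> Transposition.transpose i l))"
      proof -
        have "Suc i \<notin> cov n u (Suc i)" by (auto simp: cov_def)
        then show ?thesis unfolding cv by (simp add: finite_cov ut add.commute)
      qed
      finally have A: "mvar i * schubert_poly n w = \<dots>" .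
      have "ninv n (w \<circ> Transposition.transpose i l) = Suc (ninv n w)" if l: "l \<in> cov n u (Suc i)" for l
      proof -
        have "ninv n (u \<circ> Transposition.transpose (Suc i) l) = Suc (ninv n (w \<circ> Transposition.transpose i l))"
          unfolding ts[OF l, symmetric] by (rule ninv_simple_descent[OF perm[OF l] jn desc[OF l]])
        then show ?thesis unfolding inv[OF l] u(2) by simp
      qed
      then have "ninv n (w \<circ> Transposition.transpose i l) = Suc (ninv n w)" if "l \<in> cov n w i" for l
        using that u(2) unfolding cv ut[symmetric] by blast
      with A show ?thesis by blast
    qed
  qed
qed

section \<open>The antidiagonal complex of a permutation\<close>

text \<open>Such sets run strictly downwards and to the left; they are the supports of antidiagonal
  terms of minors.\<close>

definition achain :: "(nat \<times> nat) set \<Rightarrow> bool" where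
  "achain C \<longleftrightarrow> (\<forall>x\<in>C. \<forall>y\<in>C. x \<noteq> y \<longrightarrow> (fst x < fst y \<and> snd y < snd x) \<or> (fst y < fst x \<and> snd x < snd y))"

definition rk :: "(nat \<Rightarrow> nat) \<Rightarrow> nat \<Rightarrow> nat \<Rightarrow> nat" where
  "rk w p q = card {k \<in> {1..p}. w k \<le> q}"

definition ad_complex :: "nat \<Rightarrow> (nat \<Rightarrow> nat) \<Rightarrow> (nat \<times> nat) set set" where
  "ad_complex n w = {U. U \<subseteq> grid n \<and> (\<forall>p q C. p \<le> n \<longrightarrow> q \<le> n \<longrightarrow> achain C \<longrightarrow> C \<subseteq> U \<longrightarrow>
     C \<subseteq> {1..p} \<times> {1..q} \<longrightarrow> card C \<le> rk w p q)}"

lemma rk_eq_nw_rank: "w permutes {1..n} \<Longrightarrow> p \<le> n \<Longrightarrow> rk w p q = nw_rank w p q"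
proof -
  assume w: "w permutes {1..n}" "p \<le> n"
  have "{(i, j). i \<in> {1..p} \<and> j \<in> {1..q} \<and> w i = j} = (\<lambda>i. (i, w i)) ` {k \<in> {1..p}. w k \<le> q}"
    using permutes_in_image[OF w(1)] w(2) by fastforce
  moreover have "inj_on (\<lambda>i. (i, w i)) {k \<in> {1..p}. w k \<le> q}" by (auto simp: inj_on_def)
  ultimately show ?thesis unfolding nw_rank_def rk_def by (simp add: card_image)
qed

lemma achain_subset: "achain C \<Longrightarrow> D \<subseteq> C \<Longrightarrow> achain D"
  unfolding achain_def by blast

lemma ad_complexD:
  "U \<in> ad_complex n w \<Longrightarrow> achain C \<Longrightarrow> C \<subseteq> U \<Longrightarrow> C \<subseteq> {1..p} \<times> {1..q} \<Longrightarrow> p \<le> n \<Longrightarrow> q \<le> n \<Longrightarrow> card C \<le> rk w p q"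
  unfolding ad_complex_def by blast

lemma ad_complex_subset: "U \<in> ad_complex n w \<Longrightarrow> V \<subseteq> U \<Longrightarrow> V \<in> ad_complex n w"
  unfolding ad_complex_def by blast

lemma ad_complex_grid: "U \<in> ad_complex n w \<Longrightarrow> U \<subseteq> grid n"
  unfolding ad_complex_def by blast

lemma finite_ad_complex: "finite (ad_complex n w)"
  by (rule finite_subset[of _ "Pow (grid n)"]) (auto simp: ad_complex_def)

lemma achain_card_rows:
  assumes "achain C" shows "card C = card (fst ` C)"
proof -
  have "inj_on fst C" using assms by (fastforce simp: inj_on_def achain_def)
  then show ?thesis by (simp add: card_image)
qed

text \<open>Two crossing chains are recombined where they cross.\<close>

lemma achain_exchange:
  assumes C: "achain C" "C \<subseteq> {1..p} \<times> {1..q}" and C': "achain C'" "C' \<subseteq> {1..p'} \<times> {1..q'}"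
    and pq: "p \<le> p'" "q' \<le> q"
  obtains D D' where "achain D" "D \<subseteq> {1..p} \<times> {1..q'}" "achain D'" "D' \<subseteq> {1..p'} \<times> {1..q}"
    "D \<subseteq> C \<union> C'" "D' \<subseteq> C \<union> C'" "card D + card D' = card C + card C'"
proof -
  define low where "low r = {x \<in> C. r \<le> fst x}" for r
  define high where "high r = {x \<in> C. fst x < r}" for r
  define low' where "low' r = {x \<in> C'. r \<le> fst x}" for r
  define high' where "high' r = {x \<in> C'. fst x < r}" for r
  \<comment> \<open>At such a row \<open>r\<close> the part of \<open>C\<close> above
    \<open>r\<close> continues into the part of \<open>C'\<close> from \<open>r\<close> on. The
    greatest such \<open>r\<close> is taken so that the complementary parts fit together as
    well.\<close>
  define ok where "ok r \<longleftrightarrow> r \<le> Suc p \<and> (\<forall>x\<in>low' r. \<forall>y\<in>high r. snd x < snd y)" for r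
  have fin: "finite C" "finite C'" using C(2) C'(2) finite_subset by blast+
  have "ok 0" by (auto simp: ok_def high_def)
  moreover have "\<And>r. ok r \<Longrightarrow> r \<le> Suc p" by (simp add: ok_def)
  ultimately obtain r where r: "ok r" and max: "\<And>s. ok s \<Longrightarrow> s \<le> r"
    using GreatestI_nat[of ok 0 "Suc p"] Greatest_le_nat[of ok _ "Suc p"] by blast
  \<comment> \<open>Failure at \<open>r + 1\<close> provides \<open>x\<close> in \<open>C'\<close>
    below and \<open>y\<close> in \<open>C\<close> above with \<open>y\<close> weakly to the left of
    \<open>x\<close>; the column of \<open>x\<close> then separates the other two parts.\<close>
  have key: "(\<forall>x\<in>low r. \<forall>y\<in>high' r. snd x < snd y) \<and> (\<forall>x\<in>low r. snd x \<le> q')"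
  proof (cases "r = Suc p")
    case True
    then have "low r = {}" using C(2) by (fastforce simp: low_def)
    then show ?thesis by simp
  next
    case False
    then have "\<not> ok (Suc r)" "r < Suc p" using max[of "Suc r"] r by (auto simp: ok_def)
    then obtain x y where x: "x \<in> C'" "r < fst x" and y: "y \<in> C" "fst y \<le> r" and xy: "snd y \<le> snd x"
      unfolding ok_def low'_def high_def by (auto simp: Suc_le_eq less_Suc_eq_le not_less)
    have le: "snd z \<le> snd x" if "z \<in> low r" for z
    proof -
      have "z \<in> C" "r \<le> fst z" using that by (auto simp: low_def)
      then have "snd z \<le> snd y" using C(1) y unfolding achain_def by (cases "z = y") fastforce+
      then show ?thesis using xy by simp
    qed
    have "snd x < snd z" if "z \<in> high' r" for z
    proof -
      have "z \<in> C'" "fst z < fst x" "z \<noteq> x" using that x by (auto simp: high'_def)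
      then show ?thesis using C'(1) x(1) unfolding achain_def by fastforce
    qed
    moreover have "snd x \<le> q'" using x(1) C'(2) by auto
    ultimately show ?thesis using le by (meson le_less_trans le_trans)
  qed
  have mix: "achain (A \<union> B)"
    if "achain A" "achain B" "\<And>x y. x \<in> A \<Longrightarrow> y \<in> B \<Longrightarrow> fst y < fst x \<and> snd x < snd y" for A B
    using that unfolding achain_def by (metis Un_iff)
  have "achain (low r \<union> high' r)"
    by (rule mix) (use key in \<open>auto intro: achain_subset[OF C(1)] achain_subset[OF C'(1)] simp: low_def high'_def\<close>)
  moreover have "low r \<union> high' r \<subseteq> {1..p} \<times> {1..q'}"
  proof
    fix x assume "x \<in> low r \<union> high' r"
    then show "x \<in> {1..p} \<times> {1..q'}"
    proof
      assume "x \<in> low r" then show ?thesis using key C(2) by (cases x) (auto simp: low_def)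
    next
      assume "x \<in> high' r" then show ?thesis using C'(2) r by (cases x) (fastforce simp: high'_def ok_def)
    qed
  qed
  moreover have "achain (low' r \<union> high r)"
    by (rule mix) (use r in \<open>auto intro: achain_subset[OF C(1)] achain_subset[OF C'(1)] simp: low'_def high_def ok_def\<close>)
  moreover have "low' r \<union> high r \<subseteq> {1..p'} \<times> {1..q}"
    using C(2) C'(2) pq by (fastforce simp: low'_def high_def)
  moreover have "low r \<union> high' r \<subseteq> C \<union> C'" "low' r \<union> high r \<subseteq> C \<union> C'"
    by (auto simp: low_def high_def low'_def high'_def)
  moreover have "card (low r \<union> high' r) + card (low' r \<union> high r) = card C + card C'"
  proof -
    have "card (low r \<union> high' r) = card (low r) + card (high' r)"
      by (rule card_Un_disjoint) (use fin in \<open>auto simp: low_def high'_def\<close>)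
    moreover have "card (low' r \<union> high r) = card (low' r) + card (high r)"
      by (rule card_Un_disjoint) (use fin in \<open>auto simp: low'_def high_def\<close>)
    moreover have "card C = card (low r) + card (high r)"
      by (subst card_Un_disjoint[symmetric]) (use fin in \<open>auto simp: low_def high_def intro!: arg_cong[of _ _ card]\<close>)
    moreover have "card C' = card (low' r) + card (high' r)"
      by (subst card_Un_disjoint[symmetric]) (use fin in \<open>auto simp: low'_def high'_def intro!: arg_cong[of _ _ card]\<close>)
    ultimately show ?thesis by simp
  qed
  ultimately show ?thesis by (rule that)
qed

text \<open>The defect of this equation is the number of points of the permutation matrix in rows
  \<open>p + 1\<close> to \<open>p'\<close> and columns \<open>q' + 1\<close> to \<open>q\<close>,
  where there are none by hypothesis.\<close>

lemma rk_rectangle: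
  assumes "p \<le> p'" "q' \<le> q" "\<And>k. p < k \<Longrightarrow> k \<le> p' \<Longrightarrow> \<not> (q' < w k \<and> w k \<le> q)"
  shows "rk w p q + rk w p' q' = rk w p q' + rk w p' q"
proof -
  have split: "rk w p' b = rk w p b + card {k \<in> {p<..p'}. w k \<le> b}" for b
  proof -
    have "{k \<in> {1..p'}. w k \<le> b} = {k \<in> {1..p}. w k \<le> b} \<union> {k \<in> {p<..p'}. w k \<le> b}"
      using assms(1) by auto
    moreover have "{k \<in> {1..p}. w k \<le> b} \<inter> {k \<in> {p<..p'}. w k \<le> b} = {}" by auto
    ultimately show ?thesis unfolding rk_def by (simp add: card_Un_disjoint)
  qed
  have "{k \<in> {p<..p'}. w k \<le> q} = {k \<in> {p<..p'}. w k \<le> q'}"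
  proof (rule Set.set_eqI)
    fix k show "k \<in> {k \<in> {p<..p'}. w k \<le> q} \<longleftrightarrow> k \<in> {k \<in> {p<..p'}. w k \<le> q'}"
      using assms(2) assms(3)[of k] by auto
  qed
  then show ?thesis using split[of q] split[of q'] by simp
qed

text \<open>Exchanging the values at \<open>i < l\<close> removes a point only from blocks that end
  between the two positions and between the two values, and from these only one.\<close>

lemma rk_transpose:
  assumes il: "1 \<le> i" "i < l" "w i < w l"
  shows "\<not> (i \<le> p \<and> p < l \<and> w i \<le> q \<and> q < w l) \<Longrightarrow> rk w p q \<le> rk (w \<circ> Transposition.transpose i l) p q"
    and "rk w p q \<le> Suc (rk (w \<circ> Transposition.transpose i l) p q)"
proof -
  let ?t = "Transposition.transpose i l"
  let ?A = "{k \<in> {1..p}. w k \<le> q}" and ?B = "{k \<in> {1..p}. (w \<circ> ?t) k \<le> q}"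
  have "?A - {i} \<subseteq> ?B \<or> l \<le> p"
    using il by (auto simp: Transposition.transpose_def)
  moreover have big: "card ?A \<le> card ?B" if "l \<le> p"
  proof -
    have "?t ` ?A \<subseteq> ?B" using il that by (auto simp: Transposition.transpose_def)
    moreover have "card (?t ` ?A) = card ?A" by (rule card_image) (simp add: inj_on_subset[OF inj_transpose])
    moreover have "card (?t ` ?A) \<le> card ?B" by (rule card_mono) (use calculation(1) in simp_all)
    ultimately show ?thesis by linarith
  qed
  moreover have "card ?A \<le> Suc (card (?A - {i}))" using diff_card_le_card_Diff[of "{i}" ?A] by simp
  moreover have "?A - {i} \<subseteq> ?B \<Longrightarrow> card (?A - {i}) \<le> card ?B" by (rule card_mono) auto
  ultimately show "rk w p q \<le> Suc (rk (w \<circ> ?t) p q)" unfolding rk_def by linarith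
  assume n: "\<not> (i \<le> p \<and> p < l \<and> w i \<le> q \<and> q < w l)"
  show "rk w p q \<le> rk (w \<circ> ?t) p q"
  proof (cases "l \<le> p")
    case False
    then have "?A \<subseteq> ?B" using il n by (auto simp: Transposition.transpose_def)
    then show ?thesis unfolding rk_def by (intro card_mono) auto
  qed (use big in \<open>simp add: rk_def\<close>)
qed

lemma first_deviation_pos:
  assumes w: "w permutes {1..n}" and dev: "first_deviation n w i"
  shows "1 \<le> i" "i < n" "1 \<le> w i"
proof -
  show i: "1 \<le> i" using dev by (simp add: first_deviation_def)
  have lt: "w i < n + 1 - i" using dev by (simp add: first_deviation_def)
  then have "i \<le> n" by simp
  then show 1: "1 \<le> w i" using permutes_in_image[OF w, of i] i by simp
  show "i < n" using lt 1 by simp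
qed

text \<open>The positions before \<open>i\<close> carry the values above \<open>n + 1 - i\<close>,
  so the values between \<open>w i\<close> and \<open>n + 1 - i\<close> come after
  \<open>i\<close>.\<close>

lemma first_deviation_next:
  assumes w: "w permutes {1..n}" and dev: "first_deviation n w i" and v: "w i < v" "v \<le> n + 1 - i"
  obtains l where "i < l" "l \<le> n" "w l = v"
proof -
  have "v \<in> {1..n}" using v first_deviation_pos[OF w dev] by auto
  then obtain l where l: "l \<in> {1..n}" "w l = v" using permutes_image[OF w] by (metis imageE)
  have "\<not> l < i" using dev l v by (auto simp: first_deviation_def)
  moreover have "l \<noteq> i" using l v by auto
  ultimately show ?thesis using that[of l] l by auto
qed

lemma rk_prefix_zero:
  assumes w: "w permutes {1..n}" and dev: "first_deviation n w i" and "k < i" "k + j \<le> n"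
  shows "rk w k j = 0"
  using assms(2-4) by (auto simp: rk_def first_deviation_def)

text \<open>A single cell is a chain of length one, so a cell whose block has rank zero lies in no
  face.\<close>

lemma ad_complex_not_mem:
  assumes "U \<in> ad_complex n w" "(k, j) \<in> U" "k \<in> {1..n}" "j \<in> {1..n}" shows "rk w k j \<noteq> 0"
  using ad_complexD[OF assms(1), of "{(k, j)}" k j] assms(2-4) by (auto simp: achain_def)

text \<open>\<open>(i, w i)\<close> is a cone point: it lies in no minimal non-face.\<close>

lemma ad_complex_insert:
  assumes w: "w permutes {1..n}" and dev: "first_deviation n w i" and U: "U \<in> ad_complex n w"
  shows "insert (i, w i) U \<in> ad_complex n w"
proof -
  note pos = first_deviation_pos[OF w dev]
  have "w i \<le> n" using permutes_in_image[OF w, of i] pos by auto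
  then have "insert (i, w i) U \<subseteq> grid n" using ad_complex_grid[OF U] pos by auto
  moreover have "card C \<le> rk w p q"
    if pq: "p \<le> n" "q \<le> n" and C: "achain C" "C \<subseteq> insert (i, w i) U" "C \<subseteq> {1..p} \<times> {1..q}" for p q C
  proof (cases "(i, w i) \<in> C")
    case False
    then show ?thesis using ad_complexD[OF U C(1) _ C(3) pq] C(2) by blast
  next
    case True
    have finC: "finite C" using C(3) finite_subset by blast
    have ipq: "i \<le> p" "w i \<le> q" using True C(3) by auto
    define A where "A = {x \<in> C. fst x < i}"
    define B where "B = {x \<in> C. i < fst x}"
    have rel: "x = (i, w i) \<or> (fst x < i \<and> w i < snd x) \<or> (i < fst x \<and> snd x < w i)" if "x \<in> C" for x
      using C(1) True that unfolding achain_def by fastforce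
    have Csplit: "C = insert (i, w i) (A \<union> B)" using rel True by (fastforce simp: A_def B_def)
    have "card C \<le> Suc (card (A \<union> B))" unfolding Csplit by (rule card_insert_le_m1) simp_all
    moreover have "card (A \<union> B) \<le> card A + card B" by (rule card_Un_le)
    \<comment> \<open>A cell \<open>(k, j)\<close> of a face above row \<open>i\<close> satisfies
      \<open>n < k + j\<close>, so the point \<open>w k = n + 1 - k\<close> of its row is at most
      \<open>j\<close> and lies in the block.\<close>
    moreover have "card A \<le> card {k \<in> {1..<i}. w k \<le> q}"
    proof -
      have "k \<in> {1..<i} \<and> w k \<le> q" if "(k, j) \<in> A" for k j
      proof -
        have kj: "(k, j) \<in> C" "k < i" "(k, j) \<in> U" "1 \<le> k" "j \<le> q" "1 \<le> j"
          using that C(2,3) by (auto simp: A_def)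
        then have "rk w k j \<noteq> 0" using ad_complex_not_mem[OF U kj(3)] pos pq by auto
        then have "n < k + j" using rk_prefix_zero[OF w dev kj(2)] not_le by blast
        moreover have "w k = n + 1 - k" using dev kj by (auto simp: first_deviation_def)
        ultimately show ?thesis using kj by auto
      qed
      then have "fst ` A \<subseteq> {k \<in> {1..<i}. w k \<le> q}" by auto
      then have "card (fst ` A) \<le> card {k \<in> {1..<i}. w k \<le> q}" by (rule card_mono[rotated]) simp
      then show ?thesis using achain_card_rows[OF achain_subset[OF C(1), of A]] by (auto simp: A_def)
    qed
    \<comment> \<open>Below the cone point the chain stays strictly to the left of column
      \<open>w i\<close>, so the face condition of the narrower block applies.\<close>
    moreover have "card B \<le> rk w p (w i - 1)"
    proof (rule ad_complexD[OF U achain_subset[OF C(1)]])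
      show "B \<subseteq> {1..p} \<times> {1..w i - 1}" using rel C(3) by (fastforce simp: B_def)
    qed (use pq \<open>w i \<le> n\<close> C(2) in \<open>auto simp: B_def\<close>)
    \<comment> \<open>Three disjoint sources of rank are added: the rows before \<open>i\<close>,
      whose values exceed \<open>w i\<close>, the row \<open>i\<close> itself, and the rows with
      values below \<open>w i\<close>.\<close>
    moreover have "Suc (card {k \<in> {1..<i}. w k \<le> q} + rk w p (w i - 1)) \<le> rk w p q"
    proof -
      have big: "w i < w k" if "1 \<le> k" "k < i" for k using dev that by (auto simp: first_deviation_def)
      have "{k \<in> {1..p}. w k \<le> w i - 1} \<inter> {k \<in> {1..<i}. w k \<le> q} = {}"
        using big pos by fastforce
      then have "card ({k \<in> {1..<i}. w k \<le> q} \<union> {k \<in> {1..p}. w k \<le> w i - 1}) =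
          card {k \<in> {1..<i}. w k \<le> q} + rk w p (w i - 1)"
        unfolding rk_def by (subst card_Un_disjoint) auto
      moreover have "i \<notin> {k \<in> {1..<i}. w k \<le> q} \<union> {k \<in> {1..p}. w k \<le> w i - 1}" using pos by auto
      ultimately have "Suc (card {k \<in> {1..<i}. w k \<le> q} + rk w p (w i - 1)) =
          card (insert i ({k \<in> {1..<i}. w k \<le> q} \<union> {k \<in> {1..p}. w k \<le> w i - 1}))" by simp
      also have "\<dots> \<le> rk w p q" unfolding rk_def by (rule card_mono) (use ipq pos in auto)
      finally show ?thesis .
    qed
    ultimately show ?thesis by linarith
  qed
  ultimately show ?thesis unfolding ad_complex_def by blast
qed

text \<open>If \<open>U\<close> fails for the cover at \<open>l\<close>, some chain in
  \<open>U\<close> attains the rank bound in a block that contains the cone point and ends before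
  row \<open>l\<close> and column \<open>w l\<close>. Among such blocks ending before the first
  cover, the width is minimised. Recombining chains with a block for another cover would narrow it
  further unless the width is \<open>w i\<close>; but then the rank is at least the number of rows
  from \<open>i\<close> on, while a chain avoiding the cone point has to start below row
  \<open>i\<close>.\<close>

lemma ad_complex_delete:
  assumes w: "w permutes {1..n}" and dev: "first_deviation n w i" and U: "U \<in> ad_complex n w" "(i, w i) \<notin> U"
  obtains l where "l \<in> cov n w i" "U \<in> ad_complex n (w \<circ> Transposition.transpose i l)"
proof (rule ccontr)
  note out = that
  assume "\<not> thesis"
  then have none: "U \<notin> ad_complex n (w \<circ> Transposition.transpose i l)" if "l \<in> cov n w i" for l
    using that out by blast
  note pos = first_deviation_pos[OF w dev]
  define tight where "tight p q \<longleftrightarrow> i \<le> p \<and> w i \<le> q \<and> p \<le> n \<and> q \<le> n \<and>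
    (\<exists>C. achain C \<and> C \<subseteq> U \<and> C \<subseteq> {1..p} \<times> {1..q} \<and> card C = rk w p q)" for p q
  have ex_tight: "\<exists>p q. tight p q \<and> p < l \<and> q < w l" if l: "l \<in> cov n w i" for l
  proof -
    have il: "i < l" "w i < w l" using l by (auto simp: cov_def)
    obtain p q C where C: "p \<le> n" "q \<le> n" "achain C" "C \<subseteq> U" "C \<subseteq> {1..p} \<times> {1..q}"
        "\<not> card C \<le> rk (w \<circ> Transposition.transpose i l) p q"
      using none[OF l] ad_complex_grid[OF U(1)] unfolding ad_complex_def by blast
    have le: "card C \<le> rk w p q" using ad_complexD[OF U(1) C(3,4,5,1,2)] .
    have reg: "i \<le> p \<and> p < l \<and> w i \<le> q \<and> q < w l"
      using rk_transpose(1)[of i l w p q] pos il le C(6) by (meson le_trans)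
    moreover have "card C = rk w p q" using rk_transpose(2)[of i l w p q] pos il le C(6) by auto
    ultimately show ?thesis unfolding tight_def using C by blast
  qed
  \<comment> \<open>The first later position with a value in the window from \<open>w i + 1\<close>
    to \<open>q\<close> gives a cover; before it, no value lies in the window.\<close>
  have next_l: "\<exists>l. l \<in> cov n w i \<and> w l \<le> q \<and> (\<forall>k. i < k \<and> k < l \<longrightarrow> \<not> (w i < w k \<and> w k \<le> q))"
    if "w i < q" for q
  proof -
    obtain l0 where l0: "i < l0" "l0 \<le> n" "w l0 = Suc (w i)"
      using first_deviation_next[OF w dev, of "Suc (w i)"] dev by (auto simp: first_deviation_def)
    define l where "l = (LEAST l. i < l \<and> l \<le> n \<and> w i < w l \<and> w l \<le> q)"
    have l: "i < l \<and> l \<le> n \<and> w i < w l \<and> w l \<le> q"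
      unfolding l_def by (rule LeastI[of _ l0]) (use l0 that in auto)
    have least: "\<not> (w i < w k \<and> w k \<le> q)" if "i < k" "k < l" for k
      using not_less_Least[of k "\<lambda>l. i < l \<and> l \<le> n \<and> w i < w l \<and> w l \<le> q"] that l unfolding l_def by auto
    then have "l \<in> cov n w i" using l by (auto simp: cov_def) (meson less_imp_le less_le_trans)
    then show ?thesis using l least by blast
  qed
  have "w i < n" using dev pos by (auto simp: first_deviation_def)
  from next_l[OF this] obtain l1 where l1: "l1 \<in> cov n w i" "\<And>k. i < k \<Longrightarrow> k < l1 \<Longrightarrow> \<not> (w i < w k \<and> w k \<le> n)"
    by blast
  define Q where "Q = (LEAST q. \<exists>p. tight p q \<and> p < l1)"
  have "\<exists>p. tight p Q \<and> p < l1"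
    unfolding Q_def by (rule LeastI_ex) (use ex_tight[OF l1(1)] in blast)
  then obtain p where p: "tight p Q" "p < l1" by blast
  have minQ: "Q \<le> q" if "tight p' q" "p' < l1" for p' q
    unfolding Q_def by (rule Least_le) (use that in blast)
  have "Q = w i"
  proof (rule ccontr)
    assume "Q \<noteq> w i"
    then have "w i < Q" using p(1) by (auto simp: tight_def)
    from next_l[OF this] obtain l where l: "l \<in> cov n w i" "w l \<le> Q"
      "\<And>k. i < k \<Longrightarrow> k < l \<Longrightarrow> \<not> (w i < w k \<and> w k \<le> Q)" by blast
    obtain p' q' where p': "tight p' q'" "p' < l" "q' < w l" using ex_tight[OF l(1)] by blast
    show False
    proof (cases "p' \<le> p")
      case True
      then show False using minQ[OF p'(1)] p(2) p'(3) l(2) by linarith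
    next
      case False
      obtain C where C: "achain C" "C \<subseteq> U" "C \<subseteq> {1..p} \<times> {1..Q}" "card C = rk w p Q"
        using p(1) unfolding tight_def by blast
      obtain C' where C': "achain C'" "C' \<subseteq> U" "C' \<subseteq> {1..p'} \<times> {1..q'}" "card C' = rk w p' q'"
        using p'(1) unfolding tight_def by blast
      have le: "p \<le> p'" "q' \<le> Q" using False p'(3) l(2) by auto
      obtain D D' where D: "achain D" "D \<subseteq> {1..p} \<times> {1..q'}" "achain D'" "D' \<subseteq> {1..p'} \<times> {1..Q}"
          "D \<subseteq> C \<union> C'" "D' \<subseteq> C \<union> C'" "card D + card D' = card C + card C'"
        by (rule achain_exchange[OF C(1,3) C'(1,3) le])
      have n: "p \<le> n" "q' \<le> n" "p' \<le> n" "Q \<le> n" "i \<le> p" "w i \<le> q'" using p(1) p'(1) by (auto simp: tight_def)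
      \<comment> \<open>By the choice of \<open>l\<close>, no point of the permutation matrix lies
        in the rectangle between the two blocks, so the rank bounds add up exactly and both
        recombined chains are extremal.\<close>
      have "rk w p Q + rk w p' q' = rk w p q' + rk w p' Q"
      proof (rule rk_rectangle[OF le])
        fix k assume "p < k" "k \<le> p'"
        then show "\<not> (q' < w k \<and> w k \<le> Q)" using l(3)[of k] n p'(2) by auto
      qed
      moreover have "card D \<le> rk w p q'" using ad_complexD[OF U(1) D(1) _ D(2)] D(5) C(2) C'(2) n by blast
      moreover have "card D' \<le> rk w p' Q" using ad_complexD[OF U(1) D(3) _ D(4)] D(6) C(2) C'(2) n by blast
      ultimately have "card D = rk w p q'" using D(7) C(4) C'(4) by linarith
      then have "tight p q'" unfolding tight_def using D(1,2,5) C(2) C'(2) n by blast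
      then show False using minQ[OF _ p(2)] p'(3) l(2) by fastforce
    qed
  qed
  then obtain C where C: "achain C" "C \<subseteq> U" "C \<subseteq> {1..p} \<times> {1..w i}" "card C = rk w p (w i)" and ip: "i \<le> p" "p \<le> n"
    using p(1) unfolding tight_def by blast
  have "{i..p} \<subseteq> {k \<in> {1..p}. w k \<le> w i}"
  proof
    fix k assume k: "k \<in> {i..p}"
    have "w k \<le> n" using permutes_in_image[OF w, of k] k ip pos by auto
    then show "k \<in> {k \<in> {1..p}. w k \<le> w i}" using l1(2)[of k] k p(2) pos by (cases "k = i") auto
  qed
  then have "card {i..p} \<le> rk w p (w i)" unfolding rk_def by (rule card_mono[rotated]) simp
  \<comment> \<open>In the rows before \<open>i\<close> the relevant cells have rank zero, and in
    row \<open>i\<close> the cone point is the only cell up to column \<open>w i\<close> of nonzero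
    rank.\<close>
  moreover have "fst ` C \<subseteq> {i<..p}"
  proof (rule image_subsetI)
    fix x assume x: "x \<in> C"
    obtain k j where kj: "x = (k, j)" by (cases x)
    have k: "1 \<le> k" "k \<le> p" "1 \<le> j" "j \<le> w i" "(k, j) \<in> U" using x C kj by auto
    have "w i \<le> n" using permutes_in_image[OF w, of i] pos by auto
    then have nz: "rk w k j \<noteq> 0" using ad_complex_not_mem[OF U(1) k(5)] k ip by auto
    have "i < k"
    proof (rule ccontr)
      assume "\<not> i < k"
      moreover have "\<not> k < i"
      proof
        assume "k < i"
        moreover have "w i + i < n + 1" using dev by (auto simp: first_deviation_def)
        ultimately show False using rk_prefix_zero[OF w dev, of k j] k nz by simp
      qed
      ultimately have "k = i" by simp
      then have "j < w i" using k U(2) by (cases "j = w i") auto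
      have "w m > j" if "m \<in> {1..i}" for m
        using that dev \<open>j < w i\<close> by (cases "m = i") (auto simp: first_deviation_def)
      then have "{k \<in> {1..i}. w k \<le> j} = {}" by fastforce
      then have "rk w i j = 0" by (simp add: rk_def)
      then show False using nz \<open>k = i\<close> by simp
    qed
    then show "fst x \<in> {i<..p}" using kj k by simp
  qed
  then have "card C \<le> card {i<..p}"
    unfolding achain_card_rows[OF C(1)] by (rule card_mono[rotated]) simp
  ultimately show False using C(4) ip by simp
qed

section \<open>Facets and coefficients of Schubert polynomials\<close>

text \<open>The exponent vector of the image of \<open>z^S\<close> under the substitution of
  \<open>x_i\<close> for every \<open>z_{i,j}\<close>.\<close>

definition row_content :: "(nat \<times> nat) set \<Rightarrow> nat \<Rightarrow>\<^sub>0 nat" where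
  "row_content S = (\<Sum>x\<in>S. Poly_Mapping.single (fst x) 1)"

lemma lookup_row_content: "finite S \<Longrightarrow> Poly_Mapping.lookup (row_content S) i = card {x \<in> S. fst x = i}"
  unfolding row_content_def lookup_sum lookup_single
  by (simp add: when_def sum.If_cases Int_def)

lemma lookup_single_times: "Poly_Mapping.lookup (Poly_Mapping.single a c * f) (a + b) = c * Poly_Mapping.lookup f b"
  for f :: "('v \<Rightarrow>\<^sub>0 nat) \<Rightarrow>\<^sub>0 'a::comm_ring_1"
  by (induction f rule: poly_mapping_add_induct)
    (auto simp: mult_single lookup_single when_def ring_distribs lookup_add)

lemma lookup_mvar_times: "Poly_Mapping.lookup (mvar i * f) (Poly_Mapping.single i 1 + c) = Poly_Mapping.lookup f c"
  unfolding mvar_def lookup_single_times by simp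

lemma ex_first_deviation:
  assumes w: "w permutes {1..n}" "w \<noteq> longest_perm n"
  shows "\<exists>i. first_deviation n w i"
proof -
  have "\<exists>i. 1 \<le> i \<and> i \<le> n \<and> w i \<noteq> n + 1 - i"
  proof (rule ccontr)
    assume n: "\<not> ?thesis"
    have "w = longest_perm n"
    proof
      fix k show "w k = longest_perm n k"
        using n permutes_not_in[OF w(1), of k] by (auto simp: longest_perm_def)
    qed
    with w(2) show False by simp
  qed
  then obtain i where i: "1 \<le> i" "i \<le> n" "w i \<noteq> n + 1 - i" "\<And>k. 1 \<le> k \<Longrightarrow> k < i \<Longrightarrow> k \<le> n \<Longrightarrow> w k = n + 1 - k"
    using exists_least_iff[of "\<lambda>i. 1 \<le> i \<and> i \<le> n \<and> w i \<noteq> n + 1 - i"] by blast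
  have wi: "1 \<le> w i" "w i \<le> n" using permutes_in_image[OF w(1), of i] i by auto
  have "w i < n + 1 - i"
  proof (rule ccontr)
    assume "\<not> w i < n + 1 - i"
    then have k: "1 \<le> n + 1 - w i" "n + 1 - w i < i" using i wi by auto
    then have "w (n + 1 - w i) = w i" using i(4)[of "n + 1 - w i"] i wi by simp
    then show False using permutes_neq[OF w(1), of "n + 1 - w i" i] k by auto
  qed
  then have "first_deviation n w i" using i by (auto simp: first_deviation_def)
  then show ?thesis ..
qed

abbreviation antidiag_lower :: "nat \<Rightarrow> (nat \<times> nat) set" where
  "antidiag_lower n \<equiv> {x \<in> grid n. n < fst x + snd x}"

abbreviation antidiag_upper :: "nat \<Rightarrow> (nat \<times> nat) set" where
  "antidiag_upper n \<equiv> {x \<in> grid n. fst x + snd x \<le> n}"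

lemma ad_complex_longest: "U \<in> ad_complex n (longest_perm n) \<Longrightarrow> U \<subseteq> antidiag_lower n"
proof
  fix x assume U: "U \<in> ad_complex n (longest_perm n)" and x: "x \<in> U"
  obtain k j where kj: "x = (k, j)" by (cases x)
  have g: "k \<in> {1..n}" "j \<in> {1..n}" using ad_complex_grid[OF U] x kj by auto
  have "rk (longest_perm n) k j \<noteq> 0" by (rule ad_complex_not_mem[OF U _ g]) (use x kj in simp)
  moreover have "rk (longest_perm n) k j = 0" if "k + j \<le> n"
  proof -
    have "{m \<in> {1..k}. longest_perm n m \<le> j} = {}" using that by (auto simp: longest_perm_def)
    then show ?thesis by (simp add: rk_def)
  qed
  ultimately have "n < k + j" by (meson not_le)
  then show "x \<in> antidiag_lower n" using g kj by simp
qed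

lemma ninv_longest: "ninv n (longest_perm n) = card (antidiag_upper n)"
proof -
  have "bij_betw (\<lambda>(a, b). (a, n + 1 - b)) (inv_set n (longest_perm n)) (antidiag_upper n)"
    by (rule bij_betw_byWitness[where f' = "\<lambda>(a, b). (a, n + 1 - b)"])
      (auto simp: inv_set_def longest_perm_def)
  then show ?thesis unfolding ninv_def by (rule bij_betw_same_card)
qed

lemma card_antidiag: "card (antidiag_upper n) + card (antidiag_lower n) = n * n"
proof -
  have "card (antidiag_upper n) + card (antidiag_lower n) = card (antidiag_upper n \<union> antidiag_lower n)"
    by (rule card_Un_disjoint[symmetric]) auto
  also have "antidiag_upper n \<union> antidiag_lower n = grid n" by (auto simp: not_le)
  finally show ?thesis by simp
qed

lemma row_content_antidiag:
  "(\<Prod>i\<in>{1..n}. mvar i ^ (n - i)) = Poly_Mapping.single (row_content (antidiag_upper n)) (1::'a::comm_ring_1)"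
proof -
  have "(\<Sum>i\<in>{1..n}. Poly_Mapping.single i (n - i)) = row_content (antidiag_upper n)"
  proof (rule poly_mapping_eqI)
    fix k
    have "{x \<in> antidiag_upper n. fst x = k} = {k} \<times> {j \<in> {1..n}. k \<in> {1..n} \<and> k + j \<le> n}" by auto
    moreover have "{j \<in> {1..n}. k \<in> {1..n} \<and> k + j \<le> n} = (if k \<in> {1..n} then {1..n - k} else {})" by auto
    ultimately have "card {x \<in> antidiag_upper n. fst x = k} = (if k \<in> {1..n} then n - k else 0)"
      by (simp add: card_cartesian_product)
    moreover have "Poly_Mapping.lookup (\<Sum>i\<in>{1..n}. Poly_Mapping.single i (n - i)) k = (if k \<in> {1..n} then n - k else 0)"
      by (simp add: lookup_sum lookup_single when_def)
    moreover have "finite (antidiag_upper n)" by simp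
    ultimately show "Poly_Mapping.lookup (\<Sum>i\<in>{1..n}. Poly_Mapping.single i (n - i)) k =
        Poly_Mapping.lookup (row_content (antidiag_upper n)) k"
      by (simp only: lookup_row_content)
  qed
  then show ?thesis by (simp add: single_power_sum)
qed

text \<open>The size \<open>n * n - ninv n w\<close> is the largest possible for a face, as
  \<open>facet_count_le\<close> shows, so these are the faces of top dimension. Their content is
  taken on the complement, to match the monomials of Schubert polynomials.\<close>

definition facets_with :: "nat \<Rightarrow> (nat \<Rightarrow> nat) \<Rightarrow> (nat \<Rightarrow>\<^sub>0 nat) \<Rightarrow> (nat \<times> nat) set set" where
  "facets_with n w c = {U \<in> ad_complex n w. card U + ninv n w = n * n \<and> row_content (grid n - U) = c}"

text \<open>The size bound forces the cone point into every face counted, since otherwise it could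
  be added. Its deletion is therefore injective and lands in the corresponding sets for the covers,
  where the complement has one more cell in row \<open>i\<close>; this is the factor
  \<open>x_i\<close> of the co-transition formula. Hence both claims are carried through one
  induction.\<close>

lemma facet_count_le:
  assumes "w permutes {1..n}"
  shows "(\<forall>U\<in>ad_complex n w. card U + ninv n w \<le> n * n) \<and>
    (\<forall>c. int (card (facets_with n w c)) \<le> Poly_Mapping.lookup (schubert_poly n w) c)"
  using assms
proof (induction rule: perm_downward_induct)
  case longest
  have le: "card U + ninv n (longest_perm n) \<le> n * n" if "U \<in> ad_complex n (longest_perm n)" for U
  proof -
    have "card U \<le> card (antidiag_lower n)"
      by (rule card_mono) (use ad_complex_longest[OF that] in auto)
    then show ?thesis using ninv_longest[of n] card_antidiag[of n] by simp
  qed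
  moreover have "int (card (facets_with n (longest_perm n) c)) \<le>
      Poly_Mapping.lookup (schubert_poly n (longest_perm n)) c" for c
  proof -
    have only: "U = antidiag_lower n" if "U \<in> facets_with n (longest_perm n) c" for U
    proof (rule card_subset_eq)
      show "U \<subseteq> antidiag_lower n" using that ad_complex_longest by (auto simp: facets_with_def)
      show "card U = card (antidiag_lower n)"
        using that ninv_longest[of n] card_antidiag[of n] by (simp add: facets_with_def)
    qed simp
    show ?thesis
    proof (cases "facets_with n (longest_perm n) c = {}")
      case True
      then show ?thesis unfolding schubert_poly_longest row_content_antidiag by (simp add: lookup_single when_def)
    next
      case False
      then have eq: "facets_with n (longest_perm n) c = {antidiag_lower n}" using only by blast
      then have "row_content (grid n - antidiag_lower n) = c" unfolding facets_with_def by blast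
      moreover have "grid n - antidiag_lower n = antidiag_upper n" by auto
      ultimately show ?thesis unfolding schubert_poly_longest row_content_antidiag eq by simp
    qed
  qed
  ultimately show ?case by blast
next
  case (step w j)
  note w = step(1)
  have "w \<noteq> longest_perm n" using longest_perm_desc[of j n] step(2,3) by auto
  then obtain i where dev: "first_deviation n w i" using ex_first_deviation[OF w] by blast
  note pos = first_deviation_pos[OF w dev]
  have wi: "w i \<le> n" using permutes_in_image[OF w, of i] pos by auto
  let ?v = "\<lambda>l. w \<circ> Transposition.transpose i l"
  have ct: "mvar i * schubert_poly n w = (\<Sum>l\<in>cov n w i. schubert_poly n (?v l))"
    by (rule cotransition[OF w dev, THEN conjunct1])
  have inv: "ninv n (?v l) = Suc (ninv n w)" if "l \<in> cov n w i" for l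
    by (rule cotransition[OF w dev, THEN conjunct2, rule_format, OF that])
  have perm: "?v l permutes {1..n}" if "l \<in> cov n w i" for l by (rule cov_permutes[OF w pos(1) that])
  have less: "ninv n w < ninv n (?v l)" if "l \<in> cov n w i" for l
    unfolding inv[OF that] by simp
  have IH1: "card U + Suc (ninv n w) \<le> n * n" if "l \<in> cov n w i" "U \<in> ad_complex n (?v l)" for l U
    unfolding inv[OF that(1), symmetric]
    by (rule step(4)[OF perm[OF that(1)] less[OF that(1)], THEN conjunct1, rule_format, OF that(2)])
  have IH2: "int (card (facets_with n (?v l) c)) \<le> Poly_Mapping.lookup (schubert_poly n (?v l)) c"
    if "l \<in> cov n w i" for l c
    by (rule step(4)[OF perm[OF that] less[OF that], THEN conjunct2, rule_format])
  let ?x = "(i, w i)"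
  have bound: "card U + ninv n w \<le> n * n" if U: "U \<in> ad_complex n w" for U
  proof -
    have "U - {?x} \<in> ad_complex n w" by (rule ad_complex_subset[OF U]) simp
    then obtain l where l: "l \<in> cov n w i" "U - {?x} \<in> ad_complex n (?v l)"
      by (rule ad_complex_delete[OF w dev]) auto
    have "card U \<le> Suc (card (U - {?x}))" using diff_card_le_card_Diff[of "{?x}" U] by simp
    then show ?thesis using IH1[OF l] by simp
  qed
  moreover have "int (card (facets_with n w c)) \<le> Poly_Mapping.lookup (schubert_poly n w) c" for c
  proof -
    let ?c = "Poly_Mapping.single i 1 + c"
    have mem: "?x \<in> U" if U: "U \<in> facets_with n w c" for U
    proof (rule ccontr)
      assume "?x \<notin> U"
      moreover have "insert ?x U \<in> ad_complex n w" using ad_complex_insert[OF w dev] U by (simp add: facets_with_def)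
      moreover have "finite U" using U ad_complex_grid[of U n w] finite_subset[of U "grid n"] by (simp add: facets_with_def)
      ultimately show False using bound[of "insert ?x U"] U by (simp add: facets_with_def)
    qed
    have sub: "(\<lambda>U. U - {?x}) ` facets_with n w c \<subseteq> (\<Union>l\<in>cov n w i. facets_with n (?v l) ?c)"
    proof (rule image_subsetI)
      fix U assume U: "U \<in> facets_with n w c"
      then have Uc: "U \<in> ad_complex n w" "card U + ninv n w = n * n" "row_content (grid n - U) = c"
        by (auto simp: facets_with_def)
      have fin: "finite U" using ad_complex_grid[OF Uc(1)] finite_subset[of U "grid n"] by simp
      have "U - {?x} \<in> ad_complex n w" by (rule ad_complex_subset[OF Uc(1)]) simp
      then obtain l where l: "l \<in> cov n w i" "U - {?x} \<in> ad_complex n (?v l)"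
        by (rule ad_complex_delete[OF w dev]) auto
      have "card (U - {?x}) + ninv n (?v l) = n * n"
        unfolding inv[OF l(1)] using Uc(2) card.remove[OF fin mem[OF U]] by simp
      moreover have "row_content (grid n - (U - {?x})) = ?c"
      proof -
        have "grid n - (U - {?x}) = insert ?x (grid n - U)" using pos wi by auto
        moreover have "?x \<notin> grid n - U" using mem[OF U] by simp
        ultimately show ?thesis using Uc(3) by (simp add: row_content_def)
      qed
      ultimately have "U - {?x} \<in> facets_with n (?v l) ?c" using l(2) by (simp add: facets_with_def)
      then show "U - {?x} \<in> (\<Union>l\<in>cov n w i. facets_with n (?v l) ?c)" using l(1) by blast
    qed
    have inj: "inj_on (\<lambda>U. U - {?x}) (facets_with n w c)"
      using mem by (intro inj_onI) (metis insert_Diff)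
    have finf: "finite (facets_with n v d)" for v d
      by (rule finite_subset[OF _ finite_ad_complex[of n v]]) (auto simp: facets_with_def)
    have "card (facets_with n w c) = card ((\<lambda>U. U - {?x}) ` facets_with n w c)"
      by (rule card_image[symmetric, OF inj])
    also have "\<dots> \<le> card (\<Union>l\<in>cov n w i. facets_with n (?v l) ?c)"
      by (rule card_mono[OF _ sub]) (simp add: finite_cov finf)
    also have "\<dots> \<le> (\<Sum>l\<in>cov n w i. card (facets_with n (?v l) ?c))"
      by (rule card_UN_le[OF finite_cov])
    finally have "int (card (facets_with n w c)) \<le> (\<Sum>l\<in>cov n w i. int (card (facets_with n (?v l) ?c)))"
      by (simp flip: of_nat_sum)
    also have "\<dots> \<le> (\<Sum>l\<in>cov n w i. Poly_Mapping.lookup (schubert_poly n (?v l)) ?c)"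
      by (rule sum_mono) (rule IH2)
    also have "\<dots> = Poly_Mapping.lookup (mvar i * schubert_poly n w) ?c" unfolding ct lookup_sum ..
    also have "\<dots> = Poly_Mapping.lookup (schubert_poly n w) c" by (rule lookup_mvar_times)
    finally show ?thesis .
  qed
  ultimately show ?case by blast
qed

subsection \<open>Rank of northwest blocks\<close>

interpretation cfun: vector_space "Polynomial.smult :: complex \<Rightarrow> _"
  by unfold_locales (auto simp: smult_add_right smult_add_left)

text \<open>Truncated rows are coded as polynomials, so blocks of all widths share one vector space;
  a bound by a spanning set avoids choosing bases when rows are added or replaced.\<close>

definition rank_le :: "complex poly set \<Rightarrow> nat \<Rightarrow> bool" where
  "rank_le S r \<longleftrightarrow> (\<exists>B. finite B \<and> card B \<le> r \<and> S \<subseteq> cfun.span B)"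

lemma rank_le_span: "rank_le S r \<Longrightarrow> S' \<subseteq> cfun.span S \<Longrightarrow> rank_le S' r"
  unfolding rank_le_def by (meson cfun.span_minimal cfun.subspace_span subset_trans)

lemma rank_le_mono: "rank_le S r \<Longrightarrow> r \<le> r' \<Longrightarrow> rank_le S r'"
  unfolding rank_le_def by (meson le_trans)

lemma rank_le_insert: "rank_le S r \<Longrightarrow> rank_le (insert x S) (Suc r)"
proof -
  assume "rank_le S r"
  then obtain B where B: "finite B" "card B \<le> r" "S \<subseteq> cfun.span B" unfolding rank_le_def by blast
  have "insert x S \<subseteq> cfun.span (insert x B)"
    using B(3) cfun.span_mono[of B "insert x B"] cfun.span_base[of x "insert x B"] by auto
  moreover have "card (insert x B) \<le> Suc r" using B card_insert_le_m1[of "Suc r" B x] by simp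
  ultimately show ?thesis using B(1) unfolding rank_le_def by (metis finite_insert)
qed

text \<open>Otherwise a basis of the span of \<open>S\<close>, of size at least \<open>r\<close>,
  would remain independent after adding both \<open>x\<close> and \<open>y\<close>, which exceeds
  the bound. For \<open>r = 0\<close> nothing is demanded of \<open>S\<close>.\<close>

lemma rank_le_relation:
  assumes fin: "finite S" and no: "r > 0 \<Longrightarrow> \<not> rank_le S (r - 1)" and le: "rank_le (insert x (insert y S)) (Suc r)"
  obtains a b where "(a, b) \<noteq> (0, 0)" "Polynomial.smult a x + Polynomial.smult b y \<in> cfun.span S"
proof -
  note out = that
  obtain B where B: "B \<subseteq> S" "cfun.independent B" "S \<subseteq> cfun.span B"
    by (rule cfun.maximal_independent_subset)
  have finB: "finite B" by (rule finite_subset[OF B(1) fin])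
  have span: "cfun.span B = cfun.span S"
    by (rule subset_antisym) (rule cfun.span_mono[OF B(1)], rule cfun.span_minimal[OF B(3) cfun.subspace_span])
  have cardB: "r \<le> card B"
  proof (rule ccontr)
    assume "\<not> r \<le> card B"
    then have r: "card B \<le> r - 1" "r > 0" by auto
    then have "rank_le S (r - 1)" unfolding rank_le_def by (intro exI[of _ B] conjI finB B(3))
    then show False using no[OF r(2)] by blast
  qed
  show ?thesis
  proof (cases "y \<in> cfun.span S")
    case True
    then have "Polynomial.smult 0 x + Polynomial.smult 1 y \<in> cfun.span S" by simp
    then show ?thesis by (rule out[rotated]) simp
  next
    case y: False
    have indy: "cfun.independent (insert y B)" by (rule cfun.independent_insertI[OF _ B(2)]) (use y span in simp)
    show ?thesis
    proof (cases "x \<in> cfun.span (insert y B)")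
      case True
      have "\<exists>k. x - Polynomial.smult k y \<in> cfun.span B" by (rule iffD1[OF cfun.span_breakdown_eq True])
      then obtain k where "x - Polynomial.smult k y \<in> cfun.span B" ..
      then have "Polynomial.smult 1 x + Polynomial.smult (- k) y \<in> cfun.span S" by (simp add: span)
      then show ?thesis by (rule out[rotated]) simp
    next
      case False
      then have ind: "cfun.independent (insert x (insert y B))" by (rule cfun.independent_insertI[OF _ indy])
      have "x \<notin> insert y B" using False cfun.span_base[of x "insert y B"] by blast
      moreover have "y \<notin> B" using y B(1) cfun.span_base[of y S] by blast
      ultimately have card: "card (insert x (insert y B)) = Suc (Suc (card B))" using finB by simp
      obtain C where C: "finite C" "card C \<le> Suc r" "insert x (insert y S) \<subseteq> cfun.span C"
        using le unfolding rank_le_def by (elim exE conjE)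
      have "insert x (insert y B) \<subseteq> cfun.span C" using C(3) B(1) by (simp add: subset_trans[OF B(1)])
      then have "card (insert x (insert y B)) \<le> card C"
        by (rule conjunct2[OF cfun.independent_span_bound[OF C(1) ind]])
      then show ?thesis using card cardB C(2) by simp
    qed
  qed
qed

definition row_vec :: "(nat \<times> nat \<Rightarrow> complex) \<Rightarrow> nat \<Rightarrow> nat \<Rightarrow> complex poly" where
  "row_vec a q i = (\<Sum>j\<in>{1..q}. monom (a (i, j)) j)"

lemma coeff_row_vec: "coeff (row_vec a q i) j = (if j \<in> {1..q} then a (i, j) else 0)"
  by (simp add: row_vec_def coeff_sum)

definition nw_rank_le :: "(nat \<times> nat \<Rightarrow> complex) \<Rightarrow> nat \<Rightarrow> nat \<Rightarrow> nat \<Rightarrow> bool" where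
  "nw_rank_le a p q r \<longleftrightarrow> rank_le (row_vec a q ` {1..p}) r"

text \<open>Row rank and column rank agree, since both bounds say that the matrix factors through dimension \<open>r\<close>.\<close>

lemma span_finite_comb: "finite B \<Longrightarrow> v \<in> cfun.span B \<Longrightarrow> \<exists>u. v = (\<Sum>b\<in>B. Polynomial.smult (u b) b)"
  using cfun.span_finite by blast

text \<open>Elimination by cross-multiplication with a pivot, without division, so that it also
  applies over the ring of parameters, which is a domain but not a field.\<close>

lemma ex_row_kernel:
  fixes q :: "'i \<Rightarrow> 'j \<Rightarrow> 'a::idom"
  assumes "finite J" "finite I" "card J < card I"
  shows "\<exists>c. (\<exists>i\<in>I. c i \<noteq> 0) \<and> (\<forall>j\<in>J. (\<Sum>i\<in>I. c i * q i j) = 0)"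
  using assms
proof (induction J arbitrary: I q rule: finite_induct)
  case empty
  then obtain i where "i \<in> I" by fastforce
  then show ?case by (intro exI[of _ "\<lambda>_. 1"]) auto
next
  case (insert j0 J)
  show ?case
  proof (cases "\<forall>i\<in>I. q i j0 = 0")
    case True
    then show ?thesis using insert.IH[of I q] insert.prems insert.hyps by auto
  next
    case False
    then obtain p where p: "p \<in> I" "q p j0 \<noteq> 0" by blast
    let ?I = "I - {p}" and ?q = "\<lambda>i j. q p j0 * q i j - q i j0 * q p j"
    have "card J < card ?I" using insert.prems insert.hyps p(1) by simp
    from insert.IH[OF _ this, of ?q] insert.prems(1) obtain c where c: "\<exists>i\<in>?I. c i \<noteq> 0"
      "\<And>j. j \<in> J \<Longrightarrow> (\<Sum>i\<in>?I. c i * ?q i j) = 0" by auto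
    define d where "d i = (if i = p then - (\<Sum>i\<in>?I. c i * q i j0) else c i * q p j0)" for i
    have sum: "(\<Sum>i\<in>I. d i * q i j) = (\<Sum>i\<in>?I. c i * ?q i j)" for j
    proof -
      have "(\<Sum>i\<in>I. d i * q i j) = d p * q p j + (\<Sum>i\<in>?I. d i * q i j)"
        by (rule sum.remove) (use insert.prems p in auto)
      also have "(\<Sum>i\<in>?I. d i * q i j) = (\<Sum>i\<in>?I. c i * q p j0 * q i j)"
        by (rule sum.cong) (auto simp: d_def)
      also have "d p * q p j = (\<Sum>i\<in>?I. - (c i * q i j0 * q p j))"
        by (simp add: d_def sum_distrib_right sum_negf)
      finally show ?thesis by (simp add: sum.distrib[symmetric] algebra_simps)
    qed
    have "(\<Sum>i\<in>?I. c i * ?q i j0) = 0" by (rule sum.neutral) simp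
    then have "\<forall>j\<in>insert j0 J. (\<Sum>i\<in>I. d i * q i j) = 0" unfolding sum using c(2) by auto
    moreover have "\<exists>i\<in>I. d i \<noteq> 0" using c(1) p by (auto simp: d_def)
    ultimately show ?thesis by blast
  qed
qed

lemma nw_rank_le_iff_factor:
  "nw_rank_le a p q r \<longleftrightarrow>
    (\<exists>(b::nat \<Rightarrow> nat \<Rightarrow> complex) c. \<forall>i\<in>{1..p}. \<forall>j\<in>{1..q}. a (i, j) = (\<Sum>k<r. b i k * c k j))"
proof
  assume "nw_rank_le a p q r"
  then obtain B where B: "finite B" "card B \<le> r" "row_vec a q ` {1..p} \<subseteq> cfun.span B"
    unfolding nw_rank_le_def rank_le_def by blast
  obtain f where f: "bij_betw f {..<card B} B" using ex_bij_betw_nat_finite[OF B(1)] by (auto simp: atLeast0LessThan)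
  have "\<forall>i\<in>{1..p}. \<exists>u. row_vec a q i = (\<Sum>b\<in>B. Polynomial.smult (u b) b)"
    using B(3) span_finite_comb[OF B(1)] by blast
  then obtain u where u: "\<And>i. i \<in> {1..p} \<Longrightarrow> row_vec a q i = (\<Sum>b\<in>B. Polynomial.smult (u i b) b)" by metis
  have "a (i, j) = (\<Sum>k<r. (if k < card B then u i (f k) else 0) * coeff (f k) j)" if "i \<in> {1..p}" "j \<in> {1..q}" for i j
  proof -
    have "a (i, j) = coeff (row_vec a q i) j" using that by (simp add: coeff_row_vec)
    also have "\<dots> = (\<Sum>b\<in>B. u i b * coeff b j)" unfolding u[OF that(1)] by (simp add: coeff_sum)
    also have "\<dots> = (\<Sum>k<card B. u i (f k) * coeff (f k) j)" by (rule sum.reindex_bij_betw[OF f, symmetric])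
    also have "\<dots> = (\<Sum>k<r. (if k < card B then u i (f k) else 0) * coeff (f k) j)"
      by (rule sum.mono_neutral_cong_left) (use B(2) in auto)
    finally show ?thesis .
  qed
  then show "\<exists>(b::nat \<Rightarrow> nat \<Rightarrow> complex) c. \<forall>i\<in>{1..p}. \<forall>j\<in>{1..q}. a (i, j) = (\<Sum>k<r. b i k * c k j)"
    by (intro exI[of _ "\<lambda>i k. if k < card B then u i (f k) else 0"] exI[of _ "\<lambda>k. coeff (f k)"] ballI)
next
  assume "\<exists>(b::nat \<Rightarrow> nat \<Rightarrow> complex) c. \<forall>i\<in>{1..p}. \<forall>j\<in>{1..q}. a (i, j) = (\<Sum>k<r. b i k * c k j)"
  then obtain b c where fac: "\<forall>i\<in>{1..p}. \<forall>j\<in>{1..q}. a (i, j) = (\<Sum>k<r. b i k * (c k j :: complex))"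
    by (elim exE)
  have bc: "a (i, j) = (\<Sum>k<r. b i k * c k j)" if "i \<in> {1..p}" "j \<in> {1..q}" for i j
    by (rule bspec[OF bspec[OF fac that(1)] that(2)])
  let ?g = "\<lambda>k. \<Sum>j\<in>{1..q}. monom (c k j) j"
  have "row_vec a q i \<in> cfun.span (?g ` {..<r})" if "i \<in> {1..p}" for i
  proof -
    have "row_vec a q i = (\<Sum>k<r. Polynomial.smult (b i k) (?g k))"
    proof (rule poly_eqI)
      fix j show "coeff (row_vec a q i) j = coeff (\<Sum>k<r. Polynomial.smult (b i k) (?g k)) j"
        using bc[OF that, of j] by (cases "1 \<le> j \<and> j \<le> q") (auto simp: coeff_row_vec coeff_sum intro!: sum.neutral)
    qed
    also have "\<dots> \<in> cfun.span (?g ` {..<r})"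
      by (intro cfun.span_sum cfun.span_scale cfun.span_base imageI)
    finally show ?thesis .
  qed
  moreover have "card (?g ` {..<r}) \<le> r" using card_image_le[of "{..<r}" ?g] by simp
  ultimately show "nw_rank_le a p q r" unfolding nw_rank_le_def rank_le_def by blast
qed

lemma (in vec_space) rank_basis:
  assumes A: "A \<in> carrier_mat n nc"
  obtains S where "S \<subseteq> set (cols A)" "lin_indpt S" "rank A = card S" "set (cols A) \<subseteq> span S"
proof -
  note out = that
  let ?P = "\<lambda>T. T \<subseteq> set (cols A) \<and> lin_indpt T"
  have P0: "?P {}" by (simp add: lin_dep_def)
  have "\<And>T. ?P T \<Longrightarrow> T \<subseteq> set (cols A)" by blast
  from maximal_exists_superset[of "set (cols A)" ?P "{}", OF _ this P0]
  obtain S where S: "maximal S ?P" by blast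
  have S1: "S \<subseteq> set (cols A)" "lin_indpt S" using S unfolding maximal_def by blast+
  have colsA: "set (cols A) \<subseteq> carrier_vec n" using cols_dim A by blast
  then have SC: "S \<subseteq> carrier_vec n" using S1(1) by blast
  have "v \<in> span S" if v: "v \<in> set (cols A)" for v
  proof (rule ccontr)
    assume n: "v \<notin> span S"
    have nS: "v \<notin> S"
    proof
      assume "v \<in> S"
      then have "v \<in> span S" using span_mem[of S v] SC by simp
      with n show False ..
    qed
    have vC: "v \<in> carrier_vec n" using v colsA by blast
    have "lin_indpt (S \<union> {v})"
      using lin_dep_iff_in_span[OF _ S1(2) _ nS] SC vC n by simp
    then have "?P (S \<union> {v})" using S1(1) v by simp
    then have "S = S \<union> {v}" using S unfolding maximal_def by (metis Un_upper1)
    then show False using nS by blast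
  qed
  then show thesis by (intro out[OF S1 rank_card_indpt[OF A S]]) blast
qed

lemma rank_factor:
  assumes A: "(A :: complex mat) \<in> carrier_mat p q"
  shows "vec_space.rank p A \<le> r \<longleftrightarrow> (\<exists>(b::nat \<Rightarrow> nat \<Rightarrow> complex) c. \<forall>i<p. \<forall>j<q. A $$ (i, j) = (\<Sum>k<r. b i k * c k j))"
proof -
  interpret vec_space "TYPE(complex)" p .
  obtain S where S1: "S \<subseteq> set (cols A)" "lin_indpt S" and rank: "rank A = card S" and inspan: "set (cols A) \<subseteq> span S"
    by (rule rank_basis[OF A])
  have colsA: "set (cols A) \<subseteq> carrier_vec p" using cols_dim A by blast
  then have SC: "S \<subseteq> carrier_vec p" using S1 by blast
  have finS: "finite S" using S1(1) finite_subset by blast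
  obtain f where f: "bij_betw f {..<card S} S" using ex_bij_betw_nat_finite[OF finS] by (auto simp: atLeast0LessThan)
  show ?thesis
  proof
  assume le: "rank A \<le> r"
  have card: "card S \<le> r" using rank le by simp
  have "\<exists>u. col A j = lincomb u S" if "j < q" for j
  proof -
    have "col A j \<in> set (cols A)" using that A by (auto simp: cols_def)
    then have "col A j \<in> span S" using inspan by blast
    from finite_in_span[OF finS _ this] SC obtain u where "lincomb u S = col A j" by auto
    then show ?thesis by (intro exI[of _ u]) (rule sym)
  qed
  then have "\<forall>j. \<exists>u. j < q \<longrightarrow> col A j = lincomb u S" by blast
  from choice[OF this] obtain u where u: "\<And>j. j < q \<Longrightarrow> col A j = lincomb (u j) S" by blast
  have "A $$ (i, j) = (\<Sum>k<r. (f k $ i) * (if k < card S then u j (f k) else 0))" if ij: "i < p" "j < q" for i j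
  proof -
    have "A $$ (i, j) = col A j $ i" using ij A by auto
    also have "\<dots> = (\<Sum>x\<in>S. u j x * x $ i)" unfolding u[OF ij(2)] by (rule lincomb_index[OF ij(1) SC])
    also have "\<dots> = (\<Sum>k<card S. u j (f k) * f k $ i)" by (rule sum.reindex_bij_betw[OF f, symmetric])
    also have "\<dots> = (\<Sum>k<r. (f k $ i) * (if k < card S then u j (f k) else 0))"
      by (rule sum.mono_neutral_cong_left) (use card in auto)
    finally show ?thesis .
  qed
  then show "\<exists>(b::nat \<Rightarrow> nat \<Rightarrow> complex) c. \<forall>i<p. \<forall>j<q. A $$ (i, j) = (\<Sum>k<r. b i k * c k j)"
    by (intro exI[of _ "\<lambda>i k. f k $ i"] exI[of _ "\<lambda>k j. if k < card S then u j (f k) else 0"] allI impI)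
next
  assume "\<exists>(b::nat \<Rightarrow> nat \<Rightarrow> complex) c. \<forall>i<p. \<forall>j<q. A $$ (i, j) = (\<Sum>k<r. b i k * c k j)"
  then obtain b c where "\<forall>i<p. \<forall>j<q. A $$ (i, j) = (\<Sum>k<r. b i k * (c k j :: complex))"
    by (elim exE)
  then have bc: "\<And>i j. i < p \<Longrightarrow> j < q \<Longrightarrow> A $$ (i, j) = (\<Sum>k<r. b i k * c k j)" by simp
  show "rank A \<le> r"
  proof (rule ccontr)
    assume "\<not> ?thesis"
    then have big: "r < card S" using rank by simp
    define J where "J x = (SOME j. j < q \<and> col A j = x)" for x
    have J: "J x < q \<and> col A (J x) = x" if "x \<in> S" for x
    proof -
      have "x \<in> set (cols A)" using that S1(1) by blast
      then have "\<exists>j. j < q \<and> col A j = x" using A by (auto simp: cols_def)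
      then show ?thesis unfolding J_def by (rule someI_ex)
    qed
    \<comment> \<open>More columns than the inner dimension \<open>r\<close> leave a combination
      that annihilates the right factor, hence a relation among the columns.\<close>
    have "\<exists>g. (\<exists>x\<in>S. g x \<noteq> 0) \<and> (\<forall>k\<in>{..<r}. (\<Sum>x\<in>S. g x * c k (J x)) = 0)"
      by (rule ex_row_kernel) (use finS big in simp_all)
    then obtain g where g: "\<exists>x\<in>S. g x \<noteq> 0" "\<And>k. k < r \<Longrightarrow> (\<Sum>x\<in>S. g x * c k (J x)) = 0"
      by (meson lessThan_iff)
    have "lincomb g S = 0\<^sub>v p"
    proof (rule eq_vecI)
      fix i assume "i < dim_vec (0\<^sub>v p :: complex vec)"
      then have i: "i < p" by simp
      have "lincomb g S $ i = (\<Sum>x\<in>S. g x * x $ i)" by (rule lincomb_index[OF i SC])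
      also have "\<dots> = (\<Sum>x\<in>S. g x * (\<Sum>k<r. b i k * c k (J x)))"
      proof (rule sum.cong[OF refl])
        fix x assume "x \<in> S"
        then have "col A (J x) = x" "J x < q" using J[of x] by simp_all
        moreover have "col A (J x) $ i = A $$ (i, J x)" using i A \<open>J x < q\<close> by simp
        ultimately have "x $ i = A $$ (i, J x)" by simp
        then show "g x * x $ i = g x * (\<Sum>k<r. b i k * c k (J x))" using bc[OF i] J[OF \<open>x \<in> S\<close>] by simp
      qed
      also have "\<dots> = (\<Sum>k<r. b i k * (\<Sum>x\<in>S. g x * c k (J x)))"
        unfolding sum_distrib_left by (subst sum.swap) (simp add: ac_simps)
      also have "\<dots> = 0" using g(2) by simp
      finally show "lincomb g S $ i = 0\<^sub>v p $ i" using i by simp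
    qed (use lincomb_dim[OF finS SC] in simp)
    moreover obtain x where "x \<in> S" "g x \<noteq> 0" using g(1) by blast
    ultimately have "lin_dep S" unfolding lin_dep_def using finS
      by (intro exI[of _ S] exI[of _ g] exI[of _ x]) simp
    then show False using S1(2) by simp
  qed
  qed
qed

lemma nw_submatrix_rank_le:
  "vec_space.rank p (nw_submatrix a p q) \<le> r \<longleftrightarrow> nw_rank_le a p q r"
proof -
  have "nw_submatrix a p q \<in> carrier_mat p q" by (simp add: nw_submatrix_def)
  note rank_factor[OF this, of r]
  also have "(\<exists>(b::nat \<Rightarrow> nat \<Rightarrow> complex) c. \<forall>i<p. \<forall>j<q. nw_submatrix a p q $$ (i, j) = (\<Sum>k<r. b i k * c k j)) \<longleftrightarrow>
      (\<exists>(b::nat \<Rightarrow> nat \<Rightarrow> complex) c. \<forall>i\<in>{1..p}. \<forall>j\<in>{1..q}. a (i, j) = (\<Sum>k<r. b i k * c k j))" (is "?L \<longleftrightarrow> ?R")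
  proof
    assume ?L
    then obtain b c where "\<forall>i<p. \<forall>j<q. nw_submatrix a p q $$ (i, j) = (\<Sum>k<r. b i k * (c k j :: complex))"
      by (elim exE)
    then have bc: "\<And>i j. i < p \<Longrightarrow> j < q \<Longrightarrow> nw_submatrix a p q $$ (i, j) = (\<Sum>k<r. b i k * c k j)" by simp
    have "a (i, j) = (\<Sum>k<r. b (i - 1) k * c k (j - 1))" if "i \<in> {1..p}" "j \<in> {1..q}" for i j
    proof -
      have "i - 1 < p" "j - 1 < q" "Suc (i - 1) = i" "Suc (j - 1) = j" using that by auto
      then show ?thesis using bc[of "i - 1" "j - 1"] by (simp add: nw_submatrix_def)
    qed
    then show ?R by (intro exI[of _ "\<lambda>i. b (i - 1)"] exI[of _ "\<lambda>k j. c k (j - 1)"] ballI)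
  next
    assume ?R
    then obtain b c where fac: "\<forall>i\<in>{1..p}. \<forall>j\<in>{1..q}. a (i, j) = (\<Sum>k<r. b i k * (c k j :: complex))"
      by (elim exE)
    have bc: "a (i, j) = (\<Sum>k<r. b i k * c k j)" if "i \<in> {1..p}" "j \<in> {1..q}" for i j
      by (rule bspec[OF bspec[OF fac that(1)] that(2)])
    have "nw_submatrix a p q $$ (i, j) = (\<Sum>k<r. b (Suc i) k * c k (Suc j))" if "i < p" "j < q" for i j
      using bc[of "Suc i" "Suc j"] that by (simp add: nw_submatrix_def)
    then show ?L by (intro exI[of _ "\<lambda>i. b (Suc i)"] exI[of _ "\<lambda>k j. c k (Suc j)"] allI impI)
  qed
  finally show ?thesis unfolding nw_rank_le_iff_factor .
qed

subsection \<open>Points where a polynomial does not vanish\<close>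

text \<open>Uniqueness of expansions in base \<open>B\<close>; it makes the encoding of exponent
  vectors by single exponents injective.\<close>

lemma digits_inject:
  fixes m m' :: "nat \<Rightarrow> nat"
  assumes "\<And>k. k < d \<Longrightarrow> m k < B" "\<And>k. k < d \<Longrightarrow> m' k < B" "(\<Sum>k<d. m k * B ^ k) = (\<Sum>k<d. m' k * B ^ k)"
  shows "k < d \<Longrightarrow> m k = m' k"
  using assms
proof (induction d arbitrary: m m' k)
  case (Suc d)
  have split: "(\<Sum>k<Suc d. f k * B ^ k) = f 0 + B * (\<Sum>k<d. f (Suc k) * B ^ k)" for f :: "nat \<Rightarrow> nat"
    by (subst sum.lessThan_Suc_shift) (simp add: sum_distrib_left ac_simps)
  have eq: "m 0 + B * (\<Sum>k<d. m (Suc k) * B ^ k) = m' 0 + B * (\<Sum>k<d. m' (Suc k) * B ^ k)"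
    using Suc.prems(4) unfolding split .
  have lt: "m 0 < B" "m' 0 < B" using Suc.prems(2,3) by auto
  have "(m 0 + B * (\<Sum>k<d. m (Suc k) * B ^ k)) mod B = m 0" using lt by simp
  moreover have "(m' 0 + B * (\<Sum>k<d. m' (Suc k) * B ^ k)) mod B = m' 0" using lt by simp
  ultimately have z: "m 0 = m' 0" using eq by simp
  then have rest: "(\<Sum>k<d. m (Suc k) * B ^ k) = (\<Sum>k<d. m' (Suc k) * B ^ k)" using eq lt by auto
  show ?case
  proof (cases k)
    case (Suc k')
    then show ?thesis using Suc.IH[of k' "\<lambda>k. m (Suc k)" "\<lambda>k. m' (Suc k)"] Suc.prems rest by auto
  qed (use z in simp)
qed simp

text \<open>Kronecker substitution.\<close>

lemma ex_nonzero_eval: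
  fixes f :: "('v, 'a::{idom, ring_char_0}) mpoly"
  assumes "f \<noteq> 0"
  shows "\<exists>a. poly_eval a f \<noteq> 0"
proof -
  define V where "V = (\<Union>m\<in>Poly_Mapping.keys f. Poly_Mapping.keys m)"
  have finV: "finite V" by (simp add: V_def)
  obtain idx where idx: "bij_betw idx V {..<card V}" using ex_bij_betw_finite_nat[OF finV] by (auto simp: atLeast0LessThan)
  \<comment> \<open>A base larger than all exponents in \<open>f\<close>, so that replacing
    \<open>x_v\<close> by \<open>z ^ (B ^ idx v)\<close> keeps distinct monomials distinct.\<close>
  define B where "B = Suc (\<Sum>m\<in>Poly_Mapping.keys f. \<Sum>v\<in>V. Poly_Mapping.lookup m v)"
  have lt: "Poly_Mapping.lookup m v < B" if "m \<in> Poly_Mapping.keys f" for m v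
  proof (cases "v \<in> V")
    case True
    have "Poly_Mapping.lookup m v \<le> (\<Sum>v\<in>V. Poly_Mapping.lookup m v)" by (rule member_le_sum[OF True]) (simp_all add: finV)
    also have "\<dots> \<le> (\<Sum>m\<in>Poly_Mapping.keys f. \<Sum>v\<in>V. Poly_Mapping.lookup m v)" by (rule member_le_sum[OF that]) simp_all
    finally show ?thesis by (simp add: B_def)
  next
    case False
    then have "v \<notin> Poly_Mapping.keys m" using that by (auto simp: V_def)
    then show ?thesis by (simp add: in_keys_iff B_def)
  qed
  define wt where "wt m = (\<Sum>v\<in>V. Poly_Mapping.lookup m v * B ^ idx v)" for m :: "'v \<Rightarrow>\<^sub>0 nat"
  define vr where "vr = inv_into V idx"
  have vr: "vr k \<in> V" "idx (vr k) = k" if "k < card V" for k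
  proof -
    have "k \<in> idx ` V" using that idx by (simp add: bij_betw_def)
    then show "vr k \<in> V" "idx (vr k) = k" unfolding vr_def by (rule inv_into_into, rule f_inv_into_f)
  qed
  have idx': "bij_betw vr {..<card V} V" unfolding vr_def by (rule bij_betw_inv_into[OF idx])
  have wt': "wt m = (\<Sum>k<card V. Poly_Mapping.lookup m (vr k) * B ^ k)" for m
    unfolding wt_def by (rule sum.reindex_bij_betw[OF idx', symmetric, where g = "\<lambda>v. Poly_Mapping.lookup m v * B ^ idx v", THEN trans])
      (simp add: vr)
  have inj: "m = m'" if mm: "m \<in> Poly_Mapping.keys f" "m' \<in> Poly_Mapping.keys f" "wt m = wt m'" for m m'
  proof (rule poly_mapping_eqI)
    fix v
    show "Poly_Mapping.lookup m v = Poly_Mapping.lookup m' v"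
    proof (cases "v \<in> V")
      case True
      then have "idx v < card V" "vr (idx v) = v" using idx by (auto simp: bij_betw_def vr_def)
      then show ?thesis
        using digits_inject[of "card V" "\<lambda>k. Poly_Mapping.lookup m (vr k)" B "\<lambda>k. Poly_Mapping.lookup m' (vr k)" "idx v"]
          lt[OF mm(1)] lt[OF mm(2)] mm(3) unfolding wt' by simp
    next
      case False
      then have "v \<notin> Poly_Mapping.keys m" "v \<notin> Poly_Mapping.keys m'" using mm by (auto simp: V_def)
      then show ?thesis by (simp add: in_keys_iff)
    qed
  qed
  define p where "p = (\<Sum>m\<in>Poly_Mapping.keys f. monom (Poly_Mapping.lookup f m) (wt m))"
  obtain m0 where m0: "m0 \<in> Poly_Mapping.keys f" using assms by (metis all_not_in_conv keys_eq_empty)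
  have "coeff p (wt m0) = (\<Sum>m\<in>Poly_Mapping.keys f. if m = m0 then Poly_Mapping.lookup f m else 0)"
    unfolding p_def coeff_sum coeff_monom by (rule sum.cong) (use inj m0 in auto)
  also have "\<dots> = Poly_Mapping.lookup f m0" using m0 by simp
  finally have "p \<noteq> 0" using m0 by (auto simp: in_keys_iff)
  then have "finite {z. poly p z = 0}" by (rule poly_roots_finite)
  then obtain z where z: "poly p z \<noteq> 0" using infinite_UNIV_char_0[where 'a = 'a] by (metis (mono_tags, lifting) UNIV_eq_I mem_Collect_eq)
  have "poly_eval (\<lambda>v. z ^ (B ^ idx v)) f = poly p z"
    unfolding poly_eval_def p_def poly_sum poly_monom
  proof (rule sum.cong[OF refl])
    fix m assume m: "m \<in> Poly_Mapping.keys f"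
    have "(\<Prod>v\<in>Poly_Mapping.keys m. (z ^ (B ^ idx v)) ^ Poly_Mapping.lookup m v) = (\<Prod>v\<in>V. (z ^ (B ^ idx v)) ^ Poly_Mapping.lookup m v)"
      by (rule prod.mono_neutral_left[OF finV]) (use m in \<open>auto simp: V_def in_keys_iff\<close>)
    also have "\<dots> = z ^ wt m" unfolding wt_def by (simp add: power_sum power_mult[symmetric] mult.commute)
    finally show "Poly_Mapping.lookup f m * (\<Prod>v\<in>Poly_Mapping.keys m. (z ^ (B ^ idx v)) ^ Poly_Mapping.lookup m v) =
        Poly_Mapping.lookup f m * z ^ wt m" by simp
  qed
  then show ?thesis using z by metis
qed

section \<open>Substitution and restriction to curves\<close>

definition subst :: "('v \<Rightarrow> ('u, 'a) mpoly) \<Rightarrow> ('v, 'a::comm_ring_1) mpoly \<Rightarrow> ('u, 'a) mpoly" where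
  "subst \<sigma> = hom_eval (Poly_Mapping.single 0) \<sigma>"

interpretation subst: comm_ring_hom "subst \<sigma> :: ('v, 'a::comm_ring_1) mpoly \<Rightarrow> ('u, 'a) mpoly" for \<sigma>
  unfolding subst_def by (rule hom_eval_hom[OF comm_ring_hom_const])

lemma poly_eval_subst: "poly_eval a (subst \<sigma> f) = poly_eval (\<lambda>v. poly_eval a (\<sigma> v)) f"
proof (induction f rule: mpoly_induct)
  case (const c)
  show ?case by (simp add: subst_def hom_eval_const[OF comm_ring_hom_const])
next
  case (var v)
  show ?case by (simp add: subst_def hom_eval_mvar[OF comm_ring_hom_const])
qed (simp_all add: poly_eval.hom_add poly_eval.hom_mult subst.hom_add subst.hom_mult)

lemma comm_ring_hom_poly_const: "comm_ring_hom (\<lambda>c::'a::comm_ring_1. [:c:])"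
  by unfold_locales (auto simp: one_pCons)

text \<open>On a curve a polynomial becomes univariate, so infinitely many zeros make it vanish on
  the whole curve; limits of points are handled in this way.\<close>

lemma poly_eval_curve: "poly (hom_eval (\<lambda>c. [:c:]) \<gamma> f) t = poly_eval (\<lambda>v. poly (\<gamma> v) t) f"
proof (induction f rule: mpoly_induct)
  case (const c)
  show ?case by (simp add: hom_eval_const[OF comm_ring_hom_poly_const])
next
  case (var v)
  show ?case by (simp add: hom_eval_mvar[OF comm_ring_hom_poly_const])
qed (simp_all add: poly_eval.hom_add poly_eval.hom_mult hom_eval_add[OF comm_ring_hom_poly_const] hom_eval_mult[OF comm_ring_hom_poly_const])

lemma poly_eval_cong: "(\<And>m v. m \<in> Poly_Mapping.keys f \<Longrightarrow> v \<in> Poly_Mapping.keys m \<Longrightarrow> a v = b v) \<Longrightarrow> poly_eval a f = poly_eval b f"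
  unfolding poly_eval_def by (auto intro!: sum.cong prod.cong arg_cong2[of _ _ _ _ "(*)"])

subsection \<open>Matrix Schubert varieties are irreducible\<close>

text \<open>Entries outside the grid are left free, so row moves need no restriction afterwards; the
  variety is recovered by restricting to the grid.\<close>

definition schubert_cone :: "nat \<Rightarrow> (nat \<Rightarrow> nat) \<Rightarrow> (nat \<times> nat \<Rightarrow> complex) set" where
  "schubert_cone n w = {a. \<forall>p\<le>n. \<forall>q\<le>n. nw_rank_le a p q (rk w p q)}"

lemma nw_rank_le_rows:
  assumes "nw_rank_le a p q r" "\<And>k. k \<in> {1..p'} \<Longrightarrow> row_vec b q k \<in> cfun.span (row_vec a q ` {1..p})"
  shows "nw_rank_le b p' q r"
  using assms(1) unfolding nw_rank_le_def by (rule rank_le_span) (use assms(2) in blast)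

lemma rank_le_empty: "rank_le {} r"
  unfolding rank_le_def by (intro exI[of _ "{}"]) simp

lemma nw_rank_le_trivial: "p = 0 \<or> q = 0 \<Longrightarrow> nw_rank_le a p q r"
proof (elim disjE)
  assume "q = 0"
  then have "row_vec a q ` {1..p} \<subseteq> cfun.span {}" by (auto simp: row_vec_def)
  then show ?thesis unfolding nw_rank_le_def by (rule rank_le_span[OF rank_le_empty])
qed (simp add: nw_rank_le_def rank_le_empty)

lemma matrix_schubert_eq:
  assumes w: "w permutes {1..n}"
  shows "matrix_schubert n w = affine_space (grid n) \<inter> schubert_cone n w"
proof -
  have "(\<forall>p\<in>{1..n}. \<forall>q\<in>{1..n}. vec_space.rank p (nw_submatrix a p q) \<le> nw_rank w p q) \<longleftrightarrow> a \<in> schubert_cone n w"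
    (is "?L \<longleftrightarrow> _") for a
  proof
    assume L: ?L
    have "nw_rank_le a p q (rk w p q)" if "p \<le> n" "q \<le> n" for p q
    proof (cases "p = 0 \<or> q = 0")
      case False
      then show ?thesis using L that rk_eq_nw_rank[OF w that(1)] nw_submatrix_rank_le by auto
    qed (rule nw_rank_le_trivial)
    then show "a \<in> schubert_cone n w" by (simp add: schubert_cone_def)
  next
    assume "a \<in> schubert_cone n w"
    then show ?L using rk_eq_nw_rank[OF w] nw_submatrix_rank_le by (auto simp: schubert_cone_def)
  qed
  then show ?thesis unfolding matrix_schubert_def by blast
qed

lemma nw_rank_le_cong:
  assumes "\<And>x. x \<in> grid n \<Longrightarrow> a x = b x" "p \<le> n" "q \<le> n"
  shows "nw_rank_le a p q r \<longleftrightarrow> nw_rank_le b p q r"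
proof -
  have "row_vec a q i = row_vec b q i" if "i \<in> {1..p}" for i
    unfolding row_vec_def using assms that by (intro sum.cong) auto
  then show ?thesis unfolding nw_rank_le_def by (metis image_cong)
qed

lemma schubert_cone_restrict:
  "restrict a (grid n) \<in> schubert_cone n w \<longleftrightarrow> a \<in> schubert_cone n w"
  using nw_rank_le_cong[of n "restrict a (grid n)" a] by (simp add: schubert_cone_def)

text \<open>Row operations on rows \<open>i\<close> and \<open>i + 1\<close>; these represent the cosets of the Borel subgroup in \<open>GL\<^sub>2\<close>.\<close>

definition row_move :: "nat \<Rightarrow> complex \<Rightarrow> (nat \<times> nat \<Rightarrow> complex) \<Rightarrow> nat \<times> nat \<Rightarrow> complex" where
  "row_move i t b = (\<lambda>(k, j). if k = i then b (Suc i, j) else if k = Suc i then b (i, j) + t * b (Suc i, j) else b (k, j))"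

lemma row_vec_row_move:
  "row_vec (row_move i t b) q k = (if k = i then row_vec b q (Suc i)
    else if k = Suc i then row_vec b q i + Polynomial.smult t (row_vec b q (Suc i)) else row_vec b q k)"
  by (rule poly_eqI) (auto simp: coeff_row_vec row_move_def)

lemma rk_Suc: "rk w (Suc p) q = rk w p q + (if w (Suc p) \<le> q then 1 else 0)"
proof -
  have "{k \<in> {1..Suc p}. w k \<le> q} = (if w (Suc p) \<le> q then insert (Suc p) {k \<in> {1..p}. w k \<le> q} else {k \<in> {1..p}. w k \<le> q})"
    by (auto simp: le_Suc_eq)
  then show ?thesis by (simp add: rk_def)
qed

lemma rk_simple:
  assumes i: "1 \<le> i"
  shows "p < i \<Longrightarrow> rk (w \<circ> simple_refl i) p q = rk w p q"
    and "i < p \<Longrightarrow> rk (w \<circ> simple_refl i) p q = rk w p q"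
    and "rk (w \<circ> simple_refl i) i q = rk w (i - 1) q + (if w (Suc i) \<le> q then 1 else 0)"
    and "rk w i q = rk w (i - 1) q + (if w i \<le> q then 1 else 0)"
proof -
  show small: "rk (w \<circ> simple_refl i) p q = rk w p q" if "p < i" for p
    unfolding rk_def by (rule arg_cong[of _ _ card]) (use that in \<open>auto simp: simple_refl_apply\<close>)
  obtain i' where i': "i = Suc i'" using i by (cases i) auto
  show e1: "rk (w \<circ> simple_refl i) i q = rk w (i - 1) q + (if w (Suc i) \<le> q then 1 else 0)"
    using rk_Suc[of "w \<circ> simple_refl i" i' q] small[of i'] i' by (simp add: simple_refl_apply)
  show e2: "rk w i q = rk w (i - 1) q + (if w i \<le> q then 1 else 0)"
    using rk_Suc[of w i' q] i' by simp
  have base: "rk (w \<circ> simple_refl i) (Suc i) q = rk w (Suc i) q"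
    using rk_Suc[of "w \<circ> simple_refl i" i q] rk_Suc[of w i q] e1 e2 by (simp add: simple_refl_apply)
  show "rk (w \<circ> simple_refl i) p q = rk w p q" if "i < p"
    using that
  proof (induction p)
    case (Suc p)
    show ?case
    proof (cases "p = i")
      case True
      show ?thesis unfolding True by (rule base)
    next
      case False
      then have "i < p" using Suc.prems by simp
      moreover have "(w \<circ> simple_refl i) (Suc p) = w (Suc p)"
        using False \<open>i < p\<close> by (simp add: simple_refl_apply)
      ultimately show ?thesis by (simp only: rk_Suc Suc.IH)
    qed
  qed simp
qed

text \<open>Cutting off columns is linear, so a relation between rows of a wide block restricts to
  every narrower one.\<close>

lemma truncate_span:
  assumes "q \<le> q'" "Polynomial.smult \<alpha> (row_vec a q' i) + Polynomial.smult \<beta> (row_vec a q' j) \<in> cfun.span (row_vec a q' ` S)"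
  shows "Polynomial.smult \<alpha> (row_vec a q i) + Polynomial.smult \<beta> (row_vec a q j) \<in> cfun.span (row_vec a q ` S)"
proof -
  define tr where "tr f = (\<Sum>j\<in>{1..q}. monom (coeff f j) j)" for f :: "complex poly"
  have ctr: "coeff (tr f) k = (if k \<in> {1..q} then coeff f k else 0)" for f k by (simp add: tr_def coeff_sum)
  have tr_row: "tr (row_vec a q' k) = row_vec a q k" for k
    by (rule poly_eqI) (use assms(1) in \<open>auto simp: ctr coeff_row_vec\<close>)
  have tr_add: "tr (f + g) = tr f + tr g" and tr_smult: "tr (Polynomial.smult c f) = Polynomial.smult c (tr f)" for f g c
    by (rule poly_eqI; simp add: ctr)+
  have tr0: "tr 0 = 0" by (simp add: tr_def)
  have "tr f \<in> cfun.span (row_vec a q ` S)" if "f \<in> cfun.span (row_vec a q' ` S)" for f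
    using that
  proof (induction rule: cfun.span_induct_alt)
    case (step c x y)
    then obtain k where "k \<in> S" "x = row_vec a q' k" by blast
    then have "tr (Polynomial.smult c x + y) = Polynomial.smult c (row_vec a q k) + tr y" by (simp add: tr_add tr_smult tr_row)
    moreover have "row_vec a q k \<in> cfun.span (row_vec a q ` S)" using \<open>k \<in> S\<close> by (intro cfun.span_base imageI)
    ultimately show ?case using step by (simp add: cfun.span_add cfun.span_scale)
  qed (simp add: tr0 cfun.span_zero)
  from this[OF assms(2)] show ?thesis by (simp add: tr_add tr_smult tr_row)
qed

lemma schubert_coneD: "a \<in> schubert_cone n w \<Longrightarrow> p \<le> n \<Longrightarrow> q \<le> n \<Longrightarrow> nw_rank_le a p q (rk w p q)"
  by (simp add: schubert_cone_def)

lemma nw_rank_le_Suc_rows: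
  assumes "nw_rank_le a p q r" "\<And>k. k \<in> {1..p} \<Longrightarrow> row_vec b q k = row_vec a q k"
  shows "nw_rank_le b (Suc p) q (Suc r)"
proof -
  have "row_vec b q ` {1..p} = row_vec a q ` {1..p}" using assms(2) by (rule image_cong[OF refl])
  moreover have "{1..Suc p} = insert (Suc p) {1..p}" by auto
  ultimately show ?thesis using rank_le_insert[of "row_vec a q ` {1..p}" r "row_vec b q (Suc p)"] assms(1)
    unfolding nw_rank_le_def by (simp del: atLeastAtMost_iff)
qed

text \<open>Adding multiples of a row to a lower one never leaves the span of the first
  \<open>p\<close> rows, for any \<open>p\<close>.\<close>

lemma schubert_cone_row_op:
  fixes \<alpha> \<beta> \<gamma> :: complex
  assumes b: "b \<in> schubert_cone n w" and i: "1 \<le> i" "i < n"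
    and rows: "\<And>k q. k \<noteq> i \<Longrightarrow> k \<noteq> Suc i \<Longrightarrow> row_vec c q k = row_vec b q k"
      "\<And>q. row_vec c q i = Polynomial.smult \<alpha> (row_vec b q i)"
      "\<And>q. row_vec c q (Suc i) = Polynomial.smult \<beta> (row_vec b q i) + Polynomial.smult \<gamma> (row_vec b q (Suc i))"
  shows "c \<in> schubert_cone n w"
  unfolding schubert_cone_def
proof (intro CollectI allI impI)
  fix p q assume pq: "p \<le> n" "q \<le> n"
  show "nw_rank_le c p q (rk w p q)"
  proof (rule nw_rank_le_rows[OF schubert_coneD[OF b pq]])
    fix k assume k: "k \<in> {1..p}"
    have base: "row_vec b q l \<in> cfun.span (row_vec b q ` {1..p})" if "1 \<le> l" "l \<le> p" for l
      using that by (intro cfun.span_base imageI) simp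
    consider "k = i" | "k = Suc i" | "k \<noteq> i" "k \<noteq> Suc i" by blast
    then show "row_vec c q k \<in> cfun.span (row_vec b q ` {1..p})"
      by cases (use k i base[of i] base[of "Suc i"] base[of k] in \<open>simp_all add: rows cfun.span_add cfun.span_scale\<close>)
  qed
qed

context
  fixes n :: nat and v w :: "nat \<Rightarrow> nat" and i :: nat
  assumes i: "i \<in> {1..<n}" and asc: "v i < v (Suc i)" and w_def: "w = v \<circ> simple_refl i"
begin

lemma rk_facts:
  shows "p < i \<Longrightarrow> rk w p q = rk v p q" "i < p \<Longrightarrow> rk w p q = rk v p q"
    and "rk w i q = rk v (i - 1) q + (if v (Suc i) \<le> q then 1 else 0)"
    and "rk v i q = rk v (i - 1) q + (if v i \<le> q then 1 else 0)"
    and "rk v (Suc i) q = rk v (i - 1) q + (if v i \<le> q then 1 else 0) + (if v (Suc i) \<le> q then 1 else 0)"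
proof -
  have i1: "1 \<le> i" using i by simp
  show "p < i \<Longrightarrow> rk w p q = rk v p q" unfolding w_def by (rule rk_simple(1)[OF i1])
  show "i < p \<Longrightarrow> rk w p q = rk v p q" unfolding w_def by (rule rk_simple(2)[OF i1])
  show "rk w i q = rk v (i - 1) q + (if v (Suc i) \<le> q then 1 else 0)" unfolding w_def by (rule rk_simple(3)[OF i1])
  show e: "rk v i q = rk v (i - 1) q + (if v i \<le> q then 1 else 0)" by (rule rk_simple(4)[OF i1])
  show "rk v (Suc i) q = rk v (i - 1) q + (if v i \<le> q then 1 else 0) + (if v (Suc i) \<le> q then 1 else 0)"
    unfolding rk_Suc e ..
qed

text \<open>Only the blocks with \<open>p = i\<close> have different bounds for \<open>v\<close> and
  \<open>w\<close>. If \<open>v i \<le> q\<close>, the bound for \<open>v\<close> allows one row in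
  addition to the first \<open>i - 1\<close>, which the move keeps. If \<open>q < v i\<close>, it
  equals the bound for \<open>i + 1\<close> rows, whose span contains all new rows.\<close>

lemma row_move_cone:
  assumes b: "b \<in> schubert_cone n w" shows "row_move i t b \<in> schubert_cone n v"
  unfolding schubert_cone_def
proof (intro CollectI allI impI)
  fix p q assume pq: "p \<le> n" "q \<le> n"
  have base: "row_vec b q l \<in> cfun.span (row_vec b q ` {1..p'})" if "1 \<le> l" "l \<le> p'" for l p'
    using that by (intro cfun.span_base imageI) simp
  consider "p < i" | "p = i" "v i \<le> q" | "p = i" "q < v i" | "i < p" by linarith
  then show "nw_rank_le (row_move i t b) p q (rk v p q)"
  proof cases
    case 1
    have "nw_rank_le b p q (rk v p q)" using schubert_coneD[OF b pq] rk_facts(1)[OF 1] by simp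
    then show ?thesis by (rule nw_rank_le_rows) (use 1 base in \<open>simp add: row_vec_row_move\<close>)
  next
    case 2
    have e: "Suc (i - 1) = i" using i by simp
    have "i - 1 \<le> n" "i - 1 < i" using i by auto
    then have "nw_rank_le b (i - 1) q (rk v (i - 1) q)"
      using schubert_coneD[OF b _ pq(2)] rk_facts(1)[of "i - 1" q] by metis
    moreover have "row_vec (row_move i t b) q k = row_vec b q k" if "k \<in> {1..i - 1}" for k
      using that by (auto simp: row_vec_row_move)
    ultimately have "nw_rank_le (row_move i t b) (Suc (i - 1)) q (Suc (rk v (i - 1) q))"
      by (rule nw_rank_le_Suc_rows)
    then show ?thesis using 2 rk_facts(4)[of q] unfolding e by simp
  next
    case 3
    have "nw_rank_le b (Suc i) q (rk v p q)"
      using schubert_coneD[OF b, of "Suc i" q] i pq 3 asc rk_facts(2)[of "Suc i" q] rk_facts(4,5)[of q] by simp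
    then show ?thesis by (rule nw_rank_le_rows) (use 3 base i in \<open>auto simp: row_vec_row_move\<close>)
  next
    case 4
    have "nw_rank_le b p q (rk v p q)" using schubert_coneD[OF b pq] rk_facts(2)[OF 4] by simp
    then show ?thesis
      by (rule nw_rank_le_rows)
        (use 4 base i in \<open>auto simp: row_vec_row_move intro!: cfun.span_add cfun.span_scale\<close>)
  qed
qed

text \<open>A combination of rows \<open>i\<close> and \<open>i + 1\<close> is sought that can serve
  as row \<open>i\<close> of a point of the cone of \<open>w\<close>. For
  \<open>q < v (i + 1)\<close> it has to lie in the span of the first \<open>i - 1\<close> rows
  wherever these exhaust their rank, with the same coefficients for all such \<open>q\<close>. If
  \<open>\<beta> = 0\<close>, the point already belongs to the cone of \<open>w\<close>; otherwise
  undoing a row move leads there.\<close>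

lemma cone_cover:
  assumes a: "a \<in> schubert_cone n v"
  shows "a \<in> schubert_cone n w \<or> (\<exists>t. \<exists>b\<in>schubert_cone n w. a = row_move i t b)"
proof -
  let ?S = "\<lambda>q. row_vec a q ` {1..i - 1}" and ?r = "\<lambda>q. rk v (i - 1) q"
  let ?z = "\<lambda>\<alpha> \<beta> q. Polynomial.smult \<alpha> (row_vec a q i) + Polynomial.smult \<beta> (row_vec a q (Suc i))"
  have i1: "{1..i} = insert i {1..i - 1}" and i2: "{1..Suc i} = insert i (insert (Suc i) {1..i - 1})" using i by auto
  have S: "rank_le (?S q) (?r q)" if "q \<le> n" for q
  proof -
    have "i - 1 \<le> n" using i by auto
    from schubert_coneD[OF a this that] show ?thesis by (simp add: nw_rank_le_def)
  qed
  define bad where "bad q \<longleftrightarrow> q \<le> n \<and> q < v (Suc i) \<and> (?r q > 0 \<longrightarrow> \<not> rank_le (?S q) (?r q - 1))" for q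
  \<comment> \<open>For \<open>q < v (i + 1)\<close> the bound for \<open>i + 1\<close> rows exceeds
    that for \<open>i - 1\<close> rows by at most one, so where the latter is attained the two new
    rows are dependent modulo the others.\<close>
  have rel: "\<exists>\<alpha> \<beta>. (\<alpha>, \<beta>) \<noteq> (0, 0) \<and> ?z \<alpha> \<beta> q \<in> cfun.span (?S q)" if q: "bad q" for q
  proof -
    have "nw_rank_le a (Suc i) q (rk v (Suc i) q)" using schubert_coneD[OF a, of "Suc i" q] i q by (simp add: bad_def)
    moreover have "rk v (Suc i) q \<le> Suc (?r q)" using rk_facts(5)[of q] q by (simp add: bad_def)
    ultimately have "rank_le (row_vec a q ` {1..Suc i}) (Suc (?r q))"
      unfolding nw_rank_le_def by (rule rank_le_mono)
    then have le: "rank_le (insert (row_vec a q i) (insert (row_vec a q (Suc i)) (?S q))) (Suc (?r q))"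
      unfolding i2 by simp
    have fin: "finite (?S q)" by simp
    have no: "?r q > 0 \<Longrightarrow> \<not> rank_le (?S q) (?r q - 1)" using q by (simp add: bad_def)
    obtain \<alpha> \<beta> where "(\<alpha>, \<beta>) \<noteq> (0, 0)" "?z \<alpha> \<beta> q \<in> cfun.span (?S q)"
      by (rule rank_le_relation[OF fin no le])
    then show ?thesis by (intro exI conjI)
  qed
  obtain \<alpha> \<beta> where ab: "(\<alpha>, \<beta>) \<noteq> (0, 0)" and badz: "\<And>q. bad q \<Longrightarrow> ?z \<alpha> \<beta> q \<in> cfun.span (?S q)"
  proof (cases "\<exists>q. bad q")
    case False
    then show ?thesis using that[of 1 1] by simp
  next
    case True
    then obtain q0 where q0: "bad q0" by blast
    have bnd: "\<And>q. bad q \<Longrightarrow> q \<le> n" by (simp add: bad_def)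
    \<comment> \<open>The relation on the widest bad block restricts to all others and so supplies
      common coefficients.\<close>
    define m where "m = (GREATEST q. bad q)"
    have m1: "bad m" unfolding m_def by (rule GreatestI_nat[of bad, OF q0 bnd])
    have m2: "q \<le> m" if "bad q" for q unfolding m_def by (rule Greatest_le_nat[of bad, OF that bnd])
    obtain \<alpha> \<beta> where ab: "(\<alpha>, \<beta>) \<noteq> (0, 0)" and z: "?z \<alpha> \<beta> m \<in> cfun.span (?S m)"
      using rel[OF m1] by (elim exE conjE)
    show ?thesis
    proof (rule that[OF ab])
      fix q assume "bad q"
      then show "?z \<alpha> \<beta> q \<in> cfun.span (?S q)" by (rule truncate_span[OF m2 z])
    qed
  qed
  have key: "rank_le (insert (?z \<alpha> \<beta> q) (?S q)) (rk w i q)" if q: "q \<le> n" for q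
  proof -
    consider "v (Suc i) \<le> q" | "bad q" "q < v (Suc i)" | "\<not> bad q" "q < v (Suc i)" by linarith
    then show ?thesis
    proof cases
      case 1
      then show ?thesis using rank_le_insert[OF S[OF q]] rk_facts(3)[of q] by simp
    next
      case 2
      have "insert (?z \<alpha> \<beta> q) (?S q) \<subseteq> cfun.span (?S q)" using badz[OF 2(1)] cfun.span_superset[of "?S q"] by simp
      then show ?thesis using rank_le_span[OF S[OF q]] rk_facts(3)[of q] 2(2) by simp
    next
      case 3
      then have "?r q > 0" "rank_le (?S q) (?r q - 1)" using q by (auto simp: bad_def)
      then show ?thesis using rank_le_insert[of "?S q" "?r q - 1"] rk_facts(3)[of q] 3 by simp
    qed
  qed
  have base: "row_vec a q l \<in> cfun.span (row_vec a q ` {1..p'})" if "1 \<le> l" "l \<le> p'" for l p' q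
    using that by (intro cfun.span_base imageI) simp
  show ?thesis
  proof (cases "\<beta> = 0")
    case True
    then have \<alpha>: "\<alpha> \<noteq> 0" using ab by simp
    have "nw_rank_le a p q (rk w p q)" if pq: "p \<le> n" "q \<le> n" for p q
    proof (cases "p = i")
      case True
      have "row_vec a q i = Polynomial.smult (1 / \<alpha>) (?z \<alpha> \<beta> q)" using \<alpha> \<open>\<beta> = 0\<close> by simp
      then have "row_vec a q i \<in> cfun.span (insert (?z \<alpha> \<beta> q) (?S q))"
        using cfun.span_scale[OF cfun.span_base[of "?z \<alpha> \<beta> q" "insert (?z \<alpha> \<beta> q) (?S q)"], of "1 / \<alpha>"] by simp
      moreover have "?S q \<subseteq> cfun.span (insert (?z \<alpha> \<beta> q) (?S q))" using cfun.span_superset[of "insert (?z \<alpha> \<beta> q) (?S q)"] by simp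
      ultimately have "row_vec a q ` {1..i} \<subseteq> cfun.span (insert (?z \<alpha> \<beta> q) (?S q))" unfolding i1 by simp
      from rank_le_span[OF key[OF pq(2)] this] show ?thesis unfolding nw_rank_le_def True .
    next
      case False
      then have "rk w p q = rk v p q" using rk_facts(1)[of p q] rk_facts(2)[of p q] by (cases "p < i") auto
      then show ?thesis using schubert_coneD[OF a pq] by simp
    qed
    then show ?thesis by (simp add: schubert_cone_def)
  next
    case False
    \<comment> \<open>\<open>b\<close> is the preimage of \<open>a\<close> under the move; this
      \<open>t\<close> makes its row \<open>i\<close> the combination found above, divided by
      \<open>\<beta>\<close>.\<close>
    define t where "t = - \<alpha> / \<beta>"
    define b where "b = (\<lambda>(k, j). if k = i then a (Suc i, j) - t * a (i, j) else if k = Suc i then a (i, j) else a (k, j))"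
    have rb: "row_vec b q k = (if k = i then row_vec a q (Suc i) - Polynomial.smult t (row_vec a q i)
        else if k = Suc i then row_vec a q i else row_vec a q k)" for q k
      by (rule poly_eqI) (auto simp: coeff_row_vec b_def)
    have zb: "row_vec b q i = Polynomial.smult (1 / \<beta>) (?z \<alpha> \<beta> q)" for q
      using False by (simp add: rb t_def smult_add_right)
    have "nw_rank_le b p q (rk w p q)" if pq: "p \<le> n" "q \<le> n" for p q
    proof -
      consider "p < i" | "p = i" | "i < p" by linarith
      then show ?thesis
      proof cases
        case 1
        have "nw_rank_le a p q (rk w p q)" using schubert_coneD[OF a pq] rk_facts(1)[OF 1] by simp
        then show ?thesis by (rule nw_rank_le_rows) (use 1 base in \<open>simp add: rb\<close>)
      next
        case 2
        have "row_vec b q i \<in> cfun.span (insert (?z \<alpha> \<beta> q) (?S q))"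
          unfolding zb by (intro cfun.span_scale cfun.span_base) simp
        moreover have "row_vec b q k \<in> cfun.span (insert (?z \<alpha> \<beta> q) (?S q))" if "k \<in> {1..i - 1}" for k
        proof -
          have "row_vec b q k = row_vec a q k" using that by (auto simp: rb)
          then show ?thesis using that by (auto intro!: cfun.span_base)
        qed
        ultimately have "row_vec b q ` {1..i} \<subseteq> cfun.span (insert (?z \<alpha> \<beta> q) (?S q))" unfolding i1 by auto
        from rank_le_span[OF key[OF pq(2)] this] show ?thesis unfolding nw_rank_le_def 2 .
      next
        case 3
        have "nw_rank_le a p q (rk w p q)" using schubert_coneD[OF a pq] rk_facts(2)[OF 3] by simp
        then show ?thesis
          by (rule nw_rank_le_rows) (use 3 base i in \<open>auto simp: rb intro!: cfun.span_diff cfun.span_scale\<close>)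
      qed
    qed
    then have "b \<in> schubert_cone n w" by (simp add: schubert_cone_def)
    moreover have "a = row_move i t b" by (auto simp: row_move_def b_def fun_eq_iff)
    ultimately show ?thesis by blast
  qed
qed

end

lemma row_vec_shear:
  "row_vec (\<lambda>(k, j). if k = i then \<alpha> * b (i, j) else if k = Suc i then \<beta> * b (i, j) + \<gamma> * b (Suc i, j) else b (k, j)) q k =
    (if k = i then Polynomial.smult \<alpha> (row_vec b q i)
     else if k = Suc i then Polynomial.smult \<beta> (row_vec b q i) + Polynomial.smult \<gamma> (row_vec b q (Suc i)) else row_vec b q k)"
  by (rule poly_eqI) (auto simp: coeff_row_vec)

definition irreducible_set :: "('v \<Rightarrow> complex) set \<Rightarrow> bool" where
  "irreducible_set X \<longleftrightarrow> (\<forall>F H. (\<forall>a\<in>X. poly_eval a F * poly_eval a H = 0) \<longrightarrow>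
     (\<forall>a\<in>X. poly_eval a F = 0) \<or> (\<forall>a\<in>X. poly_eval a H = 0))"

lemma poly_zero_of_infinite: "infinite A \<Longrightarrow> (\<And>t. t \<in> A \<Longrightarrow> poly p t = 0) \<Longrightarrow> p = (0 :: complex poly)"
  by (metis (mono_tags, lifting) finite_subset mem_Collect_eq poly_roots_finite subsetI)

text \<open>Zeros on infinitely many translates \<open>row_move i t\<close> spread to all of them, and by a limit to the
  cone itself.\<close>

lemma zero_spreads:
  assumes i: "i \<in> {1..<n}" and inf: "infinite A"
    and zero: "\<And>t b. t \<in> A \<Longrightarrow> b \<in> schubert_cone n w \<Longrightarrow> poly_eval (row_move i t b) F = 0"
    and b: "b \<in> schubert_cone n w"
  shows "poly_eval (row_move i t b) F = 0" "poly_eval b F = 0"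
proof -
  have all: "poly_eval (row_move i t b) F = 0" if b: "b \<in> schubert_cone n w" for t b
  proof -
    define \<gamma> where "\<gamma> = (\<lambda>(k, j). if k = i then [:b (Suc i, j):] else if k = Suc i then [:b (i, j), b (Suc i, j):] else [:b (k, j):])"
    have ev: "row_move i t b = (\<lambda>x. poly (\<gamma> x) t)" for t by (auto simp: row_move_def \<gamma>_def fun_eq_iff)
    have "hom_eval (\<lambda>c. [:c:]) \<gamma> F = 0"
      by (rule poly_zero_of_infinite[OF inf]) (use zero b in \<open>simp add: poly_eval_curve ev[symmetric]\<close>)
    then show ?thesis unfolding ev poly_eval_curve[symmetric] by simp
  qed
  then show "poly_eval (row_move i t b) F = 0" using b by blast
  \<comment> \<open>A curve through \<open>b\<close> at \<open>\<epsilon> = 0\<close> that adds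
    \<open>\<epsilon>\<close> times row \<open>i + 1\<close> to row \<open>i\<close>. For
    \<open>\<epsilon> \<noteq> 0\<close> it is the move with parameter \<open>1 / \<epsilon>\<close>
    applied to a lower triangular transform of \<open>b\<close>, hence consists of zeros.\<close>
  define \<gamma> where "\<gamma> = (\<lambda>(k, j). if k = i then [:b (i, j), b (Suc i, j):] else [:b (k, j):])"
  have "poly (hom_eval (\<lambda>c. [:c:]) \<gamma> F) \<epsilon> = 0" if \<epsilon>: "\<epsilon> \<noteq> 0" for \<epsilon>
  proof -
    let ?b = "\<lambda>(k, j). if k = i then (- 1 / \<epsilon>) * b (i, j) else if k = Suc i then 1 * b (i, j) + \<epsilon> * b (Suc i, j) else b (k, j)"
    have "?b \<in> schubert_cone n w"
      by (rule schubert_cone_row_op[OF b, of i _ "- 1 / \<epsilon>" 1 \<epsilon>]) (use i in \<open>auto simp: row_vec_shear\<close>)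
    from all[OF this, of "1 / \<epsilon>"] have "poly_eval (row_move i (1 / \<epsilon>) ?b) F = 0" .
    moreover have "row_move i (1 / \<epsilon>) ?b = (\<lambda>x. poly (\<gamma> x) \<epsilon>)"
      using \<epsilon> by (auto simp: row_move_def \<gamma>_def fun_eq_iff field_simps)
    ultimately show ?thesis by (simp add: poly_eval_curve)
  qed
  then have "hom_eval (\<lambda>c. [:c:]) \<gamma> F = 0"
    by (intro poly_zero_of_infinite[of "UNIV - {0}"]) (auto simp: infinite_UNIV_char_0)
  then have "poly_eval (\<lambda>x. poly (\<gamma> x) 0) F = 0" unfolding poly_eval_curve[symmetric] by simp
  moreover have "(\<lambda>x. poly (\<gamma> x) 0) = b" by (auto simp: \<gamma>_def fun_eq_iff)
  ultimately show "poly_eval b F = 0" by simp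
qed

text \<open>For the longest permutation the rank conditions cut out a coordinate subspace, which
  starts the induction for irreducibility.\<close>

lemma schubert_cone_longest:
  "a \<in> schubert_cone n (longest_perm n) \<longleftrightarrow> (\<forall>x\<in>antidiag_upper n. a x = 0)"
proof
  assume a: "a \<in> schubert_cone n (longest_perm n)"
  show "\<forall>x\<in>antidiag_upper n. a x = 0"
  proof
    fix x assume "x \<in> antidiag_upper n"
    then obtain k j where x: "x = (k, j)" "1 \<le> k" "1 \<le> j" "k + j \<le> n" by (cases x) auto
    have "{m \<in> {1..k}. longest_perm n m \<le> j} = {}" using x by (auto simp: longest_perm_def)
    then have "rk (longest_perm n) k j = 0" by (simp add: rk_def)
    then have "rank_le (row_vec a j ` {1..k}) 0" using schubert_coneD[OF a, of k j] x by (simp add: nw_rank_le_def)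
    then have sub: "row_vec a j ` {1..k} \<subseteq> {0}" unfolding rank_le_def by auto
    have "row_vec a j k \<in> row_vec a j ` {1..k}" using x by (intro imageI) simp
    then have "row_vec a j k = 0" using sub by blast
    then have "coeff (row_vec a j k) j = 0" by simp
    then show "a x = 0" using x by (simp add: coeff_row_vec)
  qed
next
  assume z: "\<forall>x\<in>antidiag_upper n. a x = 0"
  show "a \<in> schubert_cone n (longest_perm n)"
    unfolding schubert_cone_def
  proof (intro CollectI allI impI)
    fix p q assume pq: "p \<le> n" "q \<le> n"
    let ?K = "{k \<in> {1..p}. longest_perm n k \<le> q}"
    have "row_vec a q k \<in> cfun.span (row_vec a q ` ?K)" if k: "k \<in> {1..p}" for k
    proof (cases "longest_perm n k \<le> q")
      case True
      then show ?thesis using k by (intro cfun.span_base imageI) simp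
    next
      case False
      then have "k + q \<le> n" using k pq by (auto simp: longest_perm_def split: if_splits)
      then have "row_vec a q k = 0"
        using z k by (intro poly_eqI) (auto simp: coeff_row_vec)
      then show ?thesis by (simp add: cfun.span_zero)
    qed
    moreover have "card (row_vec a q ` ?K) \<le> rk (longest_perm n) p q" unfolding rk_def by (rule card_image_le) simp
    ultimately show "nw_rank_le a p q (rk (longest_perm n) p q)" unfolding nw_rank_le_def rank_le_def
      by (intro exI[of _ "row_vec a q ` ?K"]) auto
  qed
qed

text \<open>A vanishing product is pulled back along each row move to the irreducible cone of
  \<open>w\<close>, so every parameter \<open>t\<close> is assigned to one of the two factors. One
  factor receives infinitely many \<open>t\<close>, and its zeros spread over the whole cone of
  \<open>v\<close>.\<close>

lemma schubert_cone_irreducible: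
  assumes "w permutes {1..n}" shows "irreducible_set (schubert_cone n w)"
  using assms
proof (induction rule: perm_downward_induct)
  case longest
  show ?case unfolding irreducible_set_def
  proof (intro allI impI)
    fix F H assume z: "\<forall>a\<in>schubert_cone n (longest_perm n). poly_eval a F * poly_eval a H = 0"
    let ?\<sigma> = "\<lambda>x. if x \<in> antidiag_upper n then 0 else mvar x :: (nat \<times> nat, complex) mpoly"
    let ?r = "\<lambda>a x. if x \<in> antidiag_upper n then 0 else a x :: complex"
    have ev: "poly_eval a (subst ?\<sigma> f) = poly_eval (?r a) f" for a f
      unfolding poly_eval_subst by (rule arg_cong[of _ _ "\<lambda>a. poly_eval a f"]) auto
    have r: "?r a \<in> schubert_cone n (longest_perm n)" for a unfolding schubert_cone_longest by simp
    have "poly_eval a (subst ?\<sigma> F * subst ?\<sigma> H) = 0" for a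
      using z r[of a] by (simp only: poly_eval.hom_mult ev)
    then have zero: "\<nexists>a. poly_eval a (subst ?\<sigma> F * subst ?\<sigma> H) \<noteq> 0" by simp
    have "subst ?\<sigma> F * subst ?\<sigma> H = 0"
    proof (rule ccontr)
      assume "subst ?\<sigma> F * subst ?\<sigma> H \<noteq> 0"
      from ex_nonzero_eval[OF this] show False by (rule notE[OF zero])
    qed
    then have disj: "subst ?\<sigma> F = 0 \<or> subst ?\<sigma> H = 0" by simp
    have key: "\<forall>a\<in>schubert_cone n (longest_perm n). poly_eval a f = 0" if "subst ?\<sigma> f = 0" for f
    proof
      fix a assume "a \<in> schubert_cone n (longest_perm n)"
      then have e: "?r a = a" unfolding schubert_cone_longest by auto
      have "poly_eval (?r a) f = 0" unfolding ev[symmetric] that by simp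
      then show "poly_eval a f = 0" unfolding e .
    qed
    from disj show "(\<forall>a\<in>schubert_cone n (longest_perm n). poly_eval a F = 0) \<or>
        (\<forall>a\<in>schubert_cone n (longest_perm n). poly_eval a H = 0)"
      by (elim disjE) (rule disjI1, erule key, rule disjI2, erule key)
  qed
next
  case (step v i)
  define w where "w = v \<circ> simple_refl i"
  have "w permutes {1..n}" unfolding w_def by (rule permutes_simple[OF step(1,2)])
  moreover have "ninv n v < ninv n w" using ninv_simple_ascent[OF step(1-3)] unfolding w_def by simp
  ultimately have irr: "irreducible_set (schubert_cone n w)" by (rule step(4))
  note cov = cone_cover[OF step(2,3) w_def] and mov = row_move_cone[OF step(2,3) w_def]
  show ?case unfolding irreducible_set_def
  proof (intro allI impI)
    fix F H assume z: "\<forall>a\<in>schubert_cone n v. poly_eval a F * poly_eval a H = 0"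
    define zset where "zset G = {t. \<forall>b\<in>schubert_cone n w. poly_eval (row_move i t b) G = 0}" for G
    have dich: "t \<in> zset F \<or> t \<in> zset H" for t
    proof -
      let ?\<sigma> = "\<lambda>(k, j). if k = i then mvar (Suc i, j) else if k = Suc i then mvar (i, j) + Poly_Mapping.single 0 t * mvar (Suc i, j)
          else mvar (k, j) :: (nat \<times> nat, complex) mpoly"
      have ev: "poly_eval b (subst ?\<sigma> G) = poly_eval (row_move i t b) G" for b G
        unfolding poly_eval_subst
        by (rule arg_cong[of _ _ "\<lambda>a. poly_eval a G"]) (auto simp: row_move_def fun_eq_iff poly_eval.hom_add poly_eval.hom_mult)
      have "\<forall>b\<in>schubert_cone n w. poly_eval b (subst ?\<sigma> F) * poly_eval b (subst ?\<sigma> H) = 0"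
      proof
        fix b assume "b \<in> schubert_cone n w"
        then show "poly_eval b (subst ?\<sigma> F) * poly_eval b (subst ?\<sigma> H) = 0"
          unfolding ev by (intro z[rule_format] mov)
      qed
      then have "(\<forall>b\<in>schubert_cone n w. poly_eval b (subst ?\<sigma> F) = 0) \<or> (\<forall>b\<in>schubert_cone n w. poly_eval b (subst ?\<sigma> H) = 0)"
        by (rule irr[unfolded irreducible_set_def, THEN spec, THEN spec, THEN mp])
      then show ?thesis unfolding ev zset_def by simp
    qed
    have vanish: "\<forall>a\<in>schubert_cone n v. poly_eval a G = 0" if inf: "infinite (zset G)" for G
    proof
      fix a assume "a \<in> schubert_cone n v"
      then have "a \<in> schubert_cone n w \<or> (\<exists>t. \<exists>b\<in>schubert_cone n w. a = row_move i t b)" by (rule cov)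
      moreover have "poly_eval (row_move i t b) G = 0" "poly_eval b G = 0" if "b \<in> schubert_cone n w" for t b
        by (rule zero_spreads[OF step(2) inf _ that]; simp add: zset_def)+
      ultimately show "poly_eval a G = 0" by (elim disjE exE bexE) simp_all
    qed
    have "zset F \<union> zset H = UNIV" using dich by blast
    then have "infinite (zset F \<union> zset H)" using infinite_UNIV_char_0[where 'a = complex] by simp
    then have "infinite (zset F) \<or> infinite (zset H)" by simp
    then show "(\<forall>a\<in>schubert_cone n v. poly_eval a F = 0) \<or> (\<forall>a\<in>schubert_cone n v. poly_eval a H = 0)"
      by (elim disjE) (rule disjI1, erule vanish, rule disjI2, erule vanish)
  qed
qed

subsection \<open>Spans of vectors depending on parameters\<close>

definition pscale :: "'r \<Rightarrow> ('v, 'r::comm_ring_1) mpoly \<Rightarrow> ('v, 'r) mpoly" where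
  "pscale c f = Poly_Mapping.single 0 c * f"

interpretation pm: Modules.module "pscale :: 'r::comm_ring_1 \<Rightarrow> ('v, 'r) mpoly \<Rightarrow> _"
  by unfold_locales (auto simp: pscale_def ring_distribs single_add mult_single mult.assoc[symmetric])

lemma lookup_pscale [simp]: "Poly_Mapping.lookup (pscale c f) m = c * Poly_Mapping.lookup f m"
  unfolding pscale_def using lookup_single_times[of 0 c f m] by simp

lemma pscale_single: "pscale c (Poly_Mapping.single m d) = Poly_Mapping.single m (c * d)"
  by (simp add: pscale_def mult_single)

lemma lookup_map_zero: "\<phi> 0 = 0 \<Longrightarrow> Poly_Mapping.lookup (Poly_Mapping.map \<phi> f) m = \<phi> (Poly_Mapping.lookup f m)"
  by (simp add: map.rep_eq when_def)

lemma mpoly_keys_sum: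
  "Poly_Mapping.keys f \<subseteq> B \<Longrightarrow> finite B \<Longrightarrow> f = (\<Sum>m\<in>B. Poly_Mapping.single m (Poly_Mapping.lookup f m))"
  by (rule poly_mapping_eqI) (auto simp: lookup_sum lookup_single when_def in_keys_iff)

context
  fixes \<phi> :: "'r::idom \<Rightarrow> 'f::field"
  assumes hom: "comm_ring_hom \<phi>"
begin

interpretation comm_ring_hom \<phi> by (rule hom)

lemma map_hom_add: "Poly_Mapping.map \<phi> (f + g) = Poly_Mapping.map \<phi> f + Poly_Mapping.map \<phi> g"
  by (rule poly_mapping_eqI) (simp add: lookup_map_zero lookup_add hom_add)

lemma map_hom_diff: "Poly_Mapping.map \<phi> (f - g) = Poly_Mapping.map \<phi> f - Poly_Mapping.map \<phi> g"
  by (rule poly_mapping_eqI) (simp add: lookup_map_zero lookup_minus hom_minus)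

lemma map_hom_pscale: "Poly_Mapping.map \<phi> (pscale c f) = pscale (\<phi> c) (Poly_Mapping.map \<phi> f)"
  by (rule poly_mapping_eqI) (simp add: lookup_map_zero hom_mult)

lemma map_hom_sum: "Poly_Mapping.map \<phi> (\<Sum>a\<in>A. f a) = (\<Sum>a\<in>A. Poly_Mapping.map \<phi> (f a))"
  by (rule poly_mapping_eqI) (simp add: lookup_map_zero lookup_sum hom_sum)

text \<open>Elimination without division, with pivots that survive specialisation: what spans at one
  parameter value spans over the parameter ring up to the factor \<open>D\<close>, the product of
  these pivots.\<close>

lemma span_of_specialisation:
  fixes V :: "('v, 'r) mpoly set"
  assumes "finite B" "\<And>f. f \<in> V \<Longrightarrow> Poly_Mapping.keys f \<subseteq> B"
    and "\<And>b. b \<in> B \<Longrightarrow> Poly_Mapping.single b 1 \<in> pm.span (Poly_Mapping.map \<phi> ` V)"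
  shows "\<exists>D. \<phi> D \<noteq> 0 \<and> (\<forall>b\<in>B. Poly_Mapping.single b D \<in> pm.span V)"
  using assms
proof (induction B arbitrary: V rule: finite_induct)
  case empty
  show ?case by (rule exI[of _ 1]) simp
next
  case (insert b B)
  let ?m = "Poly_Mapping.map \<phi> :: ('v, 'r) mpoly \<Rightarrow> _"
  have "\<exists>f\<in>V. Poly_Mapping.lookup (?m f) b \<noteq> 0"
  proof (rule ccontr)
    assume "\<not> ?thesis"
    then have z: "Poly_Mapping.lookup f b = 0" if "f \<in> ?m ` V" for f using that by blast
    have "Poly_Mapping.lookup f b = 0" if "f \<in> pm.span (?m ` V)" for f
      using that by (induction rule: pm.span_induct_alt) (simp_all add: lookup_add z)
    from this[OF insert.prems(2)[OF insertI1]] show False by simp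
  qed
  then obtain f0 where f0: "f0 \<in> V" "Poly_Mapping.lookup (?m f0) b \<noteq> 0" by blast
  define c where "c = Poly_Mapping.lookup f0 b"
  have c: "\<phi> c \<noteq> 0" using f0(2) by (simp add: c_def lookup_map_zero)
  \<comment> \<open>Clears the coordinate \<open>b\<close> by means of the pivot \<open>f0\<close>.
    The specialised images still generate the remaining coordinates, since the same elimination can
    be carried out after specialisation.\<close>
  define g where "g f = pscale c f - pscale (Poly_Mapping.lookup f b) f0" for f
  have keys_g: "Poly_Mapping.keys (g f) \<subseteq> B" if "f \<in> V" for f
  proof
    fix k assume k: "k \<in> Poly_Mapping.keys (g f)"
    then have nz: "c * Poly_Mapping.lookup f k - Poly_Mapping.lookup f b * Poly_Mapping.lookup f0 k \<noteq> 0"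
      by (simp add: in_keys_iff g_def lookup_minus)
    then have "k \<noteq> b" by (auto simp: c_def)
    moreover have "k \<in> insert b B"
    proof (rule ccontr)
      assume "k \<notin> insert b B"
      then have "k \<notin> Poly_Mapping.keys f" "k \<notin> Poly_Mapping.keys f0"
        using insert.prems(1)[OF that] insert.prems(1)[OF f0(1)] by blast+
      then show False using nz by (simp add: in_keys_iff)
    qed
    ultimately show "k \<in> B" by simp
  qed
  have reduce: "pscale (\<phi> c) y - pscale (Poly_Mapping.lookup y b) (?m f0) \<in> pm.span (?m ` g ` V)"
    if "y \<in> pm.span (?m ` V)" for y
    using that
  proof (induction rule: pm.span_induct_alt)
    case base
    show ?case by (simp add: pm.span_zero)
  next
    case (step d x y)
    obtain f where f: "f \<in> V" "x = ?m f" using step(1) by blast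
    have "pscale (\<phi> c) x - pscale (Poly_Mapping.lookup x b) (?m f0) = ?m (g f)"
      by (simp add: g_def map_hom_diff map_hom_pscale f(2) lookup_map_zero)
    also have "\<dots> \<in> pm.span (?m ` g ` V)" using f(1) by (intro pm.span_base imageI)
    finally have "pscale d (pscale (\<phi> c) x - pscale (Poly_Mapping.lookup x b) (?m f0)) \<in> pm.span (?m ` g ` V)"
      by (rule pm.span_scale)
    from pm.span_add[OF this step(2)] show ?case
      by (rule back_subst[where P = "\<lambda>z. z \<in> _"])
        (rule poly_mapping_eqI, simp add: lookup_add lookup_minus algebra_simps)
  qed
  have "Poly_Mapping.single b' 1 \<in> pm.span (?m ` g ` V)" if b': "b' \<in> B" for b'
  proof -
    have "b' \<noteq> b" using b' insert.hyps by blast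
    then have "pscale (\<phi> c) (Poly_Mapping.single b' 1) \<in> pm.span (?m ` g ` V)"
      using reduce[OF insert.prems(2)[OF insertI2[OF b']]] by (simp add: lookup_single when_def)
    then have "pscale (inverse (\<phi> c)) (pscale (\<phi> c) (Poly_Mapping.single b' 1)) \<in> pm.span (?m ` g ` V)"
      by (rule pm.span_scale)
    then show ?thesis using c by (simp add: pscale_single)
  qed
  from insert.IH[OF _ this] keys_g obtain D where D: "\<phi> D \<noteq> 0" "\<And>b. b \<in> B \<Longrightarrow> Poly_Mapping.single b D \<in> pm.span (g ` V)"
    by blast
  have "pm.span (g ` V) \<subseteq> pm.span V"
  proof (rule pm.span_minimal)
    show "g ` V \<subseteq> pm.span V"
    proof (rule image_subsetI)
      fix f assume "f \<in> V"
      then show "g f \<in> pm.span V" unfolding g_def by (intro pm.span_diff pm.span_scale pm.span_base f0(1))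
    qed
  qed (rule pm.subspace_span)
  then have D': "Poly_Mapping.single b' D \<in> pm.span V" if "b' \<in> B" for b' using D(2)[OF that] by blast
  have "Poly_Mapping.single b' (D * c) \<in> pm.span V" if "b' \<in> insert b B" for b'
  proof (cases "b' = b")
    case True
    have rest: "(\<Sum>k\<in>B. pscale (Poly_Mapping.lookup f0 k) (Poly_Mapping.single k D)) \<in> pm.span V"
      by (intro pm.span_sum pm.span_scale D')
    have "Poly_Mapping.single b (D * c) = pscale D f0 - (\<Sum>k\<in>B. pscale (Poly_Mapping.lookup f0 k) (Poly_Mapping.single k D))"
    proof (rule poly_mapping_eqI)
      fix k
      have "Poly_Mapping.lookup (\<Sum>k\<in>B. pscale (Poly_Mapping.lookup f0 k) (Poly_Mapping.single k D)) k =
          (if k \<in> B then Poly_Mapping.lookup f0 k * D else 0)"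
        using insert.hyps(1) by (simp add: lookup_sum lookup_single when_def if_distrib cong: if_cong)
      moreover have "Poly_Mapping.lookup f0 k = 0" if "k \<notin> insert b B"
        using insert.prems(1)[OF f0(1)] that by (auto simp: in_keys_iff)
      ultimately show "Poly_Mapping.lookup (Poly_Mapping.single b (D * c)) k =
          Poly_Mapping.lookup (pscale D f0 - (\<Sum>k\<in>B. pscale (Poly_Mapping.lookup f0 k) (Poly_Mapping.single k D))) k"
        using insert.hyps(2) by (auto simp: lookup_minus lookup_single when_def c_def)
    qed
    then show ?thesis unfolding True using pm.span_diff[OF pm.span_scale[OF pm.span_base[OF f0(1)]] rest] by simp
  next
    case False
    then have "pscale c (Poly_Mapping.single b' D) \<in> pm.span V" using that D' by (intro pm.span_scale) blast
    then show ?thesis by (simp add: pscale_single mult.commute)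
  qed
  moreover have "\<phi> (D * c) \<noteq> 0" using D(1) c by (simp add: hom_mult)
  ultimately show ?case by blast
qed

end

subsection \<open>Monomials modulo the degenerate relations\<close>

definition row_deg :: "nat \<Rightarrow> (nat \<times> nat \<Rightarrow>\<^sub>0 nat) \<Rightarrow> nat \<Rightarrow> nat" where
  "row_deg n m i = (\<Sum>j\<in>{1..n}. Poly_Mapping.lookup m (i, j))"

text \<open>Only row degrees are prescribed: minors are homogeneous in rows and columns alike, but
  the linear forms replacing the coordinates in \<open>T\<close> mix the columns of a row.\<close>

definition monomials :: "nat \<Rightarrow> (nat \<Rightarrow> nat) \<Rightarrow> (nat \<times> nat \<Rightarrow>\<^sub>0 nat) set" where
  "monomials n M = {m. Poly_Mapping.keys m \<subseteq> grid n \<and> (\<forall>i\<in>{1..n}. row_deg n m i = M i)}"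

definition row_set :: "(nat \<times> nat) set \<Rightarrow> nat \<Rightarrow> nat set" where
  "row_set U i = {j. (i, j) \<in> U}"

lemma finite_monomials: "finite (monomials n M)"
proof -
  let ?K = "\<Sum>i\<in>{1..n}. M i"
  have "(\<lambda>m. restrict (Poly_Mapping.lookup m) (grid n)) ` monomials n M \<subseteq> grid n \<rightarrow>\<^sub>E {..?K}"
  proof (rule image_subsetI)
    fix m assume m: "m \<in> monomials n M"
    have "Poly_Mapping.lookup m x \<le> ?K" if xg: "x \<in> grid n" for x
    proof -
      obtain i j where x: "x = (i, j)" "i \<in> {1..n}" "j \<in> {1..n}" using xg by (cases x) auto
      have "Poly_Mapping.lookup m (i, j) \<le> row_deg n m i"
        unfolding row_deg_def by (rule member_le_sum[OF x(3)]) simp_all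
      also have "\<dots> = M i" using m x(2) by (simp add: monomials_def)
      also have "\<dots> \<le> ?K" by (rule member_le_sum[OF x(2)]) simp_all
      finally show ?thesis using x by simp
    qed
    then show "restrict (Poly_Mapping.lookup m) (grid n) \<in> grid n \<rightarrow>\<^sub>E {..?K}" by auto
  qed
  then have "finite ((\<lambda>m. restrict (Poly_Mapping.lookup m) (grid n)) ` monomials n M)"
    by (rule finite_subset) (intro finite_PiE; simp)
  moreover have "inj_on (\<lambda>m. restrict (Poly_Mapping.lookup m) (grid n)) (monomials n M)"
  proof (rule inj_onI)
    fix m m' assume mm: "m \<in> monomials n M" "m' \<in> monomials n M"
      and e: "restrict (Poly_Mapping.lookup m) (grid n) = restrict (Poly_Mapping.lookup m') (grid n)"
    show "m = m'"
    proof (rule poly_mapping_eqI)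
      fix x show "Poly_Mapping.lookup m x = Poly_Mapping.lookup m' x"
      proof (cases "x \<in> grid n")
        case True
        then show ?thesis using fun_cong[OF e, of x] by simp
      next
        case False
        then have "x \<notin> Poly_Mapping.keys m" "x \<notin> Poly_Mapping.keys m'" using mm by (auto simp: monomials_def)
        then show ?thesis by (simp add: in_keys_iff)
      qed
    qed
  qed
  ultimately show ?thesis by (rule finite_imageD)
qed

lemma row_deg_add: "row_deg n (m + m') i = row_deg n m i + row_deg n m' i"
  by (simp add: row_deg_def lookup_add sum.distrib)

lemma row_deg_zero [simp]: "row_deg n 0 i = 0"
  by (simp add: row_deg_def)

lemma row_deg_single: "j \<in> {1..n} \<Longrightarrow> row_deg n (Poly_Mapping.single (i', j) k) i = (if i = i' then k else 0)"
  by (auto simp: row_deg_def lookup_single when_def)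

lemma row_deg_sum: "row_deg n (\<Sum>a\<in>A. f a) i = (\<Sum>a\<in>A. row_deg n (f a) i)"
  by (induction A rule: infinite_finite_induct) (auto simp: row_deg_add row_deg_zero)

lemma keys_add_nat: "Poly_Mapping.keys (m + m') = Poly_Mapping.keys m \<union> Poly_Mapping.keys m'"
  for m m' :: "'v \<Rightarrow>\<^sub>0 nat"
  by (auto simp: in_keys_iff lookup_add)

text \<open>In each row the excess degree is gathered on the first cell of the support.\<close>

definition canonical :: "(nat \<times> nat \<Rightarrow>\<^sub>0 nat) \<Rightarrow> bool" where
  "canonical m \<longleftrightarrow> (\<forall>(i, j)\<in>Poly_Mapping.keys m.
     (\<exists>j'. (i, j') \<in> Poly_Mapping.keys m \<and> j' < j) \<longrightarrow> Poly_Mapping.lookup m (i, j) = 1)"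

definition can_facets :: "nat \<Rightarrow> (nat \<times> nat) set set \<Rightarrow> (nat \<Rightarrow> nat) \<Rightarrow> (nat \<Rightarrow> nat) \<Rightarrow> (nat \<times> nat \<Rightarrow>\<^sub>0 nat) set" where
  "can_facets n \<Delta> t M = {m \<in> monomials n M. canonical m \<and> Poly_Mapping.keys m \<in> \<Delta> \<and>
     (\<forall>i\<in>{1..n}. card (row_set (Poly_Mapping.keys m) i) = t i)}"

lemma row_deg_row_set:
  assumes "Poly_Mapping.keys m \<subseteq> grid n"
  shows "row_deg n m i = (\<Sum>j\<in>row_set (Poly_Mapping.keys m) i. Poly_Mapping.lookup m (i, j))"
  unfolding row_deg_def
  by (rule sum.mono_neutral_right) (use assms in \<open>auto simp: row_set_def in_keys_iff subset_iff\<close>)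

lemma finite_row_set: "U \<subseteq> grid n \<Longrightarrow> finite (row_set U i)"
  by (rule finite_subset[of _ "{1..n}"]) (auto simp: row_set_def)

lemma card_row_set_le: "U \<subseteq> grid n \<Longrightarrow> card (row_set U i) \<le> n"
  using card_mono[of "{1..n}" "row_set U i"] by (auto simp: row_set_def)

lemma card_rows: "U \<subseteq> grid n \<Longrightarrow> card U = (\<Sum>i\<in>{1..n}. card (row_set U i))"
proof -
  assume U: "U \<subseteq> grid n"
  have "U = (SIGMA i:{1..n}. row_set U i)" using U by (auto simp: row_set_def)
  then have "card U = card (SIGMA i:{1..n}. row_set U i)" by simp
  also have "\<dots> = (\<Sum>i\<in>{1..n}. card (row_set U i))"
    using finite_row_set[OF U] by (intro card_SigmaI) simp_all
  finally show ?thesis .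
qed

text \<open>A canonical monomial is determined by its support: all exponents off the first cells are
  one, and the row degree fixes the exponent on the first cell.\<close>

lemma card_can_facets:
  assumes "\<Delta> \<subseteq> Pow (grid n)"
  shows "card (can_facets n \<Delta> t M) \<le> card {U \<in> \<Delta>. \<forall>i\<in>{1..n}. card (row_set U i) = t i}"
proof (rule card_inj_on_le[of Poly_Mapping.keys])
  show "finite {U \<in> \<Delta>. \<forall>i\<in>{1..n}. card (row_set U i) = t i}"
    by (rule finite_subset[of _ "Pow (grid n)"]) (use assms in auto)
  show "Poly_Mapping.keys ` can_facets n \<Delta> t M \<subseteq> {U \<in> \<Delta>. \<forall>i\<in>{1..n}. card (row_set U i) = t i}"
    by (auto simp: can_facets_def)
  show "inj_on Poly_Mapping.keys (can_facets n \<Delta> t M)"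
  proof (rule inj_onI)
    fix m m' assume m: "m \<in> can_facets n \<Delta> t M" and m': "m' \<in> can_facets n \<Delta> t M"
      and e: "Poly_Mapping.keys m = Poly_Mapping.keys m'"
    have eq1: "Poly_Mapping.lookup m (i, j) = Poly_Mapping.lookup m' (i, j)"
      if "(i, j) \<in> Poly_Mapping.keys m" "\<exists>j'. (i, j') \<in> Poly_Mapping.keys m \<and> j' < j" for i j
    proof -
      have "Poly_Mapping.lookup m (i, j) = 1" using m that by (auto simp: can_facets_def canonical_def)
      moreover have "Poly_Mapping.lookup m' (i, j) = 1" using m' that unfolding e by (auto simp: can_facets_def canonical_def)
      ultimately show ?thesis by simp
    qed
    show "m = m'"
    proof (rule poly_mapping_eqI)
      fix x :: "nat \<times> nat" obtain i j where x: "x = (i, j)" by (cases x)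
      show "Poly_Mapping.lookup m x = Poly_Mapping.lookup m' x"
      proof (cases "(i, j) \<in> Poly_Mapping.keys m")
        case False
        then have "(i, j) \<notin> Poly_Mapping.keys m'" using e by simp
        then show ?thesis using False unfolding x by (simp add: in_keys_iff)
      next
        case True
        show ?thesis
        proof (cases "\<exists>j'. (i, j') \<in> Poly_Mapping.keys m \<and> j' < j")
          case False
          let ?S = "row_set (Poly_Mapping.keys m) i"
          have g: "Poly_Mapping.keys m \<subseteq> grid n" "Poly_Mapping.keys m' \<subseteq> grid n"
            using m m' by (auto simp: can_facets_def monomials_def)
          have i: "i \<in> {1..n}" using True g by auto
          have fin: "finite ?S" by (rule finite_row_set[OF g(1)])
          have jS: "j \<in> ?S" using True by (simp add: row_set_def)
          have rest: "(\<Sum>j\<in>?S - {j}. Poly_Mapping.lookup m (i, j)) = (\<Sum>j\<in>?S - {j}. Poly_Mapping.lookup m' (i, j))"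
          proof (rule sum.cong[OF refl])
            fix l assume "l \<in> ?S - {j}"
            then have l: "(i, l) \<in> Poly_Mapping.keys m" "l \<noteq> j" by (auto simp: row_set_def)
            then have "j < l" using False by (meson linorder_neqE_nat)
            then show "Poly_Mapping.lookup m (i, l) = Poly_Mapping.lookup m' (i, l)" using eq1[OF l(1)] True by blast
          qed
          have "row_deg n m i = row_deg n m' i" using m m' i by (simp add: can_facets_def monomials_def)
          then have "(\<Sum>j\<in>?S. Poly_Mapping.lookup m (i, j)) = (\<Sum>j\<in>?S. Poly_Mapping.lookup m' (i, j))"
            unfolding row_deg_row_set[OF g(1)] row_deg_row_set[OF g(2)] e .
          then show ?thesis unfolding x using rest
            by (simp add: sum.remove[OF fin jS])
        next
          case ex: True
          then show ?thesis using eq1[OF True ex] x by simp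
        qed
      qed
    qed
  qed
qed

context
  fixes n :: nat and M t :: "nat \<Rightarrow> nat" and \<Delta> :: "(nat \<times> nat) set set" and W :: "(nat \<times> nat, complex) mpoly set"
  assumes W: "pm.subspace W"
    and size: "\<And>U. U \<in> \<Delta> \<Longrightarrow> card U \<le> (\<Sum>i\<in>{1..n}. t i)"
    and M1: "\<And>i. i \<in> {1..n} \<Longrightarrow> 1 \<le> M i" and Mbig: "\<And>i. i \<in> {1..n} \<Longrightarrow> 1 \<le> t i \<Longrightarrow> n < M i"
    and nonface: "\<And>m. m \<in> monomials n M \<Longrightarrow> Poly_Mapping.keys m \<notin> \<Delta> \<Longrightarrow> Poly_Mapping.single m 1 \<in> W"
    and forms: "\<And>i k \<mu>. i \<in> {1..n} \<Longrightarrow> Suc k < t i \<Longrightarrow>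
      (\<And>j. j \<in> {1..n} \<Longrightarrow> \<mu> + Poly_Mapping.single (i, j) 1 \<in> monomials n M) \<Longrightarrow>
      (\<Sum>j\<in>{1..n}. Poly_Mapping.single (\<mu> + Poly_Mapping.single (i, j) 1) (of_nat j ^ k)) \<in> W"
    and facets: "\<And>m. m \<in> can_facets n \<Delta> t M \<Longrightarrow> Poly_Mapping.single m 1 \<in> W"
begin

text \<open>Power forms combine to forms whose coefficients are the values of any polynomial of
  degree at most \<open>t i - 2\<close>, so that coefficients can be made to vanish at chosen
  columns.\<close>

lemma forms_poly:
  assumes "i \<in> {1..n}" "Suc (degree p) < t i"
    and "\<And>j. j \<in> {1..n} \<Longrightarrow> \<mu> + Poly_Mapping.single (i, j) 1 \<in> monomials n M"
  shows "(\<Sum>j\<in>{1..n}. Poly_Mapping.single (\<mu> + Poly_Mapping.single (i, j) 1) (poly p (of_nat j))) \<in> W"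
proof -
  have "(\<Sum>j\<in>{1..n}. Poly_Mapping.single (\<mu> + Poly_Mapping.single (i, j) 1) (poly p (of_nat j))) =
    (\<Sum>k\<le>degree p. pscale (coeff p k) (\<Sum>j\<in>{1..n}. Poly_Mapping.single (\<mu> + Poly_Mapping.single (i, j) 1) (of_nat j ^ k)))"
    (is "?l = ?r")
  proof (rule poly_mapping_eqI)
    fix e
    show "Poly_Mapping.lookup ?l e = Poly_Mapping.lookup ?r e"
      unfolding poly_altdef lookup_sum lookup_pscale lookup_single sum_distrib_left
      by (subst sum.swap) (auto simp: when_def intro!: sum.cong)
  qed
  also have "\<dots> \<in> W"
    by (intro pm.subspace_sum[OF W] pm.subspace_scale[OF W] forms) (use assms in auto)
  finally show ?thesis .
qed

text \<open>From an exponent of at least two one factor can be removed without shrinking the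
  support, leaving room for a variable of the same row.\<close>

lemma shift_monomial:
  assumes m: "m \<in> monomials n M" and ij: "(i, j) \<in> Poly_Mapping.keys m" and two: "2 \<le> Poly_Mapping.lookup m (i, j)"
  obtains \<mu> where "m = \<mu> + Poly_Mapping.single (i, j) 1" "Poly_Mapping.keys \<mu> = Poly_Mapping.keys m"
    "\<And>l. l \<in> {1..n} \<Longrightarrow> \<mu> + Poly_Mapping.single (i, l) 1 \<in> monomials n M"
proof -
  note out = that
  define \<mu> where "\<mu> = m - Poly_Mapping.single (i, j) 1"
  have m\<mu>: "m = \<mu> + Poly_Mapping.single (i, j) 1"
    by (rule poly_mapping_eqI) (use two in \<open>auto simp: \<mu>_def lookup_add lookup_minus lookup_single when_def\<close>)
  have keys: "Poly_Mapping.keys \<mu> = Poly_Mapping.keys m"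
    using two ij by (auto simp: in_keys_iff \<mu>_def lookup_minus lookup_single when_def split: if_splits)
  have j: "j \<in> {1..n}" using m ij by (auto simp: monomials_def)
  have g: "i \<in> {1..n}" using m ij by (auto simp: monomials_def)
  have "\<mu> + Poly_Mapping.single (i, l) 1 \<in> monomials n M" if l: "l \<in> {1..n}" for l
  proof -
    have "row_deg n (\<mu> + Poly_Mapping.single (i, l) 1) i' = row_deg n m i'" for i'
      by (subst m\<mu>) (simp add: row_deg_add row_deg_single[OF l] row_deg_single[OF j])
    moreover have "Poly_Mapping.keys (\<mu> + Poly_Mapping.single (i, l) 1) \<subseteq> grid n"
      unfolding keys_add_nat keys using m l g by (auto simp: monomials_def)
    ultimately show ?thesis using m by (simp add: monomials_def)
  qed
  with m\<mu> keys show thesis by (rule out)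
qed

text \<open>The value at \<open>p\<close> of the relation attached to a polynomial vanishing at the other columns of
  the support either kills a monomial, or moves an exponent to the first column of its row.\<close>

lemma monomial_in_W: "m \<in> monomials n M \<Longrightarrow> Poly_Mapping.single m 1 \<in> W"
proof (induction "n * n - card (Poly_Mapping.keys m)" arbitrary: m rule: less_induct)
  case outer: less
  define U where "U = Poly_Mapping.keys m"
  have Ug: "U \<subseteq> grid n" using outer.prems by (simp add: U_def monomials_def)
  have finU: "finite U" by (simp add: U_def)
  \<comment> \<open>The outer induction goes from large supports to small ones, so a monomial whose
    support gains a cell is already in \<open>W\<close>.\<close>
  have larger: "Poly_Mapping.single (\<mu> + Poly_Mapping.single (i, l) 1) c \<in> W"
    if "\<mu> + Poly_Mapping.single (i, l) 1 \<in> monomials n M" "Poly_Mapping.keys \<mu> = U" "(i, l) \<notin> U" for \<mu> i l c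
  proof -
    have keys: "Poly_Mapping.keys (\<mu> + Poly_Mapping.single (i, l) 1) = insert (i, l) U"
      using that(2) by (simp add: keys_add_nat)
    have "card (insert (i, l) U) \<le> card (grid n)"
      using that(1) unfolding keys[symmetric] by (intro card_mono) (auto simp: monomials_def)
    then have "n * n - card (insert (i, l) U) < n * n - card U" using that(3) finU by simp
    then have "Poly_Mapping.single (\<mu> + Poly_Mapping.single (i, l) 1) 1 \<in> W"
      using outer.hyps[OF _ that(1)] unfolding keys U_def[symmetric] by simp
    from pm.subspace_scale[OF W this, of c] show ?thesis by (simp add: pscale_single)
  qed
  let ?u = "\<lambda>i. card (row_set U i)"
  have row_fin: "finite (row_set U i)" for i by (rule finite_row_set[OF Ug])
  \<comment> \<open>Consequently a form times a monomial with support \<open>U\<close> may be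
    truncated to the columns of \<open>U\<close> in its row.\<close>
  have relation: "(\<Sum>l\<in>row_set U i. Poly_Mapping.single (\<mu> + Poly_Mapping.single (i, l) 1) (poly p (of_nat l))) \<in> W"
    if "i \<in> {1..n}" "Suc (degree p) < t i" "Poly_Mapping.keys \<mu> = U"
      "\<And>j. j \<in> {1..n} \<Longrightarrow> \<mu> + Poly_Mapping.single (i, j) 1 \<in> monomials n M" for i p \<mu>
  proof -
    let ?g = "\<lambda>l. Poly_Mapping.single (\<mu> + Poly_Mapping.single (i, l) 1) (poly p (of_nat l))"
    have sub: "row_set U i \<subseteq> {1..n}" using Ug by (auto simp: row_set_def)
    have "(\<Sum>l\<in>{1..n}. ?g l) = (\<Sum>l\<in>{1..n} - row_set U i. ?g l) + (\<Sum>l\<in>row_set U i. ?g l)"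
      by (rule sum.subset_diff[OF sub]) simp
    then have "(\<Sum>l\<in>row_set U i. ?g l) = (\<Sum>l\<in>{1..n}. ?g l) - (\<Sum>l\<in>{1..n} - row_set U i. ?g l)" by simp
    moreover have "(\<Sum>l\<in>{1..n} - row_set U i. ?g l) \<in> W"
      by (intro pm.subspace_sum[OF W] larger) (use that in \<open>auto simp: row_set_def\<close>)
    ultimately show ?thesis using pm.subspace_diff[OF W forms_poly[OF that(1,2,4)]] by simp
  qed
  have vanish: "poly (\<Prod>l\<in>A. [:- of_nat l, 1:]) (of_nat x :: complex) = 0 \<longleftrightarrow> x \<in> A" if "finite A" for A :: "nat set" and x
    using that by (simp add: poly_prod prod_zero_iff)
  have deg: "degree (\<Prod>l\<in>A. [:- of_nat l, 1 :: complex:]) = card A" for A :: "nat set"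
    by (subst degree_prod_eq_sum_degree) (auto simp: )
  have unscale: "Poly_Mapping.single e 1 \<in> W" if "Poly_Mapping.single e c \<in> W" "c \<noteq> 0" for e c
    using pm.subspace_scale[OF W that(1), of "1 / c"] that(2) by (simp add: pscale_single)
  consider "U \<notin> \<Delta>" | i where "U \<in> \<Delta>" "i \<in> {1..n}" "?u i < t i" | "U \<in> \<Delta>" "\<And>i. i \<in> {1..n} \<Longrightarrow> t i \<le> ?u i"
    by (meson not_le)
  then show ?case
  proof cases
    case 1
    then show ?thesis using nonface[OF outer.prems] by (simp add: U_def)
  next
    case 2
    \<comment> \<open>The degree of this row exceeds \<open>n\<close>, hence its number of cells, so
      some exponent is at least two.\<close>
    have "n < M i" using 2 by (intro Mbig) auto
    moreover have "row_deg n m i = M i" using outer.prems 2 by (simp add: monomials_def)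
    ultimately have big: "?u i < row_deg n m i" using card_row_set_le[OF Ug, of i] by simp
    have "\<exists>j\<in>row_set U i. 2 \<le> Poly_Mapping.lookup m (i, j)"
    proof (rule ccontr)
      assume "\<not> ?thesis"
      then have "(\<Sum>j\<in>row_set U i. Poly_Mapping.lookup m (i, j)) \<le> (\<Sum>j\<in>row_set U i. 1)"
        by (intro sum_mono) (auto simp: not_le)
      then show False using big row_deg_row_set[of m n i] Ug by (simp add: U_def)
    qed
    then obtain j where j: "(i, j) \<in> U" "2 \<le> Poly_Mapping.lookup m (i, j)" by (auto simp: row_set_def)
    obtain \<mu> where \<mu>: "m = \<mu> + Poly_Mapping.single (i, j) 1" "Poly_Mapping.keys \<mu> = U"
        "\<And>l. l \<in> {1..n} \<Longrightarrow> \<mu> + Poly_Mapping.single (i, l) 1 \<in> monomials n M"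
      using shift_monomial[OF outer.prems _ j(2)] j(1) unfolding U_def by blast
    have jr: "j \<in> row_set U i" using j by (simp add: row_set_def)
    \<comment> \<open>It vanishes at the other columns of the support. Its degree is one less than
      the number of cells, which is admissible because the row has fewer than \<open>t i\<close>
      cells.\<close>
    define p where "p = (\<Prod>l\<in>row_set U i - {j}. [:- of_nat l, 1 :: complex:])"
    have "Suc (degree p) < t i" unfolding p_def deg using 2(3) card_Suc_Diff1[OF row_fin jr] by simp
    from relation[OF 2(2) this \<mu>(2,3)]
    have "(\<Sum>l\<in>row_set U i. Poly_Mapping.single (\<mu> + Poly_Mapping.single (i, l) 1) (poly p (of_nat l))) \<in> W" .
    also have "(\<Sum>l\<in>row_set U i. Poly_Mapping.single (\<mu> + Poly_Mapping.single (i, l) 1) (poly p (of_nat l))) =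
        Poly_Mapping.single m (poly p (of_nat j))"
      unfolding sum.remove[OF row_fin jr] \<mu>(1)[symmetric]
    proof -
      have "poly p (of_nat l) = 0" if "l \<in> row_set U i - {j}" for l
        using that by (simp add: p_def vanish row_fin)
      then show "Poly_Mapping.single m (poly p (of_nat j)) +
          (\<Sum>l\<in>row_set U i - {j}. Poly_Mapping.single (\<mu> + Poly_Mapping.single (i, l) 1) (poly p (of_nat l))) =
          Poly_Mapping.single m (poly p (of_nat j))" by simp
    qed
    finally show ?thesis by (rule unscale) (simp add: p_def vanish row_fin)
  next
    case 3
    \<comment> \<open>No row has fewer than \<open>t i\<close> cells, and a face has at most as many
      cells as all \<open>t i\<close> together, so equality holds in every row.\<close>
    have sumle: "(\<Sum>i\<in>{1..n}. ?u i) \<le> (\<Sum>i\<in>{1..n}. t i)" using size[OF 3(1)] card_rows[OF Ug] by simp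
    have ut: "?u i = t i" if "i \<in> {1..n}" for i
      using sum_mono_inv[of t "{1..n}" ?u i] 3(2) sumle sum_mono[of "{1..n}" t ?u] that by auto
    define nonmin where "nonmin = {(i, j) \<in> U. \<exists>j'. (i, j') \<in> U \<and> j' < j}"
    have "Poly_Mapping.single m' 1 \<in> W" if "m' \<in> monomials n M" "Poly_Mapping.keys m' = U" for m'
      using that
    proof (induction "\<Sum>x\<in>nonmin. Poly_Mapping.lookup m' x" arbitrary: m' rule: less_induct)
      case inner: less
      show ?case
      proof (cases "canonical m'")
        case True
        then have "m' \<in> can_facets n \<Delta> t M" using inner.prems 3(1) ut by (simp add: can_facets_def)
        then show ?thesis by (rule facets)
      next
        case False
        then obtain i j j' where ij: "(i, j) \<in> U" "(i, j') \<in> U" "j' < j" "Poly_Mapping.lookup m' (i, j) \<noteq> 1"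
          unfolding canonical_def inner.prems(2) by auto
        moreover have "Poly_Mapping.lookup m' (i, j) \<noteq> 0" using ij(1) inner.prems(2) by (auto simp: in_keys_iff)
        ultimately have two: "2 \<le> Poly_Mapping.lookup m' (i, j)" by simp
        obtain \<mu> where \<mu>: "m' = \<mu> + Poly_Mapping.single (i, j) 1" "Poly_Mapping.keys \<mu> = U"
            "\<And>l. l \<in> {1..n} \<Longrightarrow> \<mu> + Poly_Mapping.single (i, l) 1 \<in> monomials n M"
          using shift_monomial[OF inner.prems(1) _ two] ij(1) inner.prems(2) by blast
        define j0 where "j0 = (LEAST l. (i, l) \<in> U)"
        have j0: "(i, j0) \<in> U" unfolding j0_def by (rule LeastI[of _ j]) (rule ij(1))
        have j0_le: "j0 \<le> l" if "(i, l) \<in> U" for l unfolding j0_def by (rule Least_le) (rule that)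
        have ne: "j0 \<noteq> j" using j0_le[OF ij(2)] ij(3) by simp
        have i: "i \<in> {1..n}" using ij(1) Ug by auto
        have mem: "j \<in> row_set U i" "j0 \<in> row_set U i - {j}" using ij(1) j0 ne by (auto simp: row_set_def)
        \<comment> \<open>With exactly \<open>t i\<close> cells the degree available is one short of
          isolating a column: the current column and the first one remain, and the relation trades
          an exponent for one on the first column. The inner induction is on the total exponent off
          the first columns.\<close>
        define p where "p = (\<Prod>l\<in>row_set U i - {j} - {j0}. [:- of_nat l, 1 :: complex:])"
        have "card (row_set U i) = Suc (Suc (card (row_set U i - {j} - {j0})))"
          using card_Suc_Diff1[OF row_fin mem(1)] card_Suc_Diff1[OF _ mem(2)] row_fin by simp
        then have "Suc (degree p) < t i" unfolding p_def deg using ut[OF i] by simp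
        from relation[OF i this \<mu>(2,3)]
        have "(\<Sum>l\<in>row_set U i. Poly_Mapping.single (\<mu> + Poly_Mapping.single (i, l) 1) (poly p (of_nat l))) \<in> W" .
        also have "(\<Sum>l\<in>row_set U i. Poly_Mapping.single (\<mu> + Poly_Mapping.single (i, l) 1) (poly p (of_nat l))) =
            Poly_Mapping.single m' (poly p (of_nat j)) +
            Poly_Mapping.single (\<mu> + Poly_Mapping.single (i, j0) 1) (poly p (of_nat j0))"
        proof -
          have fin': "finite (row_set U i - {j})" using row_fin by simp
          have "(\<Sum>l\<in>row_set U i - {j} - {j0}. Poly_Mapping.single (\<mu> + Poly_Mapping.single (i, l) 1) (poly p (of_nat l))) = 0"
          proof (intro sum.neutral ballI)
            fix l assume "l \<in> row_set U i - {j} - {j0}"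
            then have "poly p (of_nat l) = 0" by (simp add: p_def vanish row_fin)
            then show "Poly_Mapping.single (\<mu> + Poly_Mapping.single (i, l) 1) (poly p (of_nat l)) = 0" by simp
          qed
          then show ?thesis
            unfolding sum.remove[OF row_fin mem(1)] sum.remove[OF fin' mem(2)] \<mu>(1)[symmetric] by simp
        qed
        finally have rel: "Poly_Mapping.single m' (poly p (of_nat j)) +
            Poly_Mapping.single (\<mu> + Poly_Mapping.single (i, j0) 1) (poly p (of_nat j0)) \<in> W" .
        let ?m = "\<mu> + Poly_Mapping.single (i, j0) 1"
        have nm: "(i, j) \<in> nonmin" "(i, j0) \<notin> nonmin"
          using ij j0 j0_le by (auto simp: nonmin_def not_less)
        have fin: "finite nonmin" by (rule finite_subset[OF _ finU]) (auto simp: nonmin_def)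
        have "(\<Sum>x\<in>nonmin. Poly_Mapping.lookup ?m x) < (\<Sum>x\<in>nonmin. Poly_Mapping.lookup m' x)"
        proof (rule sum_strict_mono_ex1[OF fin])
          show "\<forall>x\<in>nonmin. Poly_Mapping.lookup ?m x \<le> Poly_Mapping.lookup m' x"
            using nm(2) unfolding \<mu>(1) by (auto simp: lookup_add lookup_single when_def)
          show "\<exists>x\<in>nonmin. Poly_Mapping.lookup ?m x < Poly_Mapping.lookup m' x"
            using nm(1) ne unfolding \<mu>(1) by (intro bexI[of _ "(i, j)"]) (auto simp: lookup_add lookup_single when_def)
        qed
        moreover have "?m \<in> monomials n M" using \<mu>(3) j0 Ug by auto
        moreover have "Poly_Mapping.keys ?m = U" using \<mu>(2) j0 by (auto simp: keys_add_nat)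
        ultimately have "Poly_Mapping.single ?m 1 \<in> W" by (rule inner.hyps)
        from pm.subspace_scale[OF W this, of "poly p (of_nat j0)"]
        have "Poly_Mapping.single ?m (poly p (of_nat j0)) \<in> W" by (simp add: pscale_single)
        from pm.subspace_diff[OF W rel this] have "Poly_Mapping.single m' (poly p (of_nat j)) \<in> W" by simp
        then show ?thesis by (rule unscale) (simp add: p_def vanish row_fin)
      qed
    qed
    then show ?thesis using outer.prems by (simp add: U_def)
  qed
qed

end

subsection \<open>Minors and their antidiagonal terms\<close>

lemma perm_mono_id:
  assumes "p permutes {..<k::nat}" "\<And>a b. a < b \<Longrightarrow> b < k \<Longrightarrow> p a < p b"
  shows "p = id"
proof -
  have ge: "a \<le> p a" if "a < k" for a
    using that
  proof (induction a)
    case (Suc a)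
    then have "a \<le> p a" "p a < p (Suc a)" using assms(2)[of a "Suc a"] by auto
    then show ?case by simp
  qed simp
  have "p a = a" if "a < k" for a
  proof -
    have "(\<Sum>a<k. p a) = (\<Sum>a<k. a)" using sum.permute[OF assms(1), of "\<lambda>a. a"] by (simp add: comp_def)
    then show ?thesis using sum_mono_inv[of "\<lambda>a. a" "{..<k}" p a] ge that by auto
  qed
  then show ?thesis using assms(1) by (auto simp: fun_eq_iff permutes_def)
qed

text \<open>Since \<open>R\<close> increases and \<open>C\<close> decreases, undoing an inversion of
  a permutation lowers the sum, so the identity is the only minimiser. With weight
  \<open>i * j\<close> on the cell \<open>(i, j)\<close>, this makes the antidiagonal term of a
  minor its unique lightest term.\<close>

lemma rearrangement_strict:
  fixes R C :: "nat \<Rightarrow> nat"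
  assumes R: "\<And>a b. a < b \<Longrightarrow> b < k \<Longrightarrow> R a < R b" and C: "\<And>a b. a < b \<Longrightarrow> b < k \<Longrightarrow> C b < C a"
    and p: "p permutes {..<k}" "p \<noteq> id"
  shows "(\<Sum>a<k. R a * C a) < (\<Sum>a<k. R a * C (p a))"
proof -
  let ?f = "\<lambda>p. \<Sum>a<k. R a * C (p a)"
  let ?P = "{p. p permutes {..<k}}"
  have fin: "finite ?P" "?P \<noteq> {}" using p(1) by (auto simp: finite_permutations)
  have min_id: "q = id" if q: "q \<in> ?P" "\<And>r. r \<in> ?P \<Longrightarrow> ?f q \<le> ?f r" for q
  proof (rule perm_mono_id)
    show "q permutes {..<k}" using q by simp
    fix a b assume ab: "a < b" "b < k"
    show "q a < q b"
    proof (rule ccontr)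
      assume "\<not> q a < q b"
      moreover have "q a \<noteq> q b" using q(1) ab by (auto dest: permutes_inj injD)
      ultimately have lt: "q b < q a" by simp
      have "q a < k" using q(1) ab permutes_in_image[of q "{..<k}" a] by auto
      then have Clt: "C (q a) < C (q b)" using C[OF lt] by simp
      define r where "r = q \<circ> Transposition.transpose a b"
      have "r permutes {..<k}" unfolding r_def
        by (rule permutes_compose[OF permutes_swap_id]) (use ab q(1) in auto)
      then have le: "?f q \<le> ?f r" using q(2) by simp
      have split: "sum g {..<k} = g a + g b + sum g ({..<k} - {a, b})" for g :: "nat \<Rightarrow> nat"
      proof -
        have "{..<k} = insert a (insert b ({..<k} - {a, b}))" using ab by auto
        then have "sum g {..<k} = sum g (insert a (insert b ({..<k} - {a, b})))" by simp
        also have "\<dots> = g a + g b + sum g ({..<k} - {a, b})" using ab by simp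
        finally show ?thesis .
      qed
      have rest: "(\<Sum>x\<in>{..<k} - {a, b}. R x * C (r x)) = (\<Sum>x\<in>{..<k} - {a, b}. R x * C (q x))"
        by (rule sum.cong) (auto simp: r_def Transposition.transpose_def)
      have "R a * C (q a) + R b * C (q b) \<le> R a * C (r a) + R b * C (r b)"
        using le unfolding split[of "\<lambda>x. R x * C (q x)"] split[of "\<lambda>x. R x * C (r x)"] rest by simp
      then have h: "R a * C (q a) + R b * C (q b) \<le> R a * C (q b) + R b * C (q a)" by (simp add: r_def)
      have "R a < R b" using R ab by simp
      moreover define d where "d = R b - R a"
      ultimately have d: "R b = R a + d" "d > 0" by simp_all
      then have "d * C (q b) \<le> d * C (q a)" using h by (simp add: algebra_simps)
      then show False using d(2) Clt by simp
    qed
  qed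
  obtain q where q: "q \<in> ?P" "\<And>r. r \<in> ?P \<Longrightarrow> ?f q \<le> ?f r"
  proof -
    have "Min (?f ` ?P) \<in> ?f ` ?P" using fin by (intro Min_in) simp_all
    then obtain q where q: "q \<in> ?P" "Min (?f ` ?P) = ?f q" by blast
    have "?f q \<le> ?f r" if "r \<in> ?P" for r
      unfolding q(2)[symmetric] using fin(1) that by (intro Min_le) simp_all
    with q(1) show thesis by (rule that)
  qed
  have qid: "q = id" by (rule min_id[OF q])
  have "?f id \<le> ?f p" using q(2)[of p] p(1) qid by simp
  moreover have "?f id \<noteq> ?f p"
  proof
    assume e: "?f id = ?f p"
    have "p = id"
    proof (rule min_id)
      show "p \<in> ?P" using p(1) by simp
      fix r assume "r \<in> ?P"
      then show "?f p \<le> ?f r" using q(2)[of r] qid e by simp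
    qed
    then show False using p(2) by blast
  qed
  ultimately show ?thesis by simp
qed

definition minor_sum :: "nat \<Rightarrow> (nat \<Rightarrow> nat) \<Rightarrow> (nat \<Rightarrow> nat) \<Rightarrow> (nat \<times> nat \<Rightarrow> complex) \<Rightarrow> complex" where
  "minor_sum k R C a = (\<Sum>p\<in>{p. p permutes {..<k}}. of_int (sign p) * (\<Prod>l<k. a (R l, C (p l))))"

text \<open>A factorisation through dimension \<open>r\<close> leaves a relation among
  \<open>k > r\<close> rows, which is a kernel vector of the transposed submatrix.\<close>

lemma minor_sum_eq_0:
  assumes le: "nw_rank_le a p q r" and k: "r < k"
    and R: "\<And>l. l < k \<Longrightarrow> R l \<in> {1..p}" and C: "\<And>l. l < k \<Longrightarrow> C l \<in> {1..q}"
  shows "minor_sum k R C a = 0"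
proof -
  obtain b c where "\<forall>i\<in>{1..p}. \<forall>j\<in>{1..q}. a (i, j) = (\<Sum>l<r. b i l * (c l j :: complex))"
    using le unfolding nw_rank_le_iff_factor by (elim exE)
  then have bc: "a (i, j) = (\<Sum>l<r. b i l * c l j)" if "i \<in> {1..p}" "j \<in> {1..q}" for i j using that by blast
  have "\<exists>g. (\<exists>i\<in>{..<k}. g i \<noteq> 0) \<and> (\<forall>j\<in>{..<r}. (\<Sum>i\<in>{..<k}. g i * b (R i) j) = 0)"
    by (rule ex_row_kernel) (use k in simp_all)
  then obtain g i0 where g: "i0 < k" "g i0 \<noteq> 0" "\<And>l. l < r \<Longrightarrow> (\<Sum>i<k. g i * b (R i) l) = 0"
    by (meson lessThan_iff)
  define A where "A = mat k k (\<lambda>(i, j). a (R i, C j))"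
  have A: "A \<in> carrier_mat k k" by (simp add: A_def)
  have "det (transpose_mat A) = 0"
  proof -
    have At: "transpose_mat A \<in> carrier_mat k k" using A by simp
    have "transpose_mat A *\<^sub>v vec k g = 0\<^sub>v k"
    proof (rule eq_vecI)
      fix j assume "j < dim_vec (0\<^sub>v k :: complex vec)"
      then have j: "j < k" by simp
      have "(transpose_mat A *\<^sub>v vec k g) $ j = (\<Sum>i<k. a (R i, C j) * g i)"
        using j A by (simp add: A_def scalar_prod_def atLeast0LessThan)
      also have "\<dots> = (\<Sum>i<k. (\<Sum>l<r. b (R i) l * c l (C j)) * g i)"
        using bc R C j by (intro sum.cong) auto
      also have "\<dots> = (\<Sum>l<r. c l (C j) * (\<Sum>i<k. g i * b (R i) l))"
        unfolding sum_distrib_left sum_distrib_right by (subst sum.swap) (simp add: ac_simps)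
      also have "\<dots> = 0" using g(3) by simp
      finally show "(transpose_mat A *\<^sub>v vec k g) $ j = 0\<^sub>v k $ j" using j by simp
    qed (use A in simp)
    moreover have "vec k g \<noteq> 0\<^sub>v k"
    proof
      assume "vec k g = 0\<^sub>v k"
      then have "vec k g $ i0 = 0\<^sub>v k $ i0" by simp
      then show False using g(1,2) by simp
    qed
    ultimately show ?thesis using det_0_iff_vec_prod_zero_field[OF At] by (metis vec_carrier)
  qed
  then have "det A = 0" using det_transpose[OF A] by simp
  moreover have "det A = minor_sum k R C a"
  proof -
    have "det A = (\<Sum>p\<in>{p. p permutes {0..<k}}. signof p * (\<Prod>i = 0..<k. A $$ (i, p i)))"
      by (rule det_def'[OF A])
    also have "\<dots> = minor_sum k R C a"
      unfolding minor_sum_def atLeast0LessThan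
    proof (rule sum.cong[OF refl])
      fix s assume "s \<in> {s. s permutes {..<k}}"
      then have "s l < k" if "l < k" for l using that permutes_in_image[of s "{..<k}" l] by auto
      then have "(\<Prod>i<k. A $$ (i, s i)) = (\<Prod>l<k. a (R l, C (s l)))" by (intro prod.cong) (auto simp: A_def)
      then show "signof s * (\<Prod>i<k. A $$ (i, s i)) = of_int (sign s) * (\<Prod>l<k. a (R l, C (s l)))" by simp
    qed
    finally show ?thesis .
  qed
  ultimately show ?thesis by simp
qed

lemma achain_enum:
  assumes "achain X" "finite X"
  obtains R C where "\<And>a b. a < b \<Longrightarrow> b < card X \<Longrightarrow> R a < R b" "\<And>a b. a < b \<Longrightarrow> b < card X \<Longrightarrow> C b < C a"
    "X = (\<lambda>a. (R a, C a)) ` {..<card X}"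
proof -
  note out = that
  have inj: "inj_on fst X" using assms(1) by (fastforce simp: inj_on_def achain_def)
  define xs where "xs = sorted_list_of_set (fst ` X)"
  have xs: "set xs = fst ` X" "length xs = card X" "sorted_wrt (<) xs"
    using assms(2) inj by (simp_all add: xs_def card_image)
  define g where "g = the_inv_into X fst"
  have g: "g i \<in> X \<and> fst (g i) = i" if "i \<in> fst ` X" for i
    using that inj by (simp add: g_def the_inv_into_into f_the_inv_into_f)
  let ?R = "\<lambda>a. xs ! a" and ?C = "\<lambda>a. snd (g (xs ! a))"
  have mem: "(?R a, ?C a) \<in> X" if "a < card X" for a
  proof -
    have "xs ! a \<in> set xs" using that xs(2) by simp
    then have "xs ! a \<in> fst ` X" unfolding xs(1) .
    from g[OF this] have "g (xs ! a) \<in> X" "g (xs ! a) = (xs ! a, snd (g (xs ! a)))" by (simp_all add: prod_eq_iff)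
    then show ?thesis by simp
  qed
  have R: "?R a < ?R b" if "a < b" "b < card X" for a b
    using xs(3) that xs(2) by (simp add: sorted_wrt_iff_nth_less)
  have C: "?C b < ?C a" if ab: "a < b" "b < card X" for a b
  proof -
    have X: "(?R a, ?C a) \<in> X" "(?R b, ?C b) \<in> X" using mem ab by simp_all
    have "(?R a, ?C a) \<noteq> (?R b, ?C b)" using R[OF ab] by simp
    from assms(1)[unfolded achain_def, rule_format, OF X this] show ?thesis using R[OF ab] by simp
  qed
  have "X = (\<lambda>a. (?R a, ?C a)) ` {..<card X}"
  proof
    show "(\<lambda>a. (?R a, ?C a)) ` {..<card X} \<subseteq> X" using mem by auto
    show "X \<subseteq> (\<lambda>a. (?R a, ?C a)) ` {..<card X}"
    proof
      fix x assume x: "x \<in> X"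
      then have "fst x \<in> set xs" unfolding xs(1) by (rule imageI)
      then obtain a where a: "a < card X" "xs ! a = fst x" unfolding in_set_conv_nth xs(2) by (elim exE conjE)
      have "(?R a, ?C a) = x" by (rule inj_onD[OF inj _ mem[OF a(1)] x]) (simp add: a(2))
      then show "x \<in> (\<lambda>a. (?R a, ?C a)) ` {..<card X}" using a(1) by (intro image_eqI[of _ _ a]) simp_all
    qed
  qed
  with R C show thesis by (rule out)
qed

subsection \<open>The weighted family of relations\<close>

definition weight :: "(nat \<times> nat \<Rightarrow>\<^sub>0 nat) \<Rightarrow> nat" where
  "weight m = (\<Sum>x\<in>Poly_Mapping.keys m. fst x * snd x * Poly_Mapping.lookup m x)"

lemma mon_weight: "mon (\<lambda>x. s ^ (fst x * snd x) * f x) m = s ^ weight m * mon f m"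
  by (simp add: mon_def weight_def power_sum prod.distrib power_mult_distrib power_mult[symmetric])

text \<open>The weight variable is the outer indeterminate, \<open>rho\<close> the inner one, and
  the coefficients are polynomials in the values of the coordinates. The nesting reflects the order
  of specialisation: the weight is fixed generically before \<open>rho\<close> tends to
  zero.\<close>

type_synonym params = "((nat \<times> nat, complex) mpoly) poly poly"

definition par :: "nat \<times> nat \<Rightarrow> params" where
  "par v = [:[:mvar v:]:]"

definition rho :: params where
  "rho = [:[:0, 1:]:]"

definition scal :: "complex \<Rightarrow> params" where
  "scal c = [:[:Poly_Mapping.single 0 c:]:]"

definition weightvar :: params where
  "weightvar = [:0, 1:]"

definition param_eval :: "complex \<Rightarrow> complex \<Rightarrow> (nat \<times> nat \<Rightarrow> complex) \<Rightarrow> params \<Rightarrow> complex" where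
  "param_eval s r \<theta> c = poly_eval \<theta> (poly (poly c [:Poly_Mapping.single 0 s:]) (Poly_Mapping.single 0 r))"

lemma param_eval_hom: "comm_ring_hom (param_eval s r \<theta>)"
  by unfold_locales (auto simp: param_eval_def poly_eval.hom_add poly_eval.hom_mult)

interpretation param_eval: comm_ring_hom "param_eval s r \<theta>" for s r \<theta>
  by (rule param_eval_hom)

lemma param_eval_simps [simp]:
  "param_eval s r \<theta> (par v) = \<theta> v" "param_eval s r \<theta> rho = r"
  "param_eval s r \<theta> (scal c) = c" "param_eval s r \<theta> weightvar = s"
  by (simp_all add: param_eval_def par_def rho_def scal_def weightvar_def)

lemma param_eval_power [simp]: "param_eval s r \<theta> (c ^ k) = param_eval s r \<theta> c ^ k"
  by (rule param_eval.hom_power)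

lemma par_neq_0: "par v \<noteq> 0"
proof
  assume "par v = 0"
  then have "param_eval 0 0 (\<lambda>_. 1) (par v) = param_eval 0 0 (\<lambda>_. 1) 0" by (rule arg_cong)
  then show False by (simp add: param_eval.hom_zero)
qed

definition vec_eval :: "complex \<Rightarrow> complex \<Rightarrow> (nat \<times> nat \<Rightarrow> complex) \<Rightarrow> (nat \<times> nat \<Rightarrow> complex) \<Rightarrow>
    (nat \<times> nat, params) mpoly \<Rightarrow> complex" where
  "vec_eval s r \<theta> x = hom_eval (param_eval s r \<theta>) x"

lemma vec_eval_add: "vec_eval s r \<theta> x (f + g) = vec_eval s r \<theta> x f + vec_eval s r \<theta> x g"
  unfolding vec_eval_def by (rule hom_eval_add[OF param_eval_hom])

lemma vec_eval_single: "vec_eval s r \<theta> x (Poly_Mapping.single m c) = param_eval s r \<theta> c * mon x m"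
  unfolding vec_eval_def by (rule hom_eval_single[OF param_eval_hom])

lemma vec_eval_sum: "vec_eval s r \<theta> x (\<Sum>a\<in>A. f a) = (\<Sum>a\<in>A. vec_eval s r \<theta> x (f a))"
  unfolding vec_eval_def by (rule hom_eval_sum[OF param_eval_hom])

lemma vec_eval_pscale: "vec_eval s r \<theta> x (pscale c f) = param_eval s r \<theta> c * vec_eval s r \<theta> x f"
  unfolding vec_eval_def pscale_def hom_eval_mult[OF param_eval_hom] hom_eval_single[OF param_eval_hom] by simp

lemma vec_eval_0: "vec_eval s r \<theta> x 0 = 0"
  unfolding vec_eval_def by (rule hom_eval_0[OF param_eval_hom])

definition minor_exp :: "nat \<Rightarrow> (nat \<Rightarrow> nat) \<Rightarrow> (nat \<Rightarrow> nat) \<Rightarrow> (nat \<Rightarrow> nat) \<Rightarrow> nat \<times> nat \<Rightarrow>\<^sub>0 nat" where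
  "minor_exp k R C p = (\<Sum>l<k. Poly_Mapping.single (R l, C (p l)) 1)"

text \<open>A minor of the matrix with entries \<open>s ^ (i * j) * x (i, j)\<close>, divided by the
  lowest power of \<open>s\<close> and multiplied by a monomial. The difference of exponents is
  never truncated for chains, by the rearrangement inequality, and at \<open>s = 0\<close> only the
  antidiagonal term remains.\<close>

definition minor_vec :: "nat \<Rightarrow> (nat \<Rightarrow> nat) \<Rightarrow> (nat \<Rightarrow> nat) \<Rightarrow> (nat \<times> nat \<Rightarrow>\<^sub>0 nat) \<Rightarrow> (nat \<times> nat, params) mpoly" where
  "minor_vec k R C \<mu> = (\<Sum>p\<in>{p. p permutes {..<k}}. Poly_Mapping.single (\<mu> + minor_exp k R C p)
     (of_int (sign p) * weightvar ^ ((\<Sum>l<k. R l * C (p l)) - (\<Sum>l<k. R l * C l))))"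

text \<open>The cross-multiplied statement that the deformed coordinate number \<open>k + 1\<close>
  and the first coordinate of row \<open>i\<close> are in the ratio of their parameters. At
  \<open>rho = 0\<close> the deformed coordinate is the original one; at \<open>rho = 1\<close> it
  is the form with coefficients \<open>j ^ k\<close>.\<close>

definition row_form :: "nat \<Rightarrow> (nat \<Rightarrow> nat) \<Rightarrow> nat \<Rightarrow> nat \<Rightarrow> (nat \<times> nat \<Rightarrow>\<^sub>0 nat) \<Rightarrow> (nat \<times> nat, params) mpoly" where
  "row_form n b i k \<mu> =
     Poly_Mapping.single (\<mu> + Poly_Mapping.single (i, b (Suc k)) 1) (par (i, b 0) * (1 - rho)) +
     (\<Sum>j\<in>{1..n}. Poly_Mapping.single (\<mu> + Poly_Mapping.single (i, j) 1) (par (i, b 0) * rho * of_nat j ^ k)) -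
     Poly_Mapping.single (\<mu> + Poly_Mapping.single (i, b 0) 1) (par (i, b (Suc k)))"

lemma rearrangement_le:
  assumes "\<And>a b. a < b \<Longrightarrow> b < k \<Longrightarrow> R a < R b" "\<And>a b. a < b \<Longrightarrow> b < k \<Longrightarrow> C b < (C a :: nat)"
    and "p permutes {..<k}"
  shows "(\<Sum>l<k. R l * C l) \<le> (\<Sum>l<k. R l * C (p l :: nat))"
  using rearrangement_strict[of k R C p] assms by (cases "p = id") (auto intro: less_imp_le)

lemma mon_minor_exp: "mon x (minor_exp k R C p) = (\<Prod>l<k. x (R l, C (p l)))"
  by (simp add: minor_exp_def mon_sum)

lemma vec_eval_minor:
  assumes R: "\<And>a b. a < b \<Longrightarrow> b < k \<Longrightarrow> R a < R b" and C: "\<And>a b. a < b \<Longrightarrow> b < k \<Longrightarrow> C b < C a"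
    and s: "s \<noteq> 0" and zero: "minor_sum k R C (\<lambda>x. s ^ (fst x * snd x) * f x) = 0"
  shows "vec_eval s r \<theta> f (minor_vec k R C \<mu>) = 0"
proof -
  let ?w = "\<lambda>p. \<Sum>l<k. R l * C (p l)" and ?base = "\<Sum>l<k. R l * C l"
  have "s ^ ?base * vec_eval s r \<theta> f (minor_vec k R C \<mu>) =
      (\<Sum>p\<in>{p. p permutes {..<k}}. mon f \<mu> * (of_int (sign p) * (\<Prod>l<k. s ^ (R l * C (p l)) * f (R l, C (p l)))))"
    unfolding minor_vec_def vec_eval_sum sum_distrib_left
  proof (rule sum.cong[OF refl])
    fix p assume "p \<in> {p. p permutes {..<k}}"
    then have "?base \<le> ?w p" using rearrangement_le[of k R C p] R C by blast
    then have "s ^ ?w p = s ^ ?base * s ^ (?w p - ?base)" by (simp flip: power_add)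
    then show "s ^ ?base * vec_eval s r \<theta> f (Poly_Mapping.single (\<mu> + minor_exp k R C p)
        (of_int (sign p) * weightvar ^ (?w p - ?base))) =
        mon f \<mu> * (of_int (sign p) * (\<Prod>l<k. s ^ (R l * C (p l)) * f (R l, C (p l))))"
      by (simp add: vec_eval_single param_eval.hom_mult mon_add mon_minor_exp prod.distrib power_sum[symmetric] ac_simps)
  qed
  also have "\<dots> = mon f \<mu> * minor_sum k R C (\<lambda>x. s ^ (fst x * snd x) * f x)"
    by (simp add: minor_sum_def sum_distrib_left)
  finally have "s ^ ?base * vec_eval s r \<theta> f (minor_vec k R C \<mu>) = 0" unfolding zero by simp
  then show ?thesis using s by simp
qed

lemma vec_eval_row_form:
  assumes "\<theta> (i, b 0) = f (i, b 0)"
    "\<theta> (i, b (Suc k)) = (1 - r) * f (i, b (Suc k)) + r * (\<Sum>j\<in>{1..n}. of_nat j ^ k * f (i, j))"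
  shows "vec_eval s r \<theta> f (row_form n b i k \<mu>) = 0"
proof -
  have diff: "vec_eval s r \<theta> f (g - h) = vec_eval s r \<theta> f g - vec_eval s r \<theta> f h" for g h
    using vec_eval_add[of s r \<theta> f "g - h" h] by simp
  show ?thesis
    unfolding row_form_def diff vec_eval_add vec_eval_sum vec_eval_single
    by (simp add: param_eval.hom_mult param_eval.hom_minus param_eval.hom_of_nat mon_add assms
        sum_distrib_left sum_distrib_right algebra_simps sum_subtractf)
qed

lemma map_minor_vec:
  assumes R: "\<And>a b. a < b \<Longrightarrow> b < k \<Longrightarrow> R a < R b" and C: "\<And>a b. a < b \<Longrightarrow> b < k \<Longrightarrow> C b < C a"
  shows "Poly_Mapping.map (param_eval 0 r \<theta>) (minor_vec k R C \<mu>) = Poly_Mapping.single (\<mu> + minor_exp k R C id) 1"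
proof -
  have "Poly_Mapping.map (param_eval 0 r \<theta>) (minor_vec k R C \<mu>) =
      (\<Sum>p\<in>{p. p permutes {..<k}}. if p = id then Poly_Mapping.single (\<mu> + minor_exp k R C id) 1 else 0)"
    unfolding minor_vec_def map_hom_sum[OF param_eval_hom]
  proof (rule sum.cong[OF refl])
    fix p assume p: "p \<in> {p. p permutes {..<k}}"
    show "Poly_Mapping.map (param_eval 0 r \<theta>) (Poly_Mapping.single (\<mu> + minor_exp k R C p)
        (of_int (sign p) * weightvar ^ ((\<Sum>l<k. R l * C (p l)) - (\<Sum>l<k. R l * C l)))) =
        (if p = id then Poly_Mapping.single (\<mu> + minor_exp k R C id) 1 else 0)"
    proof (cases "p = id")
      case False
      then have "0 < (\<Sum>l<k. R l * C (p l)) - (\<Sum>l<k. R l * C l)"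
        using rearrangement_strict[of k R C p] R C p by simp
      then show ?thesis using False by (simp add: param_eval.hom_mult power_0_left)
    qed (simp add: sign_id)
  qed
  also have "\<dots> = Poly_Mapping.single (\<mu> + minor_exp k R C id) 1"
    by (subst sum.delta) (simp_all add: finite_permutations permutes_id)
  finally show ?thesis .
qed

lemma map_row_form:
  assumes "\<theta> (i, b 0) = 1" "\<theta> (i, b (Suc k)) = 0"
  shows "Poly_Mapping.map (param_eval s 1 \<theta>) (row_form n b i k \<mu>) =
    (\<Sum>j\<in>{1..n}. Poly_Mapping.single (\<mu> + Poly_Mapping.single (i, j) 1) (of_nat j ^ k))"
  unfolding row_form_def map_hom_diff[OF param_eval_hom] map_hom_add[OF param_eval_hom] map_hom_sum[OF param_eval_hom]
  by (simp add: param_eval.hom_mult param_eval.hom_minus param_eval.hom_of_nat assms)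

subsection \<open>Algebraic relations over a coordinate projection\<close>

lemma polys_on_const: "Poly_Mapping.single 0 c \<in> polys_on I"
  by (auto simp: polys_on_def)

lemma polys_on_mvar: "v \<in> I \<Longrightarrow> mvar v \<in> polys_on I"
  by (simp add: polys_on_def mvar_def)

lemma polys_on_add: "f \<in> polys_on I \<Longrightarrow> g \<in> polys_on I \<Longrightarrow> f + g \<in> polys_on I"
  using keys_add[of f g] by (auto simp: polys_on_def)

lemma polys_on_mult: "f \<in> polys_on I \<Longrightarrow> g \<in> polys_on I \<Longrightarrow> f * g \<in> polys_on I"
  using keys_mult[of f g] by (fastforce simp: polys_on_def keys_add_nat)

lemma polys_on_uminus: "f \<in> polys_on I \<Longrightarrow> - f \<in> polys_on I"
  by (simp add: polys_on_def in_keys_iff)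

lemma polys_on_0: "0 \<in> polys_on I"
  by (simp add: polys_on_def)

lemma polys_on_1: "1 \<in> polys_on I"
  using polys_on_const[of 1 I] by simp

lemma polys_on_mono: "I \<subseteq> J \<Longrightarrow> polys_on I \<subseteq> polys_on J"
  by (auto simp: polys_on_def)

lemma polys_on_subst: "(\<And>v. \<sigma> v \<in> polys_on I) \<Longrightarrow> subst \<sigma> f \<in> polys_on I"
proof (induction f rule: mpoly_induct)
  case (const c)
  then show ?case by (simp add: subst_def hom_eval_const[OF comm_ring_hom_const] polys_on_const)
next
  case (var v)
  then show ?case by (simp add: subst_def hom_eval_mvar[OF comm_ring_hom_const])
qed (auto simp: subst.hom_add subst.hom_mult intro: polys_on_add polys_on_mult)

lemma poly_eval_polys_on: "f \<in> polys_on I \<Longrightarrow> (\<And>v. v \<in> I \<Longrightarrow> a v = b v) \<Longrightarrow> poly_eval a f = poly_eval b f"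
  by (rule poly_eval_cong) (auto simp: polys_on_def)

text \<open>Taking out the common power of the variable keeps a limiting relation nontrivial. The
  recursion stops because the degree of one nonzero member drops each time.\<close>

lemma divide_common_power:
  fixes d :: "'k \<Rightarrow> 'a::comm_ring_1 poly"
  assumes "d k0 \<noteq> 0"
  shows "\<exists>r e. (\<forall>k. d k = [:0, 1:] ^ r * e k) \<and> (\<exists>k. coeff (e k) 0 \<noteq> 0)"
  using assms
proof (induction "degree (d k0)" arbitrary: d rule: less_induct)
  case less
  show ?case
  proof (cases "\<exists>k. coeff (d k) 0 \<noteq> 0")
    case True
    then show ?thesis by (intro exI[of _ 0] exI[of _ d]) simp
  next
    case False
    define e where "e = (\<lambda>k. poly_shift 1 (d k))"
    have e: "d k = pCons 0 (e k)" for k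
      by (rule poly_eqI) (use False in \<open>auto simp: e_def coeff_poly_shift coeff_pCons split: nat.split\<close>)
    have nz: "e k0 \<noteq> 0" using less.prems e[of k0] by auto
    then have "degree (e k0) < degree (d k0)" unfolding e[of k0] by (simp add: degree_pCons_eq)
    from less.hyps[of e, OF this nz] show ?thesis
    proof (elim exE conjE)
      fix r e' k assume r: "\<forall>k. e k = [:0, 1:] ^ r * e' k" "coeff (e' k) 0 \<noteq> 0"
      have "d k = [:0, 1:] ^ Suc r * e' k" for k
        unfolding e r(1)[rule_format] by (simp add: mult.assoc)
      then show ?thesis using r(2) by (intro exI[of _ "Suc r"] exI[of _ e']) auto
    qed
  qed
qed

text \<open>The variable of \<open>e\<close> and the point at which its coefficients are evaluated
  move together with \<open>r\<close>; the outcome is still polynomial in \<open>r\<close>, which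
  permits passing to \<open>r = 0\<close>.\<close>

lemma poly_along_curve:
  fixes \<gamma> :: "'v \<Rightarrow> complex poly" and e :: "('v, complex) mpoly poly"
  shows "\<exists>Q. \<forall>r. poly Q r = poly_eval (\<lambda>v. poly (\<gamma> v) r) (poly e (Poly_Mapping.single 0 r))"
proof (induction e)
  case 0
  show ?case by (rule exI[of _ 0]) simp
next
  case (pCons c e)
  then obtain Q where Q: "\<And>r. poly Q r = poly_eval (\<lambda>v. poly (\<gamma> v) r) (poly e (Poly_Mapping.single 0 r))" by blast
  show ?case
    by (rule exI[of _ "hom_eval (\<lambda>c. [:c:]) \<gamma> c + [:0, 1:] * Q"])
      (simp add: Q poly_eval_curve poly_eval.hom_add poly_eval.hom_mult)
qed

lemma row_enum:
  assumes "T \<subseteq> grid n"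
  shows "\<exists>b. \<forall>i. bij_betw (b i) {..<card (row_set T i)} (row_set T i)"
proof (rule choice, rule allI)
  show "\<exists>f. bij_betw f {..<card (row_set T i)} (row_set T i)" for i
    using ex_bij_betw_nat_finite[OF finite_row_set[OF assms, of i]] by (simp add: atLeast0LessThan)
qed

lemma keys_sum_sub: "(\<And>a. a \<in> A \<Longrightarrow> Poly_Mapping.keys (f a) \<subseteq> B) \<Longrightarrow> Poly_Mapping.keys (\<Sum>a\<in>A. f a) \<subseteq> B"
proof (induction A rule: infinite_finite_induct)
  case (insert x F)
  then show ?case using keys_add[of "f x" "sum f F"] by auto
qed auto

section \<open>Spanning by facet monomials over the parameter ring\<close>

context
  fixes n :: nat and w :: "nat \<Rightarrow> nat" and T :: "(nat \<times> nat) set" and b :: "nat \<Rightarrow> nat \<Rightarrow> nat" and M :: "nat \<Rightarrow> nat"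
  assumes T: "T \<subseteq> grid n"
    and b: "\<And>i. bij_betw (b i) {..<card (row_set T i)} (row_set T i)"
    and size: "\<And>U. U \<in> ad_complex n w \<Longrightarrow> card U \<le> card T"
    and M1: "\<And>i. i \<in> {1..n} \<Longrightarrow> 1 \<le> M i" and Mbig: "\<And>i. i \<in> {1..n} \<Longrightarrow> row_set T i \<noteq> {} \<Longrightarrow> n < M i"
begin

abbreviation (input) "tn i \<equiv> card (row_set T i)"

lemma tn_pos: "row_set T i \<noteq> {} \<longleftrightarrow> 1 \<le> tn i"
  using finite_row_set[OF T, of i] by (simp add: card_gt_0_iff Suc_le_eq)

lemma b_mem: "k < tn i \<Longrightarrow> (i, b i k) \<in> T"
  using b[of i] by (auto simp: bij_betw_def row_set_def)

text \<open>All terms are required to have the prescribed row degrees, which places these vectors in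
  the finite free module on \<open>monomials n M\<close>.\<close>

definition minor_vecs :: "(nat \<times> nat, params) mpoly set" where
  "minor_vecs = {minor_vec k R C \<mu> | k R C \<mu> p q. p \<le> n \<and> q \<le> n \<and> rk w p q < k \<and>
     (\<forall>a b. a < b \<longrightarrow> b < k \<longrightarrow> R a < R b \<and> C b < C a) \<and>
     (\<forall>l<k. R l \<in> {1..p} \<and> C l \<in> {1..q}) \<and> (\<forall>\<pi>. \<pi> permutes {..<k} \<longrightarrow> \<mu> + minor_exp k R C \<pi> \<in> monomials n M)}"

definition form_vecs :: "(nat \<times> nat, params) mpoly set" where
  "form_vecs = {row_form n (b i) i k \<mu> | i k \<mu>. i \<in> {1..n} \<and> Suc k < tn i \<and>
     (\<forall>j\<in>{1..n}. \<mu> + Poly_Mapping.single (i, j) 1 \<in> monomials n M)}"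

definition facet_vecs :: "(nat \<times> nat, params) mpoly set" where
  "facet_vecs = (\<lambda>m. Poly_Mapping.single m 1) ` can_facets n (ad_complex n w) tn M"

lemma keys_vecs: "f \<in> minor_vecs \<union> form_vecs \<union> facet_vecs \<Longrightarrow> Poly_Mapping.keys f \<subseteq> monomials n M"
proof (elim UnE)
  assume "f \<in> minor_vecs"
  then obtain k R C \<mu> where f: "f = minor_vec k R C \<mu>"
    and mem: "\<And>\<pi>. \<pi> permutes {..<k} \<Longrightarrow> \<mu> + minor_exp k R C \<pi> \<in> monomials n M"
    unfolding minor_vecs_def mem_Collect_eq by (elim exE conjE) simp
  have "Poly_Mapping.keys (Poly_Mapping.single e c) \<subseteq> monomials n M" if "e \<in> monomials n M" for e and c :: params
    using that by simp
  then show ?thesis unfolding f minor_vec_def by (intro keys_sum_sub) (simp add: mem)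
next
  assume "f \<in> form_vecs"
  then obtain i k \<mu> where f: "f = row_form n (b i) i k \<mu>" "i \<in> {1..n}" "Suc k < tn i"
    "\<And>j. j \<in> {1..n} \<Longrightarrow> \<mu> + Poly_Mapping.single (i, j) 1 \<in> monomials n M" unfolding form_vecs_def mem_Collect_eq by (elim exE conjE) simp
  have "b i 0 \<in> {1..n}" "b i (Suc k) \<in> {1..n}" using b_mem[of 0 i] b_mem[of "Suc k" i] f(3) T by auto
  note mem = f(4)[OF this(1)] f(4)[OF this(2)]
  have single: "Poly_Mapping.keys (Poly_Mapping.single e c) \<subseteq> monomials n M" if "e \<in> monomials n M" for e and c :: params
    using that by simp
  have diff: "Poly_Mapping.keys (g - h) \<subseteq> Poly_Mapping.keys g \<union> Poly_Mapping.keys h" for g h :: "(nat \<times> nat, params) mpoly"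
    by (auto simp: in_keys_iff lookup_minus)
  have add: "Poly_Mapping.keys (f1 + f2 - f3) \<subseteq> monomials n M"
    if "Poly_Mapping.keys f1 \<subseteq> monomials n M" "Poly_Mapping.keys f2 \<subseteq> monomials n M" "Poly_Mapping.keys f3 \<subseteq> monomials n M"
    for f1 f2 f3 :: "(nat \<times> nat, params) mpoly"
    by (rule subset_trans[OF diff Un_least[OF subset_trans[OF keys_add Un_least]]]) (rule that)+
  have "Poly_Mapping.keys (\<Sum>j\<in>{1..n}. Poly_Mapping.single (\<mu> + Poly_Mapping.single (i, j) 1) (par (i, b i 0) * rho * of_nat j ^ k)) \<subseteq> monomials n M"
    by (rule keys_sum_sub) (rule single, rule f(4))
  then show ?thesis unfolding f(1) row_form_def by (intro add single mem)
next
  assume "f \<in> facet_vecs"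
  then show ?thesis by (auto simp: facet_vecs_def can_facets_def)
qed

lemma minor_exp_id_image: "inj_on (\<lambda>l. (R l, C l)) {..<k} \<Longrightarrow>
    minor_exp k R C id = (\<Sum>x\<in>(\<lambda>l. (R l, C l)) ` {..<k}. Poly_Mapping.single x 1)"
  unfolding minor_exp_def by (subst sum.reindex) (auto simp: comp_def)

text \<open>Permuting columns does not affect the rows involved, so all terms of a minor have equal
  row degrees.\<close>

lemma row_deg_minor_exp:
  assumes "\<And>l. l < k \<Longrightarrow> C l \<in> {1..n}" "\<pi> permutes {..<k}"
  shows "row_deg n (minor_exp k R C \<pi>) i = card {l \<in> {..<k}. R l = i}"
proof -
  have "\<pi> l < k" if "l < k" for l using permutes_in_image[OF assms(2), of l] that by simp
  then have "C (\<pi> l) \<in> {1..n}" if "l < k" for l using that by (intro assms(1))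
  then have "row_deg n (minor_exp k R C \<pi>) i = (\<Sum>l<k. if i = R l then 1 else 0)"
    unfolding minor_exp_def row_deg_sum by (intro sum.cong[OF refl] row_deg_single) simp
  also have "\<dots> = (\<Sum>l<k. if R l = i then 1 else 0)" by (rule sum.cong) auto
  also have "\<dots> = card {l \<in> {..<k}. R l = i}"
    unfolding card_eq_sum by (rule sum.inter_filter[symmetric]) simp
  finally show ?thesis .
qed

text \<open>At weight zero, \<open>rho = 1\<close>, and parameters one at the first coordinate of
  each row and zero elsewhere, minors become antidiagonal monomials and row relations become power
  forms. There \<open>monomial_in_W\<close> applies, and \<open>span_of_specialisation\<close>
  returns to the parameter ring.\<close>

lemma params_span:
  "\<exists>D. D \<noteq> 0 \<and> (\<forall>m\<in>monomials n M. Poly_Mapping.single m D \<in> pm.span (minor_vecs \<union> form_vecs \<union> facet_vecs))"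
proof -
  let ?V = "minor_vecs \<union> form_vecs \<union> facet_vecs"
  define \<theta> where "\<theta> = (\<lambda>(i, j). if j = b i 0 then 1 else 0 :: complex)"
  let ?\<phi> = "param_eval 0 1 \<theta>"
  let ?W = "pm.span (Poly_Mapping.map ?\<phi> ` ?V)"
  have "Poly_Mapping.single m 1 \<in> ?W" if m: "m \<in> monomials n M" for m
  proof (rule monomial_in_W[where \<Delta> = "ad_complex n w" and t = tn and M = M, OF pm.subspace_span _ _ _ _ _ _ m])
    show "card U \<le> (\<Sum>i\<in>{1..n}. tn i)" if "U \<in> ad_complex n w" for U
      using size[OF that] card_rows[OF T] by simp
    show "1 \<le> M i" if "i \<in> {1..n}" for i by (rule M1[OF that])
    show "n < M i" if "i \<in> {1..n}" "1 \<le> tn i" for i using Mbig[OF that(1)] that(2) tn_pos by blast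
    show "Poly_Mapping.single m 1 \<in> ?W" if m: "m \<in> monomials n M" "Poly_Mapping.keys m \<notin> ad_complex n w" for m
    proof -
      have g: "Poly_Mapping.keys m \<subseteq> grid n" using m(1) by (simp add: monomials_def)
      then obtain p q X where X: "p \<le> n" "q \<le> n" "achain X" "X \<subseteq> Poly_Mapping.keys m" "X \<subseteq> {1..p} \<times> {1..q}" "rk w p q < card X"
        using m(2) unfolding ad_complex_def mem_Collect_eq not_le[symmetric] by metis
      have finX: "finite X" by (rule finite_subset[OF X(4)]) simp
      obtain R C where R': "\<And>a b. a < b \<Longrightarrow> b < card X \<Longrightarrow> R a < R b" and C': "\<And>a b. a < b \<Longrightarrow> b < card X \<Longrightarrow> C b < C a"
        and XRC': "X = (\<lambda>a. (R a, C a)) ` {..<card X}" by (rule achain_enum[OF X(3) finX]) (rule that)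
      define k where "k = card X"
      note R = R'[folded k_def] and C = C'[folded k_def] and XRC = XRC'[folded k_def]
      have "card ((\<lambda>l. (R l, C l)) ` {..<k}) = card {..<k}" unfolding XRC[symmetric] by (simp add: k_def)
      then have inj: "inj_on (\<lambda>l. (R l, C l)) {..<k}" by (rule eq_card_imp_inj_on[rotated]) simp
      have RC: "R l \<in> {1..p}" "C l \<in> {1..q}" if "l < k" for l using X(5) that unfolding XRC by auto
      have Cn: "C l \<in> {1..n}" and Rn: "R l \<in> {1..n}" if "l < k" for l using RC[OF that] X(1,2) by auto
      \<comment> \<open>The cofactor for which the antidiagonal term times \<open>\<mu>\<close> is
        \<open>m\<close>; the subtraction is exact since the chain lies in the support of
        \<open>m\<close>.\<close>
      define \<mu> where "\<mu> = m - minor_exp k R C id"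
      have le: "Poly_Mapping.lookup (minor_exp k R C id) x \<le> Poly_Mapping.lookup m x" for x
      proof -
        have "Poly_Mapping.lookup (minor_exp k R C id) x = (if x \<in> X then 1 else 0)"
          unfolding minor_exp_id_image[OF inj] XRC[symmetric] lookup_sum lookup_single when_def using finX by simp
        then show ?thesis using X(4) by (auto simp: in_keys_iff Suc_le_eq)
      qed
      have m\<mu>: "\<mu> + minor_exp k R C id = m"
        by (rule poly_mapping_eqI) (simp add: \<mu>_def lookup_add lookup_minus le)
      have mem: "\<mu> + minor_exp k R C \<pi> \<in> monomials n M" if \<pi>: "\<pi> permutes {..<k}" for \<pi>
      proof -
        have "row_deg n (\<mu> + minor_exp k R C \<pi>) i = row_deg n m i" for i
          using row_deg_minor_exp[of k C \<pi> R i] row_deg_minor_exp[of k C id R i] Cn \<pi>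
          unfolding m\<mu>[symmetric] by (simp add: row_deg_add permutes_id)
        moreover have "Poly_Mapping.keys (\<mu> + minor_exp k R C \<pi>) \<subseteq> grid n"
        proof -
          have "C (\<pi> l) \<in> {1..n}" if "l < k" for l using Cn permutes_in_image[OF \<pi>, of l] that by simp
          then have "Poly_Mapping.keys (minor_exp k R C \<pi>) \<subseteq> grid n"
            unfolding minor_exp_def using Rn by (intro keys_sum_sub) auto
          moreover have "Poly_Mapping.keys \<mu> \<subseteq> Poly_Mapping.keys m"
            by (auto simp: \<mu>_def in_keys_iff lookup_minus)
          then have "Poly_Mapping.keys \<mu> \<subseteq> grid n" using g by (rule subset_trans)
          ultimately show ?thesis unfolding keys_add_nat by simp
        qed
        ultimately show ?thesis using m(1) by (simp add: monomials_def)
      qed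
      have v: "minor_vec k R C \<mu> \<in> minor_vecs"
        unfolding minor_vecs_def mem_Collect_eq
        by (intro exI[of _ k] exI[of _ R] exI[of _ C] exI[of _ \<mu>] exI[of _ p] exI[of _ q])
          (use X(1,2,6) R C RC mem k_def in simp)
      have "Poly_Mapping.map ?\<phi> (minor_vec k R C \<mu>) = Poly_Mapping.single m 1"
        using map_minor_vec[of k R C 1 \<theta> \<mu>, OF R C] unfolding m\<mu> .
      from this[symmetric] have "Poly_Mapping.single m 1 \<in> Poly_Mapping.map ?\<phi> ` ?V"
        by (rule image_eqI) (rule UnI1[OF UnI1[OF v]])
      then show ?thesis by (rule pm.span_base)
    qed
    show "(\<Sum>j\<in>{1..n}. Poly_Mapping.single (\<mu> + Poly_Mapping.single (i, j) 1) (of_nat j ^ k)) \<in> ?W"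
      if h: "i \<in> {1..n}" "Suc k < tn i" "\<And>j. j \<in> {1..n} \<Longrightarrow> \<mu> + Poly_Mapping.single (i, j) 1 \<in> monomials n M" for i k \<mu>
    proof -
      have "b i (Suc k) \<noteq> b i 0"
        using inj_onD[OF bij_betw_imp_inj_on[OF b[of i]], of "Suc k" 0] h(2) by auto
      then have e: "Poly_Mapping.map ?\<phi> (row_form n (b i) i k \<mu>) =
          (\<Sum>j\<in>{1..n}. Poly_Mapping.single (\<mu> + Poly_Mapping.single (i, j) 1) (of_nat j ^ k))"
        by (intro map_row_form) (simp_all add: \<theta>_def)
      have v: "row_form n (b i) i k \<mu> \<in> form_vecs" unfolding form_vecs_def mem_Collect_eq
        by (intro exI[of _ i] exI[of _ k] exI[of _ \<mu>]) (use h in simp)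
      from e[symmetric] have "(\<Sum>j\<in>{1..n}. Poly_Mapping.single (\<mu> + Poly_Mapping.single (i, j) 1) (of_nat j ^ k)) \<in> Poly_Mapping.map ?\<phi> ` ?V"
        by (rule image_eqI) (rule UnI1[OF UnI2[OF v]])
      then show ?thesis by (rule pm.span_base)
    qed
    show "Poly_Mapping.single m 1 \<in> ?W" if "m \<in> can_facets n (ad_complex n w) tn M" for m
    proof (rule pm.span_base)
      have e: "Poly_Mapping.single m 1 = Poly_Mapping.map ?\<phi> (Poly_Mapping.single m 1)" by simp
      have "Poly_Mapping.single m 1 \<in> facet_vecs" unfolding facet_vecs_def using that by (rule imageI)
      with e show "Poly_Mapping.single m 1 \<in> Poly_Mapping.map ?\<phi> ` ?V" by (rule image_eqI[OF _ UnI2])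
    qed
  qed
  from span_of_specialisation[OF param_eval_hom finite_monomials keys_vecs this]
  obtain D where "?\<phi> D \<noteq> 0" "\<forall>m\<in>monomials n M. Poly_Mapping.single m D \<in> pm.span ?V" by blast
  moreover have "D \<noteq> 0" using \<open>?\<phi> D \<noteq> 0\<close> by auto
  ultimately show ?thesis by blast
qed

text \<open>Actual points satisfy the relations: minors vanish at \<open>a\<close>, which is
  \<open>x\<close> rescaled cell by cell, and \<open>\<theta>\<close> holds the values at
  \<open>x\<close> of the deformed coordinates, the first one of each row being left
  undeformed.\<close>

lemma vec_eval_relations:
  assumes a: "a \<in> schubert_cone n w" and s: "s \<noteq> 0" and x: "\<And>v. a v = s ^ (fst v * snd v) * x v"
    and \<theta>0: "\<And>i. 1 \<le> tn i \<Longrightarrow> \<theta> (i, b i 0) = x (i, b i 0)"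
    and \<theta>S: "\<And>i k. Suc k < tn i \<Longrightarrow> \<theta> (i, b i (Suc k)) =
      (1 - r) * x (i, b i (Suc k)) + r * (\<Sum>j\<in>{1..n}. of_nat j ^ k * x (i, j))"
    and f: "f \<in> pm.span (minor_vecs \<union> form_vecs)"
  shows "vec_eval s r \<theta> x f = 0"
  using f
proof (induction rule: pm.span_induct_alt)
  case base
  show ?case by (rule vec_eval_0)
next
  case (step c f g)
  have "vec_eval s r \<theta> x f = 0"
    using step(1)
  proof
    assume "f \<in> minor_vecs"
    then obtain k R C \<mu> p q where f: "f = minor_vec k R C \<mu>" and pq: "p \<le> n" "q \<le> n" "rk w p q < k"
      and R: "\<And>a b. a < b \<Longrightarrow> b < k \<Longrightarrow> R a < R b" and C: "\<And>a b. a < b \<Longrightarrow> b < k \<Longrightarrow> C b < C a"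
      and RC: "\<And>l. l < k \<Longrightarrow> R l \<in> {1..p}" "\<And>l. l < k \<Longrightarrow> C l \<in> {1..q}"
      unfolding minor_vecs_def mem_Collect_eq by (elim exE conjE) simp
    have "minor_sum k R C a = 0" by (rule minor_sum_eq_0[OF schubert_coneD[OF a pq(1,2)] pq(3) RC])
    moreover have "a = (\<lambda>v. s ^ (fst v * snd v) * x v)" using x by blast
    ultimately have "minor_sum k R C (\<lambda>v. s ^ (fst v * snd v) * x v) = 0" by simp
    then show ?thesis unfolding f by (intro vec_eval_minor R C s)
  next
    assume "f \<in> form_vecs"
    then obtain i k \<mu> where f: "f = row_form n (b i) i k \<mu>" "Suc k < tn i"
      unfolding form_vecs_def mem_Collect_eq by (elim exE conjE) simp
    show ?thesis unfolding f(1) by (rule vec_eval_row_form[OF \<theta>0 \<theta>S[OF f(2)]]) (use f(2) in simp)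
  qed
  then show ?case using step by (simp add: vec_eval_add vec_eval_pscale)
qed

lemma span_facet_vecs: "f \<in> pm.span facet_vecs \<Longrightarrow> Poly_Mapping.keys f \<subseteq> can_facets n (ad_complex n w) tn M"
proof (induction rule: pm.span_induct_alt)
  case (step c f g)
  then obtain m where m: "m \<in> can_facets n (ad_complex n w) tn M" "f = Poly_Mapping.single m 1"
    by (auto simp: facet_vecs_def)
  have "Poly_Mapping.keys (pscale c f + g) \<subseteq> Poly_Mapping.keys (pscale c f) \<union> Poly_Mapping.keys g" by (rule keys_add)
  also have "Poly_Mapping.keys (pscale c f) \<subseteq> {m}" unfolding m(2) pscale_single by simp
  finally show ?case using m step by auto
qed simp

text \<open>Up to the factor \<open>D\<close>, each vector is a combination of facet monomials
  modulo the relations. For \<open>N + 1\<close> vectors and at most \<open>N\<close> facet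
  monomials the coefficients have a kernel vector over the parameter ring.\<close>

lemma params_relation:
  fixes G :: "nat \<Rightarrow> (nat \<times> nat, params) mpoly"
  assumes G: "\<And>k. k \<le> N \<Longrightarrow> Poly_Mapping.keys (G k) \<subseteq> monomials n M"
    and N: "card (can_facets n (ad_complex n w) tn M) \<le> N"
  shows "\<exists>c. (\<exists>k\<le>N. c k \<noteq> 0) \<and> (\<Sum>k\<le>N. pscale (c k) (G k)) \<in> pm.span (minor_vecs \<union> form_vecs)"
proof -
  let ?H = "can_facets n (ad_complex n w) tn M"
  have finH: "finite ?H" by (rule finite_subset[OF _ finite_monomials[of n M]]) (auto simp: can_facets_def)
  obtain D where D: "D \<noteq> 0" "\<And>m. m \<in> monomials n M \<Longrightarrow>
      Poly_Mapping.single m D \<in> pm.span ((minor_vecs \<union> form_vecs) \<union> facet_vecs)"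
    using params_span by blast
  have "\<forall>k\<in>{..N}. \<exists>u. pscale D (G k) = fst u + snd u \<and> fst u \<in> pm.span (minor_vecs \<union> form_vecs) \<and>
      snd u \<in> pm.span facet_vecs"
  proof
    fix k assume k: "k \<in> {..N}"
    have "pscale D (G k) = (\<Sum>m\<in>monomials n M. pscale (Poly_Mapping.lookup (G k) m) (Poly_Mapping.single m D))"
      by (subst mpoly_keys_sum[OF G finite_monomials])
        (use k in \<open>simp_all add: pm.scale_sum_right pscale_single mult.commute\<close>)
    also have "\<dots> \<in> pm.span ((minor_vecs \<union> form_vecs) \<union> facet_vecs)"
      by (intro pm.span_sum pm.span_scale D(2))
    finally obtain x y where "pscale D (G k) = x + y" "x \<in> pm.span (minor_vecs \<union> form_vecs)" "y \<in> pm.span facet_vecs"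
      unfolding pm.span_Un by blast
    then show "\<exists>u. pscale D (G k) = fst u + snd u \<and> fst u \<in> pm.span (minor_vecs \<union> form_vecs) \<and>
        snd u \<in> pm.span facet_vecs" by (intro exI[of _ "(x, y)"]) simp
  qed
  from bchoice[OF this] obtain u where u: "\<forall>k\<in>{..N}. pscale D (G k) = fst (u k) + snd (u k) \<and>
      fst (u k) \<in> pm.span (minor_vecs \<union> form_vecs) \<and> snd (u k) \<in> pm.span facet_vecs" ..
  define f h where "f k = fst (u k)" and "h k = snd (u k)" for k
  have fh: "\<And>k. k \<le> N \<Longrightarrow> pscale D (G k) = f k + h k"
    "\<And>k. k \<le> N \<Longrightarrow> f k \<in> pm.span (minor_vecs \<union> form_vecs)" "\<And>k. k \<le> N \<Longrightarrow> h k \<in> pm.span facet_vecs"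
    using u unfolding f_def h_def by simp_all
  have "\<exists>c. (\<exists>k\<in>{..N}. c k \<noteq> 0) \<and> (\<forall>m\<in>?H. (\<Sum>k\<in>{..N}. c k * Poly_Mapping.lookup (h k) m) = 0)"
    by (rule ex_row_kernel[OF finH]) (use N in simp_all)
  then obtain c where c': "\<exists>k\<in>{..N}. c k \<noteq> 0" "\<forall>m\<in>?H. (\<Sum>k\<in>{..N}. c k * Poly_Mapping.lookup (h k) m) = 0"
    by (elim exE conjE)
  then obtain k0 where "k0 \<in> {..N}" "c k0 \<noteq> 0" by (elim bexE)
  then have c: "k0 \<le> N" "c k0 \<noteq> 0" "\<And>m. m \<in> ?H \<Longrightarrow> (\<Sum>k\<in>{..N}. c k * Poly_Mapping.lookup (h k) m) = 0"
    using c'(2) by simp_all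
  have hz: "(\<Sum>k\<le>N. pscale (c k) (h k)) = 0"
  proof (rule poly_mapping_eqI)
    fix m
    show "Poly_Mapping.lookup (\<Sum>k\<le>N. pscale (c k) (h k)) m = Poly_Mapping.lookup 0 m"
    proof (cases "m \<in> ?H")
      case True
      show ?thesis unfolding lookup_sum lookup_pscale using c(3)[OF True] by (simp only: lookup_zero)
    next
      case False
      have "Poly_Mapping.lookup (h k) m = 0" if "k \<le> N" for k
      proof -
        have "m \<notin> Poly_Mapping.keys (h k)" using False subsetD[OF span_facet_vecs[OF fh(3)[OF that]], of m] by argo
        then show ?thesis by (simp only: in_keys_iff not_not)
      qed
      then show ?thesis unfolding lookup_sum lookup_pscale by (intro trans[OF sum.neutral]) simp_all
    qed
  qed
  have "(\<Sum>k\<le>N. pscale (c k * D) (G k)) = (\<Sum>k\<le>N. pscale (c k) (f k)) + (\<Sum>k\<le>N. pscale (c k) (h k))"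
    unfolding sum.distrib[symmetric]
    by (rule sum.cong) (simp_all add: fh(1)[symmetric] pm.scale_right_distrib[symmetric])
  also have "\<dots> \<in> pm.span (minor_vecs \<union> form_vecs)"
    unfolding hz add_0_right by (intro pm.span_sum pm.span_scale fh(2)) simp
  finally show ?thesis using c(1,2) D(1) by (intro exI[of _ "\<lambda>k. c k * D"]) auto
qed

end

section \<open>Homogenisation and specialisation of the parameters\<close>

context
  fixes n :: nat and w :: "nat \<Rightarrow> nat" and T :: "(nat \<times> nat) set" and b :: "nat \<Rightarrow> nat \<Rightarrow> nat"
    and M :: "nat \<Rightarrow> nat" and I :: "nat set"
  assumes T: "T \<subseteq> grid n"
    and b: "\<And>i. bij_betw (b i) {..<card (row_set T i)} (row_set T i)"
    and I: "I = {i \<in> {1..n}. row_set T i \<noteq> {}}"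
begin

text \<open>The missing row degree is supplied by the first coordinate of \<open>T\<close> in the
  row. Rows without one cannot be padded; functions must have the exact degree there.\<close>

definition pad :: "(nat \<times> nat \<Rightarrow>\<^sub>0 nat) \<Rightarrow> (nat \<times> nat \<Rightarrow>\<^sub>0 nat)" where
  "pad m = (\<Sum>i\<in>I. Poly_Mapping.single (i, b i 0) (M i - row_deg n m i))"

text \<open>Powers of the parameters compensate for the padding and powers of the weight variable
  for the rescaling: at matching values all terms acquire the same factor, the product of the
  \<open>\<theta> (i, b i 0) ^ M i\<close>.\<close>

definition homogenise :: "(nat \<times> nat, complex) mpoly \<Rightarrow> (nat \<times> nat, params) mpoly" where
  "homogenise f = (\<Sum>m\<in>Poly_Mapping.keys f. Poly_Mapping.single (m + pad m)
     (scal (Poly_Mapping.lookup f m) * weightvar ^ weight m * (\<Prod>i\<in>I. par (i, b i 0) ^ row_deg n m i)))"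

lemma first_mem: "i \<in> I \<Longrightarrow> (i, b i 0) \<in> T"
proof -
  assume "i \<in> I"
  then have "0 < card (row_set T i)" using finite_row_set[OF T] by (simp add: I card_gt_0_iff)
  then show ?thesis using b[of i] by (auto simp: bij_betw_def row_set_def)
qed

lemma finI: "finite I"
  by (simp add: I)

lemma keys_homogenise:
  assumes f: "f \<in> polys_on (grid n)"
    and low: "\<And>m i. m \<in> Poly_Mapping.keys f \<Longrightarrow> i \<in> I \<Longrightarrow> row_deg n m i \<le> M i"
    and eq: "\<And>m i. m \<in> Poly_Mapping.keys f \<Longrightarrow> i \<in> {1..n} \<Longrightarrow> i \<notin> I \<Longrightarrow> row_deg n m i = M i"
  shows "Poly_Mapping.keys (homogenise f) \<subseteq> monomials n M"
proof -
  have mem: "m + pad m \<in> monomials n M" if m: "m \<in> Poly_Mapping.keys f" for m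
  proof -
    have bn: "b i 0 \<in> {1..n}" if "i \<in> I" for i using first_mem[OF that] T by auto
    have "row_deg n (pad m) i = (\<Sum>i'\<in>I. if i = i' then M i' - row_deg n m i' else 0)" for i
      unfolding pad_def row_deg_sum by (intro sum.cong refl row_deg_single bn)
    also have "\<dots> i = (if i \<in> I then M i - row_deg n m i else 0)" for i
      using finI by (simp add: sum.delta')
    finally have "row_deg n (m + pad m) i = M i" if "i \<in> {1..n}" for i
      using low[OF m, of i] eq[OF m that] by (cases "i \<in> I") (simp_all add: row_deg_add)
    moreover have "Poly_Mapping.keys (pad m) \<subseteq> grid n"
      unfolding pad_def
    proof (rule keys_sum_sub)
      fix i assume "i \<in> I"
      then have "(i, b i 0) \<in> grid n" by (intro subsetD[OF T] first_mem)
      moreover have "Poly_Mapping.keys (Poly_Mapping.single (i, b i 0) c) \<subseteq> {(i, b i 0)}" for c :: nat by simp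
      ultimately show "Poly_Mapping.keys (Poly_Mapping.single (i, b i 0) (M i - row_deg n m i)) \<subseteq> grid n" by blast
    qed
    ultimately show ?thesis using f m by (auto simp: monomials_def keys_add_nat polys_on_def)
  qed
  have single: "Poly_Mapping.keys (Poly_Mapping.single e c) \<subseteq> monomials n M" if "e \<in> monomials n M" for e and c :: params
    using that by simp
  show ?thesis unfolding homogenise_def by (rule keys_sum_sub) (rule single, rule mem)
qed

lemma vec_eval_homogenise:
  assumes low: "\<And>m i. m \<in> Poly_Mapping.keys f \<Longrightarrow> i \<in> I \<Longrightarrow> row_deg n m i \<le> M i"
    and a: "\<And>v. a v = s ^ (fst v * snd v) * x v"
    and \<theta>: "\<And>i. i \<in> I \<Longrightarrow> \<theta> (i, b i 0) = x (i, b i 0)"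
  shows "vec_eval s r \<theta> x (homogenise f) = (\<Prod>i\<in>I. \<theta> (i, b i 0) ^ M i) * poly_eval a f"
proof -
  have "param_eval s r \<theta> (scal (Poly_Mapping.lookup f m) * weightvar ^ weight m * (\<Prod>i\<in>I. par (i, b i 0) ^ row_deg n m i)) *
      mon x (m + pad m) = (\<Prod>i\<in>I. \<theta> (i, b i 0) ^ M i) * (Poly_Mapping.lookup f m * mon a m)"
    if m: "m \<in> Poly_Mapping.keys f" for m
  proof -
    have "mon x (pad m) * (\<Prod>i\<in>I. \<theta> (i, b i 0) ^ row_deg n m i) = (\<Prod>i\<in>I. \<theta> (i, b i 0) ^ M i)"
      unfolding pad_def mon_sum prod.distrib[symmetric]
      by (rule prod.cong) (use low[OF m] \<theta> in \<open>simp_all add: power_add[symmetric]\<close>)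
    moreover have "mon a m = s ^ weight m * mon x m"
      using mon_weight[of s x m] a by (simp add: mon_def)
    ultimately show ?thesis
      by (simp add: param_eval.hom_mult param_eval.hom_prod mon_add mult_ac)
  qed
  then show ?thesis
    unfolding homogenise_def vec_eval_sum vec_eval_single
    by (simp add: poly_eval_eq_hom_eval hom_eval_def sum_distrib_left)
qed

end

context
  fixes n N :: nat and w :: "nat \<Rightarrow> nat" and T :: "(nat \<times> nat) set" and b :: "nat \<Rightarrow> nat \<Rightarrow> nat"
    and g :: "nat \<Rightarrow> (nat \<times> nat, complex) mpoly"
  assumes T: "T \<subseteq> grid n"
    and b: "\<And>i. bij_betw (b i) {..<card (row_set T i)} (row_set T i)"
    and size: "\<And>U. U \<in> ad_complex n w \<Longrightarrow> card U \<le> card T"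
    and g: "\<And>k. k \<le> N \<Longrightarrow> g k \<in> polys_on (grid n)"
    and linear: "\<And>k m i. k \<le> N \<Longrightarrow> m \<in> Poly_Mapping.keys (g k) \<Longrightarrow> i \<in> {1..n} \<Longrightarrow> row_set T i = {} \<Longrightarrow>
      row_deg n m i = 1"
    and few: "card {U \<in> ad_complex n w. \<forall>i\<in>{1..n}. card (row_set U i) = card (row_set T i)} \<le> N \<or>
      (\<exists>i\<in>{1..n}. row_set T i = {})"
begin

abbreviation (input) "cnt i \<equiv> card (row_set T i)"

text \<open>\<open>a\<close> is the matrix, \<open>x\<close> the matrix rescaled by inverse powers
  of \<open>s\<close>, and \<open>\<theta>\<close> records the deformed coordinates of
  \<open>x\<close> with deformation parameter \<open>r\<close>. Parameters at cells outside
  \<open>T\<close> stay free.\<close>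

definition compatible :: "complex \<Rightarrow> complex \<Rightarrow> (nat \<times> nat \<Rightarrow> complex) \<Rightarrow> (nat \<times> nat \<Rightarrow> complex) \<Rightarrow> (nat \<times> nat \<Rightarrow> complex) \<Rightarrow> bool" where
  "compatible s r \<theta> x a \<longleftrightarrow> s \<noteq> 0 \<and> (\<forall>v. a v = s ^ (fst v * snd v) * x v) \<and>
     (\<forall>i. 1 \<le> cnt i \<longrightarrow> \<theta> (i, b i 0) = x (i, b i 0)) \<and>
     (\<forall>i k. Suc k < cnt i \<longrightarrow> \<theta> (i, b i (Suc k)) =
       (1 - r) * x (i, b i (Suc k)) + r * (\<Sum>j\<in>{1..n}. of_nat j ^ k * x (i, j)))"

text \<open>A relation among the homogenised functions over the parameter ring is evaluated at
  compatible values, where the relation vectors vanish and the functions regain their values at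
  \<open>a\<close>.\<close>

lemma relation_with_params:
  "\<exists>c. (\<exists>k\<le>N. c k \<noteq> 0) \<and> (\<forall>a\<in>schubert_cone n w. \<forall>s r \<theta> x. compatible s r \<theta> x a \<longrightarrow>
     (\<Sum>k\<le>N. param_eval s r \<theta> (c k) * poly_eval a (g k)) = 0)"
proof -
  define I where "I = {i \<in> {1..n}. row_set T i \<noteq> {}}"
  \<comment> \<open>On rows meeting \<open>T\<close> the degree exceeds \<open>n\<close> and all
    degrees that occur, so that padding and \<open>monomial_in_W\<close> are possible; on the other
    rows it is the exact degree of the functions.\<close>
  define M where "M i = (if row_set T i = {} then 1 else Suc n + (\<Sum>k\<le>N. \<Sum>m\<in>Poly_Mapping.keys (g k). row_deg n m i))" for i
  have low: "row_deg n m i \<le> M i" if "k \<le> N" "m \<in> Poly_Mapping.keys (g k)" "i \<in> I" for k m i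
  proof -
    have "row_deg n m i \<le> (\<Sum>m\<in>Poly_Mapping.keys (g k). row_deg n m i)"
      by (rule member_le_sum) (use that in simp_all)
    also have "\<dots> \<le> (\<Sum>k\<le>N. \<Sum>m\<in>Poly_Mapping.keys (g k). row_deg n m i)"
      by (rule member_le_sum[where f = "\<lambda>k. \<Sum>m\<in>Poly_Mapping.keys (g k). row_deg n m i"]) (use that in simp_all)
    finally show ?thesis using that by (simp add: M_def I_def)
  qed
  have eq: "row_deg n m i = M i" if "k \<le> N" "m \<in> Poly_Mapping.keys (g k)" "i \<in> {1..n}" "i \<notin> I" for k m i
    using that linear[OF that(1-3)] by (simp add: M_def I_def)
  have M1: "1 \<le> M i" if "i \<in> {1..n}" for i by (simp add: M_def)
  have Mbig: "n < M i" if "i \<in> {1..n}" "row_set T i \<noteq> {}" for i using that by (simp add: M_def)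
  let ?G = "\<lambda>k. homogenise n b M I (g k)"
  have G: "Poly_Mapping.keys (?G k) \<subseteq> monomials n M" if k: "k \<le> N" for k
    by (rule keys_homogenise[OF T b I_def g[OF k]]) (rule low[OF k] eq[OF k]; assumption)+
  have few': "card (can_facets n (ad_complex n w) cnt M) \<le> N"
  proof (cases "\<exists>i\<in>{1..n}. row_set T i = {}")
    case True
    then obtain i where i: "i \<in> {1..n}" "row_set T i = {}" by blast
    \<comment> \<open>A facet monomial would have no cell in the row missing \<open>T\<close>, yet
      degree one there. So there is none, and the bound holds even for \<open>N = 0\<close>.\<close>
    have "m \<notin> can_facets n (ad_complex n w) cnt M" for m
    proof
      assume "m \<in> can_facets n (ad_complex n w) cnt M"
      then have m: "m \<in> monomials n M" "card (row_set (Poly_Mapping.keys m) i) = 0"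
        using i by (auto simp: can_facets_def)
      have sub: "Poly_Mapping.keys m \<subseteq> grid n" using m(1) by (simp add: monomials_def)
      then have "row_set (Poly_Mapping.keys m) i = {}" using m(2) finite_row_set[OF sub, of i] by simp
      then have "row_deg n m i = 0" by (simp add: row_deg_row_set[OF sub])
      then show False using m(1) i(1) M1[OF i(1)] by (simp add: monomials_def)
    qed
    then have "can_facets n (ad_complex n w) cnt M = {}" by blast
    then show ?thesis by simp
  next
    case False
    then have "card {U \<in> ad_complex n w. \<forall>i\<in>{1..n}. card (row_set U i) = cnt i} \<le> N" using few by simp
    moreover have "ad_complex n w \<subseteq> Pow (grid n)" by (rule subsetI) (rule PowI, rule ad_complex_grid)
    ultimately show ?thesis using card_can_facets[of "ad_complex n w" n cnt M] by linarith
  qed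
  have "\<exists>c. (\<exists>k\<le>N. c k \<noteq> 0) \<and> (\<Sum>k\<le>N. pscale (c k) (?G k)) \<in>
      pm.span (minor_vecs n w M \<union> form_vecs n T b M)"
    by (rule params_relation[where G = ?G and N = N and n = n and w = w and T = T and b = b and M = M])
      (fact T b size M1 Mbig G few')+
  then obtain c where c': "(\<exists>k\<le>N. c k \<noteq> 0) \<and> (\<Sum>k\<le>N. pscale (c k) (?G k)) \<in>
      pm.span (minor_vecs n w M \<union> form_vecs n T b M)" ..
  note c = conjunct1[OF c'] conjunct2[OF c']
  \<comment> \<open>The common factor produced by homogenisation, now as a nonzero element of the
    parameter ring, to be absorbed into the coefficients.\<close>
  define z where "z = (\<Prod>i\<in>I. par (i, b i 0) ^ M i)"
  have z: "z \<noteq> 0" by (simp add: z_def par_neq_0 I_def)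
  show ?thesis
  proof (intro exI[of _ "\<lambda>k. c k * z"] conjI ballI allI impI)
    show "\<exists>k\<le>N. c k * z \<noteq> 0" using c(1) z by auto
    fix a s r \<theta> x
    assume a: "a \<in> schubert_cone n w" and comp: "compatible s r \<theta> x a"
    have s: "s \<noteq> 0" and x: "\<And>v. a v = s ^ (fst v * snd v) * x v"
      and \<theta>0: "\<And>i. 1 \<le> cnt i \<Longrightarrow> \<theta> (i, b i 0) = x (i, b i 0)"
      and \<theta>S: "\<And>i k. Suc k < cnt i \<Longrightarrow> \<theta> (i, b i (Suc k)) =
        (1 - r) * x (i, b i (Suc k)) + r * (\<Sum>j\<in>{1..n}. of_nat j ^ k * x (i, j))"
      using comp unfolding compatible_def by (elim conjE, simp only: not_False_eq_True)+
    have \<theta>I: "\<theta> (i, b i 0) = x (i, b i 0)" if "i \<in> I" for i 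
      by (rule \<theta>0) (use that finite_row_set[OF T, of i] in \<open>simp add: I_def card_gt_0_iff Suc_le_eq\<close>)
    have "vec_eval s r \<theta> x (\<Sum>k\<le>N. pscale (c k) (?G k)) = 0"
      by (rule vec_eval_relations[where n = n and w = w and T = T and b = b and M = M and a = a])
        (fact T b size M1 Mbig a s x \<theta>0 \<theta>S c(2))+
    also have "vec_eval s r \<theta> x (\<Sum>k\<le>N. pscale (c k) (?G k)) =
        (\<Sum>k\<le>N. param_eval s r \<theta> (c k) * ((\<Prod>i\<in>I. \<theta> (i, b i 0) ^ M i) * poly_eval a (g k)))"
      unfolding vec_eval_sum vec_eval_pscale
    proof (rule sum.cong[OF refl])
      fix k assume "k \<in> {..N}"
      then have k: "k \<le> N" by simp
      have "vec_eval s r \<theta> x (?G k) = (\<Prod>i\<in>I. \<theta> (i, b i 0) ^ M i) * poly_eval a (g k)"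
        by (rule vec_eval_homogenise[OF T b I_def, where a = a]) (rule low[OF k] x \<theta>I; assumption?)+
      then show "param_eval s r \<theta> (c k) * vec_eval s r \<theta> x (?G k) =
          param_eval s r \<theta> (c k) * ((\<Prod>i\<in>I. \<theta> (i, b i 0) ^ M i) * poly_eval a (g k))" by simp
    qed
    also have "\<dots> = (\<Sum>k\<le>N. param_eval s r \<theta> (c k * z) * poly_eval a (g k))"
      by (simp add: z_def param_eval.hom_mult param_eval.hom_prod mult.assoc)
    finally show "(\<Sum>k\<le>N. param_eval s r \<theta> (c k * z) * poly_eval a (g k)) = 0" .
  qed
qed

text \<open>A generic value is given to the weight variable, and \<open>rho\<close> tends to \<open>0\<close>.\<close>

lemma relation_off_T:
  "\<exists>s h. s \<noteq> 0 \<and> (\<exists>k\<le>N. h k \<noteq> 0) \<and> (\<forall>a\<in>schubert_cone n w. \<forall>\<beta>.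
     (\<Sum>k\<le>N. poly_eval (\<lambda>v. if v \<in> T then a v / s ^ (fst v * snd v) else \<beta> v) (h k) * poly_eval a (g k)) = 0)"
proof -
  from relation_with_params obtain c where c': "(\<exists>k\<le>N. c k \<noteq> 0) \<and> (\<forall>a\<in>schubert_cone n w. \<forall>s r \<theta> x.
      compatible s r \<theta> x a \<longrightarrow> (\<Sum>k\<le>N. param_eval s r \<theta> (c k) * poly_eval a (g k)) = 0)" ..
  note c0 = conjunct1[OF c'] and c = conjunct2[OF c']
  obtain k0 where k0: "k0 \<le> N" "c k0 \<noteq> 0" using c0 by blast
  have "finite {z. poly (c k0) z = 0}" by (rule poly_roots_finite[OF k0(2)])
  then have "finite ((\<lambda>s. [:Poly_Mapping.single 0 s:]) -` {z. poly (c k0) z = 0})"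
    by (rule finite_vimageI) (rule injI, metis lookup_single_eq pCons_eq_iff)
  then have "finite (insert 0 ((\<lambda>s. [:Poly_Mapping.single 0 s:]) -` {z. poly (c k0) z = 0}))" by simp
  from ex_new_if_finite[OF infinite_UNIV_char_0 this] obtain s :: complex
    where "s \<notin> insert 0 ((\<lambda>s. [:Poly_Mapping.single 0 s:]) -` {z. poly (c k0) z = 0})" by (elim exE)
  then have s: "s \<noteq> 0" "poly (c k0) [:Poly_Mapping.single 0 s:] \<noteq> 0" by simp_all
  define d where "d k = (if k \<le> N then poly (c k) [:Poly_Mapping.single 0 s:] else 0)" for k
  have "d k0 \<noteq> 0" using k0 s by (simp add: d_def)
  \<comment> \<open>All coefficients might vanish at \<open>rho = 0\<close>; without their common
    power of \<open>rho\<close>, at least one constant term is nonzero.\<close>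
  from divide_common_power[of d, OF this] obtain p e k1
    where e': "\<forall>k. d k = [:0, 1:] ^ p * e k" and k1: "coeff (e k1) 0 \<noteq> 0" by (elim exE conjE)
  note e = e'[rule_format]
  have k1N: "k1 \<le> N"
  proof (rule ccontr)
    assume "\<not> k1 \<le> N"
    then have "[:0, 1:] ^ p * e k1 = 0" using e[of k1] by (simp add: d_def)
    then have "e k1 = 0" by simp
    then show False using k1 by simp
  qed
  show ?thesis
  proof (intro exI[of _ s] exI[of _ "\<lambda>k. coeff (e k) 0"] conjI ballI allI)
    show "s \<noteq> 0" by (rule s(1))
    show "\<exists>k\<le>N. coeff (e k) 0 \<noteq> 0" using k1 k1N by (intro exI[of _ k1] conjI)
    fix a \<beta>
    assume a: "a \<in> schubert_cone n w"
    define x where "x v = a v / s ^ (fst v * snd v)" for v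
    have x: "a v = s ^ (fst v * snd v) * x v" for v using s(1) by (simp add: x_def)
    define idx where "idx v = inv_into {..<cnt (fst v)} (b (fst v)) (snd v)" for v
    have idx: "idx (i, b i k) = k" if "k < cnt i" for i k
      using b[of i] that by (simp add: idx_def bij_betw_def inv_into_f_f)
    have memT: "(i, b i k) \<in> T" if "k < cnt i" for i k
      using b[of i] that by (auto simp: bij_betw_def row_set_def)
    \<comment> \<open>The parameter values belonging to the fixed point \<open>x\<close>, as
      functions of \<open>r\<close>: each is \<open>x v\<close> plus \<open>r\<close> times the
      difference of the power form and \<open>x v\<close>. At \<open>r = 0\<close> they are the
      coordinates themselves.\<close>
    define \<gamma> where "\<gamma> v = (if v \<in> T then (case idx v of 0 \<Rightarrow> [:x v:] | Suc k \<Rightarrow>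
      [:x v, (\<Sum>j\<in>{1..n}. of_nat j ^ k * x (fst v, j)) - x v:]) else [:\<beta> v:])" for v
    have \<gamma>0: "poly (\<gamma> v) 0 = (if v \<in> T then a v / s ^ (fst v * snd v) else \<beta> v)" for v
      by (simp add: \<gamma>_def x_def split: nat.split)
    have "\<exists>Q. \<forall>r. poly Q r = poly_eval (\<lambda>v. poly (\<gamma> v) r) (poly (e k) (Poly_Mapping.single 0 r))" for k
      by (rule poly_along_curve)
    then have "\<forall>k. \<exists>Q. \<forall>r. poly Q r = poly_eval (\<lambda>v. poly (\<gamma> v) r) (poly (e k) (Poly_Mapping.single 0 r))" ..
    from choice[OF this] obtain Q where "\<forall>k r. poly (Q k) r = poly_eval (\<lambda>v. poly (\<gamma> v) r) (poly (e k) (Poly_Mapping.single 0 r))" ..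
    note Q = this[rule_format]
    define R where "R = (\<Sum>k\<le>N. Q k * [:poly_eval a (g k):])"
    have "poly R r = 0" if r: "r \<in> - {0}" for r
    proof -
      let ?\<theta> = "\<lambda>v. poly (\<gamma> v) r"
      have "(\<Sum>k\<le>N. param_eval s r ?\<theta> (c k) * poly_eval a (g k)) = 0"
      proof (rule c[rule_format, OF a], unfold compatible_def, intro conjI allI impI)
        show "s \<noteq> 0" by (rule s(1))
        show "a v = s ^ (fst v * snd v) * x v" for v by (rule x)
        show "?\<theta> (i, b i 0) = x (i, b i 0)" if "1 \<le> cnt i" for i
          using that idx[of 0 i] memT[of 0 i] by (simp add: \<gamma>_def)
        show "?\<theta> (i, b i (Suc k)) = (1 - r) * x (i, b i (Suc k)) + r * (\<Sum>j\<in>{1..n}. of_nat j ^ k * x (i, j))"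
          if "Suc k < cnt i" for i k
          using idx[OF that] memT[OF that] by (simp add: \<gamma>_def algebra_simps)
      qed
      also have "(\<Sum>k\<le>N. param_eval s r ?\<theta> (c k) * poly_eval a (g k)) = (\<Sum>k\<le>N. r ^ p * (poly (Q k) r * poly_eval a (g k)))"
      proof (rule sum.cong[OF refl])
        fix k assume "k \<in> {..N}"
        then have "poly (c k) [:Poly_Mapping.single 0 s:] = [:0, 1:] ^ p * e k" using e[of k] by (simp add: d_def)
        then have "param_eval s r ?\<theta> (c k) = poly_eval ?\<theta> (Poly_Mapping.single 0 r ^ p) * poly (Q k) r"
          unfolding param_eval_def Q by (simp add: poly_eval.hom_mult)
        also have "poly_eval ?\<theta> (Poly_Mapping.single 0 r ^ p) = r ^ p" by (simp add: poly_eval.hom_power)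
        finally show "param_eval s r ?\<theta> (c k) * poly_eval a (g k) = r ^ p * (poly (Q k) r * poly_eval a (g k))"
          by simp
      qed
      also have "\<dots> = r ^ p * poly R r" by (simp add: R_def poly_sum sum_distrib_left mult.commute)
      finally show ?thesis using r by simp
    qed
    \<comment> \<open>For \<open>r \<noteq> 0\<close> the power of \<open>rho\<close> taken out is
      invertible, so \<open>R\<close> has infinitely many zeros, and its value at
      \<open>r = 0\<close> is the desired relation.\<close>
    then have "R = 0" by (intro poly_zero_of_infinite[of "- {0}"]) (simp_all add: infinite_UNIV_char_0 Compl_eq_Diff_UNIV)
    then have R0: "poly R 0 = 0" by simp
    have Q0: "poly (Q k) 0 = poly_eval (\<lambda>v. if v \<in> T then a v / s ^ (fst v * snd v) else \<beta> v) (coeff (e k) 0)" for k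
      unfolding Q \<gamma>0 by (simp add: poly_0_coeff_0)
    have "poly R 0 = (\<Sum>k\<le>N. poly_eval (\<lambda>v. if v \<in> T then a v / s ^ (fst v * snd v) else \<beta> v) (coeff (e k) 0) * poly_eval a (g k))"
      unfolding R_def poly_sum poly_mult Q0 by simp
    then show "(\<Sum>k\<le>N. poly_eval (\<lambda>v. if v \<in> T then a v / s ^ (fst v * snd v) else \<beta> v) (coeff (e k) 0) * poly_eval a (g k)) = 0"
      using R0 by simp
  qed
qed

end

text \<open>The free parameters outside \<open>T\<close> are set to values that keep one coefficient
  nonzero. Rescaling the variables in \<open>T\<close> by powers of \<open>s\<close> is invertible
  and turns the coefficients into polynomials in the coordinates of \<open>a\<close>.\<close>

lemma algebraic_relation:
  fixes g :: "nat \<Rightarrow> (nat \<times> nat, complex) mpoly"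
  assumes T: "T \<subseteq> grid n"
    and size: "\<And>U. U \<in> ad_complex n w \<Longrightarrow> card U \<le> card T"
    and g: "\<And>k. k \<le> N \<Longrightarrow> g k \<in> polys_on (grid n)"
    and linear: "\<And>k m i. k \<le> N \<Longrightarrow> m \<in> Poly_Mapping.keys (g k) \<Longrightarrow> i \<in> {1..n} \<Longrightarrow> row_set T i = {} \<Longrightarrow>
      row_deg n m i = 1"
    and few: "card {U \<in> ad_complex n w. \<forall>i\<in>{1..n}. card (row_set U i) = card (row_set T i)} \<le> N \<or>
      (\<exists>i\<in>{1..n}. row_set T i = {})"
  shows "\<exists>c. (\<exists>k\<le>N. c k \<noteq> 0) \<and> (\<forall>k. c k \<in> polys_on T) \<and>
    (\<forall>a\<in>schubert_cone n w. (\<Sum>k\<le>N. poly_eval a (c k) * poly_eval a (g k)) = 0)"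
proof -
  from row_enum[OF T] obtain b where "\<forall>i. bij_betw (b i) {..<card (row_set T i)} (row_set T i)" ..
  then have b: "\<And>i. bij_betw (b i) {..<card (row_set T i)} (row_set T i)" ..
  have "\<exists>s h. s \<noteq> 0 \<and> (\<exists>k\<le>N. h k \<noteq> 0) \<and> (\<forall>a\<in>schubert_cone n w. \<forall>\<beta>.
     (\<Sum>k\<le>N. poly_eval (\<lambda>v. if v \<in> T then a v / s ^ (fst v * snd v) else \<beta> v) (h k) * poly_eval a (g k)) = 0)"
    by (rule relation_off_T[where n = n and N = N and T = T and b = b and g = g and w = w])
      (fact T b size g linear few)+
  then obtain s where "\<exists>h. s \<noteq> 0 \<and> (\<exists>k\<le>N. h k \<noteq> 0) \<and> (\<forall>a\<in>schubert_cone n w. \<forall>\<beta>.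
     (\<Sum>k\<le>N. poly_eval (\<lambda>v. if v \<in> T then a v / s ^ (fst v * snd v) else \<beta> v) (h k) * poly_eval a (g k)) = 0)" ..
  then obtain h where h': "s \<noteq> 0 \<and> (\<exists>k\<le>N. h k \<noteq> 0) \<and> (\<forall>a\<in>schubert_cone n w. \<forall>\<beta>.
     (\<Sum>k\<le>N. poly_eval (\<lambda>v. if v \<in> T then a v / s ^ (fst v * snd v) else \<beta> v) (h k) * poly_eval a (g k)) = 0)" ..
  note s = conjunct1[OF h'] and h0 = conjunct1[OF conjunct2[OF h']] and h = conjunct2[OF conjunct2[OF h']]
  obtain k1 where k1: "k1 \<le> N" "h k1 \<noteq> 0" using h0 by blast
  obtain \<beta> where \<beta>: "poly_eval \<beta> (h k1) \<noteq> 0" using ex_nonzero_eval[OF k1(2)] by blast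
  define \<sigma> where "\<sigma> v = (if v \<in> T then Poly_Mapping.single 0 (1 / s ^ (fst v * snd v)) * mvar v
    else Poly_Mapping.single 0 (\<beta> v))" for v :: "nat \<times> nat"
  have ev: "poly_eval a (subst \<sigma> f) = poly_eval (\<lambda>v. if v \<in> T then a v / s ^ (fst v * snd v) else \<beta> v) f" for a f
    unfolding poly_eval_subst by (rule arg_cong[where f = "\<lambda>x. poly_eval x f"])
      (auto simp: \<sigma>_def poly_eval.hom_mult fun_eq_iff)
  show ?thesis
  proof (intro exI[of _ "\<lambda>k. subst \<sigma> (h k)"] conjI allI ballI)
    have "(\<lambda>v. if v \<in> T then (s ^ (fst v * snd v) * \<beta> v) / s ^ (fst v * snd v) else \<beta> v) = \<beta>"
      using s by auto
    then have "poly_eval (\<lambda>v. s ^ (fst v * snd v) * \<beta> v) (subst \<sigma> (h k1)) = poly_eval \<beta> (h k1)" unfolding ev by simp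
    then have "subst \<sigma> (h k1) \<noteq> 0" using \<beta> by (auto simp: poly_eval.hom_zero)
    then show "\<exists>k\<le>N. subst \<sigma> (h k) \<noteq> 0" using k1(1) by blast
    show "subst \<sigma> (h k) \<in> polys_on T" for k
      by (rule polys_on_subst) (auto simp: \<sigma>_def intro: polys_on_mult polys_on_const polys_on_mvar)
    show "(\<Sum>k\<le>N. poly_eval a (subst \<sigma> (h k)) * poly_eval a (g k)) = 0" if "a \<in> schubert_cone n w" for a
      unfolding ev by (rule h[rule_format, OF that])
  qed
qed

subsection \<open>The function field of an irreducible set\<close>

lemma cross_mult:
  fixes a b c d f g p q :: "'a::comm_ring_1"
  assumes "a * q = f * b" "c * p = g * d" shows "(a * c) * (q * p) = (f * g) * (b * d)"
proof -
  have "(a * c) * (q * p) = (a * q) * (c * p)" by (simp only: mult_ac)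
  then show ?thesis unfolding assms by (simp only: mult_ac)
qed

lemma cross_add:
  fixes a b c d f g p q :: "'a::comm_ring_1"
  assumes "a * q = f * b" "c * p = g * d" shows "(a * d + c * b) * (q * p) = (f * p + g * q) * (b * d)"
proof -
  have "(a * d + c * b) * (q * p) = (a * q) * (d * p) + (c * p) * (b * q)" by (simp add: algebra_simps)
  then show ?thesis unfolding assms by (simp add: algebra_simps)
qed

definition nonvanishing :: "'v set \<Rightarrow> ('v \<Rightarrow> complex) set \<Rightarrow> ('v, complex) mpoly set" where
  "nonvanishing I X = {q \<in> polys_on I. \<exists>a\<in>X. poly_eval a q \<noteq> 0}"

context
  fixes I :: "'v set" and X :: "('v \<Rightarrow> complex) set"
  assumes irred: "\<And>f g. f \<in> polys_on I \<Longrightarrow> g \<in> polys_on I \<Longrightarrow>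
      (\<And>a. a \<in> X \<Longrightarrow> poly_eval a f * poly_eval a g = 0) \<Longrightarrow>
      (\<forall>a\<in>X. poly_eval a f = 0) \<or> (\<forall>a\<in>X. poly_eval a g = 0)"
    and nonempty: "X \<noteq> {}"
begin

abbreviation (input) "P \<equiv> poly_ring I"
abbreviation (input) "V \<equiv> vanishing_ideal I X"
abbreviation (input) "R \<equiv> coord_ring I X"
abbreviation (input) "F \<equiv> function_field I X"
abbreviation (input) "cf \<equiv> coord_fun I X"
abbreviation (input) "ev \<equiv> poly_eval"

lemma P_simps: "carrier P = polys_on I" "x \<otimes>\<^bsub>P\<^esub> y = x * y" "x \<oplus>\<^bsub>P\<^esub> y = x + y" "\<zero>\<^bsub>P\<^esub> = 0" "\<one>\<^bsub>P\<^esub> = 1"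
  by (simp_all add: poly_ring_def)

lemma cring_P: "cring P"
proof (rule cringI)
  show "abelian_group P"
  proof (rule abelian_groupI)
    show "\<exists>y\<in>carrier P. y \<oplus>\<^bsub>P\<^esub> x = \<zero>\<^bsub>P\<^esub>" if "x \<in> carrier P" for x
      by (rule bexI[of _ "- x"]) (use that in \<open>simp_all add: P_simps polys_on_uminus\<close>)
  qed (simp_all add: P_simps polys_on_add polys_on_0 algebra_simps)
  show "comm_monoid P"
    by (rule comm_monoidI) (simp_all add: P_simps polys_on_mult polys_on_1 algebra_simps)
qed (simp add: P_simps algebra_simps)

interpretation P: cring P by (rule cring_P)

lemma P_minus: "x \<in> polys_on I \<Longrightarrow> y \<in> polys_on I \<Longrightarrow> x \<ominus>\<^bsub>P\<^esub> y = x - y"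
proof -
  assume x: "x \<in> polys_on I" and y: "y \<in> polys_on I"
  have "\<ominus>\<^bsub>P\<^esub> y = - y"
    by (rule P.minus_equality) (use y in \<open>simp_all add: P_simps polys_on_uminus\<close>)
  then show ?thesis by (simp add: a_minus_def P_simps)
qed

lemma V_iff: "f \<in> V \<longleftrightarrow> f \<in> polys_on I \<and> (\<forall>a\<in>X. ev a f = 0)"
  by (simp add: vanishing_ideal_def)

lemma ideal_V: "ideal V P"
proof (rule idealI[OF P.ring_axioms])
  show "subgroup V (add_monoid P)"
  proof (rule P.add.subgroupI)
    show "V \<noteq> {}" using V_iff[of 0] by (auto simp: polys_on_0 poly_eval.hom_zero)
    show "\<ominus>\<^bsub>P\<^esub> f \<in> V" if "f \<in> V" for f
    proof -
      have "\<ominus>\<^bsub>P\<^esub> f = - f"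
        by (rule P.minus_equality) (use that in \<open>simp_all add: P_simps V_iff polys_on_uminus\<close>)
      then show ?thesis using that by (simp add: V_iff polys_on_uminus poly_eval.hom_uminus)
    qed
  qed (auto simp: V_iff P_simps polys_on_add poly_eval.hom_add)
qed (auto simp: V_iff P_simps polys_on_mult poly_eval.hom_mult)

interpretation V: ideal V P by (rule ideal_V)

lemma cf_eq: "f \<in> polys_on I \<Longrightarrow> g \<in> polys_on I \<Longrightarrow> cf f = cf g \<longleftrightarrow> (\<forall>a\<in>X. ev a f = ev a g)"
proof -
  assume f: "f \<in> polys_on I" and g: "g \<in> polys_on I"
  have "f - g \<in> polys_on I" using polys_on_add[OF f polys_on_uminus[OF g]] by simp
  then show ?thesis
    using P.quotient_eq_iff_same_a_r_cos[OF ideal_V, of f g] f g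
    by (simp add: coord_fun_def P_simps P_minus V_iff poly_eval.hom_minus)
qed

lemma R_ops:
  assumes "f \<in> polys_on I" "g \<in> polys_on I"
  shows "cf f \<otimes>\<^bsub>R\<^esub> cf g = cf (f * g)" "cf f \<oplus>\<^bsub>R\<^esub> cf g = cf (f + g)"
  using V.rcoset_mult_add[of f g] V.a_rcos_sum[of f g] assms
  by (simp_all add: coord_ring_def coord_fun_def FactRing_def P_simps)

lemma R_consts: "\<one>\<^bsub>R\<^esub> = cf 1" "\<zero>\<^bsub>R\<^esub> = cf 0" "carrier R = cf ` polys_on I"
proof -
  show "\<one>\<^bsub>R\<^esub> = cf 1" by (simp add: coord_ring_def coord_fun_def FactRing_def P_simps)
  have "V +>\<^bsub>P\<^esub> \<zero>\<^bsub>P\<^esub> = V" by (rule P.a_coset_add_zero) (auto simp: V_iff P_simps)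
  then show "\<zero>\<^bsub>R\<^esub> = cf 0" by (simp add: coord_ring_def coord_fun_def FactRing_def P_simps)
  show "carrier R = cf ` polys_on I"
    by (auto simp: coord_ring_def coord_fun_def FactRing_def A_RCOSETS_def' P_simps)
qed

abbreviation (input) "dens \<equiv> nonvanishing I X"

lemmas dens_def = nonvanishing_def

lemma dens_polys: "q \<in> dens \<Longrightarrow> q \<in> polys_on I"
  by (simp add: dens_def)

lemma dens_1: "1 \<in> dens"
  using nonempty by (auto simp: dens_def polys_on_1 poly_eval.hom_one)

lemma dens_mult: "p \<in> dens \<Longrightarrow> q \<in> dens \<Longrightarrow> p * q \<in> dens"
  using irred[of p q] by (auto simp: dens_def polys_on_mult poly_eval.hom_mult)

text \<open>Irreducibility in the form of a cancellation law for values on \<open>X\<close>; it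
  replaces computations with cosets.\<close>

lemma cancel:
  assumes "q \<in> dens" "f \<in> polys_on I" "g \<in> polys_on I" "\<And>a. a \<in> X \<Longrightarrow> ev a q * ev a f = ev a q * ev a g"
  shows "\<forall>a\<in>X. ev a f = ev a g"
proof -
  have d: "f - g \<in> polys_on I" using polys_on_add[OF assms(2) polys_on_uminus[OF assms(3)]] by simp
  have "(\<forall>a\<in>X. ev a q = 0) \<or> (\<forall>a\<in>X. ev a (f - g) = 0)"
    by (rule irred[OF dens_polys[OF assms(1)] d]) (simp add: poly_eval.hom_minus right_diff_distrib assms(4))
  then show ?thesis using assms(1) by (auto simp: dens_def poly_eval.hom_minus)
qed

text \<open>Fractions are named by representing polynomials, so that equality and the field
  operations become identities between values on \<open>X\<close>.\<close>

definition Fr :: "('v, complex) mpoly \<Rightarrow> ('v, complex) mpoly \<Rightarrow> (('v, complex) mpoly set \<times> ('v, complex) mpoly set) set" where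
  "Fr f q = fraction R (cf f) (cf q)"

lemma nonzero_iff: "q \<in> polys_on I \<Longrightarrow> cf q \<noteq> \<zero>\<^bsub>R\<^esub> \<longleftrightarrow> q \<in> dens"
  by (simp add: R_consts cf_eq polys_on_0 dens_def poly_eval.hom_zero)

lemma mem_Fr:
  assumes "f \<in> polys_on I" "q \<in> polys_on I"
  shows "z \<in> Fr f q \<longleftrightarrow> (\<exists>g p. z = (cf g, cf p) \<and> g \<in> polys_on I \<and> p \<in> dens \<and> (\<forall>a\<in>X. ev a f * ev a p = ev a g * ev a q))"
proof
  assume "z \<in> Fr f q"
  then obtain g p where z: "z = (cf g, cf p)" "g \<in> polys_on I" "p \<in> polys_on I" "cf p \<noteq> \<zero>\<^bsub>R\<^esub>"
      "cf f \<otimes>\<^bsub>R\<^esub> cf p = cf g \<otimes>\<^bsub>R\<^esub> cf q"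
    unfolding Fr_def fraction_def R_consts(3) by blast
  have "cf (f * p) = cf (g * q)" using z(5) R_ops assms z(2,3) by simp
  then have "\<forall>a\<in>X. ev a f * ev a p = ev a g * ev a q"
    using cf_eq[of "f * p" "g * q"] assms z(2,3) by (simp add: polys_on_mult poly_eval.hom_mult)
  then show "\<exists>g p. z = (cf g, cf p) \<and> g \<in> polys_on I \<and> p \<in> dens \<and> (\<forall>a\<in>X. ev a f * ev a p = ev a g * ev a q)"
    using z nonzero_iff[of p] by blast
next
  assume "\<exists>g p. z = (cf g, cf p) \<and> g \<in> polys_on I \<and> p \<in> dens \<and> (\<forall>a\<in>X. ev a f * ev a p = ev a g * ev a q)"
  then obtain g p where z: "z = (cf g, cf p)" "g \<in> polys_on I" "p \<in> dens" "\<forall>a\<in>X. ev a f * ev a p = ev a g * ev a q" by blast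
  have "cf (f * p) = cf (g * q)"
    using cf_eq[of "f * p" "g * q"] assms z dens_polys[OF z(3)] by (simp add: polys_on_mult poly_eval.hom_mult)
  then show "z \<in> Fr f q"
    using z assms dens_polys[OF z(3)] nonzero_iff[of p] by (simp add: Fr_def fraction_def R_ops) (simp add: R_consts(3))
qed

lemma Fr_eq:
  assumes "f \<in> polys_on I" "q \<in> dens" "f' \<in> polys_on I" "q' \<in> dens"
  shows "Fr f q = Fr f' q' \<longleftrightarrow> (\<forall>a\<in>X. ev a f * ev a q' = ev a f' * ev a q)"
proof
  assume "Fr f q = Fr f' q'"
  moreover have "(cf f, cf q) \<in> Fr f q"
    using mem_Fr[OF assms(1) dens_polys[OF assms(2)], of "(cf f, cf q)"] assms(1,2) by blast
  ultimately have "(cf f, cf q) \<in> Fr f' q'" by simp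
  then obtain g p where g: "cf f = cf g" "cf q = cf p" "g \<in> polys_on I" "p \<in> dens"
      "\<forall>a\<in>X. ev a f' * ev a p = ev a g * ev a q'"
    unfolding mem_Fr[OF assms(3) dens_polys[OF assms(4)]] by blast
  then show "\<forall>a\<in>X. ev a f * ev a q' = ev a f' * ev a q"
    using cf_eq[OF assms(1) g(3)] cf_eq[OF dens_polys[OF assms(2)] dens_polys[OF g(4)]] by simp
next
  have main: "Fr f q \<subseteq> Fr f' q'"
    if fq: "f \<in> polys_on I" "q \<in> dens" and fq': "f' \<in> polys_on I" "q' \<in> dens" and eq: "\<forall>a\<in>X. ev a f * ev a q' = ev a f' * ev a q"
    for f q f' q'
  proof
    fix z assume "z \<in> Fr f q"
    then obtain g p where z: "z = (cf g, cf p)" "g \<in> polys_on I" "p \<in> dens" "\<forall>a\<in>X. ev a f * ev a p = ev a g * ev a q"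
      unfolding mem_Fr[OF fq(1) dens_polys[OF fq(2)]] by blast
    have "\<forall>a\<in>X. ev a (f' * p) = ev a (g * q')"
    proof (rule cancel[OF fq(2)])
      show "f' * p \<in> polys_on I" "g * q' \<in> polys_on I" using fq fq' z dens_polys by (auto intro: polys_on_mult)
      fix a assume a: "a \<in> X"
      have "ev a q * (ev a f' * ev a p) = (ev a f * ev a q') * ev a p" using eq a by (simp add: mult_ac)
      also have "\<dots> = (ev a f * ev a p) * ev a q'" by (simp add: mult_ac)
      also have "\<dots> = ev a q * (ev a g * ev a q')" using z(4) a by (simp add: mult_ac)
      finally show "ev a q * ev a (f' * p) = ev a q * ev a (g * q')" by (simp add: poly_eval.hom_mult)
    qed
    then show "z \<in> Fr f' q'"
      unfolding mem_Fr[OF fq'(1) dens_polys[OF fq'(2)]] using z by (auto simp: poly_eval.hom_mult)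
  qed
  assume "\<forall>a\<in>X. ev a f * ev a q' = ev a f' * ev a q"
  then show "Fr f q = Fr f' q'" using main[of f q f' q'] main[of f' q' f q] assms by (simp add: subset_antisym)
qed

text \<open>The unions in the field operations are over a nonempty set of representatives with a
  constant value, and hence equal that value.\<close>

lemma Fr_UN:
  assumes "f \<in> polys_on I" "q \<in> dens"
    and "\<And>g p. g \<in> polys_on I \<Longrightarrow> p \<in> dens \<Longrightarrow> Fr g p = Fr f q \<Longrightarrow> H (cf g) (cf p) = Z"
  shows "(\<Union>(a, b)\<in>Fr f q. H a b) = Z"
proof -
  have "H a b = Z" if ab: "(a, b) \<in> Fr f q" for a b
  proof -
    obtain g p where g: "a = cf g" "b = cf p" "g \<in> polys_on I" "p \<in> dens" "\<forall>a\<in>X. ev a f * ev a p = ev a g * ev a q"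
      using ab unfolding mem_Fr[OF assms(1) dens_polys[OF assms(2)]] by blast
    have "Fr g p = Fr f q" using Fr_eq[OF g(3,4) assms(1,2)] g(5) by simp
    then show ?thesis using assms(3)[OF g(3,4)] g(1,2) by simp
  qed
  moreover have "(cf f, cf q) \<in> Fr f q"
    using mem_Fr[OF assms(1) dens_polys[OF assms(2)], of "(cf f, cf q)"] assms(1,2) by blast
  ultimately show ?thesis by fastforce
qed

lemma carrier_F: "carrier F = {Fr f q | f q. f \<in> polys_on I \<and> q \<in> dens}"
proof -
  have "carrier F = {fraction R a b | a b. a \<in> carrier R \<and> b \<in> carrier R - {\<zero>\<^bsub>R\<^esub>}}"
    by (simp add: function_field_def frac_field_def)
  also have "\<dots> = {Fr f q | f q. f \<in> polys_on I \<and> q \<in> dens}"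
  proof (intro subset_antisym subsetI)
    fix z assume "z \<in> {fraction R a b | a b. a \<in> carrier R \<and> b \<in> carrier R - {\<zero>\<^bsub>R\<^esub>}}"
    then obtain a b where z: "z = fraction R a b" "a \<in> carrier R" "b \<in> carrier R" "b \<noteq> \<zero>\<^bsub>R\<^esub>"
      unfolding mem_Collect_eq Diff_iff singleton_iff by (elim exE conjE)
    obtain f where f: "a = cf f" "f \<in> polys_on I" using z(2) unfolding R_consts(3) by (elim imageE)
    obtain q where q: "b = cf q" "q \<in> polys_on I" using z(3) unfolding R_consts(3) by (elim imageE)
    have "q \<in> dens" using nonzero_iff[OF q(2)] z(4) q(1) by simp
    then show "z \<in> {Fr f q | f q. f \<in> polys_on I \<and> q \<in> dens}"
      unfolding mem_Collect_eq by (intro exI[of _ f] exI[of _ q] conjI f(2)) (simp add: Fr_def z(1) f(1) q(1))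
  next
    fix z assume "z \<in> {Fr f q | f q. f \<in> polys_on I \<and> q \<in> dens}"
    then obtain f q where z: "z = Fr f q" "f \<in> polys_on I" "q \<in> dens"
      unfolding mem_Collect_eq by (elim exE conjE)
    have "cf q \<in> carrier R - {\<zero>\<^bsub>R\<^esub>}"
      using nonzero_iff[OF dens_polys[OF z(3)]] z(3) dens_polys[OF z(3)] by (simp add: R_consts(3))
    moreover have "cf f \<in> carrier R" using z(2) by (simp add: R_consts(3))
    ultimately show "z \<in> {fraction R a b | a b. a \<in> carrier R \<and> b \<in> carrier R - {\<zero>\<^bsub>R\<^esub>}}"
      unfolding mem_Collect_eq by (intro exI[of _ "cf f"] exI[of _ "cf q"] conjI) (simp add: z(1) Fr_def)
  qed
  finally show ?thesis .
qed

lemma F_mult: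
  assumes "f \<in> polys_on I" "q \<in> dens" "g \<in> polys_on I" "p \<in> dens"
  shows "Fr f q \<otimes>\<^bsub>F\<^esub> Fr g p = Fr (f * g) (q * p)"
proof -
  have "Fr f q \<otimes>\<^bsub>F\<^esub> Fr g p = (\<Union>(a, b)\<in>Fr f q. \<Union>(c, d)\<in>Fr g p. fraction R (a \<otimes>\<^bsub>R\<^esub> c) (b \<otimes>\<^bsub>R\<^esub> d))"
    by (simp add: function_field_def frac_field_def)
  also have "\<dots> = Fr (f * g) (q * p)"
  proof (rule Fr_UN[OF assms(1,2)])
    fix f1 q1 assume 1: "f1 \<in> polys_on I" "q1 \<in> dens" "Fr f1 q1 = Fr f q"
    show "(\<Union>(c, d)\<in>Fr g p. fraction R (cf f1 \<otimes>\<^bsub>R\<^esub> c) (cf q1 \<otimes>\<^bsub>R\<^esub> d)) = Fr (f * g) (q * p)"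
    proof (rule Fr_UN[OF assms(3,4)])
      fix f2 q2 assume 2: "f2 \<in> polys_on I" "q2 \<in> dens" "Fr f2 q2 = Fr g p"
      have "\<forall>a\<in>X. ev a (f1 * f2) * ev a (q * p) = ev a (f * g) * ev a (q1 * q2)"
      proof
        fix a assume a: "a \<in> X"
        have "ev a f1 * ev a q = ev a f * ev a q1" "ev a f2 * ev a p = ev a g * ev a q2"
          using 1 2 a assms by (simp_all add: Fr_eq)
        then show "ev a (f1 * f2) * ev a (q * p) = ev a (f * g) * ev a (q1 * q2)"
          unfolding poly_eval.hom_mult by (rule cross_mult)
      qed
      then have "Fr (f1 * f2) (q1 * q2) = Fr (f * g) (q * p)"
        using 1 2 assms by (subst Fr_eq) (simp_all add: polys_on_mult dens_mult)
      then show "fraction R (cf f1 \<otimes>\<^bsub>R\<^esub> cf f2) (cf q1 \<otimes>\<^bsub>R\<^esub> cf q2) = Fr (f * g) (q * p)"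
        using 1 2 by (simp add: R_ops dens_polys Fr_def)
    qed
  qed
  finally show ?thesis .
qed

lemma F_add:
  assumes "f \<in> polys_on I" "q \<in> dens" "g \<in> polys_on I" "p \<in> dens"
  shows "Fr f q \<oplus>\<^bsub>F\<^esub> Fr g p = Fr (f * p + g * q) (q * p)"
proof -
  have "Fr f q \<oplus>\<^bsub>F\<^esub> Fr g p = (\<Union>(a, b)\<in>Fr f q. \<Union>(c, d)\<in>Fr g p.
      fraction R (a \<otimes>\<^bsub>R\<^esub> d \<oplus>\<^bsub>R\<^esub> c \<otimes>\<^bsub>R\<^esub> b) (b \<otimes>\<^bsub>R\<^esub> d))"
    by (simp add: function_field_def frac_field_def)
  also have "\<dots> = Fr (f * p + g * q) (q * p)"
  proof (rule Fr_UN[OF assms(1,2)])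
    fix f1 q1 assume 1: "f1 \<in> polys_on I" "q1 \<in> dens" "Fr f1 q1 = Fr f q"
    show "(\<Union>(c, d)\<in>Fr g p. fraction R (cf f1 \<otimes>\<^bsub>R\<^esub> d \<oplus>\<^bsub>R\<^esub> c \<otimes>\<^bsub>R\<^esub> cf q1) (cf q1 \<otimes>\<^bsub>R\<^esub> d)) = Fr (f * p + g * q) (q * p)"
    proof (rule Fr_UN[OF assms(3,4)])
      fix f2 q2 assume 2: "f2 \<in> polys_on I" "q2 \<in> dens" "Fr f2 q2 = Fr g p"
      have "\<forall>a\<in>X. ev a (f1 * q2 + f2 * q1) * ev a (q * p) = ev a (f * p + g * q) * ev a (q1 * q2)"
      proof
        fix a assume a: "a \<in> X"
        have "ev a f1 * ev a q = ev a f * ev a q1" "ev a f2 * ev a p = ev a g * ev a q2"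
          using 1 2 a assms by (simp_all add: Fr_eq)
        then show "ev a (f1 * q2 + f2 * q1) * ev a (q * p) = ev a (f * p + g * q) * ev a (q1 * q2)"
          unfolding poly_eval.hom_mult poly_eval.hom_add by (rule cross_add)
      qed
      then have "Fr (f1 * q2 + f2 * q1) (q1 * q2) = Fr (f * p + g * q) (q * p)"
        using 1 2 assms dens_polys by (subst Fr_eq) (simp_all add: polys_on_mult polys_on_add dens_mult)
      then show "fraction R (cf f1 \<otimes>\<^bsub>R\<^esub> cf q2 \<oplus>\<^bsub>R\<^esub> cf f2 \<otimes>\<^bsub>R\<^esub> cf q1) (cf q1 \<otimes>\<^bsub>R\<^esub> cf q2) = Fr (f * p + g * q) (q * p)"
        using 1 2 by (simp add: R_ops dens_polys Fr_def polys_on_mult)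
    qed
  qed
  finally show ?thesis .
qed

lemma F_consts: "\<zero>\<^bsub>F\<^esub> = Fr 0 1" "\<one>\<^bsub>F\<^esub> = Fr 1 1"
  by (simp_all add: function_field_def frac_field_def Fr_def R_consts)

lemma F_cases:
  assumes "x \<in> carrier F"
  obtains f q where "x = Fr f q" "f \<in> polys_on I" "q \<in> dens"
  using assms unfolding carrier_F by blast

lemma F_mem: "f \<in> polys_on I \<Longrightarrow> q \<in> dens \<Longrightarrow> Fr f q \<in> carrier F"
  unfolding carrier_F by blast

lemmas closed = polys_on_mult polys_on_add polys_on_uminus polys_on_0 polys_on_1 dens_polys dens_mult dens_1
lemmas evs = poly_eval.hom_mult poly_eval.hom_add poly_eval.hom_uminus poly_eval.hom_zero poly_eval.hom_one

lemma Fr_zero_iff: "f \<in> polys_on I \<Longrightarrow> q \<in> dens \<Longrightarrow> Fr f q = \<zero>\<^bsub>F\<^esub> \<longleftrightarrow> (\<forall>a\<in>X. ev a f = 0)"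
  by (simp add: F_consts Fr_eq closed evs)

lemma field_F: "field F"
proof -
  have "cring F"
  proof (rule cringI)
    show "abelian_group F"
    proof (rule abelian_groupI)
      fix x y assume X1: "x \<in> carrier F" and X2: "y \<in> carrier F"
      obtain f q where x: "x = Fr f q" "f \<in> polys_on I" "q \<in> dens" using X1 by (rule F_cases)
      obtain g p where y: "y = Fr g p" "g \<in> polys_on I" "p \<in> dens" using X2 by (rule F_cases)
      from x y show "x \<oplus>\<^bsub>F\<^esub> y \<in> carrier F" "x \<oplus>\<^bsub>F\<^esub> y = y \<oplus>\<^bsub>F\<^esub> x"
        by (simp_all add: F_add F_mem closed Fr_eq evs algebra_simps)
    next
      show "\<zero>\<^bsub>F\<^esub> \<in> carrier F" by (simp add: F_consts F_mem closed)
    next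
      fix x y z assume X1: "x \<in> carrier F" and X2: "y \<in> carrier F" and X3: "z \<in> carrier F"
      obtain f q where x: "x = Fr f q" "f \<in> polys_on I" "q \<in> dens" using X1 by (rule F_cases)
      obtain g p where y: "y = Fr g p" "g \<in> polys_on I" "p \<in> dens" using X2 by (rule F_cases)
      obtain h r where z: "z = Fr h r" "h \<in> polys_on I" "r \<in> dens" using X3 by (rule F_cases)
      from x y z show "x \<oplus>\<^bsub>F\<^esub> y \<oplus>\<^bsub>F\<^esub> z = x \<oplus>\<^bsub>F\<^esub> (y \<oplus>\<^bsub>F\<^esub> z)"
        by (simp add: F_add closed Fr_eq evs algebra_simps)
    next
      fix x assume "x \<in> carrier F"
      then obtain f q where x: "x = Fr f q" "f \<in> polys_on I" "q \<in> dens" by (rule F_cases)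
      then show "\<zero>\<^bsub>F\<^esub> \<oplus>\<^bsub>F\<^esub> x = x" by (simp add: F_add F_consts closed)
      have "Fr (- f) q \<oplus>\<^bsub>F\<^esub> x = \<zero>\<^bsub>F\<^esub>" using x by (simp add: F_add Fr_zero_iff closed evs)
      moreover have "Fr (- f) q \<in> carrier F" using x by (simp add: F_mem closed)
      ultimately show "\<exists>y\<in>carrier F. y \<oplus>\<^bsub>F\<^esub> x = \<zero>\<^bsub>F\<^esub>" by blast
    qed
    show "comm_monoid F"
    proof (rule comm_monoidI)
      fix x y assume X1: "x \<in> carrier F" and X2: "y \<in> carrier F"
      obtain f q where x: "x = Fr f q" "f \<in> polys_on I" "q \<in> dens" using X1 by (rule F_cases)
      obtain g p where y: "y = Fr g p" "g \<in> polys_on I" "p \<in> dens" using X2 by (rule F_cases)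
      from x y show "x \<otimes>\<^bsub>F\<^esub> y \<in> carrier F" "x \<otimes>\<^bsub>F\<^esub> y = y \<otimes>\<^bsub>F\<^esub> x"
        by (simp_all add: F_mult F_mem closed mult.commute)
    next
      show "\<one>\<^bsub>F\<^esub> \<in> carrier F" by (simp add: F_consts F_mem closed)
    next
      fix x y z assume X1: "x \<in> carrier F" and X2: "y \<in> carrier F" and X3: "z \<in> carrier F"
      obtain f q where x: "x = Fr f q" "f \<in> polys_on I" "q \<in> dens" using X1 by (rule F_cases)
      obtain g p where y: "y = Fr g p" "g \<in> polys_on I" "p \<in> dens" using X2 by (rule F_cases)
      obtain h r where z: "z = Fr h r" "h \<in> polys_on I" "r \<in> dens" using X3 by (rule F_cases)
      from x y z show "x \<otimes>\<^bsub>F\<^esub> y \<otimes>\<^bsub>F\<^esub> z = x \<otimes>\<^bsub>F\<^esub> (y \<otimes>\<^bsub>F\<^esub> z)"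
        by (simp add: F_mult closed mult.assoc)
    next
      fix x assume "x \<in> carrier F"
      then obtain f q where "x = Fr f q" "f \<in> polys_on I" "q \<in> dens" by (rule F_cases)
      then show "\<one>\<^bsub>F\<^esub> \<otimes>\<^bsub>F\<^esub> x = x" by (simp add: F_mult F_consts closed)
    qed
    fix x y z assume X1: "x \<in> carrier F" and X2: "y \<in> carrier F" and X3: "z \<in> carrier F"
    obtain f q where x: "x = Fr f q" "f \<in> polys_on I" "q \<in> dens" using X1 by (rule F_cases)
    obtain g p where y: "y = Fr g p" "g \<in> polys_on I" "p \<in> dens" using X2 by (rule F_cases)
    obtain h r where z: "z = Fr h r" "h \<in> polys_on I" "r \<in> dens" using X3 by (rule F_cases)
    from x y z show "(x \<oplus>\<^bsub>F\<^esub> y) \<otimes>\<^bsub>F\<^esub> z = x \<otimes>\<^bsub>F\<^esub> z \<oplus>\<^bsub>F\<^esub> y \<otimes>\<^bsub>F\<^esub> z"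
      by (simp add: F_mult F_add closed Fr_eq evs algebra_simps)
  qed
  then interpret F: cring F .
  show ?thesis
  proof (rule F.cring_fieldI2)
    show "\<zero>\<^bsub>F\<^esub> \<noteq> \<one>\<^bsub>F\<^esub>"
      using Fr_zero_iff[OF polys_on_1 dens_1] nonempty by (auto simp: F_consts(2)[symmetric] evs)
    fix x assume x: "x \<in> carrier F" "x \<noteq> \<zero>\<^bsub>F\<^esub>"
    obtain f q where f: "x = Fr f q" "f \<in> polys_on I" "q \<in> dens" using x(1) by (rule F_cases)
    have fd: "f \<in> dens" using x(2) f Fr_zero_iff[OF f(2,3)] by (auto simp: dens_def)
    have "x \<otimes>\<^bsub>F\<^esub> Fr q f = \<one>\<^bsub>F\<^esub>"
      using f fd by (simp add: F_mult F_consts Fr_eq closed evs mult.commute)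
    moreover have "Fr q f \<in> carrier F" using f fd by (simp add: F_mem closed)
    ultimately show "\<exists>y\<in>carrier F. x \<otimes>\<^bsub>F\<^esub> y = \<one>\<^bsub>F\<^esub>" by blast
  qed
qed

interpretation F: field F by (rule field_F)

context
  fixes T :: "'v set"
  assumes T: "T \<subseteq> I" and dominant: "\<And>g. g \<in> polys_on T \<Longrightarrow> g \<noteq> 0 \<Longrightarrow> g \<in> dens"
begin

lemma pullback_eq: "pullback_field I X T = {Fr f g | f g. f \<in> polys_on T \<and> g \<in> polys_on T - {0}}"
  by (simp add: pullback_field_def Fr_def)

lemma pullback_mem: "f \<in> polys_on T \<Longrightarrow> g \<in> polys_on T \<Longrightarrow> g \<noteq> 0 \<Longrightarrow> Fr f g \<in> pullback_field I X T"
  unfolding pullback_eq by blast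

text \<open>Dominance makes every nonzero polynomial in the variables \<open>T\<close> nonzero on
  \<open>X\<close>, hence a legitimate denominator and, as a numerator, invertible.\<close>

lemma subfield_pullback: "subfield (pullback_field I X T) F"
proof (rule F.subfieldI'[OF F.subringI])
  note TI = subsetD[OF polys_on_mono[OF T]]
  have cases: "\<exists>f g. x = Fr f g \<and> f \<in> polys_on T \<and> g \<in> polys_on T \<and> g \<noteq> 0 \<and> f \<in> polys_on I \<and> g \<in> dens"
    if "x \<in> pullback_field I X T" for x
    using that TI dominant unfolding pullback_eq by blast
  show "pullback_field I X T \<subseteq> carrier F" using cases F_mem by blast
  show "\<one>\<^bsub>F\<^esub> \<in> pullback_field I X T" by (simp add: F_consts pullback_mem polys_on_1)
  fix x assume x: "x \<in> pullback_field I X T"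
  obtain f g where f: "x = Fr f g" "f \<in> polys_on T" "g \<in> polys_on T" "g \<noteq> 0" "f \<in> polys_on I" "g \<in> dens"
    using cases[OF x] by (elim exE conjE)
  have "\<ominus>\<^bsub>F\<^esub> x = Fr (- f) g"
    by (rule F.minus_equality) (use f in \<open>simp_all add: F_mem F_add Fr_zero_iff closed evs\<close>)
  then show "\<ominus>\<^bsub>F\<^esub> x \<in> pullback_field I X T" using f by (simp add: pullback_mem polys_on_uminus)
  fix y assume y: "y \<in> pullback_field I X T"
  obtain f' g' where f': "y = Fr f' g'" "f' \<in> polys_on T" "g' \<in> polys_on T" "g' \<noteq> 0" "f' \<in> polys_on I" "g' \<in> dens"
    using cases[OF y] by (elim exE conjE)
  have "g * g' \<noteq> 0" using dens_mult[OF f(6) f'(6)] by (auto simp: dens_def poly_eval.hom_zero)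
  then show "x \<otimes>\<^bsub>F\<^esub> y \<in> pullback_field I X T" "x \<oplus>\<^bsub>F\<^esub> y \<in> pullback_field I X T"
    using f f' by (simp_all add: F_mult F_add pullback_mem polys_on_mult polys_on_add)
next
  note TI = subsetD[OF polys_on_mono[OF T]]
  fix x assume x: "x \<in> pullback_field I X T - {\<zero>\<^bsub>F\<^esub>}"
  then obtain f g where f: "x = Fr f g" "f \<in> polys_on T" "g \<in> polys_on T" "g \<noteq> 0"
    unfolding pullback_eq by blast
  have g: "g \<in> dens" "f \<in> polys_on I" using f TI dominant by blast+
  have "f \<noteq> 0" using x f g Fr_zero_iff[of f g] by (auto simp: evs)
  then have fd: "f \<in> dens" using dominant f by blast
  have "inv\<^bsub>F\<^esub> x = Fr g f"
    by (rule F.comm_inv_char) (use f g fd in \<open>simp_all add: F_mem F_mult F_consts Fr_eq closed evs mult.commute\<close>)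
  then show "inv\<^bsub>F\<^esub> x \<in> pullback_field I X T" using f \<open>f \<noteq> 0\<close> by (simp add: pullback_mem)
qed

lemma combine_Fr:
  assumes "\<And>k. k \<in> set ks \<Longrightarrow> c k \<in> polys_on I" "\<And>k. k \<in> set ks \<Longrightarrow> g k \<in> polys_on I" "q \<in> dens"
  shows "F.combine (map (\<lambda>k. Fr (c k) 1) ks) (map (\<lambda>k. Fr (g k) q) ks) = Fr (\<Sum>k\<leftarrow>ks. c k * g k) q
    \<and> (\<Sum>k\<leftarrow>ks. c k * g k) \<in> polys_on I"
  using assms
proof (induction ks)
  case Nil
  then show ?case by (simp add: F_consts Fr_eq closed evs)
next
  case (Cons k ks)
  have "F.combine (map (\<lambda>k. Fr (c k) 1) ks) (map (\<lambda>k. Fr (g k) q) ks) = Fr (\<Sum>k\<leftarrow>ks. c k * g k) q"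
    "(\<Sum>k\<leftarrow>ks. c k * g k) \<in> polys_on I" using Cons by auto
  then show ?case using Cons.prems by (simp add: F_mult F_add Fr_eq closed evs algebra_simps)
qed

lemma common_denominator:
  fixes m :: nat
  assumes "\<And>k. k < m \<Longrightarrow> y k \<in> carrier F"
  shows "\<exists>g q. q \<in> dens \<and> (\<forall>k<m. g k \<in> polys_on I \<and> y k = Fr (g k) q)"
  using assms
proof (induction m)
  case 0
  show ?case using dens_1 by auto
next
  case (Suc m)
  have "\<exists>g q. q \<in> dens \<and> (\<forall>k<m. g k \<in> polys_on I \<and> y k = Fr (g k) q)" by (rule Suc.IH) (simp add: Suc.prems)
  then obtain g q where g: "q \<in> dens" "\<And>k. k < m \<Longrightarrow> g k \<in> polys_on I" "\<And>k. k < m \<Longrightarrow> y k = Fr (g k) q" by blast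
  obtain f p where f: "y m = Fr f p" "f \<in> polys_on I" "p \<in> dens" using Suc.prems[of m] by (auto elim: F_cases)
  have "(if k = m then f * q else g k * p) \<in> polys_on I \<and> y k = Fr (if k = m then f * q else g k * p) (q * p)"
    if "k < Suc m" for k
  proof (cases "k = m")
    case True
    then show ?thesis using f g(1) by (simp add: Fr_eq closed evs mult_ac)
  next
    case False
    then show ?thesis using that f g(1) g(2,3)[of k] by (simp add: Fr_eq closed evs mult_ac)
  qed
  then show ?case using dens_mult[OF g(1) f(3)] by (intro exI[of _ "\<lambda>k. if k = m then f * q else g k * p"] exI[of _ "q * p"]) blast
qed

text \<open>Over a common denominator, relations between polynomials become relations between
  elements of the function field, so independent lists have at most \<open>N\<close> members. A
  longest one spans, and its length is the dimension.\<close>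

lemma dim_le:
  assumes rel: "\<And>g. (\<And>k. k \<le> N \<Longrightarrow> g k \<in> polys_on I) \<Longrightarrow> \<exists>c. (\<exists>k\<le>N. c k \<noteq> 0) \<and> (\<forall>k. c k \<in> polys_on T) \<and>
      (\<forall>a\<in>X. (\<Sum>k\<le>N. ev a (c k) * ev a (g k)) = 0)"
  shows "ring.dim F (pullback_field I X T) (carrier F) \<le> N"
proof -
  let ?K = "pullback_field I X T"
  note K = subfield_pullback
  note TI = subsetD[OF polys_on_mono[OF T]]
  have long: "length Us \<le> N" if Us: "F.independent ?K Us" for Us
  proof (rule ccontr)
    assume "\<not> length Us \<le> N"
    then have len: "Suc N \<le> length Us" by simp
    \<comment> \<open>The number of functions is cut to exactly \<open>N + 1\<close>, the number to
      which the hypothesis applies.\<close>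
    define Vs where "Vs = drop (length Us - Suc N) Us"
    have Vs: "F.independent ?K Vs" "length Vs = Suc N"
      using F.independent_split(1)[OF K, of "take (length Us - Suc N) Us" Vs] Us len by (simp_all add: Vs_def)
    have "set Vs \<subseteq> carrier F" by (rule F.independent_in_carrier[OF Vs(1)])
    then have VsF: "Vs ! k \<in> carrier F" if "k < Suc N" for k using that Vs(2) by (metis nth_mem subsetD)
    have "\<exists>g q. q \<in> dens \<and> (\<forall>k<Suc N. g k \<in> polys_on I \<and> Vs ! k = Fr (g k) q)"
      by (rule common_denominator) (rule VsF)
    then obtain g q where g: "q \<in> dens"
      "\<And>k. k < Suc N \<Longrightarrow> g k \<in> polys_on I" "\<And>k. k < Suc N \<Longrightarrow> Vs ! k = Fr (g k) q"
      by (elim exE conjE) (rule that, auto)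
    have "\<exists>c. (\<exists>k\<le>N. c k \<noteq> 0) \<and> (\<forall>k. c k \<in> polys_on T) \<and> (\<forall>a\<in>X. (\<Sum>k\<le>N. ev a (c k) * ev a (g k)) = 0)"
      by (rule rel) (use g(2) in simp)
    then obtain c k0 where c: "k0 \<le> N" "c k0 \<noteq> 0" "\<And>k. c k \<in> polys_on T"
      "\<And>a. a \<in> X \<Longrightarrow> (\<Sum>k\<le>N. ev a (c k) * ev a (g k)) = 0" by (elim exE conjE) (rule that, auto)
    let ?ks = "[0..<Suc N]"
    have VsFr: "Vs = map (\<lambda>k. Fr (g k) q) ?ks" by (rule nth_equalityI) (use Vs(2) g(3) in \<open>simp_all del: upt_Suc\<close>)
    have cI: "c k \<in> polys_on I" for k by (rule TI[OF c(3)])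
    have comb: "F.combine (map (\<lambda>k. Fr (c k) 1) ?ks) Vs = Fr (\<Sum>k\<leftarrow>?ks. c k * g k) q"
      "(\<Sum>k\<leftarrow>?ks. c k * g k) \<in> polys_on I"
      using combine_Fr[of ?ks c g q] cI g(1,2) unfolding VsFr by (simp_all del: upt_Suc)
    have "ev a (\<Sum>k\<leftarrow>?ks. c k * g k) = 0" if "a \<in> X" for a
      using c(4)[OF that] by (simp del: upt_Suc add: sum_set_upt_conv_sum_list_nat[symmetric] poly_eval.hom_sum
          poly_eval.hom_mult atLeast0LessThan lessThan_Suc_atMost)
    then have "F.combine (map (\<lambda>k. Fr (c k) 1) ?ks) Vs = \<zero>\<^bsub>F\<^esub>"
      unfolding comb(1) using Fr_zero_iff[OF comb(2) g(1)] by simp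
    moreover have "set (map (\<lambda>k. Fr (c k) 1) ?ks) \<subseteq> ?K"
      using c(3) by (auto intro!: pullback_mem polys_on_1)
    ultimately have "set (take (length Vs) (map (\<lambda>k. Fr (c k) 1) ?ks)) \<subseteq> {\<zero>\<^bsub>F\<^esub>}"
      using F.independent_imp_trivial_combine[OF K Vs(1)] by blast
    moreover have "set (take (length Vs) (map (\<lambda>k. Fr (c k) 1) ?ks)) = (\<lambda>k. Fr (c k) 1) ` {0..<Suc N}"
      by (simp add: Vs(2) del: upt_Suc)
    moreover have "Fr (c k0) 1 \<in> (\<lambda>k. Fr (c k) 1) ` {0..<Suc N}" by (rule imageI) (use c(1) in simp)
    ultimately have "Fr (c k0) 1 = \<zero>\<^bsub>F\<^esub>" by (simp only:) (drule (1) subsetD, erule singletonD)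
    then have "\<forall>a\<in>X. ev a (c k0) = 0" using Fr_zero_iff[OF cI dens_1] by simp
    moreover have "c k0 \<in> dens" by (rule dominant[OF c(3,2)])
    ultimately show False by (auto simp: dens_def)
  qed
  define m where "m = (GREATEST m. \<exists>Us. F.independent ?K Us \<and> length Us = m)"
  have "\<exists>Us. F.independent ?K Us \<and> length Us = m" unfolding m_def
    by (rule GreatestI_nat[of _ 0 N]) (use long F.li_Nil in auto)
  then obtain Us where Us: "F.independent ?K Us" "length Us = m" by blast
  have "F.Span ?K Us = carrier F"
  proof
    show "F.Span ?K Us \<subseteq> carrier F" by (rule F.Span_in_carrier) (use subfieldE(3)[OF K] F.independent_in_carrier[OF Us(1)] in auto)
    show "carrier F \<subseteq> F.Span ?K Us"
    proof
      fix u assume u: "u \<in> carrier F"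
      show "u \<in> F.Span ?K Us"
      proof (rule ccontr)
        assume "u \<notin> F.Span ?K Us"
        then have "F.independent ?K (u # Us)" by (rule F.li_Cons[OF u _ Us(1)])
        then have "length (u # Us) \<le> m" unfolding m_def
          by (intro Greatest_le_nat[of _ _ N]) (use long in auto)
        then show False using Us(2) by simp
      qed
    qed
  qed
  then have "F.dimension m ?K (carrier F)" using F.dimension_independent[OF Us(1)] Us(2) by simp
  then have "(F.dim over ?K) (carrier F) = m" by (rule F.dimI[OF K])
  then have "F.dim ?K (carrier F) = m" by (simp add: over_def)
  then show ?thesis using long[OF Us(1)] Us(2) by simp
qed

end

end

subsection \<open>Degrees of the projections of matrix Schubert varieties\<close>

text \<open>A nonzero polynomial has a nonzero value somewhere on affine space, which is the closure
  of the image of \<open>X\<close>.\<close>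

lemma dominant_nonvanishing:
  assumes dom: "dominant_projection X T" and g: "g \<in> polys_on T" and zero: "\<And>a. a \<in> X \<Longrightarrow> poly_eval a g = 0"
  shows "g = 0"
proof (rule ccontr)
  assume "g \<noteq> 0"
  from ex_nonzero_eval[OF this] obtain b where b: "poly_eval b g \<noteq> 0" ..
  have r: "poly_eval (restrict a T) g = poly_eval a g" for a
    by (rule poly_eval_polys_on[OF g]) simp
  have "g \<in> vanishing_ideal T ((\<lambda>a. restrict a T) ` X)" using g zero by (auto simp: vanishing_ideal_def r)
  moreover have "restrict b T \<in> zariski_closure T ((\<lambda>a. restrict a T) ` X)"
    using dom unfolding dominant_projection_def by (simp add: affine_space_def)
  ultimately have "poly_eval (restrict b T) g = 0" by (simp add: zariski_closure_def)
  then show False using b r by simp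
qed

text \<open>A point of every cone at which all variables of the last column are nonzero; it
  witnesses that their products do not vanish on the variety.\<close>

definition last_column :: "nat \<Rightarrow> nat \<times> nat \<Rightarrow> complex" where
  "last_column n = (\<lambda>(i, j). if j = n then 1 else 0)"

lemma last_column_mem:
  assumes w: "w permutes {1..n}" shows "last_column n \<in> schubert_cone n w"
  unfolding schubert_cone_def mem_Collect_eq
proof (intro allI impI)
  fix p q assume p: "p \<le> n" and q: "q \<le> n"
  show "nw_rank_le (last_column n) p q (rk w p q)"
  proof (cases "q = n")
    case True
    have "w k \<le> n" if "k \<in> {1..p}" for k using permutes_in_image[OF w, of k] that p by simp
    then have "{k \<in> {1..p}. w k \<le> q} = {1..p}" using True by blast
    then have "rk w p q = p" by (simp add: rk_def)
    moreover have "card (row_vec (last_column n) q ` {1..p}) \<le> p" using card_image_le[of "{1..p}"] by simp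
    ultimately show ?thesis unfolding nw_rank_le_def rank_le_def
      by (intro exI[of _ "row_vec (last_column n) q ` {1..p}"] conjI) (simp_all add: cfun.span_superset)
  next
    case False
    have "row_vec (last_column n) q i = 0" for i
      by (rule poly_eqI) (use q False in \<open>auto simp: coeff_row_vec last_column_def\<close>)
    then have "row_vec (last_column n) q ` {1..p} \<subseteq> cfun.span {}" by (auto simp: image_subset_iff)
    then show ?thesis unfolding nw_rank_le_def by (rule rank_le_span[OF rank_le_empty])
  qed
qed

lemma restrict_mem_matrix_schubert:
  "w permutes {1..n} \<Longrightarrow> a \<in> schubert_cone n w \<Longrightarrow> restrict a (grid n) \<in> matrix_schubert n w"
  unfolding matrix_schubert_eq by (intro IntI) (simp add: affine_space_def, simp only: schubert_cone_restrict)

lemma matrix_schubert_irreducible: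
  assumes w: "w permutes {1..n}" and f: "f \<in> polys_on (grid n)" and g: "g \<in> polys_on (grid n)"
    and zero: "\<And>a. a \<in> matrix_schubert n w \<Longrightarrow> poly_eval a f * poly_eval a g = 0"
  shows "(\<forall>a\<in>matrix_schubert n w. poly_eval a f = 0) \<or> (\<forall>a\<in>matrix_schubert n w. poly_eval a g = 0)"
proof -
  have r: "poly_eval (restrict a (grid n)) h = poly_eval a h" if "h \<in> polys_on (grid n)" for a h
    by (rule poly_eval_polys_on[OF that]) simp
  have "poly_eval a f * poly_eval a g = 0" if "a \<in> schubert_cone n w" for a
    using zero[OF restrict_mem_matrix_schubert[OF w that]] r[OF f] r[OF g] by simp
  then have "\<forall>a\<in>schubert_cone n w. poly_eval a f * poly_eval a g = 0" by (rule ballI)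
  from schubert_cone_irreducible[OF w, unfolded irreducible_set_def, THEN spec, THEN spec, THEN mp, OF this]
  have "(\<forall>a\<in>schubert_cone n w. poly_eval a f = 0) \<or> (\<forall>a\<in>schubert_cone n w. poly_eval a g = 0)" .
  then show ?thesis unfolding matrix_schubert_eq[OF w] by (elim disjE) simp_all
qed

text \<open>The size bound for faces and the prescribed size of \<open>T\<close> make
  \<open>algebraic_relation\<close> available. It is used twice: for a single monomial to exclude
  rows missing \<open>T\<close>, and for arbitrary functions to bound the dimension.\<close>

lemma projection_degree_le:
  assumes w: "w permutes {1..n}" and T: "T \<subseteq> grid n" and card_T: "card T + ninv n w = n * n"
  shows "projection_degree (grid n) (matrix_schubert n w) T \<le>
    card {U \<in> ad_complex n w. \<forall>i\<in>{1..n}. card (row_set U i) = card (row_set T i)}" (is "_ \<le> ?N")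
proof (cases "dominant_projection (matrix_schubert n w) T")
  case False
  then show ?thesis by (simp add: projection_degree_def)
next
  case dom: True
  let ?X = "matrix_schubert n w"
  have XC: "a \<in> schubert_cone n w" if "a \<in> ?X" for a using that by (simp add: matrix_schubert_eq[OF w])
  have ne: "?X \<noteq> {}" using restrict_mem_matrix_schubert[OF w last_column_mem[OF w]] by auto
  have size: "card U \<le> card T" if "U \<in> ad_complex n w" for U
    using bspec[OF conjunct1[OF facet_count_le[OF w]] that] card_T by simp
  \<comment> \<open>Only after this is homogenisation possible for arbitrary functions, since every
    row then has a coordinate to pad with.\<close>
  have rows: "row_set T i \<noteq> {}" if i: "i \<in> {1..n}" for i
  proof
    assume empty: "row_set T i = {}"
    define J where "J = {i \<in> {1..n}. row_set T i = {}}"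
    \<comment> \<open>The product of the last-column variables over all rows missing
      \<open>T\<close> has degree one in each of them. A relation for this single function reads
      \<open>c 0 * g = 0\<close> on the variety, so by irreducibility \<open>c 0\<close> or
      \<open>g\<close> vanishes there: the former contradicts dominance, the latter the point
      \<open>last_column\<close>.\<close>
    define \<mu> where "\<mu> = (\<Sum>i\<in>J. Poly_Mapping.single (i, n) (1::nat))"
    define g where "g = Poly_Mapping.single \<mu> (1::complex)"
    have nn: "n \<in> {1..n}" using i by simp
    have "Poly_Mapping.keys \<mu> \<subseteq> grid n" unfolding \<mu>_def by (rule keys_sum_sub) (use nn in \<open>simp add: J_def\<close>)
    then have gI: "g \<in> polys_on (grid n)" by (simp add: g_def polys_on_def)
    have deg: "row_deg n m i = 1" if "m \<in> Poly_Mapping.keys g" "i \<in> {1..n}" "row_set T i = {}" for m i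
    proof -
      have "row_deg n \<mu> i = (\<Sum>i'\<in>J. if i = i' then 1 else 0)"
        unfolding \<mu>_def row_deg_sum by (intro sum.cong refl row_deg_single nn)
      also have "\<dots> = 1" using that by (simp add: J_def)
      finally show ?thesis using that(1) by (simp add: g_def)
    qed
    have "\<exists>c. (\<exists>k\<le>(0::nat). c k \<noteq> 0) \<and> (\<forall>k. c k \<in> polys_on T) \<and>
        (\<forall>a\<in>schubert_cone n w. (\<Sum>k\<le>(0::nat). poly_eval a (c k) * poly_eval a g) = 0)"
    proof (rule algebraic_relation[where g = "\<lambda>_. g" and N = 0, OF T])
      show "card U \<le> card T" if "U \<in> ad_complex n w" for U by (rule size[OF that])
      show "g \<in> polys_on (grid n)" by (rule gI)
      show "row_deg n m i = 1" if "m \<in> Poly_Mapping.keys g" "i \<in> {1..n}" "row_set T i = {}" for m i by (rule deg[OF that])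
      show "card {U \<in> ad_complex n w. \<forall>i\<in>{1..n}. card (row_set U i) = card (row_set T i)} \<le> 0 \<or>
          (\<exists>i\<in>{1..n}. row_set T i = {})" by (rule disjI2) (rule bexI[of "\<lambda>i. row_set T i = {}" i "{1..n}"], rule empty, rule i)
    qed
    then obtain c where c: "(\<exists>k\<le>(0::nat). c k \<noteq> 0) \<and> (\<forall>k. c k \<in> polys_on T) \<and>
        (\<forall>a\<in>schubert_cone n w. (\<Sum>k\<le>(0::nat). poly_eval a (c k) * poly_eval a g) = 0)" ..
    then have c0: "c 0 \<noteq> 0" "c 0 \<in> polys_on T" by simp_all
    have "(\<forall>a\<in>?X. poly_eval a (c 0) = 0) \<or> (\<forall>a\<in>?X. poly_eval a g = 0)"
      by (rule matrix_schubert_irreducible[OF w subsetD[OF polys_on_mono[OF T] c0(2)] gI])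
        (use bspec[OF conjunct2[OF conjunct2[OF c]] XC] in simp)
    then show False
    proof
      assume all: "\<forall>a\<in>?X. poly_eval a (c 0) = 0"
      have "c 0 = 0" by (rule dominant_nonvanishing[OF dom c0(2)]) (rule bspec[OF all])
      then show False using c0(1) by simp
    next
      assume "\<forall>a\<in>?X. poly_eval a g = 0"
      from bspec[OF this restrict_mem_matrix_schubert[OF w last_column_mem[OF w]]]
      have "poly_eval (restrict (last_column n) (grid n)) g = 0" .
      moreover have "poly_eval (restrict (last_column n) (grid n)) g = poly_eval (last_column n) g"
        by (rule poly_eval_polys_on[OF gI]) simp
      moreover have "mon (last_column n) \<mu> = 1" unfolding \<mu>_def mon_sum by (simp add: last_column_def)
      then have "poly_eval (last_column n) g = 1" by (simp add: g_def)
      ultimately show False by simp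
    qed
  qed
  have "ring.dim (function_field (grid n) ?X) (pullback_field (grid n) ?X T) (carrier (function_field (grid n) ?X)) \<le> ?N"
  proof (rule dim_le)
    show "(\<forall>a\<in>?X. poly_eval a f = 0) \<or> (\<forall>a\<in>?X. poly_eval a g = 0)"
      if "f \<in> polys_on (grid n)" "g \<in> polys_on (grid n)" "\<And>a. a \<in> ?X \<Longrightarrow> poly_eval a f * poly_eval a g = 0" for f g
      by (rule matrix_schubert_irreducible[OF w that])
    show "?X \<noteq> {}" by (rule ne)
    show "T \<subseteq> grid n" by (rule T)
    show "g \<in> nonvanishing (grid n) ?X" if "g \<in> polys_on T" "g \<noteq> 0" for g
    proof -
      have "\<exists>a\<in>?X. poly_eval a g \<noteq> 0"
      proof (rule ccontr)
        assume no: "\<not> ?thesis"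
        have "g = 0"
        proof (rule dominant_nonvanishing[OF dom that(1)])
          show "poly_eval a g = 0" if "a \<in> ?X" for a using no bexI[OF _ that, of "\<lambda>a. poly_eval a g \<noteq> 0"] by argo
        qed
        then show False using that(2) by simp
      qed
      then show ?thesis
        unfolding nonvanishing_def mem_Collect_eq by (intro conjI subsetD[OF polys_on_mono[OF T] that(1)])
    qed
    show "\<exists>c. (\<exists>k\<le>?N. c k \<noteq> 0) \<and> (\<forall>k. c k \<in> polys_on T) \<and>
        (\<forall>a\<in>?X. (\<Sum>k\<le>?N. poly_eval a (c k) * poly_eval a (g k)) = 0)"
      if g: "\<And>k. k \<le> ?N \<Longrightarrow> g k \<in> polys_on (grid n)" for g
    proof -
      have "\<exists>c. (\<exists>k\<le>?N. c k \<noteq> 0) \<and> (\<forall>k. c k \<in> polys_on T) \<and>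
          (\<forall>a\<in>schubert_cone n w. (\<Sum>k\<le>?N. poly_eval a (c k) * poly_eval a (g k)) = 0)"
      proof (rule algebraic_relation[OF T])
        show "card U \<le> card T" if "U \<in> ad_complex n w" for U by (rule size[OF that])
        show "g k \<in> polys_on (grid n)" if "k \<le> ?N" for k by (rule g[OF that])
        show "row_deg n m i = 1" if "i \<in> {1..n}" "row_set T i = {}" for m i using rows[OF that(1)] that(2) by simp
      qed simp
      then obtain c where c: "(\<exists>k\<le>?N. c k \<noteq> 0) \<and> (\<forall>k. c k \<in> polys_on T) \<and>
          (\<forall>a\<in>schubert_cone n w. (\<Sum>k\<le>?N. poly_eval a (c k) * poly_eval a (g k)) = 0)" ..
      show ?thesis
        by (intro exI[of _ c] conjI conjunct1[OF c] conjunct1[OF conjunct2[OF c]] ballI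
            bspec[OF conjunct2[OF conjunct2[OF c]]] XC)
    qed
  qed
  then show ?thesis using dom by (simp add: projection_degree_def)
qed

section \<open>Squarefree coefficients and the inequality\<close>

lemma lookup_indicator:
  "finite S \<Longrightarrow> Poly_Mapping.lookup (\<Sum>v\<in>S. Poly_Mapping.single v (1::nat)) x = (if x \<in> S then 1 else 0)"
  unfolding lookup_sum lookup_single when_def by simp

text \<open>A squarefree monomial determines its support, so exactly one summand of the definition
  contributes.\<close>

lemma lookup_fine_schubert:
  assumes S: "S \<subseteq> grid n" "card S = coxeter_length n w"
  shows "Poly_Mapping.lookup (fine_schubert n w) (\<Sum>v\<in>S. Poly_Mapping.single v 1) =
    int (projection_degree (grid n) (matrix_schubert n w) (grid n - S))"
proof -
  let ?d = "\<lambda>S. projection_degree (grid n) (matrix_schubert n w) (grid n - S)"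
  let ?\<mu> = "\<lambda>S. \<Sum>v\<in>S. Poly_Mapping.single v (1::nat)"
  let ?F = "{S. S \<subseteq> grid n \<and> card S = coxeter_length n w}"
  have fin: "finite S'" if "S' \<subseteq> grid n" for S' by (rule finite_subset[OF that]) simp
  have finF: "finite ?F" by (rule finite_subset[of _ "Pow (grid n)"]) auto
  have inj: "S' = S" if "S' \<subseteq> grid n" "?\<mu> S' = ?\<mu> S" for S'
  proof (rule Set.set_eqI)
    fix x
    have "Poly_Mapping.lookup (?\<mu> S') x = Poly_Mapping.lookup (?\<mu> S) x" by (simp only: that(2))
    then have "(if x \<in> S' then 1 else 0 :: nat) = (if x \<in> S then 1 else 0)"
      by (simp only: lookup_indicator[OF fin[OF that(1)]] lookup_indicator[OF fin[OF S(1)]])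
    then show "x \<in> S' \<longleftrightarrow> x \<in> S" by (cases "x \<in> S'"; cases "x \<in> S") simp_all
  qed
  have "Poly_Mapping.lookup (fine_schubert n w) (?\<mu> S) = (\<Sum>S'\<in>?F. if S' = S then int (?d S') else 0)"
    unfolding fine_schubert_def lookup_sum
  proof (rule sum.cong[OF refl])
    fix S' assume "S' \<in> ?F"
    then have S': "S' \<subseteq> grid n" by simp
    have "(\<Prod>v\<in>S'. mvar v) = (Poly_Mapping.single (?\<mu> S') 1 :: (nat \<times> nat, int) mpoly)"
      using single_power_sum[OF fin[OF S'], of "\<lambda>_. 1"] by simp
    moreover have "(of_nat (?d S') :: (nat \<times> nat, int) mpoly) = Poly_Mapping.single 0 (int (?d S'))"
      by (simp add: single_of_nat)
    ultimately have eq: "of_nat (?d S') * (\<Prod>v\<in>S'. mvar v) = (Poly_Mapping.single (?\<mu> S') (int (?d S')) :: (nat \<times> nat, int) mpoly)"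
      by (simp only: mult_single add_0_left mult_1_right)
    show "Poly_Mapping.lookup (of_nat (?d S') * (\<Prod>v\<in>S'. mvar v)) (?\<mu> S) = (if S' = S then int (?d S') else 0)"
    proof (cases "S' = S")
      case True
      show ?thesis unfolding eq lookup_single when_def by (simp only: True refl if_True)
    next
      case False
      then have "\<not> ?\<mu> S' = ?\<mu> S" by (rule contrapos_nn) (rule inj[OF S'])
      then show ?thesis unfolding eq lookup_single when_def using False by (simp only: if_False)
    qed
  qed
  also have "\<dots> = int (?d S)" using S finF by simp
  finally show ?thesis .
qed

lemma lookup_row_content_complement:
  assumes "U \<subseteq> grid n"
  shows "Poly_Mapping.lookup (row_content (grid n - U)) i = (if i \<in> {1..n} then n - card (row_set U i) else 0)"
proof -
  have "{x \<in> grid n - U. fst x = i} = (if i \<in> {1..n} then Pair i ` ({1..n} - row_set U i) else {})"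
    by (auto simp: row_set_def)
  moreover have "card (Pair i ` ({1..n} - row_set U i)) = n - card (row_set U i)"
  proof -
    have "row_set U i \<subseteq> {1..n}" using assms by (auto simp: row_set_def)
    then show ?thesis using finite_row_set[OF assms, of i] by (simp add: card_image inj_on_def card_Diff_subset)
  qed
  ultimately show ?thesis by (simp add: lookup_row_content)
qed

theorem proposition1p5:
  fixes n :: nat and w :: "nat \<Rightarrow> nat" and S :: "(nat \<times> nat) set"
  assumes "w permutes {1..n}"
    and "S \<subseteq> {1..n} \<times> {1..n}"
    and "card S = coxeter_length n w"
  shows "Poly_Mapping.lookup (fine_schubert n w) (\<Sum>v\<in>S. Poly_Mapping.single v 1)
    \<le> Poly_Mapping.lookup (schubert_poly n w) (\<Sum>(i, j)\<in>S. Poly_Mapping.single i 1)"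
proof -
  define T where "T = grid n - S"
  have T: "T \<subseteq> grid n" by (simp add: T_def)
  have finS: "finite S" by (rule finite_subset[OF assms(2)]) simp
  have "card S \<le> n * n" using card_mono[OF _ assms(2)] by simp
  then have card_T: "card T + ninv n w = n * n"
    using assms(3) card_Diff_subset[OF finS assms(2)] by (simp add: T_def coxeter_length_eq_ninv[OF assms(1)])
  have content: "(\<Sum>(i, j)\<in>S. Poly_Mapping.single i 1) = row_content S"
    unfolding row_content_def by (rule sum.cong) auto
  have ST: "grid n - T = S" using assms(2) by (auto simp: T_def)
  \<comment> \<open>Equal row sizes of \<open>U\<close> and \<open>T\<close> give complements with
    equal row content, and the complement of \<open>T\<close> is \<open>S\<close>.\<close>
  have "{U \<in> ad_complex n w. \<forall>i\<in>{1..n}. card (row_set U i) = card (row_set T i)} \<subseteq> facets_with n w (row_content S)"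
  proof
    fix U assume "U \<in> {U \<in> ad_complex n w. \<forall>i\<in>{1..n}. card (row_set U i) = card (row_set T i)}"
    then have U: "U \<in> ad_complex n w" "\<And>i. i \<in> {1..n} \<Longrightarrow> card (row_set U i) = card (row_set T i)" by simp_all
    have Ug: "U \<subseteq> grid n" by (rule ad_complex_grid[OF U(1)])
    have "card U = card T" unfolding card_rows[OF Ug] card_rows[OF T] by (rule sum.cong[OF refl]) (rule U(2))
    moreover have "row_content (grid n - U) = row_content (grid n - T)"
      by (rule poly_mapping_eqI) (simp only: lookup_row_content_complement[OF Ug] lookup_row_content_complement[OF T] U(2) cong: if_cong)
    ultimately show "U \<in> facets_with n w (row_content S)" unfolding facets_with_def ST using U(1) card_T by simp
  qed
  moreover have "finite (facets_with n w (row_content S))"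
    by (rule finite_subset[OF _ finite_ad_complex[of n w]]) (auto simp: facets_with_def)
  ultimately have "card {U \<in> ad_complex n w. \<forall>i\<in>{1..n}. card (row_set U i) = card (row_set T i)} \<le>
      card (facets_with n w (row_content S))" by (rule card_mono[rotated])
  then have "projection_degree (grid n) (matrix_schubert n w) T \<le> card (facets_with n w (row_content S))"
    using projection_degree_le[OF assms(1) T card_T] by (rule order_trans[rotated])
  then have "int (projection_degree (grid n) (matrix_schubert n w) T) \<le> int (card (facets_with n w (row_content S)))"
    by simp
  also have "\<dots> \<le> Poly_Mapping.lookup (schubert_poly n w) (row_content S)"
    by (rule spec[OF conjunct2[OF facet_count_le[OF assms(1)]]])
  finally show ?thesis unfolding lookup_fine_schubert[OF assms(2,3)] content T_def .
qed

end
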